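(* Let $A$ be a (not necessarily associative) algebra over a field $F$ which is quasi-associative with respect to some simple subalgebra $B\subseteq\mathfrak{N}(A)$ of its nucleus ($B$ finite dimensional over $F$ with center separable over $F$). Then $A$ is semiassociative.
   Context: Algebras are unital. The associator is $(x,y,z)=(xy)z-x(yz)$ and the nucleus $\mathfrak{N}(A)$ is the set of $x\in A$ with $(x,A,A)=(A,x,A)=(A,A,x)=0$; it is an associative subalgebra. The center is $Z(A)=\{x\in\mathfrak{N}(A): xa=ax \text{ for all } a\in A\}$, and $A$ is $F$-central if $Z(A)=F$. A module over an associative ring is minimally faithful if it is faithful and has no faithful proper section (a section is a quotient of submodules). Quasi-associativity: let $L/F$ be a finite separable field extension. A (finite dimensional, associative) $L$-central simple algebra $B$ is normal over $F$ if every simple component of $B\otimes_F B^{\mathrm{op}}$ is a matrix algebra over its own center. If $B\subseteq\mathfrak{N}(A)$ is a simple subalgebra with separable center $L$, then $A$ is a $B\otimes_F B^{\mathrm{op}}$-module via left and right multiplication, and $A$ is quasi-associative with respect to $B$ if $B$ is normal over $F$ and $A$ is minimally faithful as a $B\otimes_F B^{\mathrm{op}}$-module; equivalently, the induced map $B\otimes_F B^{\mathrm{op}}\to\mathrm{End}_{L\otimes_F L}(A)$ is an isomorphism. Semiassociativity: an étale $F$-algebra is a finite direct product of finite separable field extensions of $F$. A finite dimensional $F$-central algebra $A$ is semiassociative if there is an étale $F$-subalgebra $K\subseteq\mathfrak{N}(A)$ (containing $1_A$) such that $A$ is minimally faithful (equivalently, faithful and cyclic) as a $K\otimes_F K$-module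 via $(k\otimes k')a=kak'$. *)

theory Defs
  imports "HOL-Algebra.Algebra"
begin

text \<open>
  Everything is stated with the carrier-based structures of HOL-Algebra. An algebra over a field
  \<open>F\<close> is a \<open>module\<close> record over the ring record \<open>F\<close>, whose \<open>mult\<close> and \<open>one\<close> fields carry the
  (not necessarily associative) multiplication. A subalgebra is a subset \<open>B\<close> of the carrier, and
  \<open>A\<lparr>carrier := B\<rparr>\<close> is the algebra it carries.
\<close>

section \<open>Nonassociative algebras\<close>

locale unital_algebra = module F A + field F for F and A (structure) +
  assumes mult_closed: "\<lbrakk>x \<in> carrier A; y \<in> carrier A\<rbrakk> \<Longrightarrow> x \<otimes> y \<in> carrier A"
    and one_closed: "\<one> \<in> carrier A"
    and mult_l_one: "x \<in> carrier A \<Longrightarrow> \<one> \<otimes> x = x"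
    and mult_r_one: "x \<in> carrier A \<Longrightarrow> x \<otimes> \<one> = x"
    and mult_l_distr: "\<lbrakk>x \<in> carrier A; y \<in> carrier A; z \<in> carrier A\<rbrakk>
      \<Longrightarrow> (x \<oplus> y) \<otimes> z = x \<otimes> z \<oplus> y \<otimes> z"
    and mult_r_distr: "\<lbrakk>x \<in> carrier A; y \<in> carrier A; z \<in> carrier A\<rbrakk>
      \<Longrightarrow> z \<otimes> (x \<oplus> y) = z \<otimes> x \<oplus> z \<otimes> y"
    and mult_smult_l: "\<lbrakk>c \<in> carrier F; x \<in> carrier A; y \<in> carrier A\<rbrakk>
      \<Longrightarrow> (c \<odot> x) \<otimes> y = c \<odot> (x \<otimes> y)"
    and mult_smult_r: "\<lbrakk>c \<in> carrier F; x \<in> carrier A; y \<in> carrier A\<rbrakk>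
      \<Longrightarrow> x \<otimes> (c \<odot> y) = c \<odot> (x \<otimes> y)"

definition associator :: "('a, 'm) ring_scheme \<Rightarrow> 'a \<Rightarrow> 'a \<Rightarrow> 'a \<Rightarrow> 'a" where
  "associator A x y z = ((x \<otimes>\<^bsub>A\<^esub> y) \<otimes>\<^bsub>A\<^esub> z) \<ominus>\<^bsub>A\<^esub> (x \<otimes>\<^bsub>A\<^esub> (y \<otimes>\<^bsub>A\<^esub> z))"

definition nucleus :: "('a, 'm) ring_scheme \<Rightarrow> 'a set" where
  "nucleus A = {x \<in> carrier A. \<forall>y \<in> carrier A. \<forall>z \<in> carrier A.
     associator A x y z = \<zero>\<^bsub>A\<^esub> \<and> associator A y x z = \<zero>\<^bsub>A\<^esub> \<and> associator A y z x = \<zero>\<^bsub>A\<^esub>}"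

definition alg_center :: "('a, 'm) ring_scheme \<Rightarrow> 'a set" where
  "alg_center A = {x \<in> nucleus A. \<forall>a \<in> carrier A. x \<otimes>\<^bsub>A\<^esub> a = a \<otimes>\<^bsub>A\<^esub> x}"

text \<open>
  \<open>Z(A) = F\<close>, where \<open>F\<close> is identified with its image \<open>F \<cdot> 1\<close>; the condition \<open>1 \<noteq> 0\<close> makes
  \<open>c \<mapsto> c \<cdot> 1\<close> injective.
\<close>
definition central_algebra :: "('f, 'n) ring_scheme \<Rightarrow> ('f, 'a, 'm) module_scheme \<Rightarrow> bool" where
  "central_algebra F A \<longleftrightarrow> \<one>\<^bsub>A\<^esub> \<noteq> \<zero>\<^bsub>A\<^esub> \<and> alg_center A = (\<lambda>c. c \<odot>\<^bsub>A\<^esub> \<one>\<^bsub>A\<^esub>) ` carrier F"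

definition finite_dimensional :: "('f, 'n) ring_scheme \<Rightarrow> ('f, 'a, 'm) module_scheme \<Rightarrow> bool" where
  "finite_dimensional F M \<longleftrightarrow> (\<exists>S. finite S \<and> S \<subseteq> carrier M \<and>
     (\<forall>x \<in> carrier M. \<exists>c \<in> S \<rightarrow> carrier F. x = (\<Oplus>\<^bsub>M\<^esub>s \<in> S. c s \<odot>\<^bsub>M\<^esub> s)))"

definition unital_subalgebra ::
    "('f, 'n) ring_scheme \<Rightarrow> ('f, 'a, 'm) module_scheme \<Rightarrow> 'a set \<Rightarrow> bool" where
  "unital_subalgebra F A B \<longleftrightarrow> submodule B F A \<and> \<one>\<^bsub>A\<^esub> \<in> B \<and> (\<forall>x \<in> B. \<forall>y \<in> B. x \<otimes>\<^bsub>A\<^esub> y \<in> B)"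


section \<open>Separable extensions and etale algebras\<close>

text \<open>Polynomials are coefficient lists with the leading coefficient first, as in
  \<^const>\<open>univ_poly\<close>.\<close>
definition formal_deriv :: "('a, 'm) ring_scheme \<Rightarrow> 'a list \<Rightarrow> 'a list" where
  "formal_deriv R p = ring.normalize R
     (map (\<lambda>i. add_pow R (Suc i) (ring.coeff R p (Suc i))) (rev [0..<length p - 1]))"

text \<open>For a subfield \<open>K\<close> of \<open>L\<close>, the minimal polynomial of \<open>x\<close> over \<open>K\<close> is coprime to its
  derivative.\<close>
definition separable_element :: "('a, 'm) ring_scheme \<Rightarrow> 'a set \<Rightarrow> 'a \<Rightarrow> bool" where
  "separable_element L K x \<longleftrightarrow>
     \<one>\<^bsub>univ_poly L K\<^esub> gcdof\<^bsub>univ_poly L K\<^esub> (ring.Irr L K x) (formal_deriv L (ring.Irr L K x))"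

definition finite_separable_extension ::
    "('f, 'n) ring_scheme \<Rightarrow> ('f, 'a, 'm) module_scheme \<Rightarrow> bool" where
  "finite_separable_extension F L \<longleftrightarrow> field F \<and> field L \<and> algebra F L \<and> finite_dimensional F L \<and>
     (\<forall>x \<in> carrier L. separable_element L ((\<lambda>c. c \<odot>\<^bsub>L\<^esub> \<one>\<^bsub>L\<^esub>) ` carrier F) x)"

text \<open>
  The factors may be taken on the carrier type of \<open>K\<close> itself: each factor of a direct product is
  isomorphic to an ideal of it, so this is no restriction.
\<close>
definition etale_algebra :: "('f, 'n) ring_scheme \<Rightarrow> ('f, 'a, 'm) module_scheme \<Rightarrow> bool" where
  "etale_algebra F K \<longleftrightarrow> algebra F K \<and>
     (\<exists>(Ls :: ('f, 'a) module list) h.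
        (\<forall>L \<in> set Ls. finite_separable_extension F L) \<and>
        h \<in> ring_iso K (RDirProd_list Ls) \<and>
        (\<forall>c \<in> carrier F. \<forall>x \<in> carrier K. \<forall>i < length Ls.
           h (c \<odot>\<^bsub>K\<^esub> x) ! i = c \<odot>\<^bsub>Ls ! i\<^esub> (h x ! i)))"


section \<open>Modules over associative rings\<close>

text \<open>The library locale \<^locale>\<open>module\<close> requires a commutative ring of scalars.\<close>
locale left_module = R?: ring R + M?: abelian_group M
  for R :: "('r, 'n) ring_scheme" and M :: "('r, 'a, 'm) module_scheme" (structure) +
  assumes lsmult_closed: "\<lbrakk>a \<in> carrier R; x \<in> carrier M\<rbrakk> \<Longrightarrow> a \<odot> x \<in> carrier M"
    and lsmult_l_distr: "\<lbrakk>a \<in> carrier R; b \<in> carrier R; x \<in> carrier M\<rbrakk>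
      \<Longrightarrow> (a \<oplus>\<^bsub>R\<^esub> b) \<odot> x = a \<odot> x \<oplus> b \<odot> x"
    and lsmult_r_distr: "\<lbrakk>a \<in> carrier R; x \<in> carrier M; y \<in> carrier M\<rbrakk>
      \<Longrightarrow> a \<odot> (x \<oplus> y) = a \<odot> x \<oplus> a \<odot> y"
    and lsmult_assoc: "\<lbrakk>a \<in> carrier R; b \<in> carrier R; x \<in> carrier M\<rbrakk>
      \<Longrightarrow> (a \<otimes>\<^bsub>R\<^esub> b) \<odot> x = a \<odot> (b \<odot> x)"
    and lsmult_one: "x \<in> carrier M \<Longrightarrow> \<one>\<^bsub>R\<^esub> \<odot> x = x"

definition faithful_module :: "('r, 'n) ring_scheme \<Rightarrow> ('r, 'a, 'm) module_scheme \<Rightarrow> bool" where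
  "faithful_module R M \<longleftrightarrow>
     (\<forall>r \<in> carrier R. (\<forall>x \<in> carrier M. r \<odot>\<^bsub>M\<^esub> x = \<zero>\<^bsub>M\<^esub>) \<longrightarrow> r = \<zero>\<^bsub>R\<^esub>)"

text \<open>The section \<open>P / N\<close> for submodules \<open>N \<subseteq> P\<close> of \<open>M\<close>. The record type \<open>module\<close> extends
  \<open>ring\<close>, whose \<open>mult\<close> and \<open>one\<close> fields have no meaning for a module.\<close>
definition module_section ::
    "('r, 'a, 'm) module_scheme \<Rightarrow> 'a set \<Rightarrow> 'a set \<Rightarrow> ('r, 'a set) module" where
  "module_section M P N =
     \<lparr>carrier = (\<lambda>x. N +>\<^bsub>M\<^esub> x) ` P, monoid.mult = undefined, one = undefined,
      ring.zero = N, ring.add = (<+>\<^bsub>M\<^esub>), smult = (\<lambda>r U. \<Union>x \<in> U. N +>\<^bsub>M\<^esub> (r \<odot>\<^bsub>M\<^esub> x))\<rparr>"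

definition minimally_faithful :: "('r, 'n) ring_scheme \<Rightarrow> ('r, 'a, 'm) module_scheme \<Rightarrow> bool" where
  "minimally_faithful R M \<longleftrightarrow> left_module R M \<and> faithful_module R M \<and>
     (\<forall>P N. submodule P R M \<and> submodule N R M \<and> N \<subseteq> P \<and> faithful_module R (module_section M P N)
        \<longrightarrow> P = carrier M \<and> N = {\<zero>\<^bsub>M\<^esub>})"


section \<open>Tensor products of algebras\<close>

definition opposite_algebra :: "('f, 'a, 'm) module_scheme \<Rightarrow> ('f, 'a, 'm) module_scheme" where
  "opposite_algebra A = A\<lparr>monoid.mult := (\<lambda>x y. y \<otimes>\<^bsub>A\<^esub> x)\<rparr>"

definition supp :: "('f, 'n) ring_scheme \<Rightarrow> ('i \<Rightarrow> 'f) \<Rightarrow> 'i set" where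
  "supp F f = {p. f p \<noteq> \<zero>\<^bsub>F\<^esub>}"

definition single :: "('f, 'n) ring_scheme \<Rightarrow> 'i \<Rightarrow> 'f \<Rightarrow> 'i \<Rightarrow> 'f" where
  "single F p c = (\<lambda>q. if q = p then c else \<zero>\<^bsub>F\<^esub>)"

text \<open>The monoid algebra over \<open>F\<close> of the multiplicative monoid \<open>B \<times> C\<close>: finitely supported formal
  \<open>F\<close>-linear combinations of pairs, with convolution as multiplication.\<close>
definition pair_algebra ::
    "('f, 'n) ring_scheme \<Rightarrow> ('f, 'b, 'k) module_scheme \<Rightarrow> ('f, 'c, 'l) module_scheme
      \<Rightarrow> ('b \<times> 'c \<Rightarrow> 'f) ring" where
  "pair_algebra F B C =
     \<lparr>carrier = {f. range f \<subseteq> carrier F \<and> finite (supp F f) \<and> supp F f \<subseteq> carrier B \<times> carrier C},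
      monoid.mult = (\<lambda>f g r. \<Oplus>\<^bsub>F\<^esub>z \<in> {(p, q) \<in> supp F f \<times> supp F g.
                (fst p \<otimes>\<^bsub>B\<^esub> fst q, snd p \<otimes>\<^bsub>C\<^esub> snd q) = r}. f (fst z) \<otimes>\<^bsub>F\<^esub> g (snd z)),
      one = single F (\<one>\<^bsub>B\<^esub>, \<one>\<^bsub>C\<^esub>) \<one>\<^bsub>F\<^esub>,
      ring.zero = (\<lambda>_. \<zero>\<^bsub>F\<^esub>),
      ring.add = (\<lambda>f g p. f p \<oplus>\<^bsub>F\<^esub> g p)\<rparr>"

definition tensor_relations ::
    "('f, 'n) ring_scheme \<Rightarrow> ('f, 'b, 'k) module_scheme \<Rightarrow> ('f, 'c, 'l) module_scheme
      \<Rightarrow> ('b \<times> 'c \<Rightarrow> 'f) set" where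
  "tensor_relations F B C =
     {single F (b \<oplus>\<^bsub>B\<^esub> b', c) \<one>\<^bsub>F\<^esub> \<ominus>\<^bsub>pair_algebra F B C\<^esub>
        (single F (b, c) \<one>\<^bsub>F\<^esub> \<oplus>\<^bsub>pair_algebra F B C\<^esub> single F (b', c) \<one>\<^bsub>F\<^esub>)
      | b b' c. b \<in> carrier B \<and> b' \<in> carrier B \<and> c \<in> carrier C} \<union>
     {single F (b, c \<oplus>\<^bsub>C\<^esub> c') \<one>\<^bsub>F\<^esub> \<ominus>\<^bsub>pair_algebra F B C\<^esub>
        (single F (b, c) \<one>\<^bsub>F\<^esub> \<oplus>\<^bsub>pair_algebra F B C\<^esub> single F (b, c') \<one>\<^bsub>F\<^esub>)
      | b c c'. b \<in> carrier B \<and> c \<in> carrier C \<and> c' \<in> carrier C} \<union>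
     {single F (s \<odot>\<^bsub>B\<^esub> b, c) \<one>\<^bsub>F\<^esub> \<ominus>\<^bsub>pair_algebra F B C\<^esub> single F (b, c) s
      | s b c. s \<in> carrier F \<and> b \<in> carrier B \<and> c \<in> carrier C} \<union>
     {single F (b, s \<odot>\<^bsub>C\<^esub> c) \<one>\<^bsub>F\<^esub> \<ominus>\<^bsub>pair_algebra F B C\<^esub> single F (b, c) s
      | s b c. s \<in> carrier F \<and> b \<in> carrier B \<and> c \<in> carrier C}"

text \<open>
  \<open>B \<otimes>\<^sub>F C\<close> as a ring. A product of a pair with a relation is again a relation, so the two-sided
  ideal generated by the relations coincides with the \<open>F\<close>-subspace they span.
\<close>
definition tensor_algebra ::
    "('f, 'n) ring_scheme \<Rightarrow> ('f, 'b, 'k) module_scheme \<Rightarrow> ('f, 'c, 'l) module_scheme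
      \<Rightarrow> ('b \<times> 'c \<Rightarrow> 'f) set ring" where
  "tensor_algebra F B C =
     pair_algebra F B C Quot (Idl\<^bsub>pair_algebra F B C\<^esub> (tensor_relations F B C))"

text \<open>
  \<open>A\<close> with the action \<open>(b \<otimes> b') a = b a b'\<close>. An element \<open>t\<close> of a tensor algebra is a coset of formal
  combinations; when \<open>b\<close> and \<open>b'\<close> are taken from subspaces of \<open>A\<close>, all representatives of \<open>t\<close> act
  alike, and the description operator picks their common value.
\<close>
definition bimodule :: "('f, 'n) ring_scheme \<Rightarrow> ('f, 'a, 'm) module_scheme
      \<Rightarrow> (('a \<times> 'a \<Rightarrow> 'f) set, 'a) module" where
  "bimodule F A =
     \<lparr>carrier = carrier A, monoid.mult = monoid.mult A, one = one A, ring.zero = ring.zero A,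
      ring.add = ring.add A,
      smult = (\<lambda>t a. THE y. \<forall>f \<in> t.
        y = (\<Oplus>\<^bsub>A\<^esub>p \<in> supp F f. f p \<odot>\<^bsub>A\<^esub> ((fst p \<otimes>\<^bsub>A\<^esub> a) \<otimes>\<^bsub>A\<^esub> snd p)))\<rparr>"


section \<open>Simple and normal algebras\<close>

definition simple_ring :: "('a, 'm) ring_scheme \<Rightarrow> bool" where
  "simple_ring R \<longleftrightarrow> ring R \<and> \<one>\<^bsub>R\<^esub> \<noteq> \<zero>\<^bsub>R\<^esub> \<and> (\<forall>I. ideal I R \<longrightarrow> I = {\<zero>\<^bsub>R\<^esub>} \<or> I = carrier R)"

text \<open>The simple components of a semisimple ring are its minimal nonzero two-sided ideals; each
  is a ring with its own identity.\<close>
definition simple_component :: "('a, 'm) ring_scheme \<Rightarrow> 'a set \<Rightarrow> bool" where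
  "simple_component T I \<longleftrightarrow> ideal I T \<and> I \<noteq> {\<zero>\<^bsub>T\<^esub>} \<and>
     (\<forall>J. ideal J T \<and> J \<subseteq> I \<longrightarrow> J = {\<zero>\<^bsub>T\<^esub>} \<or> J = I)"

definition component_ring :: "('a, 'm) ring_scheme \<Rightarrow> 'a set \<Rightarrow> ('a, 'm) ring_scheme" where
  "component_ring T I =
     T\<lparr>carrier := I, one := (THE e. e \<in> I \<and> (\<forall>x \<in> I. e \<otimes>\<^bsub>T\<^esub> x = x \<and> x \<otimes>\<^bsub>T\<^esub> e = x))\<rparr>"

definition matrix_ring :: "nat \<Rightarrow> ('a, 'm) ring_scheme \<Rightarrow> (nat \<times> nat \<Rightarrow> 'a) ring" where
  "matrix_ring n R =
     \<lparr>carrier = {..<n} \<times> {..<n} \<rightarrow>\<^sub>E carrier R,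
      monoid.mult = (\<lambda>U V. restrict (\<lambda>(i, j). \<Oplus>\<^bsub>R\<^esub>k \<in> {..<n}. U (i, k) \<otimes>\<^bsub>R\<^esub> V (k, j)) ({..<n} \<times> {..<n})),
      one = restrict (\<lambda>(i, j). if i = j then \<one>\<^bsub>R\<^esub> else \<zero>\<^bsub>R\<^esub>) ({..<n} \<times> {..<n}),
      ring.zero = restrict (\<lambda>_. \<zero>\<^bsub>R\<^esub>) ({..<n} \<times> {..<n}),
      ring.add = (\<lambda>U V. restrict (\<lambda>p. U p \<oplus>\<^bsub>R\<^esub> V p) ({..<n} \<times> {..<n}))\<rparr>"

text \<open>An isomorphism of \<open>Z(S)\<close>-algebras from \<open>S\<close> to a full matrix algebra over \<open>Z(S)\<close>.\<close>
definition matrix_over_center :: "('a, 'm) ring_scheme \<Rightarrow> bool" where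
  "matrix_over_center S \<longleftrightarrow> (\<exists>n > 0. \<exists>h \<in> ring_iso S (matrix_ring n (S\<lparr>carrier := alg_center S\<rparr>)).
     \<forall>z \<in> alg_center S. \<forall>x \<in> carrier S.
       h (z \<otimes>\<^bsub>S\<^esub> x) = restrict (\<lambda>p. z \<otimes>\<^bsub>S\<^esub> h x p) ({..<n} \<times> {..<n}))"

definition normal_algebra :: "('f, 'n) ring_scheme \<Rightarrow> ('f, 'b, 'm) module_scheme \<Rightarrow> bool" where
  "normal_algebra F B \<longleftrightarrow>
     (\<forall>I. simple_component (tensor_algebra F B (opposite_algebra B)) I \<longrightarrow>
        matrix_over_center (component_ring (tensor_algebra F B (opposite_algebra B)) I))"


section \<open>Quasi-associative and semiassociative algebras\<close>

definition quasi_associative ::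
    "('f, 'n) ring_scheme \<Rightarrow> ('f, 'a, 'm) module_scheme \<Rightarrow> 'a set \<Rightarrow> bool" where
  "quasi_associative F A B \<longleftrightarrow>
     unital_subalgebra F A B \<and> B \<subseteq> nucleus A \<and>
     finite_dimensional F (A\<lparr>carrier := B\<rparr>) \<and>
     simple_ring (A\<lparr>carrier := B\<rparr>) \<and>
     finite_separable_extension F (A\<lparr>carrier := alg_center (A\<lparr>carrier := B\<rparr>)\<rparr>) \<and>
     normal_algebra F (A\<lparr>carrier := B\<rparr>) \<and>
     minimally_faithful
       (tensor_algebra F (A\<lparr>carrier := B\<rparr>) (opposite_algebra (A\<lparr>carrier := B\<rparr>))) (bimodule F A)"

definition semiassociative :: "('f, 'n) ring_scheme \<Rightarrow> ('f, 'a, 'm) module_scheme \<Rightarrow> bool" where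
  "semiassociative F A \<longleftrightarrow>
     finite_dimensional F A \<and> central_algebra F A \<and>
     (\<exists>K. unital_subalgebra F A K \<and> K \<subseteq> nucleus A \<and> etale_algebra F (A\<lparr>carrier := K\<rparr>) \<and>
        minimally_faithful
          (tensor_algebra F (A\<lparr>carrier := K\<rparr>) (A\<lparr>carrier := K\<rparr>)) (bimodule F A))"

end

theory Submission imports Defs begin

text \<open>
 Let \<open>L\<close> be the center of \<open>B\<close> and \<open>T = B \<otimes> B\<^sup>o\<^sup>p\<close>. Decompose \<open>1\<close> into orthogonal idempotents \<open>e \<in> B\<close>
 for which \<open>e B e\<close> is a division algebra. By the Jacobson-Noether theorem \<open>e B e\<close> contains a
 commutative subalgebra \<open>Q e\<close> that is generated by separable elements, contains \<open>e L\<close>, and has a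
 commutative centralizer. The subalgebra \<open>K\<close> is the sum of the \<open>Q e\<close>. It has a separability
 idempotent, so every subbimodule of \<open>A\<close> over \<open>K\<close> is a summand, \<open>K \<otimes> K\<close> is reduced, and \<open>K\<close> is
 etale.

 Since the simple components of \<open>T\<close> are matrix rings over their centers and \<open>A\<close> is minimally
 faithful, every \<open>L\<close>-bilinear endomorphism of \<open>A\<close> is the action of an element of \<open>T\<close>. Hence the
 \<open>K\<close>-bimodule endomorphisms of \<open>A\<close> lie in \<open>C \<otimes> C\<close> for the commutative centralizer \<open>C\<close> of \<open>K\<close> in \<open>B\<close>,
 and they commute with each other. Together with the splitting this makes \<open>A\<close> a cyclic bimodule,
 whose endomorphism ring is \<open>K \<otimes> K\<close> itself. Minimal faithfulness and \<open>Z(A) = F\<close> are read off from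
 this.
\<close>

section \<open>Finite dimensional vector spaces\<close>

text \<open>No dimension is ever counted; commutativity does that work. An endomorphism that
  commutes with a projection preserves its image, so if the endomorphisms of a bimodule with split
  subbimodules commute with each other, they preserve every subbimodule. Then a maximal cyclic
  subbimodule is everything, and an endomorphism of a cyclic module over a commutative ring is
  multiplication by an element of that ring. For this a commutative centralizer of \<open>K\<close>
  is enough.

  Normality provides in each simple component of \<open>T\<close> an idempotent \<open>f\<close>
  such that every \<open>f x f\<close> is a central multiple of \<open>f\<close>. For a matrix ring
  over a noncommutative division algebra, the maps on the minimal faithful module that are linear
  over the center would form a ring larger than the component.

  One construction is used in both directions: the difference quotient of a polynomial
  \<open>f\<close> at \<open>x \<otimes> 1\<close> and \<open>1 \<otimes> x\<close>. Divided by the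
  derivative at \<open>x\<close> it is a separability idempotent; for an inseparable
  \<open>x\<close> and its minimal polynomial it is a nonzero element of square zero, which a
  reduced \<open>K \<otimes> K\<close> excludes. Finite dimension of \<open>A\<close> is a
  consequence of minimal faithfulness.\<close>

locale vspace = module F V + field F
 for F :: "('f, 'n) ring_scheme" and V :: "('f, 'v, 'm) module_scheme" (structure)

sublocale unital_algebra \<subseteq> vspace F A ..

definition functional :: "('f, 'n) ring_scheme => ('f, 'v, 'm) module_scheme => ('v => 'f) => bool" where
 "functional F V u \<longleftrightarrow> (\<forall>x \<in> carrier V. u x \<in> carrier F) \<and>
   (\<forall>x \<in> carrier V. \<forall>y \<in> carrier V. u (x \<oplus>\<^bsub>V\<^esub> y) = u x \<oplus>\<^bsub>F\<^esub> u y) \<and>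
   (\<forall>c \<in> carrier F. \<forall>x \<in> carrier V. u (c \<odot>\<^bsub>V\<^esub> x) = c \<otimes>\<^bsub>F\<^esub> u x)"

definition lin_map :: "('f, 'n) ring_scheme => ('f, 'v, 'm) module_scheme => ('f, 'w, 'l) module_scheme
  => ('v => 'w) => bool" where
 "lin_map F V W u \<longleftrightarrow> (\<forall>x \<in> carrier V. u x \<in> carrier W) \<and>
   (\<forall>x \<in> carrier V. \<forall>y \<in> carrier V. u (x \<oplus>\<^bsub>V\<^esub> y) = u x \<oplus>\<^bsub>W\<^esub> u y) \<and>
   (\<forall>c \<in> carrier F. \<forall>x \<in> carrier V. u (c \<odot>\<^bsub>V\<^esub> x) = c \<odot>\<^bsub>W\<^esub> u x)"

text \<open>A sum over an initial segment of the naturals. By recursion its value depends only on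
  the fields \<open>zero\<close> and \<open>add\<close> of the record and not on its carrier, so
  that sums pass between an algebra and its subalgebras without side conditions.\<close>

primrec nsum :: "('a, 'm) ring_scheme => (nat => 'a) => nat => 'a" where
 "nsum G f 0 = \<zero>\<^bsub>G\<^esub>"
| "nsum G f (Suc n) = nsum G f n \<oplus>\<^bsub>G\<^esub> f n"

lemma nsum_cong: "(!!i. i < n ==> f i = g i) ==> nsum G f n = nsum G g n"
 by (induction n) auto

context abelian_group begin

lemma nsum_closed [simp]: "(!!i. i < n ==> f i \<in> carrier G) ==> nsum G f n \<in> carrier G"
 by (induction n) auto

lemma nsum_add:
 assumes "!!i. i < n ==> f i \<in> carrier G" "!!i. i < n ==> g i \<in> carrier G"
 shows "nsum G (%i. f i \<oplus> g i) n = nsum G f n \<oplus> nsum G g n"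
 using assms by (induction n) (auto simp: a_ac)

lemma nsum_zero: "(!!i. i < n ==> f i = \<zero>) ==> nsum G f n = \<zero>"
 by (induction n) auto

text \<open>Concatenation of two sums of different lengths into a single one; this makes sets of
  elements or operators of the form \<open>\<Sum> u_i x v_i\<close> closed under addition.\<close>

lemma nsum_append:
 assumes "!!i. i < n ==> f i \<in> carrier G" "!!i. i < m ==> g i \<in> carrier G"
 shows "nsum G (%i. if i < n then f i else g (i - n)) (n + m) = nsum G f n \<oplus> nsum G g m"
 using assms
proof (induction m)
 case 0
 then show ?case by (auto intro: nsum_cong)
next
 case (Suc m)
 then show ?case by (simp add: a_assoc)
qed

lemma nsum_in:
 assumes "H \<subseteq> carrier G" "\<zero> \<in> H" "!!x y. x \<in> H ==> y \<in> H ==> x \<oplus> y \<in> H" "!!i. i < n ==> f i \<in> H"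
 shows "nsum G f n \<in> H"
 using assms by (induction n) auto

lemma finsum_in:
 assumes "H \<subseteq> carrier G" "\<zero> \<in> H" "!!x y. x \<in> H ==> y \<in> H ==> x \<oplus> y \<in> H" "!!i. i \<in> I ==> f i \<in> H"
 shows "finsum G f I \<in> H"
proof (cases "finite I")
 case True
 then show ?thesis using assms(4)
 proof (induction I)
  case empty then show ?case using assms by simp
 next
  case (insert i I)
  then have "finsum G f (insert i I) = f i \<oplus> finsum G f I"
   using assms(1) by (intro finsum_insert) auto
  then show ?case using insert assms(3) by auto
 qed
next
 case False
 then show ?thesis using assms by (simp add: finsum_infinite)
qed

lemma nsum_single:
 assumes "j < n" "x \<in> carrier G"
 shows "nsum G (%i. if i = j then x else \<zero>) n = x"
 using assms
proof (induction n)
 case (Suc n)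
 show ?case
 proof (cases "j = n")
  case True
  have "nsum G (%i. if i = j then x else \<zero>) n = \<zero>" by (rule nsum_zero) (simp add: True)
  then show ?thesis using True Suc.prems by simp
 qed (use Suc in auto)
qed simp

end

lemma additive_zero:
 assumes "abelian_group G" "abelian_group H" "!!x. x \<in> carrier G ==> h x \<in> carrier H"
  and "!!x y. x \<in> carrier G ==> y \<in> carrier G ==> h (x \<oplus>\<^bsub>G\<^esub> y) = h x \<oplus>\<^bsub>H\<^esub> h y"
 shows "h \<zero>\<^bsub>G\<^esub> = \<zero>\<^bsub>H\<^esub>"
proof -
 interpret G: abelian_group G by fact
 interpret H: abelian_group H by fact
 have "h \<zero>\<^bsub>G\<^esub> \<oplus>\<^bsub>H\<^esub> h \<zero>\<^bsub>G\<^esub> = h \<zero>\<^bsub>G\<^esub>" using assms(4)[of "\<zero>\<^bsub>G\<^esub>" "\<zero>\<^bsub>G\<^esub>"] by simp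
 then show ?thesis using assms(3)[of "\<zero>\<^bsub>G\<^esub>"] by (metis G.zero_closed H.add.l_cancel_one')
qed

lemma additive_minus:
 assumes "abelian_group G" "abelian_group H" "!!x. x \<in> carrier G ==> h x \<in> carrier H"
  and "!!x y. x \<in> carrier G ==> y \<in> carrier G ==> h (x \<oplus>\<^bsub>G\<^esub> y) = h x \<oplus>\<^bsub>H\<^esub> h y"
  and "x \<in> carrier G" "y \<in> carrier G"
 shows "h (x \<ominus>\<^bsub>G\<^esub> y) = h x \<ominus>\<^bsub>H\<^esub> h y"
proof -
 interpret G: abelian_group G by fact
 interpret H: abelian_group H by fact
 have "h (x \<ominus>\<^bsub>G\<^esub> y) \<oplus>\<^bsub>H\<^esub> h y = h x"
  using assms(4)[of "x \<ominus>\<^bsub>G\<^esub> y" y] assms(5,6) by (simp add: G.minus_eq G.a_assoc G.l_neg)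
 moreover have "h (x \<ominus>\<^bsub>G\<^esub> y) \<in> carrier H" "h y \<in> carrier H" "h x \<in> carrier H"
  using assms by auto
 ultimately show ?thesis
  by (metis H.add.inv_solve_right H.minus_eq)
qed

lemma additive_nsum:
 assumes "abelian_group G" "abelian_group H" "!!x. x \<in> carrier G ==> h x \<in> carrier H"
  and "!!x y. x \<in> carrier G ==> y \<in> carrier G ==> h (x \<oplus>\<^bsub>G\<^esub> y) = h x \<oplus>\<^bsub>H\<^esub> h y"
  and "!!i. i < n ==> f i \<in> carrier G"
 shows "h (nsum G f n) = nsum H (%i. h (f i)) n"
proof -
 interpret G: abelian_group G by fact
 show ?thesis using assms(5)
 proof (induction n)
  case 0
  show ?case using additive_zero[OF assms(1-4)] by simp
 next
  case (Suc n)
  then show ?case using assms(4)[of "nsum G f n" "f n"] by simp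
 qed
qed

lemmas (in abelian_group) endo_nsum = additive_nsum[OF abelian_group_axioms abelian_group_axioms]

lemma finsum_carrier_update:
 assumes "abelian_group M" "abelian_group (M\<lparr>carrier := W\<rparr>)" "W \<subseteq> carrier M" "!!i. i \<in> I ==> f i \<in> W"
 shows "finsum (M\<lparr>carrier := W\<rparr>) f I = finsum M f I"
proof (cases "finite I")
 case True
 interpret M: abelian_group M by fact
 interpret W: abelian_group "M\<lparr>carrier := W\<rparr>" by fact
 show ?thesis using True assms(4)
 proof (induction I)
  case (insert i I)
  then show ?case using assms(3) by (subst W.finsum_insert; force simp: Pi_iff subset_iff)
 qed simp
next
 case False
 interpret M: abelian_group M by fact
 interpret W: abelian_group "M\<lparr>carrier := W\<rparr>" by fact
 show ?thesis using False by (simp add: M.finsum_infinite W.finsum_infinite)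
qed

section \<open>Subspaces, spans and a bounded rank function\<close>

context vspace begin

abbreviation subsp :: "'v set => bool" where "subsp W \<equiv> submodule W F V"

lemma subspD:
 assumes "subsp W"
 shows "W \<subseteq> carrier V" "\<zero> \<in> W" "x \<in> W ==> y \<in> W ==> x \<oplus> y \<in> W" "x \<in> W ==> \<ominus> x \<in> W"
  "x \<in> W ==> y \<in> W ==> x \<ominus> y \<in> W" "c \<in> carrier F ==> x \<in> W ==> c \<odot> x \<in> W"
  "x \<in> W ==> x \<in> carrier V"
 using submoduleE[OF assms] subgroup.one_closed[OF submodule.axioms(1)[OF assms]]
 by (auto simp: a_minus_def)

lemma subspI:
 assumes "W \<subseteq> carrier V" "\<zero> \<in> W" "!!x y. x \<in> W ==> y \<in> W ==> x \<oplus> y \<in> W"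
  "!!c x. c \<in> carrier F ==> x \<in> W ==> c \<odot> x \<in> W"
 shows "subsp W"
proof (rule submoduleI)
 fix a assume a: "a \<in> W"
 then have "\<ominus> a = (\<ominus>\<^bsub>F\<^esub> \<one>\<^bsub>F\<^esub>) \<odot> a" using assms(1) by (simp add: smult_l_minus subset_iff)
 then show "\<ominus> a \<in> W" using assms(4) a by simp
qed (use assms in auto)

definition spanV :: "'v set => 'v set" where
 "spanV S = \<Inter>{W. subsp W \<and> S \<subseteq> W}"

lemma subsp_carrier: "subsp (carrier V)" by (rule carrier_is_submodule)

lemma subsp_zero: "subsp {\<zero>}" by (rule subspI) auto

lemma subsp_Int: "subsp U ==> subsp W ==> subsp (U \<inter> W)"
 by (rule subspI) (auto dest: subspD)

lemma spanV_subsp: assumes "S \<subseteq> carrier V" shows "subsp (spanV S)"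
proof (rule subspI)
 show "spanV S \<subseteq> carrier V" using assms subsp_carrier unfolding spanV_def by auto
qed (use subspD in \<open>auto simp: spanV_def\<close>)

lemma spanV_incl: "x \<in> S ==> x \<in> spanV S" unfolding spanV_def by auto

lemma spanV_min: "subsp W ==> S \<subseteq> W ==> spanV S \<subseteq> W" unfolding spanV_def by auto

lemma spanV_mono: "S \<subseteq> S' ==> spanV S \<subseteq> spanV S'" unfolding spanV_def by auto

lemma spanV_empty: "spanV {} = {\<zero>}"
proof
 show "spanV {} \<subseteq> {\<zero>}" by (rule spanV_min[OF subsp_zero]) simp
qed (use subspD(2)[OF spanV_subsp] in auto)

definition adjn :: "'v => 'v set => 'v set" where
 "adjn v W = {c \<odot> v \<oplus> w | c w. c \<in> carrier F \<and> w \<in> W}"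

lemma adjn_subsp: assumes "subsp W" "v \<in> carrier V" shows "subsp (adjn v W)"
proof (rule subspI)
 note W = subspD[OF assms(1)]
 show "adjn v W \<subseteq> carrier V" using W assms(2) by (auto simp: adjn_def)
 show "\<zero> \<in> adjn v W" unfolding adjn_def using W(2) assms(2)
  by (intro CollectI exI[of _ "\<zero>\<^bsub>F\<^esub>"] exI[of _ "\<zero>"]) auto
 fix x y assume x: "x \<in> adjn v W" and y: "y \<in> adjn v W"
 from x obtain c w where x: "c \<in> carrier F" "w \<in> W" "x = c \<odot> v \<oplus> w" unfolding adjn_def by auto
 from y obtain d u where y: "d \<in> carrier F" "u \<in> W" "y = d \<odot> v \<oplus> u" unfolding adjn_def by auto
 have "w \<in> carrier V" "u \<in> carrier V" using W(7) x y by auto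
 then have "x \<oplus> y = (c \<oplus>\<^bsub>F\<^esub> d) \<odot> v \<oplus> (w \<oplus> u)"
  using x y assms(2) by (simp add: smult_l_distr M.a_ac)
 then show "x \<oplus> y \<in> adjn v W" unfolding adjn_def using x y W(3) by blast
next
 note W = subspD[OF assms(1)]
 fix a x assume a: "a \<in> carrier F" and "x \<in> adjn v W"
 then obtain c w where x: "c \<in> carrier F" "w \<in> W" "x = c \<odot> v \<oplus> w" unfolding adjn_def by auto
 then have "a \<odot> x = (a \<otimes>\<^bsub>F\<^esub> c) \<odot> v \<oplus> a \<odot> w"
  using a W(7) assms(2) by (simp add: smult_r_distr smult_assoc1)
 then show "a \<odot> x \<in> adjn v W" unfolding adjn_def using x a W(6) by blast
qed

lemma adjn_incl: assumes "subsp W" "v \<in> carrier V" shows "v \<in> adjn v W" "W \<subseteq> adjn v W"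
proof -
 note W = subspD[OF assms(1)]
 have "v = \<one>\<^bsub>F\<^esub> \<odot> v \<oplus> \<zero>" using assms by simp
 then show "v \<in> adjn v W" unfolding adjn_def using W(2) R.one_closed by blast
 show "W \<subseteq> adjn v W"
 proof
  fix w assume w: "w \<in> W"
  then have "w = \<zero>\<^bsub>F\<^esub> \<odot> v \<oplus> w" using assms W(7) by simp
  then show "w \<in> adjn v W" unfolding adjn_def using w R.zero_closed by blast
 qed
qed

lemma spanV_insert:
 assumes "S \<subseteq> carrier V" "s \<in> carrier V"
 shows "spanV (insert s S) = adjn s (spanV S)"
proof
 note sp = spanV_subsp[OF assms(1)]
 show "spanV (insert s S) \<subseteq> adjn s (spanV S)"
  using adjn_subsp[OF sp assms(2)] adjn_incl[OF sp assms(2)] spanV_incl by (intro spanV_min) auto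
 have I: "subsp (spanV (insert s S))" using assms by (intro spanV_subsp) auto
 have "spanV S \<subseteq> spanV (insert s S)" by (rule spanV_mono) auto
 then show "adjn s (spanV S) \<subseteq> spanV (insert s S)"
  unfolding adjn_def using subspD(3,6)[OF I] spanV_incl[of s "insert s S"] by auto
qed

lemma adjn_solve:
 assumes "subsp W" "v \<in> carrier V" "c \<in> carrier F" "c \<noteq> \<zero>\<^bsub>F\<^esub>" "w \<in> W" "c \<odot> v \<oplus> w \<in> U" "subsp U"
 shows "\<exists>w' \<in> W. v \<oplus> w' \<in> U"
proof
 have c: "inv\<^bsub>F\<^esub> c \<in> carrier F" "inv\<^bsub>F\<^esub> c \<otimes>\<^bsub>F\<^esub> c = \<one>\<^bsub>F\<^esub>" using assms(3,4) by (auto simp: field_Units)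
 show "inv\<^bsub>F\<^esub> c \<odot> w \<in> W" using subspD(6)[OF assms(1)] c assms by auto
 have "w \<in> carrier V" using subspD(7)[OF assms(1)] assms(5) .
 then have "inv\<^bsub>F\<^esub> c \<odot> (c \<odot> v \<oplus> w) = v \<oplus> inv\<^bsub>F\<^esub> c \<odot> w"
  using c assms by (simp add: smult_r_distr smult_assoc1[symmetric])
 then show "v \<oplus> inv\<^bsub>F\<^esub> c \<odot> w \<in> U" using subspD(6)[OF assms(7) c(1) assms(6)] by simp
qed

text \<open>A stand-in for the dimension: a bounded function that is strictly monotone on subspaces.
  In the induction, subspaces of the span of \<open>insert s S\<close> are compared by their
  intersections with the span of \<open>S\<close>; if these agree, the subspaces differ in whether
  they meet the coset of \<open>s\<close> modulo that span.\<close>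

lemma rank_span:
 assumes "finite S" "S \<subseteq> carrier V"
 shows "\<exists>r :: 'v set => nat. (\<forall>U. r U \<le> card S) \<and>
  (\<forall>U W. subsp U \<longrightarrow> subsp W \<longrightarrow> U \<subset> W \<longrightarrow> W \<subseteq> spanV S \<longrightarrow> r U < r W)"
 using assms
proof (induction S)
 case empty
 have "\<not> U \<subset> W" if "subsp U" "subsp W" "W \<subseteq> {\<zero>}" for U W
  using that subspD(2) by blast
 then show ?case by (intro exI[of _ "%_. 0"]) (auto simp: spanV_empty)
next
 case (insert s S)
 let ?X = "spanV S"
 have X: "subsp ?X" using insert by (intro spanV_subsp) auto
 from insert obtain r where r: "!!U. r U \<le> card S"
  "!!U W. subsp U ==> subsp W ==> U \<subset> W ==> W \<subseteq> ?X ==> r U < r W"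
  using insert.IH insert.prems by (metis insert_subset)
 define p where "p W \<longleftrightarrow> (\<exists>v \<in> ?X. s \<oplus> v \<in> W)" for W
 define r' where "r' W = r (W \<inter> ?X) + (if p W then 1 else 0)" for W
 have s: "s \<in> carrier V" using insert by auto
 have ins: "spanV (insert s S) = adjn s ?X" using insert by (intro spanV_insert) auto
 have "r' U < r' W" if UW: "subsp U" "subsp W" "U \<subset> W" "W \<subseteq> spanV (insert s S)" for U W
 proof (cases "U \<inter> ?X \<subset> W \<inter> ?X")
  case True
  have "r (U \<inter> ?X) < r (W \<inter> ?X)" by (rule r(2)) (use True X UW subsp_Int in auto)
  moreover have "p U ==> p W" unfolding p_def using UW by auto
  ultimately show ?thesis unfolding r'_def by auto
 next
  case False
  then have eq: "U \<inter> ?X = W \<inter> ?X" using UW by auto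
  have "\<not> p U"
  proof
   assume "p U"
   then obtain v where v: "v \<in> ?X" "s \<oplus> v \<in> U" unfolding p_def by auto
   \<comment> \<open>Subtracting a multiple of \<open>s \<oplus> v\<close> moves \<open>w\<close>
     into the span of \<open>S\<close>, where \<open>U\<close> and \<open>W\<close> agree.\<close>
   have "W \<subseteq> U"
   proof
    fix w assume w: "w \<in> W"
    then have "w \<in> adjn s ?X" using UW ins by auto
    then obtain c x where cx: "c \<in> carrier F" "x \<in> ?X" "w = c \<odot> s \<oplus> x"
     unfolding adjn_def by auto
    have car: "v \<in> carrier V" "x \<in> carrier V" using v cx subspD(7)[OF X] by auto
    let ?d = "w \<ominus> c \<odot> (s \<oplus> v)"
    have u: "c \<odot> (s \<oplus> v) \<in> U" using subspD(6)[OF UW(1)] cx v by auto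
    have "?d = x \<ominus> c \<odot> v" using cx car s
     by (simp add: smult_r_distr M.minus_eq M.minus_add M.a_ac M.r_neg1 M.r_neg2)
    then have "?d \<in> ?X" using subspD(5,6)[OF X] cx v by auto
    moreover have "?d \<in> W" using subspD(5)[OF UW(2)] w u UW(3) by auto
    ultimately have "?d \<in> U" using eq by auto
    then have "?d \<oplus> c \<odot> (s \<oplus> v) \<in> U" using u subspD(3)[OF UW(1)] by auto
    moreover have "w \<in> carrier V" "c \<odot> (s \<oplus> v) \<in> carrier V" using u w subspD(7) UW by blast+
    ultimately show "w \<in> U" by (simp add: M.minus_eq M.a_assoc M.l_neg)
   qed
   then show False using UW by auto
  qed
  moreover have "p W"
  proof -
   obtain w where w: "w \<in> W" "w \<notin> U" using UW by auto
   then have "w \<in> adjn s ?X" using UW ins by auto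
   then obtain c x where cx: "c \<in> carrier F" "x \<in> ?X" "w = c \<odot> s \<oplus> x"
    unfolding adjn_def by auto
   have "c \<noteq> \<zero>\<^bsub>F\<^esub>"
   proof
    assume "c = \<zero>\<^bsub>F\<^esub>"
    then have "w = x" using cx s subspD(7)[OF X] by auto
    then show False using w cx eq by auto
   qed
   then show ?thesis unfolding p_def using adjn_solve[OF X s cx(1) _ cx(2)] cx w UW by auto
  qed
  ultimately show ?thesis using eq unfolding r'_def by auto
 qed
 moreover have "r' U \<le> card (insert s S)" for U
  using r(1)[of "U \<inter> ?X"] insert unfolding r'_def by simp
 ultimately show ?case by (intro exI[of _ r']) auto
qed

lemma span_repr:
 assumes "finite S" "S \<subseteq> carrier V" "x \<in> spanV S"
 shows "\<exists>c \<in> S \<rightarrow> carrier F. x = (\<Oplus>s \<in> S. c s \<odot> s)"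
 using assms
proof (induction S arbitrary: x)
 case empty
 then show ?case by (auto simp: spanV_empty)
next
 case (insert s S)
 have "x \<in> adjn s (spanV S)" using insert spanV_insert[of S s] by auto
 then obtain a w where aw: "a \<in> carrier F" "w \<in> spanV S" "x = a \<odot> s \<oplus> w" unfolding adjn_def by auto
 from insert aw obtain c where c: "c \<in> S \<rightarrow> carrier F" "w = (\<Oplus>s \<in> S. c s \<odot> s)" by blast
 let ?c = "c(s := a)"
 have cl: "!!i. i \<in> S ==> ?c i \<odot> i \<in> carrier V" using c insert by (auto simp: Pi_iff subset_iff)
 have "(\<Oplus>i \<in> insert s S. ?c i \<odot> i) = ?c s \<odot> s \<oplus> (\<Oplus>i \<in> S. ?c i \<odot> i)"
  using insert aw cl by (intro M.finsum_insert) auto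
 also have "(\<Oplus>i \<in> S. ?c i \<odot> i) = (\<Oplus>s \<in> S. c s \<odot> s)"
  using insert c by (intro M.finsum_cong') (auto simp: Pi_iff subset_iff)
 finally show ?case using aw c by (intro bexI[of _ ?c]) auto
qed

lemma fin_dim_span_iff:
 "finite_dimensional F V \<longleftrightarrow> (\<exists>S. finite S \<and> S \<subseteq> carrier V \<and> spanV S = carrier V)"
proof
 assume "finite_dimensional F V"
 then obtain S where S: "finite S" "S \<subseteq> carrier V"
  "!!x. x \<in> carrier V ==> \<exists>c \<in> S \<rightarrow> carrier F. x = (\<Oplus>s \<in> S. c s \<odot> s)"
  unfolding finite_dimensional_def by auto
 note sp = subspD[OF spanV_subsp[OF S(2)]]
 have "x \<in> spanV S" if x: "x \<in> carrier V" for x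
 proof -
  obtain c where c: "c \<in> S \<rightarrow> carrier F" "x = (\<Oplus>s \<in> S. c s \<odot> s)"
   using S(3)[OF x] by blast
  have "c i \<odot> i \<in> spanV S" if i: "i \<in> S" for i
   by (rule sp(6)[OF _ spanV_incl[OF i]]) (use c(1) i in auto)
  from M.finsum_in[OF sp(1,2,3) this] show ?thesis unfolding c(2) .
 qed
 then have "spanV S = carrier V" using sp(1) by (intro equalityI subsetI) auto
 then show "\<exists>S. finite S \<and> S \<subseteq> carrier V \<and> spanV S = carrier V" using S(1,2) by blast
next
 assume "\<exists>S. finite S \<and> S \<subseteq> carrier V \<and> spanV S = carrier V"
 then obtain S where S: "finite S" "S \<subseteq> carrier V" "spanV S = carrier V" by blast
 show "finite_dimensional F V" unfolding finite_dimensional_def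
  by (intro exI[of _ S] conjI ballI S(1,2) span_repr[OF S(1,2)]) (simp add: S(3))
qed

text \<open>Chosen once for all subspaces and without any normalization: it serves to extract
  extremal subspaces, to bound chains and to run inductions.\<close>

definition rnk :: "'v set => nat" where
 "rnk = (SOME r. \<exists>N. (\<forall>U. r U \<le> N) \<and> (\<forall>U W. subsp U \<longrightarrow> subsp W \<longrightarrow> U \<subset> W \<longrightarrow> r U < r W))"

end

locale fd_vspace = vspace F V
 for F :: "('f, 'n) ring_scheme" and V :: "('f, 'v, 'm) module_scheme" (structure) +
 assumes fin_dim: "finite_dimensional F V"

context fd_vspace begin

lemma rnk_ex: "\<exists>N. (\<forall>U. rnk U \<le> N) \<and> (\<forall>U W. subsp U \<longrightarrow> subsp W \<longrightarrow> U \<subset> W \<longrightarrow> rnk U < rnk W)"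
proof -
 obtain S where S: "finite S" "S \<subseteq> carrier V" "spanV S = carrier V" using fin_dim fin_dim_span_iff by auto
 obtain r :: "'v set => nat" where "\<forall>U. r U \<le> card S"
  "\<forall>U W. subsp U \<longrightarrow> subsp W \<longrightarrow> U \<subset> W \<longrightarrow> W \<subseteq> carrier V \<longrightarrow> r U < r W"
  using rank_span[OF S(1,2)] S(3) by metis
 then have "\<exists>r :: 'v set => nat. \<exists>N. (\<forall>U. r U \<le> N) \<and> (\<forall>U W. subsp U \<longrightarrow> subsp W \<longrightarrow> U \<subset> W \<longrightarrow> r U < r W)"
  using subspD(1) by blast
 then show ?thesis unfolding rnk_def by (rule someI_ex)
qed

lemma rnk_less: "subsp U ==> subsp W ==> U \<subset> W ==> rnk U < rnk W"
 using rnk_ex by blast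

lemma rnk_eq: "subsp U ==> subsp W ==> U \<subseteq> W ==> rnk W \<le> rnk U ==> U = W"
 using rnk_less by fastforce

text \<open>The subspaces are indexed by arbitrary objects, so that the chain condition, here and in
  \<open>min_ex\<close>, picks out an extremal generating set, idempotent, exponent or generator of
  a module.\<close>

lemma max_ex:
 assumes "P z" "!!x. P x ==> subsp (f x)"
 obtains m where "P m" "!!x. P x ==> f m \<subseteq> f x ==> f x = f m"
proof -
 obtain N where N: "!!U. rnk U \<le> N" using rnk_ex by auto
 obtain m where m: "P m" "!!y. P y ==> rnk (f y) \<le> rnk (f m)"
  using ex_has_greatest_nat[of P z "%x. rnk (f x)" "Suc N"] assms(1) N by (metis le_imp_less_Suc)
 show ?thesis by (rule that[OF m(1)]) (use rnk_eq assms(2) m in blast)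
qed

lemma min_ex:
 assumes "P z" "!!x. P x ==> subsp (f x)"
 obtains m where "P m" "!!x. P x ==> f x \<subseteq> f m ==> f x = f m"
proof -
 obtain m where m: "P m" "!!y. P y ==> rnk (f m) \<le> rnk (f y)"
  using ex_has_least_nat[of P z "%x. rnk (f x)"] assms(1) by auto
 show ?thesis by (rule that[OF m(1)]) (use rnk_eq assms(2) m in blast)
qed

text \<open>A finite subset of \<open>W\<close> with maximal span already spans \<open>W\<close>,
  since adding a further vector of \<open>W\<close> cannot enlarge the span.\<close>

lemma subsp_fin_span:
 assumes "subsp W"
 obtains S where "finite S" "S \<subseteq> W" "W = spanV S"
proof -
 obtain S where S: "finite S \<and> S \<subseteq> W"
  "!!S'. finite S' \<and> S' \<subseteq> W ==> spanV S \<subseteq> spanV S' ==> spanV S' = spanV S"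
  using max_ex[of "%S. finite S \<and> S \<subseteq> W" "{}" spanV] spanV_subsp subspD(1)[OF assms]
  by (metis empty_subsetI finite.emptyI subset_trans)
 have "W \<subseteq> spanV S"
 proof
  fix w assume "w \<in> W"
  then have "spanV (insert w S) = spanV S" using S(1) spanV_mono[of S "insert w S"] by (intro S(2)) auto
  then show "w \<in> spanV S" using spanV_incl[of w "insert w S"] by auto
 qed
 then show ?thesis using that[of S] S(1) spanV_min[OF assms] by blast
qed

lemma subsp_fin_dim:
 assumes "subsp W"
 shows "finite_dimensional F (V\<lparr>carrier := W\<rparr>)"
proof -
 obtain S where S: "finite S" "S \<subseteq> W" "W = spanV S" using subsp_fin_span[OF assms] .
 have W: "W \<subseteq> carrier V" using subspD(1)[OF assms] .
 have mod: "module F (V\<lparr>carrier := W\<rparr>)" by (rule submodule.submodule_is_module[OF assms]) (rule module_axioms)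
 have ab: "abelian_group (V\<lparr>carrier := W\<rparr>)" using module.axioms(2)[OF mod] .
 show ?thesis unfolding finite_dimensional_def
 proof (intro exI[of _ S] conjI ballI)
  fix x assume "x \<in> carrier (V\<lparr>carrier := W\<rparr>)"
  then have "x \<in> spanV S" using S by simp
  then obtain c where c: "c \<in> S \<rightarrow> carrier F" "x = (\<Oplus>s \<in> S. c s \<odot> s)"
   using span_repr[OF S(1)] S W by blast
  have "(\<Oplus>\<^bsub>V\<lparr>carrier := W\<rparr>\<^esub>s \<in> S. c s \<odot> s) = (\<Oplus>s \<in> S. c s \<odot> s)"
   by (rule finsum_carrier_update[OF M.abelian_group_axioms ab W]) (use c S(2) subspD(6)[OF assms] in auto)
  then show "\<exists>c \<in> S \<rightarrow> carrier F. x = (\<Oplus>\<^bsub>V\<lparr>carrier := W\<rparr>\<^esub>s \<in> S. c s \<odot>\<^bsub>V\<lparr>carrier := W\<rparr>\<^esub> s)"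
   using c by (intro bexI[of _ c]) auto
 qed (use S in auto)
qed

text \<open>A subspace \<open>M\<close> that is maximal among those containing \<open>W\<close> and
  avoiding \<open>v\<close> is a complement of the line through \<open>v\<close>: for
  \<open>x\<close> outside \<open>M\<close>, the vector \<open>v\<close> lies in the span of
  \<open>x\<close> and \<open>M\<close>, with a nonzero coefficient at \<open>x\<close>. The
  functional reads off the coefficient of \<open>v\<close>.\<close>

lemma functional_ex:
 assumes "subsp W" "v \<in> carrier V" "v \<notin> W"
 obtains u where "functional F V u" "!!w. w \<in> W ==> u w = \<zero>\<^bsub>F\<^esub>" "u v = \<one>\<^bsub>F\<^esub>"
proof -
 obtain M where M: "subsp M \<and> W \<subseteq> M \<and> v \<notin> M"
  "!!U. subsp U \<and> W \<subseteq> U \<and> v \<notin> U ==> M \<subseteq> U ==> U = M"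
  using max_ex[of "%U. subsp U \<and> W \<subseteq> U \<and> v \<notin> U" W "%U. U"] assms by blast
 note Ms = subspD[OF conjunct1[OF M(1)]]
 have ex: "\<exists>c \<in> carrier F. \<exists>w \<in> M. x = c \<odot> v \<oplus> w" if x: "x \<in> carrier V" for x
 proof (cases "x \<in> M")
  case True
  then have "x = \<zero>\<^bsub>F\<^esub> \<odot> v \<oplus> x" using assms x by simp
  then show ?thesis using True R.zero_closed by blast
 next
  case False
  have "v \<in> adjn x M"
  proof (rule ccontr)
   assume "v \<notin> adjn x M"
   then have "adjn x M = M" using M adjn_subsp[of M x] adjn_incl(2)[of M x] x by (intro M(2)) auto
   then show False using adjn_incl(1)[of M x] M x False by auto
  qed
  then obtain c w where cw: "c \<in> carrier F" "w \<in> M" "v = c \<odot> x \<oplus> w" unfolding adjn_def by auto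
  have w: "w \<in> carrier V" using cw Ms by auto
  have "c \<noteq> \<zero>\<^bsub>F\<^esub>" using cw x w M(1) by auto
  then have c: "inv\<^bsub>F\<^esub> c \<in> carrier F" "inv\<^bsub>F\<^esub> c \<otimes>\<^bsub>F\<^esub> c = \<one>\<^bsub>F\<^esub>" using cw by (auto simp: field_Units)
  have "inv\<^bsub>F\<^esub> c \<odot> v \<oplus> \<ominus> (inv\<^bsub>F\<^esub> c \<odot> w) = x"
   unfolding cw(3) using c cw(1) w x
   by (simp add: smult_r_distr smult_assoc1[symmetric] M.a_assoc M.r_neg)
  then show ?thesis using c cw Ms(4,6) by metis
 qed
 have uniq: "c = d" if "c \<in> carrier F" "d \<in> carrier F" "w \<in> M" "w' \<in> M"
  "c \<odot> v \<oplus> w = d \<odot> v \<oplus> w'" for c d w w'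
 proof (rule ccontr)
  assume ne: "c \<noteq> d"
  have w: "w \<in> carrier V" "w' \<in> carrier V" using that Ms by auto
  let ?e = "c \<ominus>\<^bsub>F\<^esub> d"
  have e: "?e \<in> carrier F" "?e \<noteq> \<zero>\<^bsub>F\<^esub>" using that ne by auto
  then have ei: "inv\<^bsub>F\<^esub> ?e \<in> carrier F" "inv\<^bsub>F\<^esub> ?e \<otimes>\<^bsub>F\<^esub> ?e = \<one>\<^bsub>F\<^esub>" by (auto simp: field_Units)
  have "c \<odot> v = d \<odot> v \<oplus> w' \<oplus> \<ominus> w"
   using that w assms(2) by (metis M.add.inv_solve_right M.add.m_closed smult_closed)
  then have "?e \<odot> v = w' \<ominus> w"
   using that w assms(2)
   by (simp add: R.minus_eq M.minus_eq smult_l_distr smult_l_minus M.a_ac M.r_neg1 M.r_neg2 M.r_neg)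
  then have "?e \<odot> v \<in> M" using Ms(5) that by auto
  then have "inv\<^bsub>F\<^esub> ?e \<odot> (?e \<odot> v) \<in> M" using Ms(6) ei by auto
  then have "v \<in> M" using ei e assms(2) by (simp add: smult_assoc1[symmetric])
  then show False using M by auto
 qed
 define u where "u x = (SOME c. c \<in> carrier F \<and> (\<exists>w \<in> M. x = c \<odot> v \<oplus> w))" for x
 have u: "u x \<in> carrier F" "\<exists>w \<in> M. x = u x \<odot> v \<oplus> w" if "x \<in> carrier V" for x
  using someI_ex[of "%c. c \<in> carrier F \<and> (\<exists>w \<in> M. x = c \<odot> v \<oplus> w)"] ex[OF that]
  unfolding u_def by blast+
 have ueq: "u x = c" if "w \<in> M" "x = c \<odot> v \<oplus> w" "x \<in> carrier V" "c \<in> carrier F" for x c w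
  using u[OF that(3)] uniq that by metis
 have "functional F V u" unfolding functional_def
 proof (intro conjI ballI)
  fix x y assume xy: "x \<in> carrier V" "y \<in> carrier V"
  obtain w w' where w: "w \<in> M" "x = u x \<odot> v \<oplus> w" "w' \<in> M" "y = u y \<odot> v \<oplus> w'"
   using u xy by blast
  have wc: "w \<in> carrier V" "w' \<in> carrier V" using w Ms by auto
  have e: "x \<oplus> y = (u x \<oplus>\<^bsub>F\<^esub> u y) \<odot> v \<oplus> (w \<oplus> w')"
   by (subst w(2), subst w(4)) (use wc u[OF xy(1)] u[OF xy(2)] assms(2) in \<open>simp add: smult_l_distr M.a_ac\<close>)
  show "u (x \<oplus> y) = u x \<oplus>\<^bsub>F\<^esub> u y"
   by (rule ueq[OF _ e]) (use xy u(1) w(1,3) Ms(3) in auto)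
 next
  fix c x assume cx: "c \<in> carrier F" "x \<in> carrier V"
  obtain w where w: "w \<in> M" "x = u x \<odot> v \<oplus> w" using u cx by blast
  have wc: "w \<in> carrier V" using w Ms by auto
  have e: "c \<odot> x = (c \<otimes>\<^bsub>F\<^esub> u x) \<odot> v \<oplus> c \<odot> w"
   by (subst w(2)) (use wc u[OF cx(2)] assms(2) cx in \<open>simp add: smult_r_distr smult_assoc1\<close>)
  show "u (c \<odot> x) = c \<otimes>\<^bsub>F\<^esub> u x"
   by (rule ueq[OF _ e]) (use cx u(1) w(1) Ms(6) in auto)
 qed (use u(1) in auto)
 moreover have "u w = \<zero>\<^bsub>F\<^esub>" if "w \<in> W" for w
  using that M(1) Ms(7) assms(2) by (intro ueq[of w]) auto
 moreover have "u v = \<one>\<^bsub>F\<^esub>"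
  using Ms(2) assms(2) by (intro ueq[of "\<zero>"]) auto
 ultimately show ?thesis by (rule that)
qed

text \<open>Induction on \<open>S\<close>. A vector \<open>s\<close> outside the old span
  \<open>X\<close> contributes a functional that vanishes on \<open>X\<close> and is 1 at
  \<open>s\<close>, paired with \<open>s\<close> minus its image under the old expansion; on
  \<open>X\<close> the new term vanishes, and at \<open>s\<close> it supplies the missing
  part.\<close>

lemma dual_system_span:
 assumes "finite S" "S \<subseteq> carrier V"
 shows "\<exists>n b l. (\<forall>i < n. b i \<in> spanV S \<and> functional F V (l i)) \<and>
   (\<forall>x \<in> spanV S. x = nsum V (%i. l i x \<odot> b i) (n :: nat))"
 using assms
proof (induction S)
 case empty
 then show ?case by (intro exI[of _ 0]) (auto simp: spanV_empty)
next
 case (insert s S)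
 let ?X = "spanV S" and ?Y = "spanV (insert s S)"
 have X: "subsp ?X" using insert by (intro spanV_subsp) auto
 have Y: "subsp ?Y" using insert by (intro spanV_subsp) auto
 have XY: "?X \<subseteq> ?Y" by (rule spanV_mono) auto
 have s: "s \<in> carrier V" "s \<in> ?Y" using insert spanV_incl by auto
 obtain n b l where IH: "!!i. i < n ==> b i \<in> ?X" "!!i. i < n ==> functional F V (l i)"
   "!!x. x \<in> ?X ==> x = nsum V (%i. l i x \<odot> b i) (n :: nat)"
  using insert.IH insert.prems by (metis insert_subset)
 show ?case
 proof (cases "s \<in> ?X")
  case True
  then have "?Y \<subseteq> ?X" using X by (intro spanV_min) (auto intro: spanV_incl)
  then have "?Y = ?X" using XY by auto
  then show ?thesis using IH by (intro exI[of _ n] exI[of _ b] exI[of _ l]) auto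
 next
  case False
  obtain u where u: "functional F V u" "!!w. w \<in> ?X ==> u w = \<zero>\<^bsub>F\<^esub>" "u s = \<one>\<^bsub>F\<^esub>"
   using functional_ex[OF X s(1) False] by blast
  have lf: "l i x \<in> carrier F" if "i < n" "x \<in> carrier V" for i x
   using IH(2) that unfolding functional_def by auto
  have bc: "b i \<in> carrier V" if "i < n" for i using IH(1) that subspD(7)[OF X] by auto
  define pp where "pp x = nsum V (%i. l i x \<odot> b i) n" for x
  have ppc: "pp x \<in> carrier V" if "x \<in> carrier V" for x
   unfolding pp_def using lf bc that by auto
  have ppX: "pp x \<in> ?X" if "x \<in> carrier V" for x
   unfolding pp_def by (rule M.nsum_in) (use subspD[OF X] lf IH(1) that in auto)
  have ppadd: "pp (x \<oplus> y) = pp x \<oplus> pp y" if "x \<in> carrier V" "y \<in> carrier V" for x y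
  proof -
   have "pp (x \<oplus> y) = nsum V (%i. l i x \<odot> b i \<oplus> l i y \<odot> b i) n"
    unfolding pp_def using that IH(2) lf bc by (intro nsum_cong) (auto simp: functional_def smult_l_distr)
   also have "\<dots> = pp x \<oplus> pp y" unfolding pp_def using lf bc that by (intro M.nsum_add) auto
   finally show ?thesis .
  qed
  have ppsm: "pp (c \<odot> x) = c \<odot> pp x" if "c \<in> carrier F" "x \<in> carrier V" for c x
  proof -
   have "pp (c \<odot> x) = nsum V (%i. c \<odot> (l i x \<odot> b i)) n"
    unfolding pp_def using that IH(2) lf bc by (intro nsum_cong) (auto simp: functional_def smult_assoc1)
   also have "\<dots> = c \<odot> pp x" unfolding pp_def
    using that lf bc by (intro additive_nsum[where h = "%z. c \<odot> z", symmetric])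
     (auto simp: smult_r_distr intro: M.abelian_group_axioms)
   finally show ?thesis .
  qed
  define b' where "b' = b(n := s \<ominus> pp s)"
  define l' where "l' = l(n := u)"
  show ?thesis
  proof (intro exI[of _ "Suc n"] exI[of _ b'] exI[of _ l'] conjI allI impI ballI)
   fix i assume i: "i < Suc n"
   show "b' i \<in> ?Y" using i IH(1) XY ppX[OF s(1)] s subspD(5)[OF Y] by (cases "i = n") (auto simp: b'_def)
   show "functional F V (l' i)" using i IH(2) u(1) by (cases "i = n") (auto simp: l'_def)
  next
   fix y assume y: "y \<in> ?Y"
   have "nsum V (%i. l' i y \<odot> b' i) n = pp y" unfolding pp_def
    by (rule nsum_cong) (auto simp: l'_def b'_def)
   then have e: "nsum V (%i. l' i y \<odot> b' i) (Suc n) = pp y \<oplus> u y \<odot> (s \<ominus> pp s)"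
    by (simp add: l'_def b'_def)
   have "y \<in> adjn s ?X" using y spanV_insert[of S s] insert by auto
   then obtain c x where cx: "c \<in> carrier F" "x \<in> ?X" "y = c \<odot> s \<oplus> x" unfolding adjn_def by auto
   have x: "x \<in> carrier V" using cx subspD(7)[OF X] by auto
   have uy: "u y = c" using cx x u s unfolding functional_def by auto
   have "pp y = c \<odot> pp s \<oplus> x" using cx x s ppadd ppsm IH(3)[OF cx(2)] unfolding pp_def by auto
   then have "pp y \<oplus> u y \<odot> (s \<ominus> pp s) = c \<odot> pp s \<oplus> x \<oplus> (c \<odot> s \<oplus> \<ominus> (c \<odot> pp s))"
    using uy cx s ppc[OF s(1)] by (simp add: M.minus_eq smult_r_distr smult_r_minus)
   also have "\<dots> = y" using cx x s ppc[OF s(1)]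
    by (simp add: M.a_ac M.r_neg1 M.r_neg2 M.r_neg)
   finally show "y = nsum V (%i. l' i y \<odot> b' i) (Suc n)" using e by simp
  qed
 qed
qed

lemma dual_system:
 assumes "subsp W"
 obtains n b l where "!!i. i < n ==> b i \<in> W" "!!i. i < n ==> functional F V (l i)"
   "!!x. x \<in> W ==> x = nsum V (%i. l i x \<odot> b i) (n :: nat)"
proof -
 obtain S where S: "finite S" "S \<subseteq> W" "W = spanV S" using subsp_fin_span[OF assms] .
 show ?thesis using dual_system_span[of S] S subspD(1)[OF assms] that by blast
qed

text \<open>The functionals of a dual system of \<open>W\<close> are defined on all of
  \<open>V\<close>, so its reproducing formula makes sense there and projects onto
  \<open>W\<close>.\<close>

lemma projection_ex:
 assumes "subsp W"
 obtains p where "lin_map F V V p" "!!x. x \<in> carrier V ==> p x \<in> W" "!!x. x \<in> W ==> p x = x"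
proof -
 obtain n b l where IH: "!!i. i < n ==> b i \<in> W" "!!i. i < n ==> functional F V (l i)"
   "!!x. x \<in> W ==> x = nsum V (%i. l i x \<odot> b i) (n :: nat)" by (rule dual_system[OF assms]) blast
 have lf: "l i x \<in> carrier F" if "i < n" "x \<in> carrier V" for i x
  using IH(2) that unfolding functional_def by auto
 have bc: "b i \<in> carrier V" if "i < n" for i using IH(1) that subspD(7)[OF assms] by auto
 define pp where "pp x = nsum V (%i. l i x \<odot> b i) n" for x
 have ppX: "pp x \<in> W" if "x \<in> carrier V" for x
  unfolding pp_def by (rule M.nsum_in) (use subspD[OF assms] lf IH(1) that in auto)
 have ppadd: "pp (x \<oplus> y) = pp x \<oplus> pp y" if "x \<in> carrier V" "y \<in> carrier V" for x y
 proof -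
  have "pp (x \<oplus> y) = nsum V (%i. l i x \<odot> b i \<oplus> l i y \<odot> b i) n"
   unfolding pp_def using that IH(2) lf bc by (intro nsum_cong) (auto simp: functional_def smult_l_distr)
  also have "\<dots> = pp x \<oplus> pp y" unfolding pp_def using lf bc that by (intro M.nsum_add) auto
  finally show ?thesis .
 qed
 have ppsm: "pp (c \<odot> x) = c \<odot> pp x" if "c \<in> carrier F" "x \<in> carrier V" for c x
 proof -
  have "pp (c \<odot> x) = nsum V (%i. c \<odot> (l i x \<odot> b i)) n"
   unfolding pp_def using that IH(2) lf bc by (intro nsum_cong) (auto simp: functional_def smult_assoc1)
  also have "\<dots> = c \<odot> pp x" unfolding pp_def
   using that lf bc by (intro additive_nsum[where h = "%z. c \<odot> z", symmetric])
    (auto simp: smult_r_distr intro: M.abelian_group_axioms)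
  finally show ?thesis .
 qed
 show ?thesis
 proof (rule that)
  show "lin_map F V V pp" unfolding lin_map_def using ppX ppadd ppsm subspD(7)[OF assms] by auto
  show "pp x = x" if "x \<in> W" for x using IH(3)[OF that] by (simp add: pp_def)
 qed (rule ppX)
qed

end

section \<open>The tensor product of two associative algebras\<close>

locale assoc_algebra = unital_algebra F A
 for F :: "('f, 'n) ring_scheme" and A :: "('f, 'a, 'm) module_scheme" (structure) +
 assumes massoc: "[|x \<in> carrier A; y \<in> carrier A; z \<in> carrier A|] ==> (x \<otimes> y) \<otimes> z = x \<otimes> (y \<otimes> z)"

sublocale assoc_algebra \<subseteq> ring A
 by (intro ringI M.abelian_group_axioms monoidI)
  (auto simp: mult_closed one_closed mult_l_one mult_r_one massoc mult_l_distr mult_r_distr)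

lemma (in abelian_group) minus_zero_imp_eq:
 assumes "x \<in> carrier G" "y \<in> carrier G" "x \<ominus> y = \<zero>"
 shows "x = y"
proof -
 have "x = (x \<ominus> y) \<oplus> y" using assms(1,2) by (simp add: minus_eq a_assoc l_neg)
 then show ?thesis using assms by simp
qed

definition bilinear_map ::
 "('f, 'n) ring_scheme => ('f, 'b, 'k) module_scheme => ('f, 'c, 'l) module_scheme
  => ('f, 'v, 'm) module_scheme => ('b => 'c => 'v) => bool" where
 "bilinear_map F B C V u \<longleftrightarrow>
   (\<forall>c \<in> carrier C. lin_map F B V (%b. u b c)) \<and> (\<forall>b \<in> carrier B. lin_map F C V (u b))"

lemma bilinear_mapI:
 assumes "!!b c. b \<in> carrier B ==> c \<in> carrier C ==> u b c \<in> carrier V"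
  and "!!b b' c. b \<in> carrier B ==> b' \<in> carrier B ==> c \<in> carrier C ==>
   u (b \<oplus>\<^bsub>B\<^esub> b') c = u b c \<oplus>\<^bsub>V\<^esub> u b' c"
  and "!!b c c'. b \<in> carrier B ==> c \<in> carrier C ==> c' \<in> carrier C ==>
   u b (c \<oplus>\<^bsub>C\<^esub> c') = u b c \<oplus>\<^bsub>V\<^esub> u b c'"
  and "!!s b c. s \<in> carrier F ==> b \<in> carrier B ==> c \<in> carrier C ==> u (s \<odot>\<^bsub>B\<^esub> b) c = s \<odot>\<^bsub>V\<^esub> u b c"
  and "!!s b c. s \<in> carrier F ==> b \<in> carrier B ==> c \<in> carrier C ==> u b (s \<odot>\<^bsub>C\<^esub> c) = s \<odot>\<^bsub>V\<^esub> u b c"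
 shows "bilinear_map F B C V u"
 using assms unfolding bilinear_map_def lin_map_def by auto

lemma bilinear_mapD:
 assumes "bilinear_map F B C V u"
 shows "b \<in> carrier B ==> c \<in> carrier C ==> u b c \<in> carrier V"
  and "b \<in> carrier B ==> b' \<in> carrier B ==> c \<in> carrier C ==>
   u (b \<oplus>\<^bsub>B\<^esub> b') c = u b c \<oplus>\<^bsub>V\<^esub> u b' c"
  and "b \<in> carrier B ==> c \<in> carrier C ==> c' \<in> carrier C ==>
   u b (c \<oplus>\<^bsub>C\<^esub> c') = u b c \<oplus>\<^bsub>V\<^esub> u b c'"
  and "s \<in> carrier F ==> b \<in> carrier B ==> c \<in> carrier C ==> u (s \<odot>\<^bsub>B\<^esub> b) c = s \<odot>\<^bsub>V\<^esub> u b c"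
  and "s \<in> carrier F ==> b \<in> carrier B ==> c \<in> carrier C ==> u b (s \<odot>\<^bsub>C\<^esub> c) = s \<odot>\<^bsub>V\<^esub> u b c"
 using assms unfolding bilinear_map_def lin_map_def by auto

text \<open>The linear extension of \<open>g\<close> to finitely supported formal combinations of
  indices.\<close>

definition ext_sum :: "('f, 'n) ring_scheme => ('f, 'v, 'm) module_scheme => ('i => 'v) => ('i => 'f) => 'v" where
 "ext_sum F V g f = (\<Oplus>\<^bsub>V\<^esub>p \<in> supp F f. f p \<odot>\<^bsub>V\<^esub> g p)"

lemma (in vspace) ext_sum_superset:
 assumes "finite S" "supp F f \<subseteq> S" "!!p. p \<in> S ==> f p \<in> carrier F" "!!p. p \<in> S ==> g p \<in> carrier V"
 shows "ext_sum F V g f = (\<Oplus>\<^bsub>V\<^esub>p \<in> S. f p \<odot>\<^bsub>V\<^esub> g p)"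
 unfolding ext_sum_def
 by (rule M.add.finprod_mono_neutral_cong_left) (use assms in \<open>auto simp: supp_def\<close>)

section \<open>The monoid algebra of pairs and its quotient\<close>

locale algebra_pair = B: assoc_algebra F B + C: assoc_algebra F C
 for F :: "('f, 'n) ring_scheme" and B :: "('f, 'b, 'k) module_scheme"
  and C :: "('f, 'c, 'l) module_scheme"
begin


abbreviation "P \<equiv> pair_algebra F B C"
abbreviation "J \<equiv> Idl\<^bsub>P\<^esub> (tensor_relations F B C)"
abbreviation "T \<equiv> tensor_algebra F B C"

definition pm :: "'b \<times> 'c => 'b \<times> 'c => 'b \<times> 'c" where
 "pm p q = (fst p \<otimes>\<^bsub>B\<^esub> fst q, snd p \<otimes>\<^bsub>C\<^esub> snd q)"

abbreviation "BC \<equiv> carrier B \<times> carrier C"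

lemma pm_closed: "p \<in> BC ==> q \<in> BC ==> pm p q \<in> BC"
 by (auto simp: pm_def)

lemma P_carrier: "f \<in> carrier P \<longleftrightarrow> (\<forall>p. f p \<in> carrier F) \<and> finite (supp F f) \<and> supp F f \<subseteq> BC"
 by (auto simp: pair_algebra_def)

lemma P_val: "f \<in> carrier P ==> f p \<in> carrier F"
 and P_fin: "f \<in> carrier P ==> finite (supp F f)"
 and P_supp: "f \<in> carrier P ==> supp F f \<subseteq> BC"
 by (simp_all only: P_carrier)

lemma P_add: "f \<oplus>\<^bsub>P\<^esub> g = (%p. f p \<oplus>\<^bsub>F\<^esub> g p)"
 by (simp add: pair_algebra_def)

lemma P_zero: "\<zero>\<^bsub>P\<^esub> = (%_. \<zero>\<^bsub>F\<^esub>)"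
 by (simp add: pair_algebra_def)

lemma P_one: "\<one>\<^bsub>P\<^esub> = single F (\<one>\<^bsub>B\<^esub>, \<one>\<^bsub>C\<^esub>) \<one>\<^bsub>F\<^esub>"
 by (simp add: pair_algebra_def)

lemma P_mult: "(f \<otimes>\<^bsub>P\<^esub> g) r =
  (\<Oplus>\<^bsub>F\<^esub>z \<in> {z \<in> supp F f \<times> supp F g. pm (fst z) (snd z) = r}. f (fst z) \<otimes>\<^bsub>F\<^esub> g (snd z))"
proof -
 have "{(p, q) \<in> supp F f \<times> supp F g. (fst p \<otimes>\<^bsub>B\<^esub> fst q, snd p \<otimes>\<^bsub>C\<^esub> snd q) = r}
   = {z \<in> supp F f \<times> supp F g. pm (fst z) (snd z) = r}" by (auto simp: pm_def)
 then show ?thesis by (simp add: pair_algebra_def)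
qed

text \<open>The support of a sum may be smaller than the union of the supports, so products are
  compared over a common larger index set, with zeros filled in.\<close>

lemma P_mult_sup:
 assumes "f \<in> carrier P" "g \<in> carrier P" "finite S" "supp F f \<subseteq> S" "finite S'" "supp F g \<subseteq> S'"
 shows "(f \<otimes>\<^bsub>P\<^esub> g) r =
  (\<Oplus>\<^bsub>F\<^esub>z \<in> S \<times> S'. if pm (fst z) (snd z) = r then f (fst z) \<otimes>\<^bsub>F\<^esub> g (snd z) else \<zero>\<^bsub>F\<^esub>)"
 unfolding P_mult
 by (rule B.R.add.finprod_mono_neutral_cong_left)
  (use assms in \<open>auto simp: P_carrier supp_def\<close>)

lemma supp_single: "supp F (single F p c) \<subseteq> {p}" by (auto simp: supp_def single_def)

lemma single_closed: "p \<in> BC ==> c \<in> carrier F ==> single F p c \<in> carrier P"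
 using supp_single[of p c] finite_subset[OF supp_single[of p c]]
 by (auto simp: P_carrier single_def)

lemma supp_add: "supp F (f \<oplus>\<^bsub>P\<^esub> g) \<subseteq> supp F f \<union> supp F g"
 by (auto simp: supp_def P_add)

lemma P_add_closed: assumes "f \<in> carrier P" "g \<in> carrier P" shows "f \<oplus>\<^bsub>P\<^esub> g \<in> carrier P"
 using assms finite_subset[OF supp_add[of f g]] supp_add[of f g] unfolding P_carrier
 by (auto simp: P_add)

lemma P_abelian: "abelian_group P"
proof (rule abelian_groupI)
 fix f assume f: "f \<in> carrier P"
 have "supp F (%p. \<ominus>\<^bsub>F\<^esub> f p) \<subseteq> supp F f"
  by (auto simp: supp_def)
 then have "(%p. \<ominus>\<^bsub>F\<^esub> f p) \<in> carrier P" using f finite_subset unfolding P_carrier by auto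
 moreover have "(%p. \<ominus>\<^bsub>F\<^esub> f p) \<oplus>\<^bsub>P\<^esub> f = \<zero>\<^bsub>P\<^esub>" using f unfolding P_carrier P_add P_zero by (auto simp: B.R.l_neg)
 ultimately show "\<exists>g \<in> carrier P. g \<oplus>\<^bsub>P\<^esub> f = \<zero>\<^bsub>P\<^esub>" by blast
next
 show "\<zero>\<^bsub>P\<^esub> \<in> carrier P" by (simp add: P_carrier P_zero supp_def)
next
 fix f g assume "f \<in> carrier P" "g \<in> carrier P"
 then show "f \<oplus>\<^bsub>P\<^esub> g \<in> carrier P" by (rule P_add_closed)
qed (simp_all add: P_val P_add P_zero B.R.a_ac fun_eq_iff del: split_paired_All)

lemma pair_induct [consumes 1, case_names single add]:
 assumes "f \<in> carrier P" "!!p c. p \<in> BC ==> c \<in> carrier F ==> Q (single F p c)"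
  "!!f g. f \<in> carrier P ==> g \<in> carrier P ==> Q f ==> Q g ==> Q (f \<oplus>\<^bsub>P\<^esub> g)"
 shows "Q f"
proof -
 have "finite S ==> S \<subseteq> BC ==> f \<in> carrier P ==> supp F f \<subseteq> S ==> Q f" for S f
 proof (induction S arbitrary: f rule: finite_induct)
  case empty
  then have "f = single F (\<one>\<^bsub>B\<^esub>, \<one>\<^bsub>C\<^esub>) \<zero>\<^bsub>F\<^esub>" by (auto simp: supp_def single_def)
  then show ?case using assms(2)[of "(\<one>\<^bsub>B\<^esub>, \<one>\<^bsub>C\<^esub>)" "\<zero>\<^bsub>F\<^esub>"] by simp
 next
  case (insert p S)
  let ?g = "f(p := \<zero>\<^bsub>F\<^esub>)"
  have f: "!!p. f p \<in> carrier F" "finite (supp F f)" "supp F f \<subseteq> BC" using insert unfolding P_carrier by auto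
  have "supp F ?g \<subseteq> supp F f \<inter> S" using insert by (auto simp: supp_def)
  then have g: "?g \<in> carrier P" "supp F ?g \<subseteq> S" using f finite_subset[of "supp F ?g" "supp F f"]
   unfolding P_carrier by auto
  have s: "single F p (f p) \<in> carrier P" using insert f by (intro single_closed) auto
  have "f = single F p (f p) \<oplus>\<^bsub>P\<^esub> ?g" using f by (simp add: P_add single_def fun_eq_iff del: split_paired_All)
  then show ?case using assms(3)[OF s g(1)] insert assms(2)[of p "f p"] f g by auto
 qed
 then show ?thesis using assms(1) unfolding P_carrier by blast
qed

lemma P_mult_closed: assumes "f \<in> carrier P" "g \<in> carrier P" shows "f \<otimes>\<^bsub>P\<^esub> g \<in> carrier P"
proof -
 note fg = assms[unfolded P_carrier]
 have "supp F (f \<otimes>\<^bsub>P\<^esub> g) \<subseteq> (%z. pm (fst z) (snd z)) ` (supp F f \<times> supp F g)"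
 proof
  fix r assume "r \<in> supp F (f \<otimes>\<^bsub>P\<^esub> g)"
  then have r: "(f \<otimes>\<^bsub>P\<^esub> g) r \<noteq> \<zero>\<^bsub>F\<^esub>" by (auto simp: supp_def)
  have "{z \<in> supp F f \<times> supp F g. pm (fst z) (snd z) = r} \<noteq> {}"
   using r unfolding P_mult by (metis (no_types, lifting) B.R.finsum_empty)
  then obtain z where "z \<in> supp F f \<times> supp F g" "r = pm (fst z) (snd z)" by blast
  then show "r \<in> (%z. pm (fst z) (snd z)) ` (supp F f \<times> supp F g)" by (rule rev_image_eqI)
 qed
 moreover have "finite ((%z. pm (fst z) (snd z)) ` (supp F f \<times> supp F g))" using fg by auto
 moreover have "(%z. pm (fst z) (snd z)) ` (supp F f \<times> supp F g) \<subseteq> BC"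
 proof
  fix r assume "r \<in> (%z. pm (fst z) (snd z)) ` (supp F f \<times> supp F g)"
  then obtain p q where "p \<in> supp F f" "q \<in> supp F g" "r = pm p q" by auto
  then show "r \<in> BC" using fg pm_closed[of p q] by blast
 qed
 moreover have "(f \<otimes>\<^bsub>P\<^esub> g) r \<in> carrier F" for r
  unfolding P_mult using fg by (intro B.R.finsum_closed) auto
 ultimately show ?thesis unfolding P_carrier by (auto intro: finite_subset)
qed

lemma P_distr_l:
 assumes "f \<in> carrier P" "g \<in> carrier P" "h \<in> carrier P"
 shows "(f \<oplus>\<^bsub>P\<^esub> g) \<otimes>\<^bsub>P\<^esub> h = f \<otimes>\<^bsub>P\<^esub> h \<oplus>\<^bsub>P\<^esub> g \<otimes>\<^bsub>P\<^esub> h"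
proof
 fix r
 let ?S = "supp F f \<union> supp F g" and ?S' = "supp F h"
 have fin: "finite ?S" "finite ?S'" using assms P_carrier by auto
 have c: "f p \<in> carrier F" "g p \<in> carrier F" for p using assms P_val by blast+
 have hc: "h p \<in> carrier F" for p using assms P_val by blast
 show "((f \<oplus>\<^bsub>P\<^esub> g) \<otimes>\<^bsub>P\<^esub> h) r = (f \<otimes>\<^bsub>P\<^esub> h \<oplus>\<^bsub>P\<^esub> g \<otimes>\<^bsub>P\<^esub> h) r"
  unfolding P_add[of "f \<otimes>\<^bsub>P\<^esub> h"]
  using P_mult_sup[OF P_add_closed[OF assms(1,2)] assms(3) fin(1) supp_add fin(2) subset_refl, of r]
   P_mult_sup[OF assms(1,3) fin(1) _ fin(2) subset_refl, of r]
   P_mult_sup[OF assms(2,3) fin(1) _ fin(2) subset_refl, of r]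
  apply (simp only: Un_upper1 Un_upper2)
  apply (subst B.R.finsum_addf[symmetric])
   apply (simp add: c hc)
   apply (simp add: c hc)
  apply (rule B.R.finsum_cong')
   apply (simp_all add: P_add B.R.l_distr c hc Pi_iff)
  done
qed

lemma P_distr_r:
 assumes "f \<in> carrier P" "g \<in> carrier P" "h \<in> carrier P"
 shows "h \<otimes>\<^bsub>P\<^esub> (f \<oplus>\<^bsub>P\<^esub> g) = h \<otimes>\<^bsub>P\<^esub> f \<oplus>\<^bsub>P\<^esub> h \<otimes>\<^bsub>P\<^esub> g"
proof
 fix r
 let ?S = "supp F f \<union> supp F g" and ?S' = "supp F h"
 have fin: "finite ?S" "finite ?S'" using assms P_carrier by auto
 have c: "f p \<in> carrier F" "g p \<in> carrier F" for p using assms P_val by blast+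
 have hc: "h p \<in> carrier F" for p using assms P_val by blast
 show "(h \<otimes>\<^bsub>P\<^esub> (f \<oplus>\<^bsub>P\<^esub> g)) r = (h \<otimes>\<^bsub>P\<^esub> f \<oplus>\<^bsub>P\<^esub> h \<otimes>\<^bsub>P\<^esub> g) r"
  unfolding P_add[of "h \<otimes>\<^bsub>P\<^esub> f"]
  using P_mult_sup[OF assms(3) P_add_closed[OF assms(1,2)] fin(2) subset_refl fin(1) supp_add, of r]
   P_mult_sup[OF assms(3,1) fin(2) subset_refl fin(1), of r]
   P_mult_sup[OF assms(3,2) fin(2) subset_refl fin(1), of r]
  apply (simp only: Un_upper1 Un_upper2)
  apply (subst B.R.finsum_addf[symmetric])
   apply (simp add: c hc)
   apply (simp add: c hc)
  apply (rule B.R.finsum_cong')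
   apply (simp_all add: P_add B.R.r_distr c hc Pi_iff)
  done
qed

lemma single_mult:
 assumes "p \<in> BC" "q \<in> BC" "c \<in> carrier F" "d \<in> carrier F"
 shows "single F p c \<otimes>\<^bsub>P\<^esub> single F q d = single F (pm p q) (c \<otimes>\<^bsub>F\<^esub> d)"
proof
 fix r
 show "(single F p c \<otimes>\<^bsub>P\<^esub> single F q d) r = single F (pm p q) (c \<otimes>\<^bsub>F\<^esub> d) r"
  using P_mult_sup[OF single_closed[OF assms(1,3)] single_closed[OF assms(2,4)] _ supp_single _ supp_single, of r] assms
  by (auto simp: single_def)
qed

lemma pm_assoc: "p \<in> BC ==> q \<in> BC ==> r \<in> BC ==> pm (pm p q) r = pm p (pm q r)"
 by (auto simp: pm_def B.massoc C.massoc)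

lemma P_assoc:
 assumes "f \<in> carrier P" "g \<in> carrier P" "h \<in> carrier P"
 shows "(f \<otimes>\<^bsub>P\<^esub> g) \<otimes>\<^bsub>P\<^esub> h = f \<otimes>\<^bsub>P\<^esub> (g \<otimes>\<^bsub>P\<^esub> h)"
 using assms(1)
proof (induction f rule: pair_induct)
 case (single p c)
 note pc = this
 note s1 = single_closed[OF pc]
 show ?case using assms(2)
 proof (induction g rule: pair_induct)
  case (single q d)
  note qd = this
  note s2 = single_closed[OF qd]
  show ?case using assms(3)
  proof (induction h rule: pair_induct)
   case (single r e)
   then show ?case using pc qd by (simp add: single_mult pm_closed pm_assoc B.R.m_assoc del: mem_Sigma_iff)
  next
   case (add f g)
   then show ?case using s1 s2 by (simp add: P_distr_r P_mult_closed)
  qed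
 next
  case (add f g)
  then show ?case using s1 assms(3) by (simp add: P_distr_r P_distr_l P_mult_closed)
 qed
next
 case (add f g)
 then show ?case using assms by (simp add: P_distr_l P_mult_closed)
qed

lemma P_ring: "ring P"
proof (rule ringI[OF P_abelian])
 have o: "(\<one>\<^bsub>B\<^esub>, \<one>\<^bsub>C\<^esub>) \<in> BC" by simp
 show "monoid P"
 proof (rule monoidI)
  show "\<one>\<^bsub>P\<^esub> \<in> carrier P" unfolding P_one by (rule single_closed) auto
  note o' = this[unfolded P_one]
  fix f assume "f \<in> carrier P"
  then show "\<one>\<^bsub>P\<^esub> \<otimes>\<^bsub>P\<^esub> f = f" unfolding P_one
  proof (induction f rule: pair_induct)
   case (single p c)
   then have "pm (\<one>\<^bsub>B\<^esub>, \<one>\<^bsub>C\<^esub>) p = p" by (auto simp: pm_def)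
   then show ?case using single_mult[OF o single(1) B.R.one_closed single(2)] single by simp
  qed (simp add: P_distr_r o')
  from \<open>f \<in> carrier P\<close> show "f \<otimes>\<^bsub>P\<^esub> \<one>\<^bsub>P\<^esub> = f" unfolding P_one
  proof (induction f rule: pair_induct)
   case (single p c)
   then have "pm p (\<one>\<^bsub>B\<^esub>, \<one>\<^bsub>C\<^esub>) = p" by (auto simp: pm_def)
   then show ?case using single_mult[OF single(1) o single(2) B.R.one_closed] single by simp
  qed (simp add: P_distr_l o')
 qed (auto simp: P_mult_closed P_assoc)
qed (auto simp: P_distr_l P_distr_r)

sublocale P: ring P by (rule P_ring)

lemma relations_closed: "tensor_relations F B C \<subseteq> carrier P"
 unfolding tensor_relations_def
 by (auto intro!: P.minus_closed P_add_closed single_closed)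

lemma J_ideal: "ideal J P" by (rule P.genideal_ideal[OF relations_closed])

sublocale J: ideal J P by (rule J_ideal)

lemma T_eq: "T = P Quot J" by (simp add: tensor_algebra_def)

lemma T_ring: "ring T" unfolding T_eq by (rule J.quotient_is_ring)

sublocale T: ring T by (rule T_ring)

definition cls :: "('b \<times> 'c => 'f) => ('b \<times> 'c => 'f) set" where "cls f = J +>\<^bsub>P\<^esub> f"

lemma cls_hom: "cls \<in> ring_hom P T"
 unfolding cls_def[abs_def] T_eq by (rule J.rcos_ring_hom)

lemma cls_closed: "f \<in> carrier P ==> cls f \<in> carrier T" by (rule ring_hom_closed[OF cls_hom])
lemma cls_add: "f \<in> carrier P ==> g \<in> carrier P ==> cls (f \<oplus>\<^bsub>P\<^esub> g) = cls f \<oplus>\<^bsub>T\<^esub> cls g" by (rule ring_hom_add[OF cls_hom])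
lemma cls_mult: "f \<in> carrier P ==> g \<in> carrier P ==> cls (f \<otimes>\<^bsub>P\<^esub> g) = cls f \<otimes>\<^bsub>T\<^esub> cls g" by (rule ring_hom_mult[OF cls_hom])
lemma cls_one: "cls \<one>\<^bsub>P\<^esub> = \<one>\<^bsub>T\<^esub>" by (rule ring_hom_one[OF cls_hom])

lemma cls_surj: assumes "t \<in> carrier T" obtains f where "f \<in> carrier P" "t = cls f"
 using assms unfolding T_eq FactRing_def cls_def A_RCOSETS_def RCOSETS_def a_r_coset_def by auto

lemma cls_mem: "f \<in> carrier P ==> f \<in> cls f" unfolding cls_def by (rule J.a_rcos_self)

lemma cls_eq_iff: assumes "f \<in> carrier P" "g \<in> carrier P" shows "cls f = cls g \<longleftrightarrow> f \<ominus>\<^bsub>P\<^esub> g \<in> J"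
 unfolding cls_def by (rule P.quotient_eq_iff_same_a_r_cos[OF J_ideal assms, symmetric])

lemma mem_cls: assumes "f \<in> carrier P" "g \<in> cls f" shows "g \<in> carrier P" "cls g = cls f"
proof -
 show "g \<in> carrier P" using assms J.a_subset P_add_closed unfolding cls_def a_r_coset_def r_coset_def
  by auto
 show "cls g = cls f" using assms unfolding cls_def
  by (metis J.a_repr_independence' J.a_subgroup abelian_subgroup.a_repr_independence' J.abelian_subgroup_axioms)
qed

definition tns :: "'b => 'c => ('b \<times> 'c => 'f) set" where
 "tns b c = cls (single F (b, c) \<one>\<^bsub>F\<^esub>)"

lemma tns_closed [simp]: "b \<in> carrier B ==> c \<in> carrier C ==> tns b c \<in> carrier T"
 unfolding tns_def by (intro cls_closed single_closed) auto

lemma rel_cls: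
 assumes "f \<ominus>\<^bsub>P\<^esub> g \<in> tensor_relations F B C" "f \<in> carrier P" "g \<in> carrier P"
 shows "cls f = cls g"
 using assms cls_eq_iff P.genideal_self[OF relations_closed] by auto

lemma tns_add_l:
 assumes "b \<in> carrier B" "b' \<in> carrier B" "c \<in> carrier C"
 shows "tns (b \<oplus>\<^bsub>B\<^esub> b') c = tns b c \<oplus>\<^bsub>T\<^esub> tns b' c"
proof -
 have "cls (single F (b \<oplus>\<^bsub>B\<^esub> b', c) \<one>\<^bsub>F\<^esub>) = cls (single F (b, c) \<one>\<^bsub>F\<^esub> \<oplus>\<^bsub>P\<^esub> single F (b', c) \<one>\<^bsub>F\<^esub>)"
  by (rule rel_cls) (use assms in \<open>auto simp: tensor_relations_def intro!: single_closed P_add_closed\<close>)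
 then show ?thesis unfolding tns_def using assms by (simp add: cls_add single_closed)
qed

lemma tns_add_r:
 assumes "b \<in> carrier B" "c \<in> carrier C" "c' \<in> carrier C"
 shows "tns b (c \<oplus>\<^bsub>C\<^esub> c') = tns b c \<oplus>\<^bsub>T\<^esub> tns b c'"
proof -
 have "cls (single F (b, c \<oplus>\<^bsub>C\<^esub> c') \<one>\<^bsub>F\<^esub>) = cls (single F (b, c) \<one>\<^bsub>F\<^esub> \<oplus>\<^bsub>P\<^esub> single F (b, c') \<one>\<^bsub>F\<^esub>)"
  by (rule rel_cls) (use assms in \<open>auto simp: tensor_relations_def intro!: single_closed P_add_closed\<close>)
 then show ?thesis unfolding tns_def using assms by (simp add: cls_add single_closed)
qed

lemma tns_smult_l:
 assumes "s \<in> carrier F" "b \<in> carrier B" "c \<in> carrier C"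
 shows "tns (s \<odot>\<^bsub>B\<^esub> b) c = cls (single F (b, c) s)"
 unfolding tns_def
 by (rule rel_cls) (use assms in \<open>auto simp: tensor_relations_def intro!: single_closed P_add_closed\<close>)

lemma tns_smult_r:
 assumes "s \<in> carrier F" "b \<in> carrier B" "c \<in> carrier C"
 shows "tns b (s \<odot>\<^bsub>C\<^esub> c) = cls (single F (b, c) s)"
 unfolding tns_def
 by (rule rel_cls) (use assms in \<open>auto simp: tensor_relations_def intro!: single_closed P_add_closed\<close>)

lemma tns_smult:
 assumes "s \<in> carrier F" "b \<in> carrier B" "c \<in> carrier C"
 shows "tns b (s \<odot>\<^bsub>C\<^esub> c) = tns (s \<odot>\<^bsub>B\<^esub> b) c"
 using tns_smult_l[OF assms] tns_smult_r[OF assms] by simp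

lemma tns_mult:
 assumes "b \<in> carrier B" "c \<in> carrier C" "b' \<in> carrier B" "c' \<in> carrier C"
 shows "tns b c \<otimes>\<^bsub>T\<^esub> tns b' c' = tns (b \<otimes>\<^bsub>B\<^esub> b') (c \<otimes>\<^bsub>C\<^esub> c')"
 unfolding tns_def using assms
 by (simp add: cls_mult[symmetric] single_closed single_mult pm_def)

lemma tns_one: "tns \<one>\<^bsub>B\<^esub> \<one>\<^bsub>C\<^esub> = \<one>\<^bsub>T\<^esub>"
 unfolding tns_def cls_one[symmetric] P_one by simp

text \<open>A scalar coefficient can be absorbed into the left factor, so the elements of
  \<open>T\<close> are plain sums of pure tensors and the induction has no case for scalars.\<close>

lemma tns_induct [consumes 1, case_names tns add]:
 assumes "t \<in> carrier T" "!!b c. b \<in> carrier B ==> c \<in> carrier C ==> Q (tns b c)"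
  "!!t u. t \<in> carrier T ==> u \<in> carrier T ==> Q t ==> Q u ==> Q (t \<oplus>\<^bsub>T\<^esub> u)"
 shows "Q t"
proof -
 obtain f where f: "f \<in> carrier P" "t = cls f" using cls_surj[OF assms(1)] .
 from f(1) have "Q (cls f)"
 proof (induction f rule: pair_induct)
  case (single p c)
  then have "cls (single F p c) = tns (c \<odot>\<^bsub>B\<^esub> fst p) (snd p)" by (auto simp: tns_smult_l)
  then show ?case using assms(2) single by auto
 next
  case (add f g)
  then show ?case using assms(3) by (simp add: cls_add cls_closed)
 qed
 then show ?thesis using f by simp
qed

section \<open>Universal property of the tensor product\<close>

context
 fixes V :: "('f, 'v, 'm) module_scheme"
 assumes V: "vspace F V"
begin

interpretation V: vspace F V by (rule V)

lemma ext_closed: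
 assumes "f \<in> carrier P" "!!p. p \<in> BC ==> g p \<in> carrier V"
 shows "ext_sum F V g f \<in> carrier V"
 unfolding ext_sum_def using assms P_carrier by (intro V.M.finsum_closed) auto

lemma ext_single:
 assumes "p \<in> BC" "c \<in> carrier F" "!!p. p \<in> BC ==> g p \<in> carrier V"
 shows "ext_sum F V g (single F p c) = c \<odot>\<^bsub>V\<^esub> g p"
proof -
 have g: "g p \<in> carrier V" using assms by blast
 have "ext_sum F V g (single F p c) = (\<Oplus>\<^bsub>V\<^esub>q \<in> {p}. single F p c q \<odot>\<^bsub>V\<^esub> g q)"
  by (rule V.ext_sum_superset[OF _ supp_single]) (use assms g in \<open>auto simp: single_def\<close>)
 then show ?thesis using assms(2) g by (simp add: single_def)
qed

lemma ext_add:
 assumes "f \<in> carrier P" "f' \<in> carrier P" "!!p. p \<in> BC ==> g p \<in> carrier V"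
 shows "ext_sum F V g (f \<oplus>\<^bsub>P\<^esub> f') = ext_sum F V g f \<oplus>\<^bsub>V\<^esub> ext_sum F V g f'"
proof -
 let ?S = "supp F f \<union> supp F f'"
 have S: "finite ?S" "?S \<subseteq> BC" using assms P_carrier by auto
 have c: "f p \<in> carrier F" "f' p \<in> carrier F" for p using assms P_val by blast+
 have gc: "g p \<in> carrier V" if "p \<in> ?S" for p using assms(3) S that by blast
 have 1: "ext_sum F V g f = (\<Oplus>\<^bsub>V\<^esub>p \<in> ?S. f p \<odot>\<^bsub>V\<^esub> g p)"
  by (rule V.ext_sum_superset) (use S c gc in auto)
 have 2: "ext_sum F V g f' = (\<Oplus>\<^bsub>V\<^esub>p \<in> ?S. f' p \<odot>\<^bsub>V\<^esub> g p)"
  by (rule V.ext_sum_superset) (use S c gc in auto)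
 have 3: "ext_sum F V g (f \<oplus>\<^bsub>P\<^esub> f') = (\<Oplus>\<^bsub>V\<^esub>p \<in> ?S. (f p \<oplus>\<^bsub>F\<^esub> f' p) \<odot>\<^bsub>V\<^esub> g p)"
  unfolding P_add by (rule V.ext_sum_superset) (use S c gc supp_add[of f f'] in \<open>auto simp: P_add\<close>)
 have "(\<Oplus>\<^bsub>V\<^esub>p \<in> ?S. (f p \<oplus>\<^bsub>F\<^esub> f' p) \<odot>\<^bsub>V\<^esub> g p) = (\<Oplus>\<^bsub>V\<^esub>p \<in> ?S. f p \<odot>\<^bsub>V\<^esub> g p \<oplus>\<^bsub>V\<^esub> f' p \<odot>\<^bsub>V\<^esub> g p)"
  by (rule V.M.finsum_cong') (use c gc in \<open>auto simp: V.smult_l_distr\<close>)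
 also have "\<dots> = (\<Oplus>\<^bsub>V\<^esub>p \<in> ?S. f p \<odot>\<^bsub>V\<^esub> g p) \<oplus>\<^bsub>V\<^esub> (\<Oplus>\<^bsub>V\<^esub>p \<in> ?S. f' p \<odot>\<^bsub>V\<^esub> g p)"
  by (rule V.M.finsum_addf) (use c gc in auto)
 finally show ?thesis using 1 2 3 by simp
qed

lemma ext_mult_single:
 assumes "p \<in> BC" "c \<in> carrier F" "f \<in> carrier P" "!!p. p \<in> BC ==> g p \<in> carrier V"
 shows "ext_sum F V g (single F p c \<otimes>\<^bsub>P\<^esub> f) = c \<odot>\<^bsub>V\<^esub> ext_sum F V (%q. g (pm p q)) f"
  and "ext_sum F V g (f \<otimes>\<^bsub>P\<^esub> single F p c) = c \<odot>\<^bsub>V\<^esub> ext_sum F V (%q. g (pm q p)) f"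
proof -
 have g1: "!!q. q \<in> BC ==> g (pm p q) \<in> carrier V" "!!q. q \<in> BC ==> g (pm q p) \<in> carrier V"
  using assms pm_closed by blast+
 show "ext_sum F V g (single F p c \<otimes>\<^bsub>P\<^esub> f) = c \<odot>\<^bsub>V\<^esub> ext_sum F V (%q. g (pm p q)) f"
  using assms(3)
 proof (induction f rule: pair_induct)
  case (single q d)
  then show ?case using assms g1
   by (simp add: single_mult ext_single pm_closed V.smult_assoc1 del: mem_Sigma_iff)
 next
  case (add f h)
  then show ?case using assms g1
   by (simp add: P_distr_r P_mult_closed single_closed ext_add ext_closed V.smult_r_distr del: mem_Sigma_iff)
 qed
 show "ext_sum F V g (f \<otimes>\<^bsub>P\<^esub> single F p c) = c \<odot>\<^bsub>V\<^esub> ext_sum F V (%q. g (pm q p)) f"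
  using assms(3)
 proof (induction f rule: pair_induct)
  case (single q d)
  then show ?case using assms g1
   by (simp add: single_mult ext_single pm_closed V.smult_assoc1[symmetric] B.R.m_comm del: mem_Sigma_iff)
 next
  case (add f h)
  then show ?case using assms g1
   by (simp add: P_distr_l P_mult_closed single_closed ext_add ext_closed V.smult_r_distr del: mem_Sigma_iff)
 qed
qed

text \<open>\<open>J\<close> is generated as a two-sided ideal, whereas the kernel of the extension
  of \<open>u\<close> is a priori only a subspace. The set \<open>N\<close> of those
  \<open>f\<close> on which all translates \<open>p \<mapsto> u (x p y)\<close> vanish is an ideal,
  and it contains the relations because each translate is again bilinear. Putting \<open>x\<close>
  and \<open>y\<close> equal to 1 recovers \<open>u\<close>.\<close>

lemma ext_J:
 assumes "bilinear_map F B C V u" "f \<in> J"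
 shows "ext_sum F V (%p. u (fst p) (snd p)) f = \<zero>\<^bsub>V\<^esub>"
proof -
 note u = bilinear_mapD[OF assms(1)]
 define g where "g x y p = u (fst (pm (pm x p) y)) (snd (pm (pm x p) y))" for x y p
 define N where "N = {f \<in> carrier P. \<forall>x \<in> BC. \<forall>y \<in> BC. ext_sum F V (g x y) f = \<zero>\<^bsub>V\<^esub>}"
 have gc: "g x y p \<in> carrier V" if "x \<in> BC" "y \<in> BC" "p \<in> BC" for x y p
  unfolding g_def by (rule u(1)) (use that in \<open>auto simp: pm_def\<close>)
 have Nz: "f \<in> carrier P" "x \<in> BC ==> y \<in> BC ==> ext_sum F V (g x y) f = \<zero>\<^bsub>V\<^esub>" if "f \<in> N" for f x y
  using that unfolding N_def by blast+
 have NI: "f \<in> N" if "f \<in> carrier P" "!!x y. x \<in> BC ==> y \<in> BC ==> ext_sum F V (g x y) f = \<zero>\<^bsub>V\<^esub>" for f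
  using that unfolding N_def by blast
 have neg: "\<ominus>\<^bsub>P\<^esub> f \<in> N" if f: "f \<in> N" for f
 proof -
  have fP: "f \<in> carrier P" using f N_def by auto
  have "ext_sum F V (g x y) (\<ominus>\<^bsub>P\<^esub> f) = \<zero>\<^bsub>V\<^esub>" if "x \<in> BC" "y \<in> BC" for x y
  proof -
   have e0: "ext_sum F V (g x y) \<zero>\<^bsub>P\<^esub> = \<zero>\<^bsub>V\<^esub>" by (simp add: ext_sum_def supp_def P_zero)
   have "ext_sum F V (g x y) (\<ominus>\<^bsub>P\<^esub> f \<oplus>\<^bsub>P\<^esub> f) = ext_sum F V (g x y) (\<ominus>\<^bsub>P\<^esub> f) \<oplus>\<^bsub>V\<^esub> ext_sum F V (g x y) f"
    by (rule ext_add) (use fP gc that in blast)+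
   moreover have "ext_sum F V (g x y) (\<ominus>\<^bsub>P\<^esub> f) \<in> carrier V"
    by (rule ext_closed) (use fP gc that in blast)+
   moreover have "ext_sum F V (g x y) f = \<zero>\<^bsub>V\<^esub>" using f that unfolding N_def by blast
   ultimately show ?thesis using e0 fP by (simp add: P.l_neg)
  qed
  then show ?thesis using fP by (intro NI) auto
 qed
 have zero: "\<zero>\<^bsub>P\<^esub> \<in> N" by (simp add: N_def ext_sum_def supp_def P_zero[symmetric]) (simp add: P_zero)
 have add: "f \<oplus>\<^bsub>P\<^esub> h \<in> N" if "f \<in> N" "h \<in> N" for f h
 proof -
  have "ext_sum F V (g x y) (f \<oplus>\<^bsub>P\<^esub> h) = \<zero>\<^bsub>V\<^esub>" if "x \<in> BC" "y \<in> BC" for x y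
   using ext_add[OF Nz(1) Nz(1) gc[OF that], OF \<open>f \<in> N\<close> \<open>h \<in> N\<close>] Nz(2)[OF _ that] \<open>f \<in> N\<close> \<open>h \<in> N\<close> by simp
  then show ?thesis using that Nz(1) by (intro NI P_add_closed) auto
 qed
 have lm: "h \<otimes>\<^bsub>P\<^esub> f \<in> N" if f: "f \<in> N" and h: "h \<in> carrier P" for f h
  using h
 proof (induction h rule: pair_induct)
  case (single p c)
  have fP: "f \<in> carrier P" using f N_def by auto
  have "ext_sum F V (g x y) (single F p c \<otimes>\<^bsub>P\<^esub> f) = \<zero>\<^bsub>V\<^esub>" if xy: "x \<in> BC" "y \<in> BC" for x y
  proof -
   have xp: "pm x p \<in> BC" using xy single pm_closed by blast
   have "ext_sum F V (%q. g x y (pm p q)) f = ext_sum F V (g (pm x p) y) f"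
    unfolding ext_sum_def
   proof (rule V.M.finsum_cong')
    fix q assume "q \<in> supp F f"
    then have q: "q \<in> BC" using P_supp[OF fP] by blast
    then show "f q \<odot>\<^bsub>V\<^esub> g x y (pm p q) = f q \<odot>\<^bsub>V\<^esub> g (pm x p) y q"
     using xy single by (simp add: g_def pm_assoc pm_closed del: mem_Sigma_iff)
   next
    show "(%q. f q \<odot>\<^bsub>V\<^esub> g (pm x p) y q) \<in> supp F f \<rightarrow> carrier V"
     using P_supp[OF fP] P_val[OF fP] gc[OF xp xy(2)] by (intro funcsetI V.smult_closed) blast+
   qed simp
   also have "\<dots> = \<zero>\<^bsub>V\<^esub>" by (rule Nz(2)[OF f xp xy(2)])
   finally show ?thesis using ext_mult_single(1)[OF single fP gc[OF xy]] single by simp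
  qed
  then show ?case using single_closed[OF single] fP by (intro NI P_mult_closed) auto
 next
  case (add h h')
  have fP: "f \<in> carrier P" using f N_def by auto
  then show ?case using add \<open>!!f h. f \<in> N ==> h \<in> N ==> f \<oplus>\<^bsub>P\<^esub> h \<in> N\<close> by (simp add: P_distr_l)
 qed
 have rm: "f \<otimes>\<^bsub>P\<^esub> h \<in> N" if f: "f \<in> N" and h: "h \<in> carrier P" for f h
  using h
 proof (induction h rule: pair_induct)
  case (single p c)
  have fP: "f \<in> carrier P" using f N_def by auto
  have "ext_sum F V (g x y) (f \<otimes>\<^bsub>P\<^esub> single F p c) = \<zero>\<^bsub>V\<^esub>" if xy: "x \<in> BC" "y \<in> BC" for x y
  proof -
   have xp: "pm p y \<in> BC" using xy single pm_closed by blast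
   have "ext_sum F V (%q. g x y (pm q p)) f = ext_sum F V (g x (pm p y)) f"
    unfolding ext_sum_def
   proof (rule V.M.finsum_cong')
    fix q assume "q \<in> supp F f"
    then have q: "q \<in> BC" using P_supp[OF fP] by blast
    then show "f q \<odot>\<^bsub>V\<^esub> g x y (pm q p) = f q \<odot>\<^bsub>V\<^esub> g x (pm p y) q"
     using xy single by (simp add: g_def pm_assoc pm_closed del: mem_Sigma_iff)
   next
    show "(%q. f q \<odot>\<^bsub>V\<^esub> g x (pm p y) q) \<in> supp F f \<rightarrow> carrier V"
     using P_supp[OF fP] P_val[OF fP] gc[OF xy(1) xp] by (intro funcsetI V.smult_closed) blast+
   qed simp
   also have "\<dots> = \<zero>\<^bsub>V\<^esub>" by (rule Nz(2)[OF f xy(1) xp])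
   finally show ?thesis using ext_mult_single(2)[OF single fP gc[OF xy]] single by simp
  qed
  then show ?case using single_closed[OF single] fP by (intro NI P_mult_closed) auto
 next
  case (add h h')
  have fP: "f \<in> carrier P" using f N_def by auto
  then show ?case using add \<open>!!f h. f \<in> N ==> h \<in> N ==> f \<oplus>\<^bsub>P\<^esub> h \<in> N\<close> by (simp add: P_distr_r)
 qed
 have id: "ideal N P"
 proof (rule idealI[OF P_ring])
  show "subgroup N (add_monoid P)"
   by (rule P.add.subgroupI) (use neg zero add Nz(1) in \<open>auto simp: a_inv_def\<close>)
 qed (use lm rm in auto)
 have diff: "h \<ominus>\<^bsub>P\<^esub> h' \<in> N" if hh: "h \<in> carrier P" "h' \<in> carrier P"
  "!!x y. x \<in> BC ==> y \<in> BC ==> ext_sum F V (g x y) h = ext_sum F V (g x y) h'" for h h'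
 proof -
  have "ext_sum F V (g x y) (h \<ominus>\<^bsub>P\<^esub> h') = \<zero>\<^bsub>V\<^esub>" if xy: "x \<in> BC" "y \<in> BC" for x y
  proof -
   have "ext_sum F V (g x y) (h \<ominus>\<^bsub>P\<^esub> h') = ext_sum F V (g x y) h \<ominus>\<^bsub>V\<^esub> ext_sum F V (g x y) h'"
    by (rule additive_minus[OF P_abelian V.M.abelian_group_axioms, where h = "ext_sum F V (g x y)",
      OF ext_closed[OF _ gc[OF xy]] ext_add[OF _ _ gc[OF xy]] hh(1,2)]) assumption+
   then show ?thesis using hh(3)[OF xy] ext_closed[OF hh(2) gc[OF xy]] by (simp add: V.M.minus_eq V.M.r_neg)
  qed
  then show ?thesis using hh(1,2) by (intro NI P.minus_closed) auto
 qed
 have ge: "ext_sum F V (g x y) (single F p c) = c \<odot>\<^bsub>V\<^esub> g x y p" if "x \<in> BC" "y \<in> BC" "p \<in> BC" "c \<in> carrier F" for x y p c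
  by (rule ext_single[OF that(3,4) gc[OF that(1,2)]])
 have gs: "ext_sum F V (g x y) (single F p c \<oplus>\<^bsub>P\<^esub> single F q d) = c \<odot>\<^bsub>V\<^esub> g x y p \<oplus>\<^bsub>V\<^esub> d \<odot>\<^bsub>V\<^esub> g x y q"
  if "x \<in> BC" "y \<in> BC" "p \<in> BC" "q \<in> BC" "c \<in> carrier F" "d \<in> carrier F" for x y p q c d
  using ext_add[OF single_closed[OF that(3,5)] single_closed[OF that(4,6)] gc[OF that(1,2)]]
   ge[OF that(1,2,3,5)] ge[OF that(1,2,4,6)] by simp
 have g_eq: "g x y p = u (fst x \<otimes>\<^bsub>B\<^esub> fst p \<otimes>\<^bsub>B\<^esub> fst y) (snd x \<otimes>\<^bsub>C\<^esub> snd p \<otimes>\<^bsub>C\<^esub> snd y)" for x y p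
  by (simp add: g_def pm_def)
 have BCD: "fst x \<in> carrier B" "snd x \<in> carrier C" if "x \<in> BC" for x using that by auto
 have "tensor_relations F B C \<subseteq> N"
 proof
  fix r assume "r \<in> tensor_relations F B C"
  then consider
   (1) b b' c where "r = single F (b \<oplus>\<^bsub>B\<^esub> b', c) \<one>\<^bsub>F\<^esub> \<ominus>\<^bsub>P\<^esub> (single F (b, c) \<one>\<^bsub>F\<^esub> \<oplus>\<^bsub>P\<^esub> single F (b', c) \<one>\<^bsub>F\<^esub>)"
    "b \<in> carrier B" "b' \<in> carrier B" "c \<in> carrier C"
  | (2) b c c' where "r = single F (b, c \<oplus>\<^bsub>C\<^esub> c') \<one>\<^bsub>F\<^esub> \<ominus>\<^bsub>P\<^esub> (single F (b, c) \<one>\<^bsub>F\<^esub> \<oplus>\<^bsub>P\<^esub> single F (b, c') \<one>\<^bsub>F\<^esub>)"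
    "b \<in> carrier B" "c \<in> carrier C" "c' \<in> carrier C"
  | (3) s b c where "r = single F (s \<odot>\<^bsub>B\<^esub> b, c) \<one>\<^bsub>F\<^esub> \<ominus>\<^bsub>P\<^esub> single F (b, c) s"
    "s \<in> carrier F" "b \<in> carrier B" "c \<in> carrier C"
  | (4) s b c where "r = single F (b, s \<odot>\<^bsub>C\<^esub> c) \<one>\<^bsub>F\<^esub> \<ominus>\<^bsub>P\<^esub> single F (b, c) s"
    "s \<in> carrier F" "b \<in> carrier B" "c \<in> carrier C"
   unfolding tensor_relations_def by blast
  then show "r \<in> N"
  proof cases
   case 1
   show ?thesis unfolding 1(1)
   proof (rule diff)
    fix x y assume xy: "x \<in> BC" "y \<in> BC"
    show "ext_sum F V (g x y) (single F (b \<oplus>\<^bsub>B\<^esub> b', c) \<one>\<^bsub>F\<^esub>) =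
     ext_sum F V (g x y) (single F (b, c) \<one>\<^bsub>F\<^esub> \<oplus>\<^bsub>P\<^esub> single F (b', c) \<one>\<^bsub>F\<^esub>)"
     using BCD[OF xy(1)] BCD[OF xy(2)] 1(2-) by (simp add: ge[OF xy] gs[OF xy] g_eq B.l_distr B.r_distr u)
   qed (use 1 in \<open>auto intro!: single_closed P_add_closed\<close>)
  next
   case 2
   show ?thesis unfolding 2(1)
   proof (rule diff)
    fix x y assume xy: "x \<in> BC" "y \<in> BC"
    show "ext_sum F V (g x y) (single F (b, c \<oplus>\<^bsub>C\<^esub> c') \<one>\<^bsub>F\<^esub>) =
     ext_sum F V (g x y) (single F (b, c) \<one>\<^bsub>F\<^esub> \<oplus>\<^bsub>P\<^esub> single F (b, c') \<one>\<^bsub>F\<^esub>)"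
     using BCD[OF xy(1)] BCD[OF xy(2)] 2(2-) by (simp add: ge[OF xy] gs[OF xy] g_eq C.l_distr C.r_distr u)
   qed (use 2 in \<open>auto intro!: single_closed P_add_closed\<close>)
  next
   case 3
   show ?thesis unfolding 3(1)
   proof (rule diff)
    fix x y assume xy: "x \<in> BC" "y \<in> BC"
    show "ext_sum F V (g x y) (single F (s \<odot>\<^bsub>B\<^esub> b, c) \<one>\<^bsub>F\<^esub>) = ext_sum F V (g x y) (single F (b, c) s)"
     using BCD[OF xy(1)] BCD[OF xy(2)] 3(2-) by (simp add: ge[OF xy] g_eq u B.mult_smult_l B.mult_smult_r)
   qed (use 3 in \<open>auto intro!: single_closed P_add_closed\<close>)
  next
   case 4
   show ?thesis unfolding 4(1)
   proof (rule diff)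
    fix x y assume xy: "x \<in> BC" "y \<in> BC"
    show "ext_sum F V (g x y) (single F (b, s \<odot>\<^bsub>C\<^esub> c) \<one>\<^bsub>F\<^esub>) = ext_sum F V (g x y) (single F (b, c) s)"
     using BCD[OF xy(1)] BCD[OF xy(2)] 4(2-) by (simp add: ge[OF xy] g_eq u C.mult_smult_l C.mult_smult_r)
   qed (use 4 in \<open>auto intro!: single_closed P_add_closed\<close>)
  qed
 qed
 then have "f \<in> N" using P.genideal_minimal[OF id] assms(2) by auto
 then have f: "f \<in> carrier P" "ext_sum F V (g (\<one>\<^bsub>B\<^esub>, \<one>\<^bsub>C\<^esub>) (\<one>\<^bsub>B\<^esub>, \<one>\<^bsub>C\<^esub>)) f = \<zero>\<^bsub>V\<^esub>"
  using Nz by auto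
 have "ext_sum F V (%p. u (fst p) (snd p)) f = ext_sum F V (g (\<one>\<^bsub>B\<^esub>, \<one>\<^bsub>C\<^esub>) (\<one>\<^bsub>B\<^esub>, \<one>\<^bsub>C\<^esub>)) f"
  unfolding ext_sum_def
  by (rule V.M.finsum_cong') (use f(1) P_carrier in \<open>auto simp: g_def pm_def intro!: V.smult_closed u(1)\<close>)
 then show ?thesis using f by simp
qed

text \<open>The last clause says that every representative of \<open>t\<close> evaluates to
  \<open>h t\<close>. It is what turns the description operator in \<open>bimodule\<close> into an
  additive function of \<open>t\<close>.\<close>

lemma tensor_lift:
 assumes "bilinear_map F B C V u"
 obtains h where "!!t. t \<in> carrier T ==> h t \<in> carrier V"
  "!!t t'. t \<in> carrier T ==> t' \<in> carrier T ==> h (t \<oplus>\<^bsub>T\<^esub> t') = h t \<oplus>\<^bsub>V\<^esub> h t'"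
  "!!b c. b \<in> carrier B ==> c \<in> carrier C ==> h (tns b c) = u b c"
  "!!t f. t \<in> carrier T ==> f \<in> t ==> ext_sum F V (%p. u (fst p) (snd p)) f = h t"
proof -
 note u = bilinear_mapD[OF assms]
 let ?e = "ext_sum F V (%p. u (fst p) (snd p))"
 have uc: "!!p. p \<in> BC ==> u (fst p) (snd p) \<in> carrier V" using u(1) by auto
 have eq: "?e f = ?e g" if fg: "f \<in> carrier P" "g \<in> carrier P" "cls f = cls g" for f g
 proof -
  have "f \<ominus>\<^bsub>P\<^esub> g \<in> J" using fg cls_eq_iff by auto
  then have "?e (f \<ominus>\<^bsub>P\<^esub> g) = \<zero>\<^bsub>V\<^esub>" by (rule ext_J[OF assms])
  moreover have "?e (f \<ominus>\<^bsub>P\<^esub> g) = ?e f \<ominus>\<^bsub>V\<^esub> ?e g"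
   by (rule additive_minus[OF P_abelian V.M.abelian_group_axioms, where h = ?e,
      OF ext_closed[OF _ uc] ext_add[OF _ _ uc] fg(1,2)]) assumption+
  ultimately show ?thesis
   using V.M.minus_zero_imp_eq[OF ext_closed[OF fg(1) uc] ext_closed[OF fg(2) uc]] by simp
 qed
 define h where "h t = ?e (SOME f. f \<in> carrier P \<and> t = cls f)" for t
 have hc: "h (cls f) = ?e f" if f: "f \<in> carrier P" for f
 proof -
  have "(SOME g. g \<in> carrier P \<and> cls f = cls g) \<in> carrier P \<and> cls f = cls (SOME g. g \<in> carrier P \<and> cls f = cls g)"
   by (rule someI[of "%g. g \<in> carrier P \<and> cls f = cls g" f]) (simp add: f)
  from eq[OF conjunct1[OF this] f conjunct2[OF this, symmetric]] show ?thesis unfolding h_def .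
 qed
 show ?thesis
 proof (rule that[of h])
  fix t assume t: "t \<in> carrier T"
  obtain f where f: "f \<in> carrier P" "t = cls f" using cls_surj[OF t] .
  show "h t \<in> carrier V" unfolding f(2) hc[OF f(1)] by (rule ext_closed[OF f(1) uc])
  fix t' assume t': "t' \<in> carrier T"
  obtain g where g: "g \<in> carrier P" "t' = cls g" using cls_surj[OF t'] .
  show "h (t \<oplus>\<^bsub>T\<^esub> t') = h t \<oplus>\<^bsub>V\<^esub> h t'"
   unfolding f(2) g(2) cls_add[OF f(1) g(1), symmetric] hc[OF f(1)] hc[OF g(1)] hc[OF P_add_closed[OF f(1) g(1)]]
   by (rule ext_add[OF f(1) g(1) uc])
 next
  fix b c assume bc: "b \<in> carrier B" "c \<in> carrier C"
  then have p: "(b, c) \<in> BC" by simp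
  show "h (tns b c) = u b c"
   unfolding tns_def hc[OF single_closed[OF p B.R.one_closed]]
   using ext_single[OF p B.R.one_closed, where g = "%p. u (fst p) (snd p)", OF uc] u(1)[OF bc] by simp
 next
  show "?e f = h t" if t: "t \<in> carrier T" "f \<in> t" for t f
  proof -
   obtain g where g: "g \<in> carrier P" "t = cls g" using cls_surj[OF t(1)] .
   have f: "f \<in> carrier P" "cls f = cls g" using mem_cls[OF g(1)] t(2) g(2) by auto
   show ?thesis unfolding g(2) f(2)[symmetric] hc[OF f(1)] ..
  qed
 qed
qed

end

end

section \<open>Separable elements of division algebras\<close>

text \<open>Over a field these are the powers of the characteristic exponent: only 1 in
  characteristic 0, and all powers of \<open>p\<close> in characteristic \<open>p\<close>.
  Statements about Frobenius powers thus cover both cases at once.\<close>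

inductive_set frob :: "('f, 'n) ring_scheme => nat set" for F where
 one: "1 \<in> frob F"
| step: "q \<in> frob F ==> Factorial_Ring.prime p ==> add_pow F p \<one>\<^bsub>F\<^esub> = \<zero>\<^bsub>F\<^esub> ==> p * q \<in> frob F"

section \<open>Binomial expansion of additive operators\<close>

context abelian_group begin

lemma nsum_Suc_shift:
 assumes "!!i. i < Suc n ==> f i \<in> carrier G"
 shows "nsum G f (Suc n) = f 0 \<oplus> nsum G (%i. f (Suc i)) n"
 using assms
proof (induction n)
 case (Suc n)
 have "nsum G f (Suc (Suc n)) = f 0 \<oplus> nsum G (%i. f (Suc i)) n \<oplus> f (Suc n)"
  using Suc by simp
 then show ?case using Suc.prems by (simp add: a_assoc)
qed simp

lemma nsum_plus:
 assumes "!!i. i < n + m ==> f i \<in> carrier G"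
 shows "nsum G f (n + m) = nsum G f n \<oplus> nsum G (%i. f (n + i)) m"
 using assms by (induction m) (simp_all add: a_assoc)

lemma nsum_truncate:
 assumes "!!i. i < n ==> f i \<in> carrier G" "m \<le> n" "!!i. m \<le> i ==> i < n ==> f i = \<zero>"
 shows "nsum G f n = nsum G f m"
proof -
 have "nsum G f (m + (n - m)) = nsum G f m \<oplus> nsum G (%i. f (m + i)) (n - m)"
  using assms by (intro nsum_plus) auto
 moreover have "nsum G (%i. f (m + i)) (n - m) = \<zero>" using assms by (intro nsum_zero) auto
 ultimately show ?thesis using assms by simp
qed

text \<open>For a polynomial whose exponents are all divisible by \<open>p\<close>: its value at
  \<open>x\<close> becomes the value of a shorter polynomial at the \<open>p\<close>-th power of
  \<open>x\<close>.\<close>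

lemma nsum_multiples:
 assumes "!!i. f i \<in> carrier G" "p > 0" "!!i. \<not> p dvd i ==> f i = \<zero>"
 shows "nsum G f (Suc (p * m)) = nsum G (%j. f (p * j)) (Suc m)"
proof (induction m)
 case (Suc m)
 have e: "Suc (p * Suc m) = Suc (p * m) + p" by simp
 obtain r where r: "p = Suc r" using assms(2) by (cases p) auto
 have z: "nsum G (%i. f (Suc (p * m) + i)) r = \<zero>"
 proof (rule nsum_zero)
  fix i assume "i < r"
  then have "\<not> p dvd Suc i" using r by (auto dest: dvd_imp_le)
  then have "\<not> p dvd p * m + Suc i" by (subst dvd_add_right_iff) simp
  then show "f (Suc (p * m) + i) = \<zero>" using assms(3) by simp
 qed
 have "nsum G (%i. f (Suc (p * m) + i)) p = f (Suc (p * m) + r)"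
  unfolding r nsum.simps using z[unfolded r] assms(1) by simp
 moreover have "Suc (p * m) + r = p * Suc m" using r by simp
 ultimately have "nsum G (%i. f (Suc (p * m) + i)) p = f (p * Suc m)" by (simp only:)
 then show ?case unfolding e nsum_plus[OF assms(1)] using Suc by simp
qed (use assms in simp)

text \<open>The binomial theorem for \<open>1 + g\<close> with an additive operator
  \<open>g\<close>. As \<open>g\<close> commutes with the identity operator, it can be used inside
  noncommutative rings.\<close>

lemma binomial_op:
 assumes "!!v. v \<in> carrier G ==> g v \<in> carrier G"
  and "!!v w. v \<in> carrier G ==> w \<in> carrier G ==> g (v \<oplus> w) = g v \<oplus> g w"
  and "v \<in> carrier G"
 shows "((%v. v \<oplus> g v) ^^ n) v = nsum G (%k. add_pow G (n choose k) ((g ^^ k) v)) (Suc n)"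
proof (induction n)
 case 0
 then show ?case using assms by simp
next
 case (Suc n)
 have gc: "(g ^^ k) v \<in> carrier G" for k using assms by (induction k) auto
 let ?t = "%n k. add_pow G (n choose k) ((g ^^ k) v)"
 have tc: "?t n k \<in> carrier G" for n k using gc by simp
 let ?S = "nsum G (?t n) (Suc n)"
 have gadd: "g (add_pow G m w) = add_pow G m (g w)" if "w \<in> carrier G" for m :: nat and w
 proof (induction m)
  case 0
  show ?case using additive_zero[OF abelian_group_axioms abelian_group_axioms, of g] assms by simp
 next
  case (Suc m)
  then show ?case using that assms by simp
 qed
 have S: "?S \<in> carrier G" using tc by (intro nsum_closed)
 have "g ?S = nsum G (%k. g (?t n k)) (Suc n)"
  by (rule additive_nsum[OF abelian_group_axioms abelian_group_axioms assms(1,2)]) (use tc in auto)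
 also have "\<dots> = nsum G (%k. add_pow G (n choose k) ((g ^^ Suc k) v)) (Suc n)"
  by (rule nsum_cong) (use gadd gc in simp)
 finally have gS: "g ?S = nsum G (%k. add_pow G (n choose k) ((g ^^ Suc k) v)) (Suc n)" .
 \<comment> \<open>Pascal's rule needs the sum for \<open>n\<close> both unshifted and shifted by
   one; to align the ranges, the vanishing term with \<open>n choose Suc n\<close> is
   appended.\<close>
 have "nsum G (?t n) (Suc (Suc n)) = ?t n 0 \<oplus> nsum G (%k. ?t n (Suc k)) (Suc n)"
  by (rule nsum_Suc_shift) (rule tc)
 moreover have "nsum G (?t n) (Suc (Suc n)) = ?S"
  unfolding nsum.simps(2)[of G "?t n" "Suc n"] using S gc[of "Suc n"] by (simp add: binomial_eq_0 del: nsum.simps)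
 ultimately have S2: "?S = ?t n 0 \<oplus> nsum G (%k. ?t n (Suc k)) (Suc n)" by simp
 have "nsum G (?t (Suc n)) (Suc (Suc n)) = ?t (Suc n) 0 \<oplus> nsum G (%k. ?t (Suc n) (Suc k)) (Suc n)"
  by (rule nsum_Suc_shift) (rule tc)
 also have "nsum G (%k. ?t (Suc n) (Suc k)) (Suc n) =
   nsum G (%k. ?t n (Suc k) \<oplus> add_pow G (n choose k) ((g ^^ Suc k) v)) (Suc n)"
 proof (rule nsum_cong)
  fix k
  have w: "(g ^^ Suc k) v \<in> carrier G" by (rule gc)
  show "?t (Suc n) (Suc k) = ?t n (Suc k) \<oplus> add_pow G (n choose k) ((g ^^ Suc k) v)"
   using add.nat_pow_mult[OF w, of "n choose Suc k" "n choose k"] by (simp add: add.commute)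
 qed
 also have "\<dots> = nsum G (%k. ?t n (Suc k)) (Suc n) \<oplus> g ?S"
  unfolding gS by (rule nsum_add) (rule tc, rule add.nat_pow_closed, rule gc)
 finally have "nsum G (?t (Suc n)) (Suc (Suc n)) = ?S \<oplus> g ?S"
  unfolding S2 using nsum_closed[of "Suc n" "%k. ?t n (Suc k)", OF tc] assms(1)[OF S, unfolded S2] tc[of n 0]
  by (simp add: a_assoc del: nsum.simps(2))
 then show ?case using Suc by (simp del: nsum.simps)
qed

text \<open>The binomial coefficients strictly between the ends are multiples of \<open>p\<close>
  and annihilate everything.\<close>

lemma frobenius_op_prime:
 assumes "!!v. v \<in> carrier G ==> g v \<in> carrier G"
  and "!!v w. v \<in> carrier G ==> w \<in> carrier G ==> g (v \<oplus> w) = g v \<oplus> g w"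
  and "v \<in> carrier G" "Factorial_Ring.prime p" "!!v. v \<in> carrier G ==> add_pow G p v = \<zero>"
 shows "((%v. v \<oplus> g v) ^^ p) v = v \<oplus> (g ^^ p) v"
proof -
 have gc: "(g ^^ k) v \<in> carrier G" for k using assms by (induction k) auto
 let ?t = "%k. add_pow G (p choose k) ((g ^^ k) v)"
 have tc: "?t k \<in> carrier G" for k using gc by simp
 obtain r where r: "p = Suc r" using assms(4) by (cases p) auto
 have z: "nsum G (%k. ?t (Suc k)) r = \<zero>"
 proof (rule nsum_zero)
  fix i assume i: "i < r"
  have "p dvd (p choose Suc i)" using assms(4) i r by (intro dvd_choose_prime) auto
  then obtain m where m: "p choose Suc i = m * p" by (metis dvdE mult.commute)
  have "add_pow G (m * p) ((g ^^ Suc i) v) = add_pow G p (add_pow G m ((g ^^ Suc i) v))"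
   using add.nat_pow_pow[OF gc[of "Suc i"]] by metis
  then show "?t (Suc i) = \<zero>" unfolding m using assms(5) gc add.nat_pow_closed by metis
 qed
 have "nsum G ?t (Suc p) = ?t 0 \<oplus> nsum G (%k. ?t (Suc k)) p" by (rule nsum_Suc_shift) (rule tc)
 also have "nsum G (%k. ?t (Suc k)) p = ?t p"
  unfolding r nsum.simps(2) using z[unfolded r] gc[of "Suc r"] by simp
 finally show ?thesis using binomial_op[OF assms(1-3), of p] gc[of p] assms(3) by simp
qed

end

text \<open>\<open>(1 + g)^q = 1 + g^q\<close> for operators and not for ring elements, since it is
  applied both to a conjugation minus the identity and to a left multiplication. The induction
  varies \<open>g\<close>: the hypothesis for \<open>q\<close> is applied to the \<open>p\<close>-th
  iterate of \<open>g\<close>.\<close>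

lemma (in vspace) frobenius_op:
 assumes "q \<in> frob F" "!!v. v \<in> carrier V ==> g v \<in> carrier V"
  and "!!v w. v \<in> carrier V ==> w \<in> carrier V ==> g (v \<oplus>\<^bsub>V\<^esub> w) = g v \<oplus>\<^bsub>V\<^esub> g w"
  and "v \<in> carrier V"
 shows "((%v. v \<oplus>\<^bsub>V\<^esub> g v) ^^ q) v = v \<oplus>\<^bsub>V\<^esub> (g ^^ q) v"
 using assms
proof (induction arbitrary: g v rule: frob.induct)
 case one
 then show ?case by simp
next
 case (step q p)
 note g = step.prems
 have pz: "add_pow V p v = \<zero>\<^bsub>V\<^esub>" if v: "v \<in> carrier V" for v
 proof -
  have "add_pow V n v = (add_pow F n \<one>\<^bsub>F\<^esub>) \<odot>\<^bsub>V\<^esub> v" for n :: nat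
   using v by (induction n) (auto simp: smult_l_distr)
  then show ?thesis using step v by simp
 qed
 have gk: "(g ^^ k) v \<in> carrier V" if "v \<in> carrier V" for k v using that g by (induction k) auto
 have gka: "(g ^^ k) (v \<oplus>\<^bsub>V\<^esub> w) = (g ^^ k) v \<oplus>\<^bsub>V\<^esub> (g ^^ k) w" if "v \<in> carrier V" "w \<in> carrier V" for k v w
  using that g gk by (induction k) auto
 have pr: "((%v. v \<oplus>\<^bsub>V\<^esub> g v) ^^ p) v = v \<oplus>\<^bsub>V\<^esub> (g ^^ p) v" if "v \<in> carrier V" for v
  by (rule M.frobenius_op_prime[OF g(1,2) that step(2) pz])
 have it: "(((%v. v \<oplus>\<^bsub>V\<^esub> g v) ^^ p) ^^ k) v = ((%v. v \<oplus>\<^bsub>V\<^esub> (g ^^ p) v) ^^ k) v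
   \<and> ((%v. v \<oplus>\<^bsub>V\<^esub> (g ^^ p) v) ^^ k) v \<in> carrier V" for k
  using g(3) by (induction k) (auto simp: pr gk)
 have "((%v. v \<oplus>\<^bsub>V\<^esub> (g ^^ p) v) ^^ q) v = v \<oplus>\<^bsub>V\<^esub> ((g ^^ p) ^^ q) v"
  by (rule step.IH[OF gk gka g(3)])
 then show ?case using it[of q] by (simp add: funpow_mult)
qed

section \<open>Subalgebras, centralizers and separable elements\<close>

locale fd_algebra = assoc_algebra F A
 for F :: "('f, 'n) ring_scheme" and A :: "('f, 'a, 'm) module_scheme" (structure) +
 assumes fd: "finite_dimensional F A"

sublocale fd_algebra \<subseteq> fd_vspace F A by unfold_locales (rule fd)

context assoc_algebra begin

definition subalg :: "'a set => bool" where
 "subalg W \<longleftrightarrow> subsp W \<and> \<one> \<in> W \<and> (\<forall>x \<in> W. \<forall>y \<in> W. x \<otimes> y \<in> W)"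

definition gen :: "'a set => 'a set" where
 "gen S = \<Inter>{W. subalg W \<and> S \<subseteq> W}"

definition cent :: "'a set => 'a set" where
 "cent S = {x \<in> carrier A. \<forall>s \<in> S. x \<otimes> s = s \<otimes> x}"

text \<open>Some polynomial over \<open>F\<close> has \<open>x\<close> as a root, while its
  derivative does not vanish at \<open>x\<close>. In a division algebra \<open>F[x]\<close> is a
  field, and there this amounts to separability of the minimal polynomial: if \<open>f = m g\<close>
  and \<open>m(x) = 0\<close>, the derivative of \<open>f\<close> at \<open>x\<close> is that of
  \<open>m\<close> times \<open>g(x)\<close>.\<close>

definition sep :: "'a => bool" where
 "sep x \<longleftrightarrow> (\<exists>a n. (\<forall>k. a k \<in> carrier F) \<and> nsum A (%k. a k \<odot> x [^] k) (Suc n) = \<zero> \<and>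
   nsum A (%k. add_pow F (Suc k) (a (Suc k)) \<odot> x [^] k) n \<noteq> \<zero>)"

lemma subalgD:
 assumes "subalg W"
 shows "subsp W" "\<one> \<in> W" "x \<in> W ==> y \<in> W ==> x \<otimes> y \<in> W"
 using assms by (auto simp: subalg_def)

lemma subalg_carrier: "subalg (carrier A)"
 by (auto simp: subalg_def subsp_carrier)

lemma gen_incl: "S \<subseteq> gen S" by (auto simp: gen_def)

lemma gen_min: "subalg W ==> S \<subseteq> W ==> gen S \<subseteq> W" by (auto simp: gen_def)

lemma gen_mono: "S \<subseteq> S' ==> gen S \<subseteq> gen S'" by (auto simp: gen_def)

lemma gen_subalg: assumes "S \<subseteq> carrier A" shows "subalg (gen S)"
proof -
 have "subsp (gen S)"
 proof (rule subspI)
  show "gen S \<subseteq> carrier A" by (rule gen_min[OF subalg_carrier assms])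
 next
  show "\<zero> \<in> gen S" unfolding gen_def by (auto dest!: subalgD(1) dest: subspD(2))
 next
  fix x y assume "x \<in> gen S" "y \<in> gen S"
  then show "x \<oplus> y \<in> gen S" unfolding gen_def by (auto intro: subspD(3)[OF subalgD(1)])
 next
  fix c x assume "c \<in> carrier F" "x \<in> gen S"
  then show "c \<odot> x \<in> gen S" unfolding gen_def by (auto intro: subspD(6)[OF subalgD(1)])
 qed
 then show ?thesis unfolding subalg_def by (auto simp: gen_def subalg_def)
qed

lemma cent_carrier: "cent S \<subseteq> carrier A" by (auto simp: cent_def)

lemma cent_subalg: assumes "S \<subseteq> carrier A" shows "subalg (cent S)"
 unfolding subalg_def
proof (intro conjI ballI)
 show "subsp (cent S)"
 proof (rule subspI)
  fix x y assume "x \<in> cent S" "y \<in> cent S"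
  then show "x \<oplus> y \<in> cent S" using assms by (auto simp: cent_def subset_iff l_distr r_distr)
 next
  fix c x assume "c \<in> carrier F" "x \<in> cent S"
  then show "c \<odot> x \<in> cent S" using assms by (auto simp: cent_def subset_iff mult_smult_l mult_smult_r)
 qed (use assms in \<open>auto simp: cent_def subset_iff\<close>)
 show "\<one> \<in> cent S" using assms by (auto simp: cent_def subset_iff)
 fix x y assume xy: "x \<in> cent S" "y \<in> cent S"
 have "(x \<otimes> y) \<otimes> s = s \<otimes> (x \<otimes> y)" if s: "s \<in> S" for s
 proof -
  have c: "x \<in> carrier A" "y \<in> carrier A" "s \<in> carrier A" using xy s assms by (auto simp: cent_def)
  have "(x \<otimes> y) \<otimes> s = x \<otimes> (s \<otimes> y)" using xy s c by (simp add: cent_def massoc)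
  also have "\<dots> = (x \<otimes> s) \<otimes> y" using c by (simp add: massoc)
  also have "\<dots> = (s \<otimes> x) \<otimes> y" using xy s by (simp add: cent_def)
  finally show ?thesis using c by (simp add: massoc)
 qed
 then show "x \<otimes> y \<in> cent S" using xy by (simp add: cent_def)
qed

lemma cent_sym: "S \<subseteq> carrier A ==> S' \<subseteq> cent S ==> S \<subseteq> cent S'"
 by (force simp: cent_def subset_iff)

lemma gen_comm: assumes "S \<subseteq> carrier A" "S \<subseteq> cent S" shows "gen S \<subseteq> cent (gen S)"
proof -
 have "gen S \<subseteq> cent S" by (rule gen_min[OF cent_subalg[OF assms(1)] assms(2)])
 then have "S \<subseteq> cent (gen S)" by (rule cent_sym[OF assms(1)])
 then show ?thesis
  by (rule gen_min[OF cent_subalg[OF subspD(1)[OF subalgD(1)[OF gen_subalg[OF assms(1)]]]]])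
qed

text \<open>\<open>S\<close> lies in its double centralizer, and that is a subalgebra, so it
  contains \<open>gen S\<close> as well.\<close>

lemma cent_gen: assumes "S \<subseteq> carrier A" shows "cent (gen S) = cent S"
proof
 show "cent (gen S) \<subseteq> cent S" using gen_incl by (auto simp: cent_def subset_iff)
 have c: "cent S \<subseteq> carrier A" by (rule cent_carrier)
 have "S \<subseteq> cent (cent S)" by (rule cent_sym[OF assms subset_refl])
 then have "gen S \<subseteq> cent (cent S)" by (rule gen_min[OF cent_subalg[OF c]])
 then show "cent S \<subseteq> cent (gen S)" by (rule cent_sym[OF c])
qed

lemma subalg_pow: "subalg W ==> x \<in> W ==> x [^] (n :: nat) \<in> W"
 by (induction n) (auto dest: subalgD)

end

section \<open>Division algebras and the Jacobson-Noether theorem\<close>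

locale division_algebra = fd_algebra +
 assumes one_nz: "\<one> \<noteq> \<zero>"
  and left_inv_ex: "[|x \<in> carrier A; x \<noteq> \<zero>|] ==> \<exists>y \<in> carrier A. y \<otimes> x = \<one>"
begin

lemma inv_ex:
 assumes "x \<in> carrier A" "x \<noteq> \<zero>"
 obtains y where "y \<in> carrier A" "y \<otimes> x = \<one>" "x \<otimes> y = \<one>"
proof -
 obtain y where y: "y \<in> carrier A" "y \<otimes> x = \<one>" using left_inv_ex assms by auto
 have "y \<noteq> \<zero>" using y assms one_nz by auto
 then obtain z where z: "z \<in> carrier A" "z \<otimes> y = \<one>" using left_inv_ex y by auto
 have "z = x" using massoc[of z y x] y z assms by simp
 then show ?thesis using that y z by auto
qed

lemma cancel_l:
 assumes "x \<in> carrier A" "x \<noteq> \<zero>" "u \<in> carrier A" "v \<in> carrier A" "x \<otimes> u = x \<otimes> v"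
 shows "u = v"
proof -
 obtain y where y: "y \<in> carrier A" "y \<otimes> x = \<one>" using left_inv_ex assms by auto
 then show ?thesis using massoc[of y x u] massoc[of y x v] assms by simp
qed

lemma no_zero_div:
 assumes "x \<in> carrier A" "x \<noteq> \<zero>" "u \<in> carrier A" "x \<otimes> u = \<zero>" shows "u = \<zero>"
 by (rule cancel_l[OF assms(1,2)]) (use assms in auto)

lemma pow_nz: assumes "x \<in> carrier A" "x \<noteq> \<zero>" shows "x [^] (n :: nat) \<noteq> \<zero>"
proof (induction n)
 case 0
 show ?case using one_nz by simp
next
 case (Suc n)
 then show ?case using no_zero_div[of "x [^] n" x] assms by auto
qed

text \<open>The chain of subspaces \<open>x^n W\<close> becomes stationary, so
  \<open>x^n = x^(n+1) w\<close> for some \<open>w\<close> in \<open>W\<close>; cancelling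
  \<open>x^n\<close> leaves \<open>x w = 1\<close>.\<close>

lemma inv_in_subalg:
 assumes "subalg W" "x \<in> W" "x \<noteq> \<zero>"
 obtains y where "y \<in> W" "x \<otimes> y = \<one>"
proof -
 note W = subspD[OF subalgD(1)[OF assms(1)]]
 have x: "x \<in> carrier A" using W assms by auto
 define f where "f n = (%w. x [^] (n :: nat) \<otimes> w) ` W" for n
 have sub: "subsp (f n)" for n
 proof (rule subspI)
  show "f n \<subseteq> carrier A" using W x by (auto simp: f_def)
  show "\<zero> \<in> f n" unfolding f_def using W(2) x by (intro image_eqI[of _ _ "\<zero>"]) auto
 next
  fix u v assume "u \<in> f n" "v \<in> f n"
  then obtain a b where ab: "a \<in> W" "u = x [^] n \<otimes> a" "b \<in> W" "v = x [^] n \<otimes> b" by (auto simp: f_def)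
  then have "u \<oplus> v = x [^] n \<otimes> (a \<oplus> b)" using W(7) x by (simp add: r_distr)
  then show "u \<oplus> v \<in> f n" unfolding f_def using ab W(3) by auto
 next
  fix c u assume c: "c \<in> carrier F" and "u \<in> f n"
  then obtain a where ab: "a \<in> W" "u = x [^] n \<otimes> a" by (auto simp: f_def)
  then have "c \<odot> u = x [^] n \<otimes> (c \<odot> a)" using W(7) x c by (simp add: mult_smult_r)
  then show "c \<odot> u \<in> f n" unfolding f_def using ab W(6) c by auto
 qed
 obtain n where n: "!!m. f m \<subseteq> f n ==> f m = f n"
  using min_ex[of "%_. True" "0 :: nat" f] sub by auto
 have "f (Suc n) \<subseteq> f n"
 proof
  fix u assume "u \<in> f (Suc n)"
  then obtain a where ab: "a \<in> W" "u = x [^] Suc n \<otimes> a" by (auto simp: f_def)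
  then have "u = x [^] n \<otimes> (x \<otimes> a)" using W(7) x by (simp add: massoc)
  then show "u \<in> f n" unfolding f_def using ab assms subalgD(3)[OF assms(1)] by auto
 qed
 then have "f (Suc n) = f n" by (rule n)
 moreover have "x [^] n \<in> f n" unfolding f_def using subalgD(2)[OF assms(1)] x
  by (intro image_eqI[of _ _ "\<one>"]) auto
 ultimately obtain w where w: "w \<in> W" "x [^] n = x [^] Suc n \<otimes> w" by (auto simp: f_def)
 have wc: "w \<in> carrier A" using w W by auto
 have "x [^] n \<otimes> \<one> = x [^] n \<otimes> (x \<otimes> w)" using w x wc by (simp add: massoc)
 then have "\<one> = x \<otimes> w" by (rule cancel_l[rotated -1]) (use x wc pow_nz assms in auto)
 then show ?thesis using that w by metis
qed

text \<open>If no power of \<open>x\<close> were a combination of lower powers, the spans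
  \<open>W n\<close> of the first \<open>n\<close> powers would form a strictly increasing chain and
  their ranks would be unbounded.\<close>

lemma monic_ex:
 assumes "x \<in> carrier A"
 shows "\<exists>a n. (\<forall>k. a k \<in> carrier F) \<and> a n = \<one>\<^bsub>F\<^esub> \<and> nsum A (%k. a k \<odot> x [^] k) (Suc n) = \<zero>"
proof -
 define W where "W n = {nsum A (%j. a j \<odot> x [^] j) n | a. \<forall>k. a k \<in> carrier F}" for n :: nat
 have xc: "x [^] (k :: nat) \<in> carrier A" for k using assms by simp
 have sub: "subsp (W n)" for n
 proof (rule subspI)
  show "W n \<subseteq> carrier A" using xc by (auto simp: W_def)
  show "\<zero> \<in> W n" unfolding W_def using xc
   by (intro CollectI exI[of _ "%_. \<zero>\<^bsub>F\<^esub>"]) (auto intro: nsum_zero[symmetric])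
 next
  fix u v assume "u \<in> W n" "v \<in> W n"
  then obtain a b where ab: "!!k. a k \<in> carrier F" "!!k. b k \<in> carrier F"
    "u = nsum A (%j. a j \<odot> x [^] j) n" "v = nsum A (%j. b j \<odot> x [^] j) n" by (auto simp: W_def)
  have "u \<oplus> v = nsum A (%j. a j \<odot> x [^] j \<oplus> b j \<odot> x [^] j) n"
   unfolding ab(3,4) using ab xc by (intro nsum_add[symmetric]) auto
  also have "\<dots> = nsum A (%j. (a j \<oplus>\<^bsub>F\<^esub> b j) \<odot> x [^] j) n"
   using ab xc by (intro nsum_cong) (simp add: smult_l_distr)
  finally show "u \<oplus> v \<in> W n" unfolding W_def using ab
   by (intro CollectI exI[of _ "%j. a j \<oplus>\<^bsub>F\<^esub> b j"]) auto
 next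
  fix c u assume c: "c \<in> carrier F" and "u \<in> W n"
  then obtain a where a: "!!k. a k \<in> carrier F" "u = nsum A (%j. a j \<odot> x [^] j) n" by (auto simp: W_def)
  have "c \<odot> u = nsum A (%j. c \<odot> (a j \<odot> x [^] j)) n"
   unfolding a(2) by (rule additive_nsum[OF M.abelian_group_axioms M.abelian_group_axioms, where h = "%z. c \<odot> z"])
    (use c a xc in \<open>auto simp: smult_r_distr\<close>)
  also have "\<dots> = nsum A (%j. (c \<otimes>\<^bsub>F\<^esub> a j) \<odot> x [^] j) n"
   using a xc c by (intro nsum_cong) (simp add: smult_assoc1)
  finally show "c \<odot> u \<in> W n" unfolding W_def using a c
   by (intro CollectI exI[of _ "%j. c \<otimes>\<^bsub>F\<^esub> a j"]) auto
 qed
 have mono: "W n \<subseteq> W (Suc n)" for n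
 proof
  fix u assume "u \<in> W n"
  then obtain a where a: "!!k. a k \<in> carrier F" "u = nsum A (%j. a j \<odot> x [^] j) n" by (auto simp: W_def)
  let ?a = "a(n := \<zero>\<^bsub>F\<^esub>)"
  have "nsum A (%j. ?a j \<odot> x [^] j) n = nsum A (%j. a j \<odot> x [^] j) n" by (rule nsum_cong) auto
  then have "nsum A (%j. ?a j \<odot> x [^] j) (Suc n) = u" using a xc by simp
  then show "u \<in> W (Suc n)" unfolding W_def using a by (intro CollectI exI[of _ ?a]) auto
 qed
 have top: "x [^] n \<in> W (Suc n)" for n
 proof -
  let ?a = "%j. if j = n then \<one>\<^bsub>F\<^esub> else \<zero>\<^bsub>F\<^esub>"
  have "nsum A (%j. ?a j \<odot> x [^] j) n = \<zero>" using xc by (intro nsum_zero) auto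
  then have "nsum A (%j. ?a j \<odot> x [^] j) (Suc n) = x [^] n" using xc by simp
  then show ?thesis unfolding W_def by (intro CollectI exI[of _ ?a]) auto
 qed
 have "\<exists>n. x [^] n \<in> W n"
 proof (rule ccontr)
  assume no: "\<not> ?thesis"
  have "W n \<subset> W (Suc n)" for n using mono[of n] top[of n] no by auto
  then have "rnk (W n) < rnk (W (Suc n))" for n using rnk_less sub by blast
  then have ge: "n \<le> rnk (W n)" for n by (induction n) (auto intro: Suc_leI le_less_trans)
  obtain N where N: "!!U. rnk U \<le> N" using rnk_ex by auto
  show False using ge[of "Suc N"] N[of "W (Suc N)"] by simp
 qed
 then obtain n a where a: "!!k. a k \<in> carrier F" "x [^] n = nsum A (%j. a j \<odot> x [^] j) n" by (auto simp: W_def)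
 let ?a = "%j. if j = n then \<one>\<^bsub>F\<^esub> else \<ominus>\<^bsub>F\<^esub> a j"
 have "nsum A (%j. ?a j \<odot> x [^] j) n = nsum A (%j. \<ominus> (a j \<odot> x [^] j)) n"
  using a xc by (intro nsum_cong) (auto simp: smult_l_minus)
 also have "\<dots> = \<ominus> (nsum A (%j. a j \<odot> x [^] j) n)"
  by (rule additive_nsum[OF M.abelian_group_axioms M.abelian_group_axioms, where h = "%z. \<ominus> z", symmetric])
   (use a xc in \<open>auto simp: minus_add\<close>)
 finally have "nsum A (%j. ?a j \<odot> x [^] j) (Suc n) = \<zero>" using a(2) xc[of n] by (simp add: l_neg)
 then show ?thesis using a by (intro exI[of _ ?a] exI[of _ n]) auto
qed

lemma add_pow_F: "c \<in> carrier F ==> add_pow F (n :: nat) c = (add_pow F n \<one>\<^bsub>F\<^esub>) \<otimes>\<^bsub>F\<^esub> c"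
 by (induction n) (auto simp: R.l_distr)

text \<open>\<open>p\<close> is the characteristic, the least positive multiple of 1 that vanishes.
  Division with remainder gives divisibility, and the absence of zero divisors gives
  primality.\<close>

lemma char_prime:
 assumes "n > 0" "add_pow F (n :: nat) \<one>\<^bsub>F\<^esub> = \<zero>\<^bsub>F\<^esub>"
 obtains p where "Factorial_Ring.prime p" "add_pow F p \<one>\<^bsub>F\<^esub> = \<zero>\<^bsub>F\<^esub>" "!!k :: nat. add_pow F k \<one>\<^bsub>F\<^esub> = \<zero>\<^bsub>F\<^esub> ==> p dvd k"
proof -
 let ?Q = "%n :: nat. n > 0 \<and> add_pow F n \<one>\<^bsub>F\<^esub> = \<zero>\<^bsub>F\<^esub>"
 define p where "p = (LEAST n. ?Q n)"
 have p: "?Q p" unfolding p_def by (rule LeastI[of ?Q n]) (use assms in simp)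
 have least: "p \<le> k" if "?Q k" for k unfolding p_def using that by (rule Least_le)
 have mul: "add_pow F (m * k) \<one>\<^bsub>F\<^esub> = add_pow F m \<one>\<^bsub>F\<^esub> \<otimes>\<^bsub>F\<^esub> add_pow F k \<one>\<^bsub>F\<^esub>" for m k :: nat
  using add_pow_F[of "add_pow F k \<one>\<^bsub>F\<^esub>" m] R.add.nat_pow_pow[of "\<one>\<^bsub>F\<^esub>" m k] by (simp add: mult.commute)
 have dv: "p dvd k" if k: "add_pow F k \<one>\<^bsub>F\<^esub> = \<zero>\<^bsub>F\<^esub>" for k :: nat
 proof -
  have "add_pow F (k div p * p + k mod p) \<one>\<^bsub>F\<^esub> = add_pow F (k div p * p) \<one>\<^bsub>F\<^esub> \<oplus>\<^bsub>F\<^esub> add_pow F (k mod p) \<one>\<^bsub>F\<^esub>"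
   using R.add.nat_pow_mult[of "\<one>\<^bsub>F\<^esub>" "k div p * p" "k mod p"] by simp
  then have "add_pow F (k mod p) \<one>\<^bsub>F\<^esub> = \<zero>\<^bsub>F\<^esub>" using k p by (simp add: mul)
  moreover have "k mod p < p" using p by simp
  ultimately have "k mod p = 0" using least[of "k mod p"] by (cases "k mod p = 0") auto
  then show ?thesis by auto
 qed
 have "p \<noteq> 1" using p by auto
 moreover have "a = 1 \<or> a = p" if "a dvd p" for a
 proof -
  obtain b where b: "p = a * b" using \<open>a dvd p\<close> by auto
  then have ab: "a > 0" "b > 0" using p by auto
  have "add_pow F a \<one>\<^bsub>F\<^esub> = \<zero>\<^bsub>F\<^esub> \<or> add_pow F b \<one>\<^bsub>F\<^esub> = \<zero>\<^bsub>F\<^esub>"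
   using p mul[of a b] b by (intro integral_iff[THEN iffD1]) auto
  then have "p \<le> a \<or> p \<le> b" using least ab by blast
  then show ?thesis using b ab by auto
 qed
 ultimately have "Factorial_Ring.prime p" using p by (auto simp: prime_nat_iff)
 then show ?thesis using that p dv by blast
qed

text \<open>Descent on the degree of a monic polynomial with root \<open>x\<close>. If its
  derivative does not vanish at \<open>x\<close>, then \<open>x\<close> is separable. If the
  derivative vanishes at \<open>x\<close> without being the zero polynomial, it can be made monic
  and has smaller degree. If the derivative is the zero polynomial, only exponents divisible by the
  characteristic \<open>p\<close> occur, and the argument continues with \<open>x^p\<close>, a root
  of a polynomial of degree \<open>n / p\<close>.\<close>

lemma sep_power_aux:
 assumes "x \<in> carrier A" "!!k. a k \<in> carrier F" "a n = \<one>\<^bsub>F\<^esub>" "nsum A (%k. a k \<odot> x [^] k) (Suc n) = \<zero>"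
 shows "\<exists>q \<in> frob F. sep (x [^] q)"
 using assms
proof (induction n arbitrary: x a rule: less_induct)
 case (less n)
 note x = less.prems(1) and a = less.prems(2) and an = less.prems(3) and ev = less.prems(4)
 have xc: "x [^] (k :: nat) \<in> carrier A" for k using x by simp
 define b where "b k = add_pow F (Suc k) (a (Suc k))" for k
 have bc: "b k \<in> carrier F" for k unfolding b_def by (rule R.add.nat_pow_closed) (rule a)
 show ?case
 proof (cases "nsum A (%k. b k \<odot> x [^] k) n = \<zero>")
  case False
  then have "sep x" unfolding sep_def using a ev b_def by (intro exI[of _ a] exI[of _ n]) auto
  then show ?thesis using frob.one x by (intro bexI[of _ 1]) auto
 next
  case dz: True
  show ?thesis
  proof (cases "\<exists>k < n. b k \<noteq> \<zero>\<^bsub>F\<^esub>")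
   case True
   \<comment> \<open>The degree of the derivative; its leading coefficient is inverted to obtain a
     monic polynomial.\<close>
   define m where "m = Max {k. k < n \<and> b k \<noteq> \<zero>\<^bsub>F\<^esub>}"
   have fin: "finite {k. k < n \<and> b k \<noteq> \<zero>\<^bsub>F\<^esub>}" by simp
   have m: "m < n" "b m \<noteq> \<zero>\<^bsub>F\<^esub>" using Max_in[OF fin] True unfolding m_def by auto
   have mx: "b k = \<zero>\<^bsub>F\<^esub>" if "m < k" "k < n" for k
    using Max_ge[OF fin, of k] that unfolding m_def by fastforce
   let ?i = "inv\<^bsub>F\<^esub> b m"
   have i: "?i \<in> carrier F" "?i \<otimes>\<^bsub>F\<^esub> b m = \<one>\<^bsub>F\<^esub>" using m bc by (auto simp: field_Units)
   have "nsum A (%k. b k \<odot> x [^] k) n = nsum A (%k. b k \<odot> x [^] k) (Suc m)"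
    by (rule nsum_truncate) (use m mx bc xc in auto)
   then have z: "nsum A (%k. b k \<odot> x [^] k) (Suc m) = \<zero>" using dz by simp
   have "nsum A (%k. (?i \<otimes>\<^bsub>F\<^esub> b k) \<odot> x [^] k) (Suc m) = nsum A (%k. ?i \<odot> (b k \<odot> x [^] k)) (Suc m)"
    using i bc xc by (intro nsum_cong) (simp add: smult_assoc1)
   also have "\<dots> = ?i \<odot> nsum A (%k. b k \<odot> x [^] k) (Suc m)"
    by (rule additive_nsum[OF M.abelian_group_axioms M.abelian_group_axioms, where h = "%z. ?i \<odot> z", symmetric])
     (use i bc xc in \<open>auto simp: smult_r_distr\<close>)
   finally have "nsum A (%k. (?i \<otimes>\<^bsub>F\<^esub> b k) \<odot> x [^] k) (Suc m) = \<zero>" unfolding z using i by simp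
   then show ?thesis by (intro less.IH[OF m(1) x, of "%k. ?i \<otimes>\<^bsub>F\<^esub> b k"]) (use i bc in auto)
  next
   case False
   have n0: "n > 0"
   proof (rule ccontr)
    assume "\<not> n > 0"
    then have "\<one> = \<zero>" using ev an by simp
    then show False using one_nz by simp
   qed
   \<comment> \<open>The leading coefficient is 1, so the vanishing of the top coefficient of the
     derivative says that \<open>n\<close> times 1 is zero.\<close>
   have cz: "add_pow F n \<one>\<^bsub>F\<^esub> = \<zero>\<^bsub>F\<^esub>" using False n0 an unfolding b_def
    by (cases n) auto
   obtain p where p: "Factorial_Ring.prime p" "add_pow F p \<one>\<^bsub>F\<^esub> = \<zero>\<^bsub>F\<^esub>" "!!k :: nat. add_pow F k \<one>\<^bsub>F\<^esub> = \<zero>\<^bsub>F\<^esub> ==> p dvd k"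
    using char_prime[OF n0 cz] by blast
   obtain m where m: "n = p * m" using p(3)[OF cz] by auto
   have p1: "p > 1" using p(1) prime_gt_1_nat by auto
   have mn: "m < n" using m n0 p1 by auto
   have az: "a k = \<zero>\<^bsub>F\<^esub>" if k: "k \<le> n" "\<not> p dvd k" for k
   proof -
    obtain j where j: "k = Suc j" using k by (cases k) auto
    have "b j = \<zero>\<^bsub>F\<^esub>" using False j k by auto
    then have "(add_pow F k \<one>\<^bsub>F\<^esub>) \<otimes>\<^bsub>F\<^esub> a k = \<zero>\<^bsub>F\<^esub>" unfolding b_def j using add_pow_F[OF a] by simp
    moreover have "add_pow F k \<one>\<^bsub>F\<^esub> \<noteq> \<zero>\<^bsub>F\<^esub>" using p(3) k by auto
    ultimately show ?thesis using a integral by blast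
   qed
   \<comment> \<open>Coefficients beyond the degree are arbitrary values of \<open>a\<close>; they
     are cut off because \<open>nsum_multiples\<close> requires vanishing at every index not
     divisible by \<open>p\<close>.\<close>
   let ?f = "%k. (if k \<le> n then a k else \<zero>\<^bsub>F\<^esub>) \<odot> x [^] k"
   have "nsum A ?f (Suc (p * m)) = nsum A (%j. ?f (p * j)) (Suc m)"
   proof (rule nsum_multiples)
    show "?f i \<in> carrier A" for i using a xc by auto
    show "p > 0" using p1 by simp
    show "?f i = \<zero>" if "\<not> p dvd i" for i using that az xc by auto
   qed
   moreover have "nsum A ?f (Suc (p * m)) = nsum A (%k. a k \<odot> x [^] k) (Suc n)"
    unfolding m[symmetric] by (rule nsum_cong) simp
   moreover have "nsum A (%j. ?f (p * j)) (Suc m) = nsum A (%j. a (p * j) \<odot> (x [^] p) [^] j) (Suc m)"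
    by (rule nsum_cong) (use m x in \<open>simp add: nat_pow_pow\<close>)
   ultimately have "nsum A (%j. a (p * j) \<odot> (x [^] p) [^] j) (Suc m) = \<zero>" using ev by metis
   then obtain q where q: "q \<in> frob F" "sep ((x [^] p) [^] q)"
    using less.IH[OF mn xc[of p], of "%j. a (p * j)"] a an m by auto
   then show ?thesis using frob.step[OF q(1) p(1,2)] x by (intro bexI[of _ "p * q"]) (auto simp: nat_pow_pow)
  qed
 qed
qed

lemma sep_power: "x \<in> carrier A ==> \<exists>q \<in> frob F. sep (x [^] q)"
 using monic_ex[of x] sep_power_aux[of x] by blast

text \<open>If every element of a centralizer \<open>C\<close> is purely inseparable over the centralized set, then
 conjugation by a noncentral \<open>x \<in> C\<close> is unipotent, which produces \<open>c \<in> C\<close> with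
 \<open>x c x\<^sup>-\<^sup>1 = c + 1\<close>; taking a Frobenius power of this equation is absurd.\<close>
lemma jacobson_noether:
 assumes "K \<subseteq> carrier A" "!!c. c \<in> cent K ==> \<exists>q \<in> frob F. c [^] q \<in> K"
  and "x \<in> cent K" "y \<in> cent K"
 shows "x \<otimes> y = y \<otimes> x"
proof (rule ccontr)
 assume ne: "x \<otimes> y \<noteq> y \<otimes> x"
 note C = subalgD[OF cent_subalg[OF assms(1)]]
 have Cc: "c \<in> carrier A" if "c \<in> cent K" for c using that cent_carrier by blast
 have x: "x \<in> carrier A" and y: "y \<in> carrier A" using assms Cc by auto
 have x0: "x \<noteq> \<zero>" using ne y by auto
 obtain x' where x': "x' \<in> cent K" "x \<otimes> x' = \<one>" using inv_in_subalg[OF cent_subalg[OF assms(1)] assms(3) x0] .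
 have x'c: "x' \<in> carrier A" using x' Cc by auto
 have x'x: "x' \<otimes> x = \<one>"
 proof -
  obtain z where z: "z \<in> carrier A" "z \<otimes> x = \<one>" using left_inv_ex[OF x x0] by auto
  have "z = x'" using massoc[of z x x'] z x x'c x'(2) by simp
  then show ?thesis using z by simp
 qed
 define s where "s v = x \<otimes> v \<otimes> x'" for v
 define d where "d v = s v \<ominus> v" for v
 have sc: "s v \<in> carrier A" if "v \<in> carrier A" for v using that x x'c by (simp add: s_def)
 have dc: "d v \<in> carrier A" if "v \<in> carrier A" for v using that sc by (simp add: d_def)
 have sadd: "s (v \<oplus> w) = s v \<oplus> s w" if "v \<in> carrier A" "w \<in> carrier A" for v w
  using that x x'c by (simp add: s_def l_distr r_distr)
 have dadd: "d (v \<oplus> w) = d v \<oplus> d w" if "v \<in> carrier A" "w \<in> carrier A" for v w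
  using that sc[OF that(1)] sc[OF that(2)] sadd[OF that] by (simp add: d_def M.minus_eq M.minus_add M.a_ac)
 have sd: "s v = v \<oplus> d v" if "v \<in> carrier A" for v
  using that sc[OF that] M.add.m_lcomm[of v "s v" "\<ominus> v"] by (simp add: d_def M.minus_eq M.r_neg)
 have smul: "s (v \<otimes> w) = s v \<otimes> s w" if "v \<in> carrier A" "w \<in> carrier A" for v w
 proof -
  have "s v \<otimes> s w = x \<otimes> v \<otimes> (x' \<otimes> x) \<otimes> w \<otimes> x'" using that x x'c by (simp add: s_def massoc)
  then show ?thesis using that x x'c x'x by (simp add: s_def massoc)
 qed
 have sfix: "s v = v \<longleftrightarrow> x \<otimes> v = v \<otimes> x" if v: "v \<in> carrier A" for v
 proof
  assume "s v = v"
  then have "x \<otimes> v \<otimes> (x' \<otimes> x) = v \<otimes> x" using v x x'c by (simp add: s_def massoc[symmetric])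
  then show "x \<otimes> v = v \<otimes> x" using v x x'x by simp
 next
  assume "x \<otimes> v = v \<otimes> x"
  then have "s v = v \<otimes> (x \<otimes> x')" using v x x'c by (simp add: s_def massoc)
  then show "s v = v" using v x'(2) by simp
 qed
 obtain q where q: "q \<in> frob F" "x [^] q \<in> K" using assms(2)[OF assms(3)] by auto
 have spow: "(s ^^ n) v = x [^] n \<otimes> v \<otimes> x' [^] n" if "v \<in> carrier A" for n v
 proof (induction n)
  case 0
  then show ?case using that by simp
 next
  case (Suc n)
  have "x [^] Suc n = x \<otimes> x [^] n" using nat_pow_Suc2[OF x] .
  then show ?case using Suc that x x'c by (simp add: s_def massoc)
 qed
 have dpow: "(d ^^ n) v \<in> carrier A" if "v \<in> carrier A" for n v using that dc by (induction n) auto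
 have spq: "x [^] n \<otimes> x' [^] n = \<one>" for n :: nat
 proof (induction n)
  case (Suc n)
  have "x' [^] Suc n = x' \<otimes> x' [^] n" using nat_pow_Suc2[OF x'c] .
  then have "x [^] Suc n \<otimes> x' [^] Suc n = x [^] n \<otimes> (x \<otimes> x') \<otimes> x' [^] n" using x x'c by (simp add: massoc)
  then show ?case using Suc x'(2) x x'c by simp
 qed simp
 \<comment> \<open>\<open>x^q\<close> lies in \<open>K\<close> and so commutes with
   \<open>y\<close>; hence \<open>s^q\<close> fixes \<open>y\<close>, and by the Frobenius identity
   for \<open>s = 1 + d\<close> this means \<open>d^q y = 0\<close>.\<close>
 have "(s ^^ q) y = y"
 proof -
  have "x [^] q \<otimes> y = y \<otimes> x [^] q" using assms(4) q(2) unfolding cent_def by auto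
  then have "(s ^^ q) y = (y \<otimes> x [^] q) \<otimes> x' [^] q" using spow[OF y, of q] by simp
  then have "(s ^^ q) y = y \<otimes> (x [^] q \<otimes> x' [^] q)" using x x'c y by (simp add: massoc)
  then show ?thesis using spq y by simp
 qed
 moreover have "(s ^^ q) y = y \<oplus> (d ^^ q) y"
 proof -
  have "(s ^^ n) y = ((%v. v \<oplus> d v) ^^ n) y \<and> (s ^^ n) y \<in> carrier A" for n
  proof (induction n)
   case (Suc n)
   then show ?case using sd[of "(s ^^ n) y"] sc[of "(s ^^ n) y"] by auto
  qed (use y in simp)
  then show ?thesis using frobenius_op[OF q(1) dc dadd y] by simp
 qed
 ultimately have dq: "(d ^^ q) y = \<zero>" using y dpow[OF y, of q] M.add.r_cancel_one'[of y "(d ^^ q) y"] by simp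
 define m where "m = (LEAST n. (d ^^ n) y = \<zero>)"
 have m: "(d ^^ m) y = \<zero>" unfolding m_def by (rule LeastI[of "%n. (d ^^ n) y = \<zero>", OF dq])
 have ml: "(d ^^ k) y \<noteq> \<zero>" if "k < m" for k using not_less_Least that unfolding m_def by auto
 have "d y \<noteq> \<zero>"
 proof
  assume "d y = \<zero>"
  then have "s y = y" using sd[OF y] y by simp
  then show False using sfix[OF y] ne by simp
 qed
 moreover have "y \<noteq> \<zero>" using ne x by auto
 ultimately have "m \<noteq> 0 \<and> m \<noteq> Suc 0" using m by (cases "m = 0"; cases "m = Suc 0"; simp)
 then obtain k where k: "m = Suc (Suc k)" by (metis not0_implies_Suc)
 \<comment> \<open>The last two nonzero terms of the sequence \<open>y, d y, d (d y), ...\<close>.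
   They satisfy \<open>s u = u\<close> and \<open>s w = w + u\<close>, so conjugation by
   \<open>x\<close> adds 1 to \<open>w\<close> times the inverse of \<open>u\<close>.\<close>
 define w where "w = (d ^^ k) y"
 define u where "u = d w"
 have w: "w \<in> carrier A" and u: "u \<in> carrier A" unfolding w_def u_def by (simp_all add: dpow[OF y] dc)
 have du: "d u = \<zero>" using m unfolding u_def w_def k by simp
 have u0: "u \<noteq> \<zero>" using ml[of "Suc k"] unfolding u_def w_def k by simp
 have sC: "s v \<in> cent K" if "v \<in> cent K" for v
  unfolding s_def by (intro C(3) assms(3) x'(1) that)
 have dC: "d v \<in> cent K" if "v \<in> cent K" for v
  unfolding d_def by (intro subspD(5)[OF C(1)] sC that)
 have "(d ^^ n) y \<in> cent K" for n by (induction n) (simp_all add: assms(4) dC)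
 then have wC: "w \<in> cent K" and uC: "u \<in> cent K" unfolding w_def u_def by (simp_all add: dC)
 obtain u' where u': "u' \<in> cent K" "u \<otimes> u' = \<one>" using inv_in_subalg[OF cent_subalg[OF assms(1)] uC u0] .
 have u'c: "u' \<in> carrier A" using u' Cc by auto
 have su: "s u = u" using sd[OF u] du u by simp
 have s1: "s \<one> = \<one>" using x x'c x'(2) by (simp add: s_def)
 have "u \<otimes> s u' = u \<otimes> u'" using smul[OF u u'c] su u'(2) s1 by simp
 then have su': "s u' = u'" by (rule cancel_l[OF u u0 sc[OF u'c] u'c])
 define c where "c = w \<otimes> u'"
 have c: "c \<in> carrier A" and cC: "c \<in> cent K" unfolding c_def using w u'c by simp (intro C(3) wC u'(1))
 have "s c = (w \<oplus> u) \<otimes> u'" unfolding c_def using smul[OF w u'c] su' sd[OF w] u_def by simp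
 then have scc: "s c = c \<oplus> \<one>" using w u u'c u'(2) by (simp add: l_distr c_def)
 obtain r where r: "r \<in> frob F" "c [^] r \<in> K" using assms(2)[OF cC] by auto
 have sp: "s (c [^] n) = (c \<oplus> \<one>) [^] n" for n :: nat
 proof (induction n)
  case (Suc n)
  then show ?case using smul[of "c [^] n" c] c scc by simp
 qed (simp add: s1)
 have "s (c [^] r) = c [^] r"
  using sfix[of "c [^] r"] c assms(3) r(2) unfolding cent_def by auto
 then have e1: "(c \<oplus> \<one>) [^] r = c [^] r" using sp by simp
 \<comment> \<open>Iterating left multiplication by \<open>1 + c\<close> at 1 gives
   \<open>(1 + c)^r = 1 + c^r\<close>. On the other hand \<open>x\<close> commutes with
   \<open>c^r\<close>, which lies in \<open>K\<close>, so that conjugating \<open>c^r\<close> gives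
   \<open>(c + 1)^r = c^r\<close>.\<close>
 have "((%v. v \<oplus> c \<otimes> v) ^^ r) \<one> = \<one> \<oplus> ((%v. c \<otimes> v) ^^ r) \<one>"
  by (rule frobenius_op[OF r(1)]) (use c in \<open>auto simp: r_distr\<close>)
 moreover have "((%v. v \<oplus> c \<otimes> v) ^^ n) \<one> = (c \<oplus> \<one>) [^] n" for n
 proof (induction n)
  case (Suc n)
  have "(c \<oplus> \<one>) [^] Suc n = (c \<oplus> \<one>) \<otimes> (c \<oplus> \<one>) [^] n" using nat_pow_Suc2[of "c \<oplus> \<one>" n] c by simp
  then show ?case using Suc c by (simp add: l_distr M.a_comm)
 qed simp
 moreover have "((%v. c \<otimes> v) ^^ n) \<one> = c [^] n" for n
 proof (induction n)
  case (Suc n)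
  have "c [^] Suc n = c \<otimes> c [^] n" using nat_pow_Suc2[of c n] c by simp
  then show ?case using Suc by simp
 qed simp
 ultimately have "c [^] r = \<one> \<oplus> c [^] r" using e1 by simp
 then have "\<one> = \<zero>" using c M.add.l_cancel_one'[of "c [^] r" "\<one>"] by simp
 then show False using one_nz by simp
qed

text \<open>\<open>S\<close> is chosen with \<open>gen S\<close> maximal among finite commuting sets
  of separable elements. A separable element that centralizes \<open>gen S\<close> could be added to
  \<open>S\<close>, so it already lies in \<open>gen S\<close>; by \<open>sep_power\<close> every
  element of the centralizer therefore has a Frobenius power in \<open>gen S\<close>, as
  \<open>jacobson_noether\<close> demands. The finite generating set is recorded because
  separability idempotents are built from generators.\<close>

theorem max_separable_subfield:
 obtains S where "finite S" "S \<subseteq> carrier A" "S \<subseteq> cent S" "!!s. s \<in> S ==> sep s"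
  "!!c. c \<in> cent (gen S) ==> sep c ==> c \<in> gen S"
  "!!x y. x \<in> cent (gen S) ==> y \<in> cent (gen S) ==> x \<otimes> y = y \<otimes> x"
proof -
 let ?P = "%S. finite S \<and> S \<subseteq> carrier A \<and> S \<subseteq> cent S \<and> (\<forall>s \<in> S. sep s)"
 obtain S where S: "?P S" and mx: "!!S'. ?P S' ==> gen S \<subseteq> gen S' ==> gen S' = gen S"
 proof (rule max_ex[of ?P "{}" gen])
  show "subsp (gen S)" if "?P S" for S using subalgD(1)[OF gen_subalg[of S]] that by simp
 qed simp_all
 have Sc: "S \<subseteq> carrier A" using S by simp
 have gc: "gen S \<subseteq> carrier A" by (rule subspD(1)[OF subalgD(1)[OF gen_subalg[OF Sc]]])
 have in_gen: "c \<in> gen S" if c: "c \<in> cent (gen S)" "sep c" for c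
 proof -
  have cS: "c \<in> cent S" using c(1) unfolding cent_gen[OF Sc] .
  have "?P (insert c S)" using S cS c(2) by (simp add: cent_def subset_iff)
  then have "gen (insert c S) = gen S" by (rule mx) (rule gen_mono[OF subset_insertI])
  then show ?thesis using gen_incl[of "insert c S"] by simp
 qed
 have pw: "\<exists>q \<in> frob F. c [^] q \<in> gen S" if c: "c \<in> cent (gen S)" for c
 proof -
  have "c \<in> carrier A" using c cent_carrier by blast
  then obtain q where q: "q \<in> frob F" "sep (c [^] q)" using sep_power by auto
  have "c [^] q \<in> cent (gen S)" by (rule subalg_pow[OF cent_subalg[OF gc] c])
  from in_gen[OF this q(2)] show ?thesis using q(1) by (rule bexI)
 qed
 show ?thesis
 proof (rule that[of S])
  fix x y assume "x \<in> cent (gen S)" "y \<in> cent (gen S)"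
  from jacobson_noether[OF gc pw this] show "x \<otimes> y = y \<otimes> x" .
 qed (use S in simp, use S in simp, use S in simp, use S in simp, rule in_gen)
qed

end

section \<open>Simple algebras\<close>

locale simple_algebra = fd_algebra F A
 for F :: "('f, 'n) ring_scheme" and A :: "('f, 'a, 'm) module_scheme" (structure) +
 assumes simple: "simple_ring A"

section \<open>Corners and decompositions into primitive idempotents\<close>

context assoc_algebra begin

definition corner :: "'a => 'a set" where
 "corner e = {x \<in> carrier A. e \<otimes> x = x \<and> x \<otimes> e = x}"

lemma cornerD: "x \<in> corner e ==> x \<in> carrier A" "x \<in> corner e ==> e \<otimes> x = x" "x \<in> corner e ==> x \<otimes> e = x"
 by (auto simp: corner_def)

lemma cornerI: "x \<in> carrier A ==> e \<otimes> x = x ==> x \<otimes> e = x ==> x \<in> corner e"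
 by (auto simp: corner_def)

lemma corner_subsp: assumes "e \<in> carrier A" shows "subsp (corner e)"
proof (rule subspI)
 show "\<zero> \<in> corner e" using assms by (intro cornerI) auto
next
 fix x y assume "x \<in> corner e" "y \<in> corner e"
 then show "x \<oplus> y \<in> corner e" using assms by (intro cornerI) (simp_all add: cornerD l_distr r_distr)
next
 fix c x assume "c \<in> carrier F" "x \<in> corner e"
 then show "c \<odot> x \<in> corner e" using assms by (intro cornerI) (simp_all add: cornerD mult_smult_l mult_smult_r)
qed (auto dest: cornerD)

lemma corner_mult: assumes "e \<in> carrier A" "x \<in> corner e" "y \<in> corner e" shows "x \<otimes> y \<in> corner e"
proof (rule cornerI)
 have c: "x \<in> carrier A" "y \<in> carrier A" using assms cornerD by auto
 show "x \<otimes> y \<in> carrier A" using c by simp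
 show "e \<otimes> (x \<otimes> y) = x \<otimes> y" using massoc[OF assms(1) c] cornerD(2)[OF assms(2)] by simp
 show "x \<otimes> y \<otimes> e = x \<otimes> y" using massoc[OF c assms(1)] cornerD(3)[OF assms(3)] by simp
qed

lemma corner_self: "e \<in> carrier A ==> e \<otimes> e = e ==> e \<in> corner e"
 by (rule cornerI)

lemma corner_sandwich:
 assumes "e \<in> carrier A" "e \<otimes> e = e" "b \<in> carrier A" shows "e \<otimes> b \<otimes> e \<in> corner e"
proof (rule cornerI)
 show "e \<otimes> b \<otimes> e \<in> carrier A" using assms by simp
 show "e \<otimes> (e \<otimes> b \<otimes> e) = e \<otimes> b \<otimes> e"
  using massoc[of e "e \<otimes> b" e] massoc[of e e b] assms by simp
 show "e \<otimes> b \<otimes> e \<otimes> e = e \<otimes> b \<otimes> e"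
  using massoc[of "e \<otimes> b" e e] assms by simp
qed

definition left_id :: "'a set => bool" where
 "left_id I \<longleftrightarrow> subsp I \<and> (\<forall>b \<in> carrier A. \<forall>x \<in> I. b \<otimes> x \<in> I)"

end

context simple_algebra begin

lemma one_nz: "\<one> \<noteq> \<zero>" using simple by (simp add: simple_ring_def)

lemma two_sided:
 assumes "subsp I" "!!b x. b \<in> carrier A ==> x \<in> I ==> b \<otimes> x \<in> I"
  "!!b x. b \<in> carrier A ==> x \<in> I ==> x \<otimes> b \<in> I" "y \<in> I" "y \<noteq> \<zero>"
 shows "I = carrier A"
proof -
 have "ideal I A"
  by (rule idealI[OF ring_axioms submodule.axioms(1)[OF assms(1)]]) (use assms in auto)
 then show ?thesis using simple assms(4,5) unfolding simple_ring_def by blast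
qed

text \<open>Brauer's lemma: a minimal left ideal inside \<open>A x\<close> has nonzero square and
  therefore contains a nonzero idempotent \<open>f = b x\<close>. Then \<open>e f\<close> is a
  nonzero idempotent of the corner, so \<open>e f = e\<close> by primitivity, and
  \<open>e b e\<close> is a left inverse of \<open>x\<close>.\<close>

lemma primitive_division:
 assumes e: "e \<in> carrier A" "e \<otimes> e = e"
  and prim: "!!f. f \<in> corner e ==> f \<otimes> f = f ==> f = \<zero> \<or> f = e"
  and x: "x \<in> corner e" "x \<noteq> \<zero>"
 shows "\<exists>y \<in> corner e. y \<otimes> x = e"
proof -
 have xc: "x \<in> carrier A" using x cornerD by auto
 define Bx where "Bx = (%b. b \<otimes> x) ` carrier A"
 have imid: "left_id ((%b. b \<otimes> y) ` I)" if I: "left_id I" and y: "y \<in> carrier A" for I y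
 proof -
  have Is: "subsp I" and Im: "!!b w. b \<in> carrier A ==> w \<in> I ==> b \<otimes> w \<in> I"
   using I unfolding left_id_def by auto
  note Id = subspD[OF Is]
  have "subsp ((%b. b \<otimes> y) ` I)"
  proof (rule subspI)
   show "(%b. b \<otimes> y) ` I \<subseteq> carrier A" using Id(7) y by auto
   show "\<zero> \<in> (%b. b \<otimes> y) ` I" using Id(2) y by (intro image_eqI[of _ _ "\<zero>"]) auto
  next
   fix u v assume "u \<in> (%b. b \<otimes> y) ` I" "v \<in> (%b. b \<otimes> y) ` I"
   then obtain a b where ab: "a \<in> I" "b \<in> I" "u = a \<otimes> y" "v = b \<otimes> y" by blast
   then have "u \<oplus> v = (a \<oplus> b) \<otimes> y" using Id(7) y by (simp add: l_distr)
   then show "u \<oplus> v \<in> (%b. b \<otimes> y) ` I" using Id(3)[OF ab(1,2)] by (rule image_eqI)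
  next
   fix c u assume c: "c \<in> carrier F" and "u \<in> (%b. b \<otimes> y) ` I"
   then obtain a where ab: "a \<in> I" "u = a \<otimes> y" by blast
   then have "c \<odot> u = (c \<odot> a) \<otimes> y" using Id(7) y c by (simp add: mult_smult_l)
   then show "c \<odot> u \<in> (%b. b \<otimes> y) ` I" using Id(6)[OF c ab(1)] by (rule image_eqI)
  qed
  moreover have "b \<otimes> u \<in> (%b. b \<otimes> y) ` I" if b: "b \<in> carrier A" and u: "u \<in> (%b. b \<otimes> y) ` I" for b u
  proof -
   obtain a where ab: "a \<in> I" "u = a \<otimes> y" using u by blast
   then have "b \<otimes> u = (b \<otimes> a) \<otimes> y" using Id(7) y b by (simp add: massoc)
   then show ?thesis using Im[OF b ab(1)] by (rule image_eqI)
  qed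
  ultimately show ?thesis by (simp add: left_id_def)
 qed
 have Bxid: "left_id Bx" unfolding Bx_def
  by (rule imid[OF _ xc]) (simp add: left_id_def subsp_carrier)
 have "x \<in> Bx" unfolding Bx_def using xc by (intro image_eqI[of _ _ "\<one>"]) auto
 let ?P = "%I. left_id I \<and> I \<noteq> {\<zero>} \<and> I \<subseteq> Bx"
 obtain I where I: "?P I" and mn: "!!I'. ?P I' ==> I' \<subseteq> I ==> I' = I"
 proof (rule min_ex[of ?P Bx "%I. I"])
  show "?P Bx" using Bxid \<open>x \<in> Bx\<close> x by auto
 qed (auto simp: left_id_def)
 have Is: "subsp I" and Im: "!!b w. b \<in> carrier A ==> w \<in> I ==> b \<otimes> w \<in> I"
  using I unfolding left_id_def by auto
 note Id = subspD[OF Is]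
 \<comment> \<open>If all products in \<open>I\<close> vanished, the left annihilator of
   \<open>I\<close> would be a nonzero two-sided ideal and would contain 1.\<close>
 obtain y z where yz: "y \<in> I" "z \<in> I" "z \<otimes> y \<noteq> \<zero>"
 proof (rule ccontr)
  assume no: "\<not> thesis"
  then have zero: "z \<otimes> y = \<zero>" if "y \<in> I" "z \<in> I" for y z using that \<open>!!y z. y \<in> I ==> z \<in> I ==> z \<otimes> y \<noteq> \<zero> ==> thesis\<close> by blast
  define N where "N = {t \<in> carrier A. \<forall>y \<in> I. t \<otimes> y = \<zero>}"
  obtain w where w: "w \<in> I" "w \<noteq> \<zero>" using I Id(2) by blast
  have wN: "w \<in> N" using zero w Id(7) by (simp add: N_def)
  have "N = carrier A"
  proof (rule two_sided[OF _ _ _ wN w(2)])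
   show "subsp N"
    by (rule subspI) (simp_all add: N_def Id(7) l_distr mult_smult_l subset_iff)
   fix b t assume b: "b \<in> carrier A" and t: "t \<in> N"
   then show "b \<otimes> t \<in> N" by (simp add: N_def massoc Id(7))
   from b t show "t \<otimes> b \<in> N" by (simp add: N_def massoc Id(7) Im)
  qed
  then have "\<one> \<in> N" by simp
  then have "\<one> \<otimes> w = \<zero>" using w(1) unfolding N_def by blast
  then show False using w Id(7) by simp
 qed
 have y: "y \<in> carrier A" and z: "z \<in> carrier A" using yz Id(7) by auto
 have y0: "y \<noteq> \<zero>" using yz z by auto
 have "(%b. b \<otimes> y) ` I = I"
 proof (rule mn)
  have sub: "(%b. b \<otimes> y) ` I \<subseteq> I" using Im yz(1) Id(7) by auto
  then show "(%b. b \<otimes> y) ` I \<subseteq> I" .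
  have "z \<otimes> y \<in> (%b. b \<otimes> y) ` I" using yz(2) by (rule imageI)
  then have "(%b. b \<otimes> y) ` I \<noteq> {\<zero>}" using yz(3) by blast
  then show "?P ((%b. b \<otimes> y) ` I)" using imid[of I y] y I sub by blast
 qed
 then have "y \<in> (%b. b \<otimes> y) ` I" using yz(1) by simp
 then obtain f where f: "f \<in> I" "f \<otimes> y = y" by force
 have fc: "f \<in> carrier A" using f Id(7) by auto
 \<comment> \<open>By minimality of \<open>I\<close>, right multiplication by \<open>y\<close> is
   injective on \<open>I\<close>; since \<open>f y = y\<close>, the element \<open>f f - f\<close>
   is mapped to zero.\<close>
 define Z where "Z = {w \<in> I. w \<otimes> y = \<zero>}"
 have Zid: "left_id Z" unfolding left_id_def
 proof (intro conjI ballI)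
  show "subsp Z"
   by (rule subspI) (use Id y in \<open>simp_all add: Z_def l_distr mult_smult_l subset_iff\<close>)
  fix b w assume "b \<in> carrier A" "w \<in> Z"
  then show "b \<otimes> w \<in> Z" using Im Id(7) y by (simp add: Z_def massoc)
 qed
 have "Z = {\<zero>}"
 proof (rule ccontr)
  assume "Z \<noteq> {\<zero>}"
  moreover have ZI: "Z \<subseteq> I" by (auto simp: Z_def)
  ultimately have "Z = I" using Zid I by (intro mn) auto
  then have "z \<in> Z" using yz(2) by simp
  then show False using yz(3) by (simp add: Z_def)
 qed
 moreover have "f \<otimes> f \<ominus> f \<in> Z"
  unfolding Z_def
 proof (intro CollectI conjI)
  show "f \<otimes> f \<ominus> f \<in> I" by (rule Id(5)[OF Im[OF fc f(1)] f(1)])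
  have "(f \<otimes> f \<ominus> f) \<otimes> y = f \<otimes> (f \<otimes> y) \<ominus> f \<otimes> y"
   using fc y by (simp add: minus_eq l_distr l_minus massoc)
  then show "(f \<otimes> f \<ominus> f) \<otimes> y = \<zero>" using f y by (simp add: minus_eq r_neg)
 qed
 ultimately have ff: "f \<otimes> f = f" using minus_zero_imp_eq[of "f \<otimes> f" f] fc by simp
 have f0: "f \<noteq> \<zero>" using f y y0 by auto
 obtain b where b: "b \<in> carrier A" "f = b \<otimes> x" using f(1) I unfolding Bx_def by blast
 have fe: "f \<otimes> e = f" using b massoc[of b x e] xc e cornerD(3)[OF x(1)] by simp
 have ef_c: "e \<otimes> f \<in> corner e"
  by (rule cornerI) (use e fc fe massoc[of e e f] massoc[of e f e] in simp_all)
 have "e \<otimes> f \<otimes> (e \<otimes> f) = e \<otimes> f"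
 proof -
  have "e \<otimes> f \<otimes> (e \<otimes> f) = e \<otimes> (f \<otimes> (e \<otimes> f))" using e fc by (simp add: massoc)
  also have "f \<otimes> (e \<otimes> f) = f" using massoc[of f e f] e fc fe ff by simp
  finally show ?thesis .
 qed
 then have "e \<otimes> f = \<zero> \<or> e \<otimes> f = e" using prim ef_c by blast
 moreover have "e \<otimes> f \<noteq> \<zero>"
 proof
  assume "e \<otimes> f = \<zero>"
  then have "f \<otimes> (e \<otimes> f) = \<zero>" using fc by simp
  then show False using massoc[of f e f] e fc fe ff f0 by simp
 qed
 ultimately have "e \<otimes> f = e" by simp
 moreover have "e \<otimes> f = e \<otimes> b \<otimes> e \<otimes> x"
  using b e xc cornerD(2)[OF x(1)] by (simp add: massoc)
 ultimately show ?thesis using corner_sandwich[OF e b(1)] by (intro bexI[of _ "e \<otimes> b \<otimes> e"]) auto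
qed

definition division_decomp :: "'a => 'a set => bool" where
 "division_decomp g E \<longleftrightarrow> finite E \<and> E \<subseteq> corner g \<and> (\<forall>e \<in> E. e \<otimes> e = e \<and> e \<noteq> \<zero>) \<and>
   (\<forall>e \<in> E. \<forall>f \<in> E. e \<noteq> f \<longrightarrow> e \<otimes> f = \<zero>) \<and> finsum A (%e. e) E = g \<and>
   (\<forall>e \<in> E. \<forall>x \<in> corner e. x \<noteq> \<zero> \<longrightarrow> (\<exists>y \<in> corner e. y \<otimes> x = e))"

lemma division_decompD:
 assumes "division_decomp g E"
 shows "finite E" "E \<subseteq> corner g" "e \<in> E ==> e \<otimes> e = e" "e \<in> E ==> e \<noteq> \<zero>"
  "e \<in> E ==> e' \<in> E ==> e \<noteq> e' ==> e \<otimes> e' = \<zero>" "finsum A (%e. e) E = g"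
  "e \<in> E ==> x \<in> corner e ==> x \<noteq> \<zero> ==> \<exists>y \<in> corner e. y \<otimes> x = e"
 using assms by (simp_all add: division_decomp_def)

text \<open>Induction on the rank of the corner. A primitive \<open>g\<close> has a division algebra
  as its corner; otherwise \<open>g = f + (g - f)\<close> with orthogonal idempotents whose corners
  are strictly smaller, and the two decompositions are united.\<close>

lemma idempotent_decomposition:
 assumes "g \<in> carrier A" "g \<otimes> g = g"
 shows "\<exists>E. division_decomp g E"
 using assms
proof (induction "rnk (corner g)" arbitrary: g rule: less_induct)
 case less
 note g = less.prems
 show ?case
 proof (cases "g = \<zero>")
  case True
  then show ?thesis unfolding division_decomp_def by (intro exI[of _ "{}"]) simp
 next
  case g0: False
  show ?thesis
  proof (cases "\<exists>f. f \<in> corner g \<and> f \<otimes> f = f \<and> f \<noteq> \<zero> \<and> f \<noteq> g")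
   case False
   then have "\<forall>x \<in> corner g. x \<noteq> \<zero> \<longrightarrow> (\<exists>y \<in> corner g. y \<otimes> x = g)"
    using primitive_division[OF g] by blast
   then show ?thesis unfolding division_decomp_def using g g0 corner_self[OF g] by (intro exI[of _ "{g}"]) simp
  next
   case True
   then obtain f where f: "f \<in> corner g" "f \<otimes> f = f" "f \<noteq> \<zero>" "f \<noteq> g" by blast
   note fg = cornerD[OF f(1)]
   define h where "h = g \<ominus> f"
   have h: "h \<in> carrier A" using g fg by (simp add: h_def)
   have gh: "g \<otimes> h = h" "h \<otimes> g = h" using g fg by (simp_all add: h_def minus_eq r_distr l_distr r_minus l_minus)
   have fh: "f \<otimes> h = \<zero>" "h \<otimes> f = \<zero>" using g fg f(2)
    by (simp_all add: h_def minus_eq r_distr l_distr r_minus l_minus r_neg)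
   have hh: "h \<otimes> h = h"
   proof -
    have "h \<otimes> h = g \<otimes> h \<ominus> f \<otimes> h" using g fg h by (simp add: h_def minus_eq l_distr l_minus)
    then show ?thesis using gh fh h by (simp add: minus_eq)
   qed
   have fph: "f \<oplus> h = g" using g fg M.a_lcomm[of f g "\<ominus> f"] by (simp add: h_def minus_eq r_neg)
   have sub: "corner k \<subset> corner g" if k: "k \<in> carrier A" "g \<otimes> k = k" "k \<otimes> g = k" "k \<noteq> g" for k
   proof -
    have "corner k \<subseteq> corner g"
    proof
     fix x assume x: "x \<in> corner k"
     note xk = cornerD[OF x]
     show "x \<in> corner g"
     proof (rule cornerI)
      show "g \<otimes> x = x" using massoc[of g k x] g k xk by simp
      show "x \<otimes> g = x" using massoc[of x k g] g k xk by simp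
     qed (rule xk)
    qed
    moreover have "g \<notin> corner k" using k cornerD(2)[of g k] by auto
    ultimately show ?thesis using corner_self[OF g] by blast
   qed
   have hg: "h \<noteq> g" using fh(1) fg f(3) by auto
   have r: "rnk (corner f) < rnk (corner g)" "rnk (corner h) < rnk (corner g)"
    using rnk_less[OF corner_subsp corner_subsp] sub fg f(4) gh h hg g(1) by simp_all
   obtain E1 where "division_decomp f E1" using less.hyps[OF r(1) fg(1) f(2)] by (rule exE)
   note E1 = division_decompD[OF this]
   obtain E2 where "division_decomp h E2" using less.hyps[OF r(2) h hh] by (rule exE)
   note E2 = division_decompD[OF this]
   have orth: "x \<otimes> y = \<zero>" "y \<otimes> x = \<zero>" if "x \<in> corner f" "y \<in> corner h" for x y
   proof -
    note xf = cornerD[OF that(1)] and yh = cornerD[OF that(2)]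
    have "x \<otimes> y = x \<otimes> f \<otimes> (h \<otimes> y)" using xf yh by simp
    also have "\<dots> = x \<otimes> (f \<otimes> h) \<otimes> y" using xf(1) yh(1) fg(1) h by (simp add: massoc del: xf yh)
    finally show "x \<otimes> y = \<zero>" using fh xf(1) yh(1) by simp
    have "y \<otimes> x = y \<otimes> h \<otimes> (f \<otimes> x)" using xf yh by simp
    also have "\<dots> = y \<otimes> (h \<otimes> f) \<otimes> x" using xf(1) yh(1) fg(1) h by (simp add: massoc)
    finally show "y \<otimes> x = \<zero>" using fh xf(1) yh(1) by simp
   qed
   have disj: "E1 \<inter> E2 = {}"
   proof (rule ccontr)
    assume "E1 \<inter> E2 \<noteq> {}"
    then obtain e where "e \<in> E1" "e \<in> E2" by blast
    then show False using E1(3)[of e] E1(4)[of e] orth(1)[of e e] E1(2) E2(2) by auto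
   qed
   have c: "corner f \<subseteq> corner g" "corner h \<subseteq> corner g" using sub[OF fg f(4)] sub[OF h gh hg] by auto
   have cg: "corner g \<subseteq> carrier A" by (auto dest: cornerD)
   have "finsum A (%e. e) (E1 \<union> E2) = finsum A (%e. e) E1 \<oplus> finsum A (%e. e) E2"
    by (rule finsum_Un_disjoint[OF E1(1) E2(1) disj]) (use E1(2) E2(2) c cg in auto)
   then have sum: "finsum A (%e. e) (E1 \<union> E2) = g" using E1(6) E2(6) fph by simp
   show ?thesis unfolding division_decomp_def
   proof (intro exI[of _ "E1 \<union> E2"] conjI ballI impI)
    show "finite (E1 \<union> E2)" using E1(1) E2(1) by simp
    show "E1 \<union> E2 \<subseteq> corner g" using E1(2) E2(2) c by blast
    show "e \<otimes> e = e" "e \<noteq> \<zero>" if "e \<in> E1 \<union> E2" for e using that E1(3,4) E2(3,4) by auto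
    show "e \<otimes> e' = \<zero>" if "e \<in> E1 \<union> E2" "e' \<in> E1 \<union> E2" "e \<noteq> e'" for e e'
     using that E1(2,5) E2(2,5) orth by (auto simp: subset_iff)
    show "finsum A (%e. e) (E1 \<union> E2) = g" by (rule sum)
    show "\<exists>y \<in> corner e. y \<otimes> x = e" if "e \<in> E1 \<union> E2" "x \<in> corner e" "x \<noteq> \<zero>" for e x
     using that E1(7) E2(7) by auto
   qed
  qed
 qed
qed

end

section \<open>Multiplication operators and dual bases over the center\<close>

context assoc_algebra begin

text \<open>The operators through which the enveloping algebra \<open>A \<otimes> A^op\<close> acts
  on \<open>A\<close>.\<close>

definition mop :: "('a => 'a) => bool" where
 "mop p \<longleftrightarrow> (\<exists>n u v. (\<forall>i. u i \<in> carrier A \<and> v i \<in> carrier A) \<and>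
   (\<forall>x \<in> carrier A. p x = nsum A (%i. u i \<otimes> x \<otimes> v i) n))"

lemma mopE:
 assumes "mop p"
 obtains n u v where "!!i. u i \<in> carrier A" "!!i. v i \<in> carrier A"
  "!!x. x \<in> carrier A ==> p x = nsum A (%i. u i \<otimes> x \<otimes> v i) (n :: nat)"
 using assms unfolding mop_def by blast

lemma mop_closed: assumes "mop p" "x \<in> carrier A" shows "p x \<in> carrier A"
proof -
 obtain n u v where m: "!!i. u i \<in> carrier A" "!!i. v i \<in> carrier A"
  "!!x. x \<in> carrier A ==> p x = nsum A (%i. u i \<otimes> x \<otimes> v i) (n :: nat)" by (rule mopE[OF assms(1)]) blast
 show ?thesis unfolding m(3)[OF assms(2)] by (rule nsum_closed) (simp add: m(1,2) assms(2))
qed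

lemma mop_add: assumes "mop p" "x \<in> carrier A" "y \<in> carrier A" shows "p (x \<oplus> y) = p x \<oplus> p y"
proof -
 obtain n u v where m: "!!i. u i \<in> carrier A" "!!i. v i \<in> carrier A"
  "!!x. x \<in> carrier A ==> p x = nsum A (%i. u i \<otimes> x \<otimes> v i) (n :: nat)" by (rule mopE[OF assms(1)]) blast
 have "p (x \<oplus> y) = nsum A (%i. u i \<otimes> x \<otimes> v i \<oplus> u i \<otimes> y \<otimes> v i) n"
  unfolding m(3)[OF a_closed[OF assms(2,3)]] using m(1,2) assms by (intro nsum_cong) (simp add: l_distr r_distr)
 also have "\<dots> = p x \<oplus> p y" unfolding m(3)[OF assms(2)] m(3)[OF assms(3)]
  using m(1,2) assms by (intro nsum_add) simp_all
 finally show ?thesis .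
qed

lemma mop_smult: assumes "mop p" "c \<in> carrier F" "y \<in> carrier A" shows "p (c \<odot> y) = c \<odot> p y"
proof -
 obtain n u v where m: "!!i. u i \<in> carrier A" "!!i. v i \<in> carrier A"
  "!!x. x \<in> carrier A ==> p x = nsum A (%i. u i \<otimes> x \<otimes> v i) (n :: nat)" by (rule mopE[OF assms(1)]) blast
 have "p (c \<odot> y) = nsum A (%i. c \<odot> (u i \<otimes> y \<otimes> v i)) n"
  unfolding m(3)[OF smult_closed[OF assms(2,3)]] using m(1,2) assms
  by (intro nsum_cong) (simp add: mult_smult_l mult_smult_r)
 also have "\<dots> = c \<odot> p y" unfolding m(3)[OF assms(3)]
  by (rule additive_nsum[OF M.abelian_group_axioms M.abelian_group_axioms, where h = "%z. c \<odot> z", symmetric])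
   (simp_all add: m(1,2) assms smult_r_distr)
 finally show ?thesis .
qed

lemma mop_basic: assumes "a \<in> carrier A" "b \<in> carrier A" shows "mop (%x. a \<otimes> x \<otimes> b)"
 unfolding mop_def using assms
 by (intro exI[of _ 1] exI[of _ "%_. a"] exI[of _ "%_. b"]) simp

lemma mop_cong: assumes "mop p" "!!x. x \<in> carrier A ==> q x = p x" shows "mop q"
 using assms unfolding mop_def by simp

lemma mop_plus: assumes "mop p" "mop q" shows "mop (%x. p x \<oplus> q x)"
proof -
 obtain n u v where m: "!!i. u i \<in> carrier A" "!!i. v i \<in> carrier A"
  "!!x. x \<in> carrier A ==> p x = nsum A (%i. u i \<otimes> x \<otimes> v i) (n :: nat)" by (rule mopE[OF assms(1)]) blast
 obtain n' u' v' where m': "!!i. u' i \<in> carrier A" "!!i. v' i \<in> carrier A"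
  "!!x. x \<in> carrier A ==> q x = nsum A (%i. u' i \<otimes> x \<otimes> v' i) (n' :: nat)" by (rule mopE[OF assms(2)]) blast
 let ?u = "%i. if i < n then u i else u' (i - n)" and ?v = "%i. if i < n then v i else v' (i - n)"
 have "p x \<oplus> q x = nsum A (%i. ?u i \<otimes> x \<otimes> ?v i) (n + n')" if x: "x \<in> carrier A" for x
 proof -
  have "nsum A (%i. ?u i \<otimes> x \<otimes> ?v i) (n + n') =
   nsum A (%i. if i < n then u i \<otimes> x \<otimes> v i else u' (i - n) \<otimes> x \<otimes> v' (i - n)) (n + n')"
   by (rule nsum_cong) simp
  also have "\<dots> = p x \<oplus> q x" unfolding m(3)[OF x] m'(3)[OF x]
   by (rule nsum_append) (simp_all add: m(1,2) m'(1,2) x)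
  finally show ?thesis by simp
 qed
 then show ?thesis unfolding mop_def using m(1,2) m'(1,2)
  by (intro exI[of _ "n + n'"] exI[of _ ?u] exI[of _ ?v]) simp
qed

lemma mop_lr: assumes "mop p" "a \<in> carrier A" "b \<in> carrier A" shows "mop (%x. a \<otimes> p x \<otimes> b)"
proof -
 obtain n u v where m: "!!i. u i \<in> carrier A" "!!i. v i \<in> carrier A"
  "!!x. x \<in> carrier A ==> p x = nsum A (%i. u i \<otimes> x \<otimes> v i) (n :: nat)" by (rule mopE[OF assms(1)]) blast
 have "a \<otimes> p x \<otimes> b = nsum A (%i. (a \<otimes> u i) \<otimes> x \<otimes> (v i \<otimes> b)) n" if x: "x \<in> carrier A" for x
 proof -
  have "a \<otimes> p x \<otimes> b = nsum A (%i. a \<otimes> (u i \<otimes> x \<otimes> v i) \<otimes> b) n" unfolding m(3)[OF x]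
   by (rule additive_nsum[OF M.abelian_group_axioms M.abelian_group_axioms, where h = "%z. a \<otimes> z \<otimes> b"])
    (simp_all add: m(1,2) assms x r_distr l_distr)
  also have "\<dots> = nsum A (%i. (a \<otimes> u i) \<otimes> x \<otimes> (v i \<otimes> b)) n"
   by (rule nsum_cong) (simp add: m(1,2) assms x massoc)
  finally show ?thesis .
 qed
 then show ?thesis unfolding mop_def using m(1,2) assms
  by (intro exI[of _ n] exI[of _ "%i. a \<otimes> u i"] exI[of _ "%i. v i \<otimes> b"]) simp
qed

lemma mop_nsum: assumes "!!i. i < n ==> mop (p i)" shows "mop (%x. nsum A (%i. p i x) n)"
 using assms
proof (induction n)
 case 0
 have "mop (%x. \<zero> \<otimes> x \<otimes> \<zero>)" by (rule mop_basic) simp_all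
 then show ?case by (rule mop_cong) simp
next
 case (Suc n)
 then show ?case by (simp add: mop_plus)
qed

end

context simple_algebra begin

text \<open>Biorthogonality makes the \<open>b i\<close> independent, with the multiplication
  operators \<open>p i\<close> in the role of coordinate functions; the coordinates turn out to be
  central once the system is maximal.\<close>

definition dualsys :: "nat => (nat => 'a) => (nat => 'a => 'a) => bool" where
 "dualsys n b p \<longleftrightarrow> (\<forall>i < n. b i \<in> carrier A \<and> mop (p i)) \<and>
   (\<forall>i < n. \<forall>j < n. p i (b j) = (if i = j then \<one> else \<zero>))"

text \<open>The operator \<open>p k\<close> vanishes on the span of the earlier \<open>b j\<close>
  but not at \<open>b k\<close>, so each further vector raises the rank.\<close>

lemma dualsys_bound: assumes "dualsys n b p" shows "n \<le> rnk (spanV (b ` {..<n}))"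
proof -
 have bc: "!!i. i < n ==> b i \<in> carrier A" and pm: "!!i. i < n ==> mop (p i)"
  and pb: "!!i j. i < n ==> j < n ==> p i (b j) = (if i = j then \<one> else \<zero>)"
  using assms unfolding dualsys_def by blast+
 have "k \<le> n ==> k \<le> rnk (spanV (b ` {..<k}))" for k
 proof (induction k)
  case (Suc k)
  have sub: "b ` {..<k} \<subseteq> carrier A" "b ` {..<Suc k} \<subseteq> carrier A" using bc Suc.prems by auto
  let ?N = "{x \<in> carrier A. p k x = \<zero>}"
  have pk: "mop (p k)" using pm Suc.prems by simp
  have z: "p k \<zero> = \<zero>"
   by (rule additive_zero[OF M.abelian_group_axioms M.abelian_group_axioms mop_closed[OF pk] mop_add[OF pk]])
  have "subsp ?N"
   by (rule subspI) (simp_all add: mop_add[OF pk] mop_smult[OF pk] z subset_iff)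
  moreover have "b ` {..<k} \<subseteq> ?N"
  proof
   fix y assume "y \<in> b ` {..<k}"
   then obtain j where "j < k" "y = b j" by auto
   then show "y \<in> ?N" using bc[of j] pb[of k j] Suc.prems by simp
  qed
  ultimately have "spanV (b ` {..<k}) \<subseteq> ?N" by (rule spanV_min)
  moreover have "b k \<notin> ?N" using pb[of k k] Suc.prems one_nz by simp
  moreover have "b k \<in> spanV (b ` {..<Suc k})" by (rule spanV_incl) simp
  moreover have "spanV (b ` {..<k}) \<subseteq> spanV (b ` {..<Suc k})" by (rule spanV_mono) auto
  ultimately have "spanV (b ` {..<k}) \<subset> spanV (b ` {..<Suc k})" by blast
  then have "rnk (spanV (b ` {..<k})) < rnk (spanV (b ` {..<Suc k}))"
   by (rule rnk_less[OF spanV_subsp[OF sub(1)] spanV_subsp[OF sub(2)]])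
  then show ?case using Suc by simp
 qed simp
 then show ?thesis by simp
qed

text \<open>A biorthogonal system of maximal length works. The values at \<open>y\<close> of the
  operators that kill all \<open>b i\<close> form a two-sided ideal; were it nonzero, it would
  contain 1 by simplicity, and \<open>y\<close> could be added to the system. Hence an operator is
  determined by its values at the \<open>b i\<close>, and applying this to the identity gives the
  expansion.\<close>

lemma mop_dual_basis:
 obtains n b p where "!!i. i < n ==> b i \<in> carrier A" "!!i. i < n ==> mop (p i)"
  "!!i y. i < n ==> y \<in> carrier A ==> p i y \<in> cent (carrier A)"
  "!!y. y \<in> carrier A ==> y = nsum A (%i. b i \<otimes> p i y) (n :: nat)"
proof -
 obtain N where N: "!!U. rnk U \<le> N" using rnk_ex by blast
 let ?Q = "%n. \<exists>b p. dualsys n b p"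
 have Q0: "?Q 0" by (simp add: dualsys_def)
 have bnd: "n < Suc N" if "?Q n" for n using that dualsys_bound N by (metis le_imp_less_Suc order_trans)
 obtain n where n: "?Q n" and mx: "!!m. ?Q m ==> m \<le> n"
  using ex_has_greatest_nat[of ?Q 0 "%n. n" "Suc N"] Q0 bnd by blast
 obtain b p where "dualsys n b p" using n by blast
 then have bc: "!!i. i < n ==> b i \<in> carrier A" and pm: "!!i. i < n ==> mop (p i)"
  and pb: "!!i j. i < n ==> j < n ==> p i (b j) = (if i = j then \<one> else \<zero>)"
  unfolding dualsys_def by blast+
 have kill: "m y = \<zero>" if m: "mop m" and mb: "!!i. i < n ==> m (b i) = \<zero>" and y: "y \<in> carrier A" for m y
 proof (rule ccontr)
  assume ne: "m y \<noteq> \<zero>"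
  define I where "I = {q y | q. mop q \<and> (\<forall>i < n. q (b i) = \<zero>)}"
  have II: "a \<otimes> t \<otimes> c \<in> I" if ac: "a \<in> carrier A" "c \<in> carrier A" and t: "t \<in> I" for a c t
  proof -
   obtain q where q: "t = q y" "mop q" "\<forall>i < n. q (b i) = \<zero>" using t unfolding I_def by blast
   have "mop (%x. a \<otimes> q x \<otimes> c)" by (rule mop_lr[OF q(2) ac])
   then show ?thesis unfolding I_def q(1) using q(3) ac by (intro CollectI exI[of _ "%x. a \<otimes> q x \<otimes> c"]) simp
  qed
  have Ic: "I \<subseteq> carrier A" using mop_closed y unfolding I_def by blast
  have Is: "subsp I"
  proof (rule subspI[OF Ic])
   have "m y \<in> I" unfolding I_def using m mb by blast
   from II[OF zero_closed zero_closed this] show "\<zero> \<in> I" using mop_closed[OF m y] by simp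
  next
   fix s t assume "s \<in> I" "t \<in> I"
   then obtain q q' where q: "s = q y" "mop q" "\<forall>i < n. q (b i) = \<zero>"
    "t = q' y" "mop q'" "\<forall>i < n. q' (b i) = \<zero>" unfolding I_def by blast
   have "mop (%x. q x \<oplus> q' x)" by (rule mop_plus[OF q(2,5)])
   then show "s \<oplus> t \<in> I" unfolding I_def q(1,4) using q(3,6) by (intro CollectI exI[of _ "%x. q x \<oplus> q' x"]) simp
  next
   fix c t assume c: "c \<in> carrier F" and t: "t \<in> I"
   have "(c \<odot> \<one>) \<otimes> t \<otimes> \<one> \<in> I" using II[of "c \<odot> \<one>" \<one> t] c t by simp
   then show "c \<odot> t \<in> I" using c t Ic by (simp add: mult_smult_l subset_iff)
  qed
  have "I = carrier A"
  proof (rule two_sided[OF Is _ _ _ ne])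
   fix a t assume a: "a \<in> carrier A" and t: "t \<in> I"
   have tc: "t \<in> carrier A" using t Ic by blast
   show "a \<otimes> t \<in> I" using II[OF a one_closed t] a tc by simp
   show "t \<otimes> a \<in> I" using II[OF one_closed a t] a tc by simp
  qed (use m mb in \<open>auto simp: I_def\<close>)
  then have "\<one> \<in> I" by simp
  then obtain q where q: "\<one> = q y" "mop q" "\<forall>i < n. q (b i) = \<zero>" unfolding I_def by blast
  define b' where "b' = b(n := y)"
  \<comment> \<open>The operator \<open>q\<close> is 1 at \<open>y\<close> and 0 at each
    \<open>b i\<close>; subtracting \<open>p i y\<close> times \<open>q\<close> makes the old
    operators vanish at \<open>y\<close>.\<close>
  define p' where "p' = (%i x. if i < n then p i x \<oplus> (\<ominus> p i y) \<otimes> q x \<otimes> \<one> else q x)"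
  have pmn: "mop (p' i)" if "i < Suc n" for i
  proof (cases "i < n")
   case True
   have "mop (%x. p i x \<oplus> (\<ominus> p i y) \<otimes> q x \<otimes> \<one>)"
    by (rule mop_plus[OF pm[OF True] mop_lr[OF q(2)]]) (simp_all add: mop_closed[OF pm[OF True] y])
   then show ?thesis using True by (simp add: p'_def)
  next
   case False
   then show ?thesis using q(2) by (simp add: p'_def)
  qed
  have piy: "p i y \<in> carrier A" if "i < n" for i by (rule mop_closed[OF pm[OF that] y])
  have "dualsys (Suc n) b' p'"
   unfolding dualsys_def
  proof (intro conjI allI impI)
   fix i j assume ij: "i < Suc n" "j < Suc n"
   show "p' i (b' j) = (if i = j then \<one> else \<zero>)"
   proof (cases "i < n")
    case i: True
    show ?thesis
    proof (cases "j < n")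
     case True
     then show ?thesis using i pb q(3) piy[OF i] one_nz by (simp add: p'_def b'_def)
    next
     case False
     then show ?thesis using i ij q(1)[symmetric] piy[OF i] by (simp add: p'_def b'_def r_neg)
    qed
   next
    case False
    then show ?thesis using ij q by (auto simp: p'_def b'_def)
   qed
  qed (use bc y pmn in \<open>simp_all add: b'_def\<close>)
  then have "Suc n \<le> n" by (intro mx) blast
  then show False by simp
 qed
 \<comment> \<open>The difference of the two sides is a multiplication operator that kills every
   \<open>b i\<close>.\<close>
 have expand: "m y = nsum A (%i. m (b i) \<otimes> p i y) n" if m: "mop m" and y: "y \<in> carrier A" for m y
 proof -
  define q where "q = (%x. m x \<oplus> nsum A (%i. (\<ominus> m (b i)) \<otimes> p i x \<otimes> \<one>) n)"
  have mb: "m (b i) \<in> carrier A" if "i < n" for i by (rule mop_closed[OF m bc[OF that]])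
  have q: "mop q" unfolding q_def
   by (rule mop_plus[OF m mop_nsum[OF mop_lr[OF pm]]]) (simp_all add: mb)
  have pc: "p i x \<in> carrier A" if "i < n" "x \<in> carrier A" for i x by (rule mop_closed[OF pm[OF that(1)] that(2)])
  have e: "q x = m x \<ominus> nsum A (%i. m (b i) \<otimes> p i x) n" if x: "x \<in> carrier A" for x
  proof -
   have "nsum A (%i. (\<ominus> m (b i)) \<otimes> p i x \<otimes> \<one>) n = nsum A (%i. \<ominus> (m (b i) \<otimes> p i x)) n"
    by (rule nsum_cong) (simp add: mb pc x l_minus)
   also have "\<dots> = \<ominus> nsum A (%i. m (b i) \<otimes> p i x) n"
    by (rule additive_nsum[OF M.abelian_group_axioms M.abelian_group_axioms, where h = "%z. \<ominus> z", symmetric])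
     (simp_all add: mb pc x minus_add)
   finally show ?thesis by (simp add: q_def minus_eq)
  qed
  have "q (b j) = \<zero>" if j: "j < n" for j
  proof -
   have "nsum A (%i. m (b i) \<otimes> p i (b j)) n = nsum A (%i. if i = j then m (b j) else \<zero>) n"
    by (rule nsum_cong) (simp add: pb j mb)
   also have "\<dots> = m (b j)" by (rule nsum_single[OF j mb[OF j]])
   finally show ?thesis using e[OF bc[OF j]] mb[OF j] by (simp add: minus_eq r_neg)
  qed
  then have "q y = \<zero>" by (rule kill[OF q _ y])
  then show ?thesis using e[OF y] minus_zero_imp_eq[OF mop_closed[OF m y]] mb pc y by simp
 qed
 have pc: "p i x \<in> carrier A" if "i < n" "x \<in> carrier A" for i x by (rule mop_closed[OF pm[OF that(1)] that(2)])
 show ?thesis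
 proof (rule that[of n b p, OF bc pm])
  fix i y assume i: "i < n" and y: "y \<in> carrier A"
  have "p i y \<otimes> z = z \<otimes> p i y" if z: "z \<in> carrier A" for z
  proof -
   \<comment> \<open>The operator \<open>x \<mapsto> p i x z\<close> has the value \<open>z\<close>
     at \<open>b i\<close> and 0 at the other \<open>b k\<close>, so its expansion at
     \<open>y\<close> reads \<open>p i y z = z p i y\<close>.\<close>
   have m: "mop (%x. \<one> \<otimes> p i x \<otimes> z)" by (rule mop_lr[OF pm[OF i] one_closed z])
   have "\<one> \<otimes> p i y \<otimes> z = nsum A (%k. (\<one> \<otimes> p i (b k) \<otimes> z) \<otimes> p k y) n" by (rule expand[OF m y])
   also have "\<dots> = nsum A (%k. if k = i then z \<otimes> p i y else \<zero>) n"
    by (rule nsum_cong) (simp add: pb i z pc y)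
   also have "\<dots> = z \<otimes> p i y" by (rule nsum_single[OF i]) (simp add: z pc i y)
   finally show ?thesis using pc[OF i y] by simp
  qed
  then show "p i y \<in> cent (carrier A)" using pc[OF i y] by (simp add: cent_def)
 next
  fix y assume y: "y \<in> carrier A"
  have m: "mop (%x. \<one> \<otimes> x \<otimes> \<one>)" by (rule mop_basic) simp_all
  have "\<one> \<otimes> y \<otimes> \<one> = nsum A (%i. (\<one> \<otimes> b i \<otimes> \<one>) \<otimes> p i y) n" by (rule expand[OF m y])
  also have "\<dots> = nsum A (%i. b i \<otimes> p i y) n" by (rule nsum_cong) (simp add: bc)
  finally show "y = nsum A (%i. b i \<otimes> p i y) n" using y by simp
 qed
qed

end

section \<open>The action of a tensor product on an algebra\<close>

lemma opposite_simps [simp]: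
 "carrier (opposite_algebra A) = carrier A" "monoid.mult (opposite_algebra A) = (%x y. y \<otimes>\<^bsub>A\<^esub> x)"
 "one (opposite_algebra A) = one A" "ring.zero (opposite_algebra A) = ring.zero A" "ring.add (opposite_algebra A) = ring.add A"
 "smult (opposite_algebra A) = smult A"
 by (simp_all add: opposite_algebra_def)

lemma bimodule_simps [simp]:
 "carrier (bimodule F A) = carrier A" "ring.zero (bimodule F A) = ring.zero A" "ring.add (bimodule F A) = ring.add A"
 by (simp_all add: bimodule_def)

lemma abelian_group_cong:
 assumes "abelian_group M" "carrier M' = carrier M" "ring.add M' = ring.add M" "ring.zero M' = ring.zero M"
 shows "abelian_group M'"
proof -
 interpret abelian_group M by fact
 show ?thesis
 proof (rule abelian_groupI)
  fix x assume "x \<in> carrier M'"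
  then show "\<exists>y \<in> carrier M'. y \<oplus>\<^bsub>M'\<^esub> x = \<zero>\<^bsub>M'\<^esub>"
   using assms(2-4) by (intro bexI[of _ "\<ominus>\<^bsub>M\<^esub> x"]) (simp_all add: l_neg)
 qed (simp_all add: assms(2-4) a_ac)
qed

lemma nsum_update [simp]:
 "nsum (A\<lparr>carrier := B\<rparr>) f n = nsum A f n"
 "nsum (A\<lparr>carrier := B, one := e\<rparr>) f n = nsum A f n"
 by (induction n) simp_all

lemma opposite_assoc_algebra:
 assumes "assoc_algebra F B" shows "assoc_algebra F (opposite_algebra B)"
proof -
 interpret assoc_algebra F B by fact
 have "module F (opposite_algebra B)"
  by (intro moduleI module.axioms(1)[OF module_axioms] abelian_group_cong[OF abelian_group_axioms])
   (simp_all add: smult_l_distr smult_r_distr smult_assoc1)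
 then show ?thesis
  by (intro assoc_algebra.intro unital_algebra.intro assoc_algebra_axioms.intro unital_algebra_axioms.intro)
   (simp_all add: field_axioms mult_l_one mult_r_one mult_l_distr mult_r_distr mult_smult_l mult_smult_r massoc)
qed

context unital_algebra begin

lemma nucleusD:
 assumes "x \<in> nucleus A" "y \<in> carrier A" "z \<in> carrier A"
 shows "(x \<otimes> y) \<otimes> z = x \<otimes> (y \<otimes> z)" "(y \<otimes> x) \<otimes> z = y \<otimes> (x \<otimes> z)" "(y \<otimes> z) \<otimes> x = y \<otimes> (z \<otimes> x)"
proof -
 have x: "x \<in> carrier A" and a: "associator A x y z = \<zero>" "associator A y x z = \<zero>" "associator A y z x = \<zero>"
  using assms unfolding nucleus_def by blast+
 show "(x \<otimes> y) \<otimes> z = x \<otimes> (y \<otimes> z)"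
  by (rule minus_zero_imp_eq) (use a(1) x assms in \<open>simp_all add: associator_def mult_closed\<close>)
 show "(y \<otimes> x) \<otimes> z = y \<otimes> (x \<otimes> z)"
  by (rule minus_zero_imp_eq) (use a(2) x assms in \<open>simp_all add: associator_def mult_closed\<close>)
 show "(y \<otimes> z) \<otimes> x = y \<otimes> (z \<otimes> x)"
  by (rule minus_zero_imp_eq) (use a(3) x assms in \<open>simp_all add: associator_def mult_closed\<close>)
qed

lemma nucleus_carrier: "nucleus A \<subseteq> carrier A" by (auto simp: nucleus_def)

text \<open>The identity \<open>e\<close> may differ from that of \<open>A\<close>, because corners
  of \<open>B\<close> and their subalgebras are also treated as algebras.\<close>

lemma subalgebra_assoc:
 assumes "submodule D F A" "D \<subseteq> nucleus A" "!!x y. x \<in> D ==> y \<in> D ==> x \<otimes> y \<in> D"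
  "e \<in> D" "!!x. x \<in> D ==> e \<otimes> x = x" "!!x. x \<in> D ==> x \<otimes> e = x"
 shows "assoc_algebra F (A\<lparr>carrier := D, one := e\<rparr>)"
proof -
 have c: "x \<in> carrier A" if "x \<in> D" for x using that assms(2) nucleus_carrier by blast
 have "module F (A\<lparr>carrier := D\<rparr>)" by (rule submodule.submodule_is_module[OF assms(1)]) (rule module_axioms)
 then have m: "module F (A\<lparr>carrier := D, one := e\<rparr>)"
  by (simp add: module_def module_axioms_def abelian_group_def abelian_monoid_def abelian_group_axioms_def)
 then show ?thesis
  by (intro assoc_algebra.intro unital_algebra.intro assoc_algebra_axioms.intro unital_algebra_axioms.intro)
   (simp_all add: field_axioms mult_l_distr mult_r_distr mult_smult_l mult_smult_r assms(3-6) c nucleusD(1)[OF subsetD[OF assms(2)]])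
qed

end

lemma (in unital_algebra) zero_mult_l: "x \<in> carrier A ==> \<zero> \<otimes> x = \<zero>"
 using mult_smult_l[of "\<zero>\<^bsub>F\<^esub>" "\<zero>" x] mult_closed[of "\<zero>" x] by simp

lemma (in unital_algebra) zero_mult_r: "x \<in> carrier A ==> x \<otimes> \<zero> = \<zero>"
 using mult_smult_r[of "\<zero>\<^bsub>F\<^esub>" x "\<zero>"] mult_closed[of x "\<zero>"] by simp

text \<open>\<open>C\<close> is a record of its own whose product is the reversed product of
  \<open>A\<close>. One theory thereby covers the opposite algebra of \<open>B\<close>, used in
  quasi-associativity, and a commutative \<open>K\<close>, which is its own opposite, used in
  semiassociativity.\<close>

locale tensor_action = unital_algebra F A
 for F :: "('f, 'n) ring_scheme" and A :: "('f, 'a, 'm) module_scheme" (structure)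
  and B :: "'a set" and C :: "('f, 'a, 'm) module_scheme" +
 assumes alg_B: "assoc_algebra F (A\<lparr>carrier := B\<rparr>)" and alg_C: "assoc_algebra F C"
  and B_nuc: "B \<subseteq> nucleus A" and C_nuc: "carrier C \<subseteq> nucleus A"
  and C_mult: "!!x y. x \<in> carrier C ==> y \<in> carrier C ==> x \<otimes>\<^bsub>C\<^esub> y = y \<otimes> x"
  and C_add: "ring.add C = ring.add A" and C_smult: "smult C = smult A" and C_one: "\<one>\<^bsub>C\<^esub> = \<one>"
  and C_zero: "\<zero>\<^bsub>C\<^esub> = \<zero>"
begin

sublocale tp: algebra_pair F "A\<lparr>carrier := B\<rparr>" C
 by (intro algebra_pair.intro alg_B alg_C)

abbreviation "T \<equiv> tensor_algebra F (A\<lparr>carrier := B\<rparr>) C"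
abbreviation "C0 \<equiv> carrier C"
abbreviation "tns \<equiv> tp.tns"

definition act where "act t a = t \<odot>\<^bsub>bimodule F A\<^esub> a"

lemma Bc [simp]: "b \<in> B ==> b \<in> carrier A" using B_nuc nucleus_carrier by blast
lemma Cc [simp]: "c \<in> C0 ==> c \<in> carrier A" using C_nuc nucleus_carrier by blast
lemma Bone: "\<one> \<in> B" using tp.B.one_closed by simp
lemma Cone: "\<one> \<in> C0" using tp.C.one_closed C_one by simp
lemma Bmult: "x \<in> B ==> y \<in> B ==> x \<otimes> y \<in> B" using tp.B.mult_closed[of x y] by simp
lemma Badd: "x \<in> B ==> y \<in> B ==> x \<oplus> y \<in> B" using tp.B.a_closed[of x y] by simp
lemma Bsmult: "c \<in> carrier F ==> y \<in> B ==> c \<odot> y \<in> B" using tp.B.smult_closed[of c y] by simp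
lemma Cmult: "x \<in> C0 ==> y \<in> C0 ==> x \<otimes> y \<in> C0" using tp.C.mult_closed[of y x] C_mult by simp
lemma Cadd: "x \<in> C0 ==> y \<in> C0 ==> x \<oplus> y \<in> C0" using tp.C.a_closed[of x y] C_add by simp
lemma Csmult: "c \<in> carrier F ==> y \<in> C0 ==> c \<odot> y \<in> C0" using tp.C.smult_closed[of c y] C_smult by simp
lemma Bzero: "\<zero> \<in> B" using tp.B.zero_closed by simp
lemma Czero: "\<zero> \<in> C0" using tp.C.zero_closed C_zero by simp

lemma tns_c [simp]: "b \<in> B ==> c \<in> C0 ==> tns b c \<in> carrier T"
 using tp.tns_closed[of b c] by simp

lemma tns_m: "b \<in> B ==> c \<in> C0 ==> b' \<in> B ==> c' \<in> C0 ==>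
 tns b c \<otimes>\<^bsub>T\<^esub> tns b' c' = tns (b \<otimes> b') (c' \<otimes> c)"
 using tp.tns_mult[of b c b' c'] by (simp add: C_mult)

lemma tns_al: "b \<in> B ==> b' \<in> B ==> c \<in> C0 ==> tns (b \<oplus> b') c = tns b c \<oplus>\<^bsub>T\<^esub> tns b' c"
 using tp.tns_add_l[of b b' c] by simp

lemma tns_ar: "b \<in> B ==> c \<in> C0 ==> c' \<in> C0 ==> tns b (c \<oplus> c') = tns b c \<oplus>\<^bsub>T\<^esub> tns b c'"
 using tp.tns_add_r[of b c c'] by (simp add: C_add)

lemma tns_s: "s \<in> carrier F ==> b \<in> B ==> c \<in> C0 ==> tns b (s \<odot> c) = tns (s \<odot> b) c"
 using tp.tns_smult[of s b c] by (simp add: C_smult)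

lemma tns_1: "tns \<one> \<one> = \<one>\<^bsub>T\<^esub>" using tp.tns_one by (simp add: C_one)

lemma T_induct [consumes 1, case_names tns add]:
 assumes "t \<in> carrier T" "!!b c. b \<in> B ==> c \<in> C0 ==> Q (tns b c)"
  "!!t u. t \<in> carrier T ==> u \<in> carrier T ==> Q t ==> Q u ==> Q (t \<oplus>\<^bsub>T\<^esub> u)"
 shows "Q t"
 using assms(1) by (rule tp.tns_induct) (use assms(2,3) in auto)

lemma T_lift:
 fixes V :: "('f, 'v, 'w) module_scheme"
 assumes "vspace F V"
  and "!!b c. b \<in> B ==> c \<in> C0 ==> u b c \<in> carrier V"
  and "!!b b' c. b \<in> B ==> b' \<in> B ==> c \<in> C0 ==> u (b \<oplus> b') c = u b c \<oplus>\<^bsub>V\<^esub> u b' c"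
  and "!!b c c'. b \<in> B ==> c \<in> C0 ==> c' \<in> C0 ==> u b (c \<oplus> c') = u b c \<oplus>\<^bsub>V\<^esub> u b c'"
  and "!!s b c. s \<in> carrier F ==> b \<in> B ==> c \<in> C0 ==> u (s \<odot> b) c = s \<odot>\<^bsub>V\<^esub> u b c"
  and "!!s b c. s \<in> carrier F ==> b \<in> B ==> c \<in> C0 ==> u b (s \<odot> c) = s \<odot>\<^bsub>V\<^esub> u b c"
 obtains h where "!!t. t \<in> carrier T ==> h t \<in> carrier V"
  "!!t t'. t \<in> carrier T ==> t' \<in> carrier T ==> h (t \<oplus>\<^bsub>T\<^esub> t') = h t \<oplus>\<^bsub>V\<^esub> h t'"
  "!!b c. b \<in> B ==> c \<in> C0 ==> h (tns b c) = u b c"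
  "!!t f. t \<in> carrier T ==> f \<in> t ==> ext_sum F V (%p. u (fst p) (snd p)) f = h t"
proof -
 have "bilinear_map F (A\<lparr>carrier := B\<rparr>) C V u"
  by (rule bilinear_mapI) (use assms(2-6) in \<open>simp_all add: C_add C_smult\<close>)
 from tp.tensor_lift[OF assms(1) this] obtain h where h: "!!t. t \<in> carrier T ==> h t \<in> carrier V"
  "!!t t'. t \<in> carrier T ==> t' \<in> carrier T ==> h (t \<oplus>\<^bsub>T\<^esub> t') = h t \<oplus>\<^bsub>V\<^esub> h t'"
  "!!b c. b \<in> carrier (A\<lparr>carrier := B\<rparr>) ==> c \<in> C0 ==> h (tns b c) = u b c"
  "!!t f. t \<in> carrier T ==> f \<in> t ==> ext_sum F V (%p. u (fst p) (snd p)) f = h t"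
  by blast
 show ?thesis by (rule that[of h]) (use h in simp_all)
qed

text \<open>Here the description operator of \<open>bimodule\<close> is evaluated, by the
  independence of representatives from \<open>T_lift\<close>. Everything about the action is
  afterwards derived from its values on pure tensors and additivity.\<close>

lemma act_ex:
 assumes a: "a \<in> carrier A"
 obtains h where "!!t. t \<in> carrier T ==> h t \<in> carrier A"
  "!!t t'. t \<in> carrier T ==> t' \<in> carrier T ==> h (t \<oplus>\<^bsub>T\<^esub> t') = h t \<oplus> h t'"
  "!!b c. b \<in> B ==> c \<in> C0 ==> h (tns b c) = (b \<otimes> a) \<otimes> c"
  "!!t. t \<in> carrier T ==> act t a = h t"
proof -
 obtain h where h: "!!t. t \<in> carrier T ==> h t \<in> carrier A"
  "!!t t'. t \<in> carrier T ==> t' \<in> carrier T ==> h (t \<oplus>\<^bsub>T\<^esub> t') = h t \<oplus> h t'"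
  "!!b c. b \<in> B ==> c \<in> C0 ==> h (tns b c) = (b \<otimes> a) \<otimes> c"
  "!!t f. t \<in> carrier T ==> f \<in> t ==> ext_sum F A (%p. (fst p \<otimes> a) \<otimes> snd p) f = h t"
  by (rule T_lift[of A "%b c. (b \<otimes> a) \<otimes> c", OF vspace_axioms],
   (simp_all add: a mult_closed mult_l_distr mult_r_distr mult_smult_l mult_smult_r)[5], blast)
 have "act t a = h t" if t: "t \<in> carrier T" for t
 proof -
  obtain f where f: "f \<in> carrier tp.P" "t = tp.cls f" using tp.cls_surj[OF t] by blast
  have ft: "f \<in> t" using tp.cls_mem[OF f(1)] f(2) by simp
  have e: "(\<Oplus>p \<in> supp F g. g p \<odot> ((fst p \<otimes> a) \<otimes> snd p)) = h t" if "g \<in> t" for g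
   using h(4)[OF t that] by (simp add: ext_sum_def)
  have "(THE y. \<forall>f \<in> t. y = (\<Oplus>p \<in> supp F f. f p \<odot> ((fst p \<otimes> a) \<otimes> snd p))) = h t"
  proof (rule the_equality)
   show "\<forall>f \<in> t. h t = (\<Oplus>p \<in> supp F f. f p \<odot> ((fst p \<otimes> a) \<otimes> snd p))" using e by simp
   fix y assume "\<forall>f \<in> t. y = (\<Oplus>p \<in> supp F f. f p \<odot> ((fst p \<otimes> a) \<otimes> snd p))"
   then have "y = (\<Oplus>p \<in> supp F f. f p \<odot> ((fst p \<otimes> a) \<otimes> snd p))" using ft by (rule bspec)
   then show "y = h t" using e[OF ft] by simp
  qed
  then show ?thesis by (simp add: act_def bimodule_def)
 qed
 from that[OF h(1-3) this] show ?thesis .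
qed

lemma act_closed [simp]: assumes "t \<in> carrier T" "a \<in> carrier A" shows "act t a \<in> carrier A"
proof -
 obtain h where h: "!!t. t \<in> carrier T ==> h t \<in> carrier A" "!!t. t \<in> carrier T ==> act t a = h t"
  by (rule act_ex[OF assms(2)]) blast
 then show ?thesis using assms by simp
qed

lemma act_add_l: assumes "t \<in> carrier T" "u \<in> carrier T" "a \<in> carrier A"
 shows "act (t \<oplus>\<^bsub>T\<^esub> u) a = act t a \<oplus> act u a"
proof -
 obtain h where h: "!!t t'. t \<in> carrier T ==> t' \<in> carrier T ==> h (t \<oplus>\<^bsub>T\<^esub> t') = h t \<oplus> h t'"
  "!!t. t \<in> carrier T ==> act t a = h t"
  by (rule act_ex[OF assms(3)]) blast
 then show ?thesis using assms by simp
qed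

lemma act_tns: assumes "b \<in> B" "c \<in> C0" "a \<in> carrier A" shows "act (tns b c) a = (b \<otimes> a) \<otimes> c"
proof -
 obtain h where h: "!!b c. b \<in> B ==> c \<in> C0 ==> h (tns b c) = (b \<otimes> a) \<otimes> c"
  "!!t. t \<in> carrier T ==> act t a = h t"
  by (rule act_ex[OF assms(3)]) blast
 then show ?thesis using assms by simp
qed

lemma act_add_r: assumes "t \<in> carrier T" "a \<in> carrier A" "a' \<in> carrier A"
 shows "act t (a \<oplus> a') = act t a \<oplus> act t a'"
 using assms(1)
proof (induction t rule: T_induct)
 case (tns b c)
 then show ?case using assms by (simp add: act_tns mult_l_distr mult_r_distr mult_closed)
next
 case (add t u)
 then show ?case using assms by (simp add: act_add_l a_ac)
qed

lemma act_smult: assumes "t \<in> carrier T" "a \<in> carrier A" "s \<in> carrier F"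
 shows "act t (s \<odot> a) = s \<odot> act t a"
 using assms(1)
proof (induction t rule: T_induct)
 case (tns b c)
 then show ?case using assms by (simp add: act_tns mult_smult_l mult_smult_r mult_closed)
next
 case (add t u)
 then show ?case using assms by (simp add: act_add_l smult_r_distr)
qed

lemma act_zero_r: "t \<in> carrier T ==> act t \<zero> = \<zero>"
 by (rule additive_zero[OF abelian_group_axioms abelian_group_axioms]) (simp_all add: act_add_r)

lemma act_zero_l: "a \<in> carrier A ==> act \<zero>\<^bsub>T\<^esub> a = \<zero>"
 by (rule additive_zero[OF tp.T.abelian_group_axioms abelian_group_axioms, where h = "%t. act t a"])
  (simp_all add: act_add_l)

lemma act_minus_l: "t \<in> carrier T ==> u \<in> carrier T ==> a \<in> carrier A ==> act (t \<ominus>\<^bsub>T\<^esub> u) a = act t a \<ominus> act u a"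
 by (rule additive_minus[OF tp.T.abelian_group_axioms abelian_group_axioms, where h = "%t. act t a"])
  (simp_all add: act_add_l)

lemma sandwich_assoc:
 assumes "b \<in> nucleus A" "c \<in> nucleus A" "b' \<in> nucleus A" "c' \<in> nucleus A" "a \<in> carrier A"
 shows "((b \<otimes> b') \<otimes> a) \<otimes> (c' \<otimes> c) = (b \<otimes> ((b' \<otimes> a) \<otimes> c')) \<otimes> c"
proof -
 have car: "b \<in> carrier A" "c \<in> carrier A" "b' \<in> carrier A" "c' \<in> carrier A"
  using assms nucleus_carrier by blast+
 have e1: "((b \<otimes> b') \<otimes> a) \<otimes> (c' \<otimes> c) = (((b \<otimes> b') \<otimes> a) \<otimes> c') \<otimes> c"
  using nucleusD(3)[OF assms(2), of "(b \<otimes> b') \<otimes> a" c'] car assms(5) by (simp add: mult_closed)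
 have e2: "(b \<otimes> b') \<otimes> a = b \<otimes> (b' \<otimes> a)" using nucleusD(1)[OF assms(1)] car assms(5) by simp
 have e3: "(b \<otimes> (b' \<otimes> a)) \<otimes> c' = b \<otimes> ((b' \<otimes> a) \<otimes> c')"
  using nucleusD(1)[OF assms(1), of "b' \<otimes> a" c'] car assms(5) by (simp add: mult_closed)
 show ?thesis unfolding e1 unfolding e2 unfolding e3 ..
qed

lemma act_mult: assumes "t \<in> carrier T" "u \<in> carrier T" "a \<in> carrier A"
 shows "act (t \<otimes>\<^bsub>T\<^esub> u) a = act t (act u a)"
 using assms(1)
proof (induction t rule: T_induct)
 case (tns b c)
 note bc = this
 show ?case using assms(2)
 proof (induction u rule: T_induct)
  case (tns b' c')
  have n: "b \<in> nucleus A" "c \<in> nucleus A" "b' \<in> nucleus A" "c' \<in> nucleus A"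
   using bc tns B_nuc C_nuc by blast+
  show ?case using bc tns assms(3) sandwich_assoc[OF n assms(3)]
   by (simp add: tns_m act_tns Bmult Cmult mult_closed)
 next
  case (add t u)
  then show ?case using bc assms(3) by (simp add: tp.T.r_distr act_add_l act_add_r)
 qed
next
 case (add t t')
 then show ?case using assms by (simp add: tp.T.l_distr act_add_l)
qed

lemma act_one: "a \<in> carrier A ==> act \<one>\<^bsub>T\<^esub> a = a"
 unfolding tns_1[symmetric] using Bone Cone by (simp add: act_tns mult_l_one mult_r_one)

lemma bimodule_left_module: "left_module T (bimodule F A)"
proof (intro left_module.intro left_module_axioms.intro tp.T_ring)
 show "abelian_group (bimodule F A)"
  by (rule abelian_group_cong[OF abelian_group_axioms]) simp_all
qed (simp_all add: act_def[symmetric] act_add_l act_add_r act_mult act_one)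

lemma subspace_submodule:
 assumes "subsp W" "!!b c w. b \<in> B ==> c \<in> C0 ==> w \<in> W ==> (b \<otimes> w) \<otimes> c \<in> W"
 shows "submodule W T (bimodule F A)"
proof -
 note W = subspD[OF assms(1)]
 have "act t w \<in> W" if "t \<in> carrier T" "w \<in> W" for t w
  using that(1)
 proof (induction t rule: T_induct)
  case (tns b c)
  then show ?case using that(2) W(7) assms(2) by (simp add: act_tns)
 next
  case (add t u)
  then show ?case using that(2) W(3,7) by (simp add: act_add_l)
 qed
 moreover have "subgroup W (add_monoid (bimodule F A))"
  using submodule.axioms(1)[OF assms(1)] by (simp add: subgroup_def m_inv_def)
 ultimately show ?thesis by (simp add: submodule_def submodule_axioms_def act_def)
qed

lemma submodule_subspace:
 assumes "submodule W T (bimodule F A)"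
 shows "subsp W" "!!t w. t \<in> carrier T ==> w \<in> W ==> act t w \<in> W"
proof -
 show st: "act t w \<in> W" if "t \<in> carrier T" "w \<in> W" for t w
  using assms that by (simp add: submodule_def submodule_axioms_def act_def)
 have sg: "subgroup W (add_monoid A)"
  using submodule.axioms(1)[OF assms] by (simp add: subgroup_def m_inv_def)
 show "subsp W"
 proof (rule subspI)
  show W: "W \<subseteq> carrier A" using subgroup.subset[OF sg] by simp
  show "\<zero> \<in> W" using subgroup.one_closed[OF sg] by simp
  show "x \<oplus> y \<in> W" if "x \<in> W" "y \<in> W" for x y using subgroup.m_closed[OF sg that] by simp
  fix s w assume s: "s \<in> carrier F" and w: "w \<in> W"
  have "act (tns (s \<odot> \<one>) \<one>) w \<in> W" by (rule st[OF _ w]) (simp add: Bsmult Bone Cone s)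
  then show "s \<odot> w \<in> W" using s w W Bone Cone
   by (simp add: act_tns Bsmult mult_smult_l subset_iff mult_l_one mult_r_one)
 qed
qed

text \<open>The zero of the section is the coset \<open>N\<close>, so a scalar annihilates
  \<open>P / N\<close> exactly when it maps \<open>P\<close> into \<open>N\<close>. Cosets do not
  occur beyond this point.\<close>

lemma section_faithful_iff:
 assumes "submodule P T (bimodule F A)" "submodule N T (bimodule F A)" "N \<subseteq> P"
 shows "faithful_module T (module_section (bimodule F A) P N) \<longleftrightarrow>
  (\<forall>r \<in> carrier T. (\<forall>x \<in> P. act r x \<in> N) \<longrightarrow> r = \<zero>\<^bsub>T\<^esub>)"
proof -
 note P = submodule_subspace[OF assms(1)] and N = submodule_subspace[OF assms(2)]
 note Ps = subspD[OF P(1)] and Ns = subspD[OF N(1)]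
 have coset: "N +>\<^bsub>bimodule F A\<^esub> x = {n \<oplus> x | n. n \<in> N}" for x
  by (auto simp: a_r_coset_def r_coset_def)
 have cosN: "N +>\<^bsub>bimodule F A\<^esub> y = N" if y: "y \<in> N" for y
 proof
  show "N +>\<^bsub>bimodule F A\<^esub> y \<subseteq> N" using y Ns(3) by (auto simp: coset)
  show "N \<subseteq> N +>\<^bsub>bimodule F A\<^esub> y"
  proof
   fix n assume n: "n \<in> N"
   have "n = (n \<ominus> y) \<oplus> y" using n y Ns(7) by (simp add: minus_eq a_assoc l_neg)
   then show "n \<in> N +>\<^bsub>bimodule F A\<^esub> y" using Ns(5)[OF n y] by (auto simp: coset)
  qed
 qed
 have self: "x \<in> N +>\<^bsub>bimodule F A\<^esub> x" if "x \<in> carrier A" for x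
 proof -
  have "x = \<zero> \<oplus> x" using that by simp
  then show ?thesis using Ns(2) by (auto simp: coset)
 qed
 have "(\<forall>U \<in> carrier (module_section (bimodule F A) P N). r \<odot>\<^bsub>module_section (bimodule F A) P N\<^esub> U
    = \<zero>\<^bsub>module_section (bimodule F A) P N\<^esub>) \<longleftrightarrow> (\<forall>x \<in> P. act r x \<in> N)" if r: "r \<in> carrier T" for r
 proof -
  have "(\<Union>y \<in> N +>\<^bsub>bimodule F A\<^esub> x. N +>\<^bsub>bimodule F A\<^esub> (act r y)) = N \<longleftrightarrow> act r x \<in> N"
   if all: "\<forall>x \<in> P. act r x \<in> N \<or> True" and x: "x \<in> P" for x
  proof
   assume e: "(\<Union>y \<in> N +>\<^bsub>bimodule F A\<^esub> x. N +>\<^bsub>bimodule F A\<^esub> (act r y)) = N"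
   have xc: "x \<in> carrier A" using x Ps(7) by simp
   have "act r x \<in> N +>\<^bsub>bimodule F A\<^esub> (act r x)" by (rule self) (simp add: r xc)
   then have "act r x \<in> (\<Union>y \<in> N +>\<^bsub>bimodule F A\<^esub> x. N +>\<^bsub>bimodule F A\<^esub> (act r y))"
    using self[OF xc] by blast
   then show "act r x \<in> N" unfolding e .
  next
   assume rx: "act r x \<in> N"
   have xc: "x \<in> carrier A" using x Ps(7) by simp
   have "N +>\<^bsub>bimodule F A\<^esub> (act r y) = N" if "y \<in> N +>\<^bsub>bimodule F A\<^esub> x" for y
   proof (rule cosN)
    obtain n where n: "n \<in> N" "y = n \<oplus> x" using \<open>y \<in> _\<close> by (auto simp: coset)
    have "act r y = act r n \<oplus> act r x" unfolding n(2) by (rule act_add_r) (simp_all add: r xc n(1) Ns(7))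
    then show "act r y \<in> N" using Ns(3)[OF N(2)[OF r n(1)] rx] by simp
   qed
   then show "(\<Union>y \<in> N +>\<^bsub>bimodule F A\<^esub> x. N +>\<^bsub>bimodule F A\<^esub> (act r y)) = N"
    using self[OF xc] by auto
  qed
  then show ?thesis by (simp add: module_section_def act_def[symmetric])
 qed
 then show ?thesis unfolding faithful_module_def by simp
qed

text \<open>The image of \<open>U \<otimes> W\<close> in \<open>T\<close>. It allows
  \<open>L \<otimes> L\<close>, \<open>K \<otimes> K\<close> and the tensor square of a centralizer
  to be handled as subsets of one ring. Zero is not among the rules; it is
  \<open>tns \<zero> \<zero>\<close> whenever \<open>U\<close> and \<open>W\<close> contain
  zero.\<close>

inductive_set Sp :: "'a set => 'a set => ('a \<times> 'a => 'f) set set" for U W where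
 tns: "x \<in> U ==> y \<in> W ==> tns x y \<in> Sp U W"
| add: "t \<in> Sp U W ==> u \<in> Sp U W ==> t \<oplus>\<^bsub>T\<^esub> u \<in> Sp U W"

lemma Sp_carrier: assumes "t \<in> Sp U W" "U \<subseteq> B" "W \<subseteq> C0" shows "t \<in> carrier T"
 using assms(1)
proof (induction rule: Sp.induct)
 case (tns x y)
 then show ?case using assms(2,3) by (intro tns_c) blast+
qed simp

lemma Sp_mono: assumes "U \<subseteq> U'" "W \<subseteq> W'" shows "Sp U W \<subseteq> Sp U' W'"
proof
 fix t assume "t \<in> Sp U W"
 then show "t \<in> Sp U' W'" by induction (use assms in \<open>auto intro: Sp.intros\<close>)
qed

lemma Sp_all: "t \<in> carrier T ==> t \<in> Sp B C0"
 by (induction t rule: T_induct) (auto intro: Sp.intros)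

lemma Sp_zero: assumes "U \<subseteq> B" "\<zero> \<in> U" "\<zero> \<in> W" "W \<subseteq> C0" shows "\<zero>\<^bsub>T\<^esub> \<in> Sp U W"
proof -
 have "tns \<zero> \<zero> \<oplus>\<^bsub>T\<^esub> tns \<zero> \<zero> = tns \<zero> \<zero>" using tns_al[OF Bzero Bzero Czero] by simp
 then have "tns \<zero> \<zero> = \<zero>\<^bsub>T\<^esub>" using tp.T.add.r_cancel_one'[of "tns \<zero> \<zero>" "tns \<zero> \<zero>"] Bzero Czero by simp
 then show ?thesis using Sp.tns[OF assms(2,3)] by simp
qed

lemma Sp_mult:
 assumes "t \<in> Sp U W" "u \<in> Sp U W" "U \<subseteq> B" "W \<subseteq> C0"
  "!!x y. x \<in> U ==> y \<in> U ==> x \<otimes> y \<in> U" "!!x y. x \<in> W ==> y \<in> W ==> x \<otimes> y \<in> W"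
 shows "t \<otimes>\<^bsub>T\<^esub> u \<in> Sp U W"
 using assms(1)
proof (induction rule: Sp.induct)
 case (tns x y)
 note xy = this
 show ?case using assms(2)
 proof (induction rule: Sp.induct)
  case (tns x' y')
  have "tns x y \<otimes>\<^bsub>T\<^esub> tns x' y' = tns (x \<otimes> x') (y' \<otimes> y)"
   by (rule tns_m) (use xy tns assms(3,4) in blast)+
  then show ?case using Sp.tns[OF assms(5)[OF xy(1) tns(1)] assms(6)[OF tns(2) xy(2)]] by simp
 next
  case (add t u)
  have c: "tns x y \<in> carrier T" using xy assms(3,4) by (intro tns_c) blast+
  show ?case unfolding tp.T.r_distr[OF Sp_carrier[OF add(1) assms(3,4)] Sp_carrier[OF add(2) assms(3,4)] c]
   by (rule Sp.add[OF add(3,4)])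
 qed
next
 case (add t t')
 show ?case unfolding tp.T.l_distr[OF Sp_carrier[OF add(1) assms(3,4)] Sp_carrier[OF add(2) assms(3,4)] Sp_carrier[OF assms(2-4)]]
  by (rule Sp.add[OF add(3,4)])
qed

lemma Sp_commute:
 assumes "t \<in> Sp U W" "u \<in> Sp U' W'" "U \<subseteq> B" "W \<subseteq> C0" "U' \<subseteq> B" "W' \<subseteq> C0"
  "!!x y. x \<in> U ==> y \<in> U' ==> x \<otimes> y = y \<otimes> x" "!!x y. x \<in> W ==> y \<in> W' ==> x \<otimes> y = y \<otimes> x"
 shows "t \<otimes>\<^bsub>T\<^esub> u = u \<otimes>\<^bsub>T\<^esub> t"
 using assms(1)
proof (induction rule: Sp.induct)
 case (tns x y)
 note xy = this
 have c: "x \<in> B" "y \<in> C0" using xy assms(3,4) by blast+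
 show ?case using assms(2)
 proof (induction rule: Sp.induct)
  case (tns x' y')
  have c': "x' \<in> B" "y' \<in> C0" using tns assms(5,6) by blast+
  show ?case using assms(7)[OF xy(1) tns(1)] assms(8)[OF xy(2) tns(2)] by (simp add: tns_m c c')
 next
  case (add t u)
  note cc = Sp_carrier[OF add(1) assms(5,6)] Sp_carrier[OF add(2) assms(5,6)] tns_c[OF c]
  show ?case unfolding tp.T.r_distr[OF cc] tp.T.l_distr[OF cc] add(3,4) ..
 qed
next
 case (add t t')
 note cc = Sp_carrier[OF add(1) assms(3,4)] Sp_carrier[OF add(2) assms(3,4)] Sp_carrier[OF assms(2,5,6)]
 show ?case unfolding tp.T.r_distr[OF cc] tp.T.l_distr[OF cc] add(3,4) ..
qed

end

context tensor_action begin

text \<open>The tensor algebra is a plain ring record without scalars. As a vector space,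
  \<open>F\<close> acts on it by left multiplication with \<open>(c 1) \<otimes> 1\<close>, which
  makes the chain conditions for subspaces available in \<open>T\<close>.\<close>

definition Tm :: "('f, ('a \<times> 'a => 'f) set) module" where
 "Tm = \<lparr>carrier = carrier T, monoid.mult = monoid.mult T, one = one T, ring.zero = ring.zero T, ring.add = ring.add T,
   smult = (%c t. tns (c \<odot> \<one>) \<one> \<otimes>\<^bsub>T\<^esub> t)\<rparr>"

lemma Tm_simps [simp]:
 "carrier Tm = carrier T" "monoid.mult Tm = monoid.mult T" "one Tm = one T" "ring.zero Tm = ring.zero T" "ring.add Tm = ring.add T"
 by (simp_all add: Tm_def)

lemma sm_eq: "c \<odot>\<^bsub>Tm\<^esub> t = tns (c \<odot> \<one>) \<one> \<otimes>\<^bsub>T\<^esub> t" by (simp add: Tm_def)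

lemma sm_tns: "s \<in> carrier F ==> b \<in> B ==> c \<in> C0 ==> s \<odot>\<^bsub>Tm\<^esub> tns b c = tns (s \<odot> b) c"
 by (simp add: sm_eq tns_m Bsmult Bone Cone mult_smult_l mult_l_one mult_r_one)

lemma sone: "c \<in> carrier F ==> tns (c \<odot> \<one>) \<one> \<in> carrier T" by (simp add: Bsmult Bone Cone)

lemma Tm_vspace: "vspace F Tm"
proof (intro vspace.intro moduleI module.axioms(1)[OF module_axioms] field_axioms)
 show "abelian_group Tm" by (rule abelian_group_cong[OF tp.T.abelian_group_axioms]) simp_all
 fix c d t u assume c: "c \<in> carrier F" and d: "d \<in> carrier F" and "t \<in> carrier Tm" "u \<in> carrier Tm"
 then have t: "t \<in> carrier T" and u: "u \<in> carrier T" by simp_all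
 show "c \<odot>\<^bsub>Tm\<^esub> t \<in> carrier Tm" using sone[OF c] t by (simp add: sm_eq)
 show "(c \<oplus>\<^bsub>F\<^esub> d) \<odot>\<^bsub>Tm\<^esub> t = c \<odot>\<^bsub>Tm\<^esub> t \<oplus>\<^bsub>Tm\<^esub> d \<odot>\<^bsub>Tm\<^esub> t"
  using c d t sone by (simp add: sm_eq smult_l_distr tns_al Bsmult Bone Cone tp.T.l_distr)
 show "c \<odot>\<^bsub>Tm\<^esub> (t \<oplus>\<^bsub>Tm\<^esub> u) = c \<odot>\<^bsub>Tm\<^esub> t \<oplus>\<^bsub>Tm\<^esub> c \<odot>\<^bsub>Tm\<^esub> u"
  using c t u sone by (simp add: sm_eq tp.T.r_distr)
 have "tns (c \<odot> \<one>) \<one> \<otimes>\<^bsub>T\<^esub> tns (d \<odot> \<one>) \<one> = tns ((c \<otimes>\<^bsub>F\<^esub> d) \<odot> \<one>) \<one>"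
  using c d by (simp add: tns_m Bsmult Bone Cone mult_smult_l smult_assoc1 mult_l_one)
 then show "(c \<otimes>\<^bsub>F\<^esub> d) \<odot>\<^bsub>Tm\<^esub> t = c \<odot>\<^bsub>Tm\<^esub> (d \<odot>\<^bsub>Tm\<^esub> t)"
  using c d t sone by (simp add: sm_eq tp.T.m_assoc[symmetric])
next
 fix t assume "t \<in> carrier Tm"
 then show "\<one>\<^bsub>F\<^esub> \<odot>\<^bsub>Tm\<^esub> t = t" using Bc[OF Bone] by (simp add: sm_eq tns_1)
qed

sublocale TV: vspace F Tm by (rule Tm_vspace)

lemma tns_zero_l: assumes "c \<in> C0" shows "tns \<zero> c = \<zero>\<^bsub>T\<^esub>"
 using tns_al[OF Bzero Bzero assms] tp.T.add.r_cancel_one'[of "tns \<zero> c" "tns \<zero> c"] Bzero assms by simp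

lemma tns_zero_r: assumes "b \<in> B" shows "tns b \<zero> = \<zero>\<^bsub>T\<^esub>"
 using tns_ar[OF assms Czero Czero] tp.T.add.r_cancel_one'[of "tns b \<zero>" "tns b \<zero>"] Czero assms by simp

lemma tns_nsum_r:
 assumes "b \<in> B" "!!i. i < n ==> f i \<in> C0"
 shows "tns b (nsum A f n) = nsum T (%i. tns b (f i)) n \<and> nsum A f n \<in> C0"
 using assms(2) by (induction n) (simp_all add: tns_zero_r assms(1) tns_ar Czero Cadd)

lemma tns_nsum_l:
 assumes "c \<in> C0" "!!i. i < n ==> f i \<in> B"
 shows "tns (nsum A f n) c = nsum T (%i. tns (f i) c) n \<and> nsum A f n \<in> B"
 using assms(2) by (induction n) (simp_all add: tns_zero_l assms(1) tns_al Bzero Badd)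

lemma act_nsum:
 assumes "a \<in> carrier A" "!!i. i < n ==> t i \<in> carrier T"
 shows "act (nsum T t n) a = nsum A (%i. act (t i) a) n"
 by (rule additive_nsum[OF tp.T.abelian_group_axioms abelian_group_axioms, where h = "%t. act t a"])
  (simp_all add: assms act_add_l)

lemma Sp_nsum:
 assumes "U \<subseteq> B" "\<zero> \<in> U" "\<zero> \<in> W" "W \<subseteq> C0" "!!i. i < n ==> f i \<in> Sp U W"
 shows "nsum T f n \<in> Sp U W"
 using assms(5) by (induction n) (simp_all add: Sp_zero[OF assms(1-4)] Sp.add)

end

section \<open>Quasi-associative algebras and their finite dimension\<close>

locale qassoc = unital_algebra F A
 for F :: "('f, 'n) ring_scheme" and A :: "('f, 'a, 'm) module_scheme" (structure) and B :: "'a set" +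
 assumes qa: "quasi_associative F A B"
begin

lemma qaD:
 shows "submodule B F A" "\<one> \<in> B" "!!x y. x \<in> B ==> y \<in> B ==> x \<otimes> y \<in> B" "B \<subseteq> nucleus A"
  "finite_dimensional F (A\<lparr>carrier := B\<rparr>)" "simple_ring (A\<lparr>carrier := B\<rparr>)"
  "finite_separable_extension F (A\<lparr>carrier := alg_center (A\<lparr>carrier := B\<rparr>)\<rparr>)"
  "normal_algebra F (A\<lparr>carrier := B\<rparr>)"
  "minimally_faithful (tensor_algebra F (A\<lparr>carrier := B\<rparr>) (opposite_algebra (A\<lparr>carrier := B\<rparr>))) (bimodule F A)"
 using qa unfolding quasi_associative_def unital_subalgebra_def by blast+

lemma B_assoc: "assoc_algebra F (A\<lparr>carrier := B\<rparr>)"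
proof -
 have c: "x \<in> carrier A" if "x \<in> B" for x using that qaD(4) nucleus_carrier by blast
 have "assoc_algebra F (A\<lparr>carrier := B, one := \<one>\<rparr>)"
  by (rule subalgebra_assoc[OF qaD(1,4,3,2)]) (simp_all add: c mult_l_one mult_r_one)
 then show ?thesis by simp
qed

sublocale tensor_action F A B "opposite_algebra (A\<lparr>carrier := B\<rparr>)"
proof (intro tensor_action.intro unital_algebra_axioms tensor_action_axioms.intro B_assoc opposite_assoc_algebra qaD(4))
 show "carrier (opposite_algebra (A\<lparr>carrier := B\<rparr>)) \<subseteq> nucleus A" using qaD(4) by simp
qed simp_all

sublocale BA: simple_algebra F "A\<lparr>carrier := B\<rparr>"
 by (intro simple_algebra.intro fd_algebra.intro B_assoc fd_algebra_axioms.intro simple_algebra_axioms.intro qaD)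

lemma C0_eq [simp]: "carrier (opposite_algebra (A\<lparr>carrier := B\<rparr>)) = B" by simp

lemma faithful:
 assumes "t \<in> carrier T" "!!a. a \<in> carrier A ==> act t a = \<zero>" shows "t = \<zero>\<^bsub>T\<^esub>"
proof -
 have "faithful_module T (bimodule F A)" using qaD(9) unfolding minimally_faithful_def by (elim conjE)
 then have "(\<forall>x \<in> carrier (bimodule F A). t \<odot>\<^bsub>bimodule F A\<^esub> x = \<zero>\<^bsub>bimodule F A\<^esub>) \<longrightarrow> t = \<zero>\<^bsub>T\<^esub>"
  unfolding faithful_module_def using assms(1) by (rule bspec)
 then show ?thesis using assms(2) by (simp add: act_def)
qed

lemma faithful_eq:
 assumes "t \<in> carrier T" "u \<in> carrier T" "!!a. a \<in> carrier A ==> act t a = act u a" shows "t = u"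
proof (rule tp.T.minus_zero_imp_eq[OF assms(1,2)])
 show "t \<ominus>\<^bsub>T\<^esub> u = \<zero>\<^bsub>T\<^esub>"
  by (rule faithful) (simp_all add: assms act_minus_l minus_eq r_neg)
qed

lemma zero_submodule: "submodule {\<zero>} T (bimodule F A)"
 by (rule subspace_submodule[OF subsp_zero]) (simp add: zero_mult_l zero_mult_r)

lemma minimal:
 assumes "subsp P" "!!b c w. b \<in> B ==> c \<in> B ==> w \<in> P ==> (b \<otimes> w) \<otimes> c \<in> P"
  "!!r. r \<in> carrier T ==> (!!x. x \<in> P ==> act r x = \<zero>) ==> r = \<zero>\<^bsub>T\<^esub>"
 shows "P = carrier A"
proof -
 have P: "submodule P T (bimodule F A)" by (rule subspace_submodule[OF assms(1)]) (simp add: assms(2))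
 have z: "{\<zero>} \<subseteq> P" using subspD(2)[OF assms(1)] by simp
 have "faithful_module T (module_section (bimodule F A) P {\<zero>})"
  unfolding section_faithful_iff[OF P zero_submodule z] using assms(3) by simp
 moreover have "\<forall>P N. submodule P T (bimodule F A) \<and> submodule N T (bimodule F A) \<and> N \<subseteq> P \<and>
   faithful_module T (module_section (bimodule F A) P N) \<longrightarrow>
   P = carrier (bimodule F A) \<and> N = {\<zero>\<^bsub>bimodule F A\<^esub>}"
  using qaD(9) unfolding minimally_faithful_def by (elim conjE)
 ultimately show ?thesis using P zero_submodule z by (metis bimodule_simps(1))
qed

text \<open>The pure tensors of spanning vectors span. The two factors are freed one after the
  other, the set of admissible factors being a subspace each time.\<close>

lemma T_fd: "finite_dimensional F Tm"
proof -
 obtain S where S: "finite S" "S \<subseteq> B" "tp.B.spanV S = B"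
  using tp.B.fin_dim_span_iff qaD(5) by auto
 let ?G = "(%p. tns (fst p) (snd p)) ` (S \<times> S)"
 have G: "?G \<subseteq> carrier Tm" using S(2) by (auto simp: subset_iff)
 note W = TV.subspD[OF TV.spanV_subsp[OF G]]
 have g: "tns x y \<in> TV.spanV ?G" if "x \<in> S" "y \<in> S" for x y
  by (rule TV.spanV_incl) (use that in force)
 have 1: "tp.B.subsp {b \<in> B. \<forall>s \<in> S. tns b s \<in> TV.spanV ?G}"
 proof (rule tp.B.subspI)
  show "\<zero>\<^bsub>A\<lparr>carrier := B\<rparr>\<^esub> \<in> {b \<in> B. \<forall>s \<in> S. tns b s \<in> TV.spanV ?G}"
   using S(2) W(2) by (auto simp: Bzero tns_zero_l subset_iff)
 next
  fix x y assume "x \<in> {b \<in> B. \<forall>s \<in> S. tns b s \<in> TV.spanV ?G}" "y \<in> {b \<in> B. \<forall>s \<in> S. tns b s \<in> TV.spanV ?G}"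
  then show "x \<oplus>\<^bsub>A\<lparr>carrier := B\<rparr>\<^esub> y \<in> {b \<in> B. \<forall>s \<in> S. tns b s \<in> TV.spanV ?G}"
   using S(2) W(3) by (simp add: Badd tns_al subset_iff)
 next
  fix c x assume c: "c \<in> carrier F" and x: "x \<in> {b \<in> B. \<forall>s \<in> S. tns b s \<in> TV.spanV ?G}"
  have "tns (c \<odot> x) s \<in> TV.spanV ?G" if s: "s \<in> S" for s
   using W(6)[OF c, of "tns x s"] sm_tns[OF c, of x s] x s S(2) by auto
  then show "c \<odot>\<^bsub>A\<lparr>carrier := B\<rparr>\<^esub> x \<in> {b \<in> B. \<forall>s \<in> S. tns b s \<in> TV.spanV ?G}"
   using c x by (simp add: Bsmult)
 qed auto
 have "tp.B.spanV S \<subseteq> {b \<in> B. \<forall>s \<in> S. tns b s \<in> TV.spanV ?G}"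
  by (rule tp.B.spanV_min[OF 1]) (use S(2) g in auto)
 then have bs: "tns b s \<in> TV.spanV ?G" if "b \<in> B" "s \<in> S" for b s using that S(3) by blast
 have 2: "tp.B.subsp {c \<in> B. \<forall>b \<in> B. tns b c \<in> TV.spanV ?G}"
 proof (rule tp.B.subspI)
  show "\<zero>\<^bsub>A\<lparr>carrier := B\<rparr>\<^esub> \<in> {c \<in> B. \<forall>b \<in> B. tns b c \<in> TV.spanV ?G}"
   using W(2) by (auto simp: Bzero tns_zero_r)
 next
  fix x y assume "x \<in> {c \<in> B. \<forall>b \<in> B. tns b c \<in> TV.spanV ?G}" "y \<in> {c \<in> B. \<forall>b \<in> B. tns b c \<in> TV.spanV ?G}"
  then show "x \<oplus>\<^bsub>A\<lparr>carrier := B\<rparr>\<^esub> y \<in> {c \<in> B. \<forall>b \<in> B. tns b c \<in> TV.spanV ?G}"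
   using W(3) by (simp add: Badd tns_ar)
 next
  fix c x assume c: "c \<in> carrier F" and x: "x \<in> {c \<in> B. \<forall>b \<in> B. tns b c \<in> TV.spanV ?G}"
  have "tns b (c \<odot> x) \<in> TV.spanV ?G" if b: "b \<in> B" for b
   using W(6)[OF c, of "tns b x"] sm_tns[OF c b, of x] tns_s[OF c b, of x] x b by simp
  then show "c \<odot>\<^bsub>A\<lparr>carrier := B\<rparr>\<^esub> x \<in> {c \<in> B. \<forall>b \<in> B. tns b c \<in> TV.spanV ?G}"
   using c x by (simp add: Bsmult)
 qed auto
 have "tp.B.spanV S \<subseteq> {c \<in> B. \<forall>b \<in> B. tns b c \<in> TV.spanV ?G}"
  by (rule tp.B.spanV_min[OF 2]) (use S(2) bs in auto)
 then have bc: "tns b c \<in> TV.spanV ?G" if "b \<in> B" "c \<in> B" for b c using that S(3) by blast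
 have "t \<in> TV.spanV ?G" if "t \<in> carrier T" for t
  using that
 proof (induction t rule: T_induct)
  case (tns b c)
  then show ?case using bc by simp
 next
  case (add t u)
  then show ?case using W(3) by simp
 qed
 then have "TV.spanV ?G = carrier Tm" using W(1) by auto
 then show ?thesis unfolding TV.fin_dim_span_iff using S(1) G by (intro exI[of _ ?G]) simp
qed

sublocale TV: fd_vspace F Tm by (intro fd_vspace.intro TV.vspace_axioms fd_vspace_axioms.intro T_fd)

text \<open>As \<open>T\<close> is finite dimensional, some finite \<open>G\<close> has a minimal
  annihilator in \<open>T\<close>; no further vector can shrink it, so by faithfulness it is zero.
  The submodule generated by \<open>G\<close> is then faithful and equals \<open>A\<close> by
  minimality, and it is spanned by finitely many products.\<close>

lemma A_fd: "finite_dimensional F A"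
proof -
 define Ann where "Ann G = {t \<in> carrier T. \<forall>g \<in> G. act t g = \<zero>}" for G
 have sub: "TV.subsp (Ann G)" if G: "G \<subseteq> carrier A" for G
 proof (rule TV.subspI)
  show "Ann G \<subseteq> carrier Tm" by (auto simp: Ann_def)
  show "\<zero>\<^bsub>Tm\<^esub> \<in> Ann G" using G by (simp add: Ann_def act_zero_l subset_iff)
 next
  fix x y assume "x \<in> Ann G" "y \<in> Ann G"
  then show "x \<oplus>\<^bsub>Tm\<^esub> y \<in> Ann G" using G by (simp add: Ann_def act_add_l subset_iff)
 next
  fix c x assume c: "c \<in> carrier F" and x: "x \<in> Ann G"
  then show "c \<odot>\<^bsub>Tm\<^esub> x \<in> Ann G" using G sone[OF c]
   by (simp add: Ann_def sm_eq act_mult act_zero_r subset_iff)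
 qed
 obtain G where G: "finite G \<and> G \<subseteq> carrier A"
  and mn: "!!G'. finite G' \<and> G' \<subseteq> carrier A ==> Ann G' \<subseteq> Ann G ==> Ann G' = Ann G"
 proof (rule TV.min_ex[of "%G. finite G \<and> G \<subseteq> carrier A" "{}" Ann])
  show "TV.subsp (Ann G)" if "finite G \<and> G \<subseteq> carrier A" for G using sub that by simp
 qed simp_all
 have AG: "t = \<zero>\<^bsub>T\<^esub>" if t: "t \<in> carrier T" "!!g. g \<in> G ==> act t g = \<zero>" for t
 proof (rule faithful[OF t(1)])
  fix a assume a: "a \<in> carrier A"
  have "Ann (insert a G) = Ann G" by (rule mn) (use G a in \<open>auto simp: Ann_def\<close>)
  moreover have "t \<in> Ann G" using t by (simp add: Ann_def)
  ultimately have "t \<in> Ann (insert a G)" by simp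
  then show "act t a = \<zero>" by (simp add: Ann_def)
 qed
 obtain S where S: "finite S" "S \<subseteq> B" "tp.B.spanV S = B"
  using tp.B.fin_dim_span_iff qaD(5) by auto
 have Sc: "!!s. s \<in> S ==> s \<in> carrier A" using S(2) by auto
 have Gc: "!!g. g \<in> G ==> g \<in> carrier A" using G by auto
 \<comment> \<open>The generators sandwiched between spanning vectors of \<open>B\<close>; the span
   of \<open>H\<close> is the submodule generated by \<open>G\<close>.\<close>
 define H where "H = (%(s, g, s'). (s \<otimes> g) \<otimes> s') ` (S \<times> G \<times> S)"
 have H: "H \<subseteq> carrier A" "finite H"
  using G S(1) Sc Gc unfolding H_def by (auto simp: mult_closed)
 note W = subspD[OF spanV_subsp[OF H(1)]]
 have g: "(s \<otimes> g) \<otimes> s' \<in> spanV H" if "s \<in> S" "g \<in> G" "s' \<in> S" for s g s'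
  by (rule spanV_incl) (use that in \<open>force simp: H_def\<close>)
 have 1: "tp.B.subsp {b \<in> B. \<forall>g \<in> G. \<forall>s \<in> S. (b \<otimes> g) \<otimes> s \<in> spanV H}"
  by (rule tp.B.subspI) (use W(2,3,6) Gc Sc in
   \<open>simp_all add: subset_iff Bzero Badd Bsmult mult_l_distr mult_smult_l mult_closed zero_mult_l\<close>)
 have "tp.B.spanV S \<subseteq> {b \<in> B. \<forall>g \<in> G. \<forall>s \<in> S. (b \<otimes> g) \<otimes> s \<in> spanV H}"
  by (rule tp.B.spanV_min[OF 1]) (use S(2) g in auto)
 then have bs: "(b \<otimes> g) \<otimes> s \<in> spanV H" if "b \<in> B" "g \<in> G" "s \<in> S" for b g s using that S(3) by blast
 have 2: "tp.B.subsp {c \<in> B. \<forall>b \<in> B. \<forall>g \<in> G. (b \<otimes> g) \<otimes> c \<in> spanV H}"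
  by (rule tp.B.subspI) (use W(2,3,6) Gc Sc in
   \<open>simp_all add: subset_iff Bzero Badd Bsmult mult_r_distr mult_smult_r mult_closed zero_mult_r\<close>)
 have "tp.B.spanV S \<subseteq> {c \<in> B. \<forall>b \<in> B. \<forall>g \<in> G. (b \<otimes> g) \<otimes> c \<in> spanV H}"
  by (rule tp.B.spanV_min[OF 2]) (use S(2) bs in auto)
 then have bc: "(b \<otimes> g) \<otimes> c \<in> spanV H" if "b \<in> B" "g \<in> G" "c \<in> B" for b g c using that S(3) by blast
 have st: "(b \<otimes> w) \<otimes> c \<in> spanV H" if b: "b \<in> B" and c: "c \<in> B" and w: "w \<in> spanV H" for b c w
 proof -
  have "subsp {w \<in> carrier A. (b \<otimes> w) \<otimes> c \<in> spanV H}"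
   by (rule subspI) (use W(2,3,6) b c in
    \<open>simp_all add: mult_r_distr mult_l_distr mult_smult_r mult_smult_l mult_closed zero_mult_r zero_mult_l subset_iff\<close>)
  moreover have "H \<subseteq> {w \<in> carrier A. (b \<otimes> w) \<otimes> c \<in> spanV H}"
  proof
   fix h assume "h \<in> H"
   then obtain s g s' where h: "h = (s \<otimes> g) \<otimes> s'" "s \<in> S" "g \<in> G" "s' \<in> S" unfolding H_def by auto
   then have n: "b \<in> nucleus A" "c \<in> nucleus A" "s \<in> nucleus A" "s' \<in> nucleus A" and sB: "s \<in> B" "s' \<in> B"
    using b c S(2) B_nuc by auto
   have "(b \<otimes> h) \<otimes> c = ((b \<otimes> s) \<otimes> g) \<otimes> (s' \<otimes> c)"
    unfolding h(1) using sandwich_assoc[OF n Gc[OF h(3)]] by simp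
   then show "h \<in> {w \<in> carrier A. (b \<otimes> w) \<otimes> c \<in> spanV H}"
    using bc[OF Bmult[OF b sB(1)] h(3) Bmult[OF sB(2) c]] H(1) \<open>h \<in> H\<close> by auto
  qed
  ultimately have "spanV H \<subseteq> {w \<in> carrier A. (b \<otimes> w) \<otimes> c \<in> spanV H}" by (rule spanV_min)
  then show ?thesis using w by blast
 qed
 have "spanV H = carrier A"
 proof (rule minimal[OF spanV_subsp[OF H(1)] st])
  fix r assume r: "r \<in> carrier T" and z: "!!x. x \<in> spanV H ==> act r x = \<zero>"
  show "r = \<zero>\<^bsub>T\<^esub>"
  proof (rule AG[OF r])
   fix g assume g: "g \<in> G"
   have "(\<one> \<otimes> g) \<otimes> \<one> \<in> spanV H" by (rule bc[OF Bone g Bone])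
   then show "act r g = \<zero>" using z Gc[OF g] by (simp add: mult_l_one mult_r_one)
  qed
 qed
 then show ?thesis unfolding fin_dim_span_iff using H by (intro exI[of _ H]) simp
qed

sublocale fd_vspace F A by (intro fd_vspace.intro vspace_axioms fd_vspace_axioms.intro A_fd)

end

section \<open>Separability idempotents\<close>

context tensor_action begin

definition bilA :: "('a => 'a => 'a) => bool" where
 "bilA u \<longleftrightarrow> bilinear_map F (A\<lparr>carrier := B\<rparr>) C A u"

text \<open>A chosen additive extension of \<open>u\<close> from pure tensors to \<open>T\<close>,
  so that later constructions can name it as a function of \<open>u\<close>.\<close>

definition lft :: "('a => 'a => 'a) => ('a \<times> 'a => 'f) set => 'a" where
 "lft u = (SOME h. (\<forall>t \<in> carrier T. h t \<in> carrier A) \<and>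
   (\<forall>t \<in> carrier T. \<forall>t' \<in> carrier T. h (t \<oplus>\<^bsub>T\<^esub> t') = h t \<oplus> h t') \<and>
   (\<forall>b \<in> B. \<forall>c \<in> C0. h (tns b c) = u b c))"

lemma bilAI:
 assumes "!!b c. b \<in> B ==> c \<in> C0 ==> u b c \<in> carrier A"
  and "!!b b' c. b \<in> B ==> b' \<in> B ==> c \<in> C0 ==> u (b \<oplus> b') c = u b c \<oplus> u b' c"
  and "!!b c c'. b \<in> B ==> c \<in> C0 ==> c' \<in> C0 ==> u b (c \<oplus> c') = u b c \<oplus> u b c'"
  and "!!s b c. s \<in> carrier F ==> b \<in> B ==> c \<in> C0 ==> u (s \<odot> b) c = s \<odot> u b c"
  and "!!s b c. s \<in> carrier F ==> b \<in> B ==> c \<in> C0 ==> u b (s \<odot> c) = s \<odot> u b c"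
 shows "bilA u"
 unfolding bilA_def by (rule bilinear_mapI) (use assms in \<open>simp_all add: C_add C_smult\<close>)

lemma lft:
 assumes "bilA u"
 shows lft_closed: "t \<in> carrier T ==> lft u t \<in> carrier A"
  and lft_add: "t \<in> carrier T ==> t' \<in> carrier T ==> lft u (t \<oplus>\<^bsub>T\<^esub> t') = lft u t \<oplus> lft u t'"
  and lft_tns: "b \<in> B ==> c \<in> C0 ==> lft u (tns b c) = u b c"
proof -
 let ?Q = "%h. (\<forall>t \<in> carrier T. h t \<in> carrier A) \<and>
   (\<forall>t \<in> carrier T. \<forall>t' \<in> carrier T. h (t \<oplus>\<^bsub>T\<^esub> t') = h t \<oplus> h t') \<and>
   (\<forall>b \<in> B. \<forall>c \<in> C0. h (tns b c) = u b c)"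
 have "\<exists>h. ?Q h"
  by (rule tp.tensor_lift[OF vspace_axioms assms[unfolded bilA_def]]) (intro exI conjI ballI; simp)
 then have "?Q (lft u)" unfolding lft_def by (rule someI_ex)
 then show "t \<in> carrier T ==> lft u t \<in> carrier A"
  "t \<in> carrier T ==> t' \<in> carrier T ==> lft u (t \<oplus>\<^bsub>T\<^esub> t') = lft u t \<oplus> lft u t'"
  "b \<in> B ==> c \<in> C0 ==> lft u (tns b c) = u b c" by simp_all
qed

end

context qassoc begin

abbreviation AC where "AC \<equiv> carrier A"
abbreviation TC where "TC \<equiv> carrier T"
abbreviation AB where "AB \<equiv> A\<lparr>carrier := B\<rparr>"
abbreviation tmult (infixl "\<star>" 70) where "t \<star> u \<equiv> t \<otimes>\<^bsub>T\<^esub> u"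
abbreviation tadd (infixl "\<boxplus>" 65) where "t \<boxplus> u \<equiv> t \<oplus>\<^bsub>T\<^esub> u"
abbreviation tzero ("\<zero>\<^sub>T") where "\<zero>\<^sub>T \<equiv> \<zero>\<^bsub>T\<^esub>"
abbreviation tone ("\<one>\<^sub>T") where "\<one>\<^sub>T \<equiv> \<one>\<^bsub>T\<^esub>"

text \<open>\<open>act z \<one>\<close> is the image of \<open>z\<close> under multiplication, and
  \<open>tns \<one> k\<close> multiplies the second factors by \<open>k\<close> from the right. So
  this is the usual defining condition of a separability idempotent, for \<open>z\<close> in the
  image of \<open>K \<otimes> K\<close>.\<close>

definition sepid :: "'a set => ('a \<times> 'a => 'f) set => bool" where
 "sepid K z \<longleftrightarrow> K \<subseteq> B \<and> z \<in> Sp K K \<and> (\<forall>k \<in> K. tns k \<one> \<star> z = tns \<one> k \<star> z) \<and> act z \<one> = \<one>"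

lemma nucB: "b \<in> B ==> b \<in> nucleus A" using B_nuc by blast

lemma assB:
 "x \<in> B ==> y \<in> AC ==> z \<in> AC ==> (x \<otimes> y) \<otimes> z = x \<otimes> (y \<otimes> z)"
 "x \<in> B ==> y \<in> AC ==> z \<in> AC ==> (y \<otimes> x) \<otimes> z = y \<otimes> (x \<otimes> z)"
 "x \<in> B ==> y \<in> AC ==> z \<in> AC ==> (y \<otimes> z) \<otimes> x = y \<otimes> (z \<otimes> x)"
 by (rule nucleusD[OF nucB]; assumption)+

lemma SpB: "t \<in> Sp U W ==> U \<subseteq> B ==> W \<subseteq> B ==> t \<in> TC"
 using Sp_carrier[of t U W] by simp

lemma oneA: "\<one> \<in> AC" using Bc[OF Bone] .

text \<open>As in Maschke's theorem, a linear projection onto \<open>N\<close> is averaged, with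
  \<open>z\<close> in place of the mean over a group. One average over the left action and one over
  the right action give a map that is linear on both sides.\<close>

lemma maschke:
 assumes "sepid K z" "subsp N" "!!k n. k \<in> K ==> n \<in> N ==> k \<otimes> n \<in> N" "!!k n. k \<in> K ==> n \<in> N ==> n \<otimes> k \<in> N"
 obtains p where "lin_map F A A p" "!!a. a \<in> AC ==> p a \<in> N" "!!n. n \<in> N ==> p n = n"
  "!!k a. k \<in> K ==> a \<in> AC ==> p (k \<otimes> a) = k \<otimes> p a"
  "!!k a. k \<in> K ==> a \<in> AC ==> p (a \<otimes> k) = p a \<otimes> k"
proof -
 have K: "K \<subseteq> B" and z: "z \<in> Sp K K" and zk: "!!k. k \<in> K ==> tns k \<one> \<star> z = tns \<one> k \<star> z"
  and z1: "act z \<one> = \<one>" using assms(1) unfolding sepid_def by blast+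
 have KB: "k \<in> B" if "k \<in> K" for k using that K by blast
 have zT: "z \<in> TC" by (rule SpB[OF z K K])
 note N = subspD[OF assms(2)]
 obtain p0 where "lin_map F A A p0" and p0N: "!!a. a \<in> AC ==> p0 a \<in> N" and p0i: "!!n. n \<in> N ==> p0 n = n"
  by (rule projection_ex[OF assms(2)]) blast
 then have p0c: "!!a. a \<in> AC ==> p0 a \<in> AC"
  and p0a: "!!x y. x \<in> AC ==> y \<in> AC ==> p0 (x \<oplus> y) = p0 x \<oplus> p0 y"
  and p0s: "!!c x. c \<in> carrier F ==> x \<in> AC ==> p0 (c \<odot> x) = c \<odot> p0 x"
  unfolding lin_map_def by blast+
 \<comment> \<open>If \<open>z = \<Sum> x_i \<otimes> y_i\<close>, then
   \<open>p1 a = \<Sum> x_i p0 (y_i a)\<close>. Moving \<open>k\<close> across \<open>z\<close>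
   makes \<open>p1\<close> left linear, and on \<open>N\<close> it is multiplication by
   \<open>\<Sum> x_i y_i = 1\<close>.\<close>
 define u where "u a b c = b \<otimes> p0 (c \<otimes> a)" for a b c
 have u: "bilA (u a)" if a: "a \<in> AC" for a
  by (rule bilAI) (simp_all add: u_def a p0c p0a p0s mult_closed mult_l_distr mult_r_distr mult_smult_l mult_smult_r)
 have ut: "lft (u a) (tns b c) = b \<otimes> p0 (c \<otimes> a)" if "a \<in> AC" "b \<in> B" "c \<in> B" for a b c
  by (subst lft_tns[OF u]) (simp_all add: that u_def)
 define p1 where "p1 a = lft (u a) z" for a
 have p1c: "p1 a \<in> AC" if "a \<in> AC" for a unfolding p1_def by (rule lft_closed[OF u[OF that] zT])
 have p1a: "p1 (a \<oplus> a') = p1 a \<oplus> p1 a'" if a: "a \<in> AC" "a' \<in> AC" for a a'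
 proof -
  have aa: "a \<oplus> a' \<in> AC" using a by simp
  have "lft (u (a \<oplus> a')) t = lft (u a) t \<oplus> lft (u a') t" if "t \<in> TC" for t
   using that
  proof (induction t rule: T_induct)
   case (tns b c)
   then show ?case using a
    by (simp add: ut[OF aa] ut[OF a(1)] ut[OF a(2)]  p0a p0c mult_closed mult_r_distr)
  next
   case (add t t')
   then show ?case using lft_closed[OF u[OF a(1)]] lft_closed[OF u[OF a(2)]]
    by (simp add: lft_add[OF u[OF aa]] lft_add[OF u[OF a(1)]] lft_add[OF u[OF a(2)]] a_ac)
  qed
  then show ?thesis unfolding p1_def using zT by simp
 qed
 have p1s: "p1 (s \<odot> a) = s \<odot> p1 a" if s: "s \<in> carrier F" and a: "a \<in> AC" for s a
 proof -
  have aa: "s \<odot> a \<in> AC" using s a by simp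
  have "lft (u (s \<odot> a)) t = s \<odot> lft (u a) t" if "t \<in> TC" for t
   using that
  proof (induction t rule: T_induct)
   case (tns b c)
   then show ?case using a s
    by (simp add: ut[OF aa] ut[OF a]  p0s p0c mult_closed mult_smult_r)
  next
   case (add t t')
   then show ?case using lft_closed[OF u[OF a]] s
    by (simp add: lft_add[OF u[OF aa]] lft_add[OF u[OF a]] smult_r_distr)
  qed
  then show ?thesis unfolding p1_def using zT by simp
 qed
 have p1l: "p1 (k \<otimes> a) = k \<otimes> p1 a" if k: "k \<in> K" and a: "a \<in> AC" for k a
 proof -
  have kB: "k \<in> B" using KB k by simp
  have aa: "k \<otimes> a \<in> AC" using kB a by (simp add: mult_closed)
  have l1: "tns k \<one> \<in> TC" and l2: "tns \<one> k \<in> TC" using kB Bone by simp_all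
  have e1: "lft (u (k \<otimes> a)) t = lft (u a) (tns \<one> k \<star> t)" if "t \<in> TC" for t
   using that
  proof (induction t rule: T_induct)
   case (tns b c)
   then show ?case using a kB Bone
    by (simp add: ut[OF aa] ut[OF a]  tns_m Bmult mult_l_one assB)
  next
   case (add t t')
   then show ?case using l2
    by (simp add: lft_add[OF u[OF aa]] lft_add[OF u[OF a]] tp.T.r_distr)
  qed
  have e2: "lft (u a) (tns k \<one> \<star> t) = k \<otimes> lft (u a) t" if "t \<in> TC" for t
   using that
  proof (induction t rule: T_induct)
   case (tns b c)
   then show ?case using a kB Bone
    by (simp add: ut[OF a]  tns_m Bmult mult_r_one assB p0c mult_closed)
  next
   case (add t t')
   then show ?case using l1 lft_closed[OF u[OF a]] kB
    by (simp add: lft_add[OF u[OF a]] tp.T.r_distr mult_r_distr)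
  qed
  show ?thesis unfolding p1_def e1[OF zT] zk[OF k, symmetric] e2[OF zT] ..
 qed
 have p1N: "p1 a \<in> N" if a: "a \<in> AC" for a
 proof -
  have "lft (u a) t \<in> N" if "t \<in> Sp K K" for t
   using that
  proof (induction rule: Sp.induct)
   case (tns x y)
   then show ?case using a KB p0N assms(3) by (simp add: ut[OF a]  mult_closed)
  next
   case (add t t')
   then show ?case using lft_add[OF u[OF a] SpB[OF add(1) K K] SpB[OF add(2) K K]] N(3) by simp
  qed
  then show ?thesis unfolding p1_def using z by simp
 qed
 have p1i: "p1 n = n" if n: "n \<in> N" for n
 proof -
  have nc: "n \<in> AC" using N(7) n .
  have "lft (u n) t = act t \<one> \<otimes> n" if "t \<in> Sp K K" for t
   using that
  proof (induction rule: Sp.induct)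
   case (tns x y)
   then have xy: "x \<in> B" "y \<in> B" using KB by auto
   show ?case using xy nc p0i[OF assms(3)[OF tns(2) n]] oneA
    by (simp add: ut[OF nc]  act_tns mult_r_one assB)
  next
   case (add t t')
   note c = SpB[OF add(1) K K] SpB[OF add(2) K K]
   show ?case using add c nc oneA lft_add[OF u[OF nc] c] by (simp add: act_add_l mult_l_distr)
  qed
  from this[OF z] show ?thesis unfolding p1_def z1 using nc by (simp add: mult_l_one)
 qed
 \<comment> \<open>The average on the right, \<open>p a = \<Sum> p1 (a x_i) y_i\<close>; it inherits
   left linearity from \<open>p1\<close>.\<close>
 define v where "v a b c = p1 (a \<otimes> b) \<otimes> c" for a b c
 have v: "bilA (v a)" if a: "a \<in> AC" for a
  by (rule bilAI) (simp_all add: v_def a p1c p1a p1s mult_closed mult_l_distr mult_r_distr mult_smult_l mult_smult_r)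
 have vt: "lft (v a) (tns b c) = p1 (a \<otimes> b) \<otimes> c" if "a \<in> AC" "b \<in> B" "c \<in> B" for a b c
  by (subst lft_tns[OF v]) (simp_all add: that v_def)
 define p where "p a = lft (v a) z" for a
 show ?thesis
 proof (rule that[of p])
  have pc: "p a \<in> AC" if "a \<in> AC" for a unfolding p_def by (rule lft_closed[OF v[OF that] zT])
  have pa: "p (a \<oplus> a') = p a \<oplus> p a'" if a: "a \<in> AC" "a' \<in> AC" for a a'
  proof -
   have aa: "a \<oplus> a' \<in> AC" using a by simp
   have "lft (v (a \<oplus> a')) t = lft (v a) t \<oplus> lft (v a') t" if "t \<in> TC" for t
    using that
   proof (induction t rule: T_induct)
    case (tns b c)
    then show ?case using a
     by (simp add: vt[OF aa] vt[OF a(1)] vt[OF a(2)]  p1a p1c mult_closed mult_l_distr)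
   next
    case (add t t')
    then show ?case using lft_closed[OF v[OF a(1)]] lft_closed[OF v[OF a(2)]]
     by (simp add: lft_add[OF v[OF aa]] lft_add[OF v[OF a(1)]] lft_add[OF v[OF a(2)]] a_ac)
   qed
   then show ?thesis unfolding p_def using zT by simp
  qed
  have ps: "p (s \<odot> a) = s \<odot> p a" if s: "s \<in> carrier F" and a: "a \<in> AC" for s a
  proof -
   have aa: "s \<odot> a \<in> AC" using s a by simp
   have "lft (v (s \<odot> a)) t = s \<odot> lft (v a) t" if "t \<in> TC" for t
    using that
   proof (induction t rule: T_induct)
    case (tns b c)
    then show ?case using a s
     by (simp add: vt[OF aa] vt[OF a]  p1s p1c mult_closed mult_smult_l)
   next
    case (add t t')
    then show ?case using lft_closed[OF v[OF a]] s
     by (simp add: lft_add[OF v[OF aa]] lft_add[OF v[OF a]] smult_r_distr)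
   qed
   then show ?thesis unfolding p_def using zT by simp
  qed
  show "lin_map F A A p" unfolding lin_map_def using pc pa ps by simp
  show "p a \<in> N" if a: "a \<in> AC" for a
  proof -
   have "lft (v a) t \<in> N" if "t \<in> Sp K K" for t
    using that
   proof (induction rule: Sp.induct)
    case (tns x y)
    then show ?case using a KB p1N assms(4) by (simp add: vt[OF a]  mult_closed)
   next
    case (add t t')
    then show ?case using lft_add[OF v[OF a] SpB[OF add(1) K K] SpB[OF add(2) K K]] N(3) by simp
   qed
   then show ?thesis unfolding p_def using z by simp
  qed
  show "p n = n" if n: "n \<in> N" for n
  proof -
   have nc: "n \<in> AC" using N(7) n .
   have "lft (v n) t = n \<otimes> act t \<one>" if "t \<in> Sp K K" for t
    using that
   proof (induction rule: Sp.induct)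
    case (tns x y)
    then have xy: "x \<in> B" "y \<in> B" using KB by auto
    show ?case using xy nc p1i[OF assms(4)[OF tns(1) n]] oneA
     by (simp add: vt[OF nc]  act_tns mult_r_one assB)
   next
    case (add t t')
    note c = SpB[OF add(1) K K] SpB[OF add(2) K K]
    show ?case using add c nc oneA lft_add[OF v[OF nc] c] by (simp add: act_add_l mult_r_distr)
   qed
   from this[OF z] show ?thesis unfolding p_def z1 using nc by (simp add: mult_r_one)
  qed
  show "p (k \<otimes> a) = k \<otimes> p a" if k: "k \<in> K" and a: "a \<in> AC" for k a
  proof -
   have kB: "k \<in> B" using KB k by simp
   have aa: "k \<otimes> a \<in> AC" using kB a by (simp add: mult_closed)
   have "lft (v (k \<otimes> a)) t = k \<otimes> lft (v a) t" if "t \<in> TC" for t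
    using that
   proof (induction t rule: T_induct)
    case (tns b c)
    then show ?case using a kB k
     by (simp add: vt[OF aa] vt[OF a]  assB p1l p1c mult_closed)
   next
    case (add t t')
    then show ?case using lft_closed[OF v[OF a]] kB
     by (simp add: lft_add[OF v[OF aa]] lft_add[OF v[OF a]] mult_r_distr)
   qed
   then show ?thesis unfolding p_def using zT by simp
  qed
  show "p (a \<otimes> k) = p a \<otimes> k" if k: "k \<in> K" and a: "a \<in> AC" for k a
  proof -
   have kB: "k \<in> B" using KB k by simp
   have aa: "a \<otimes> k \<in> AC" using kB a by (simp add: mult_closed)
   have l1: "tns k \<one> \<in> TC" and l2: "tns \<one> k \<in> TC" using kB Bone by simp_all
   have e1: "lft (v (a \<otimes> k)) t = lft (v a) (tns k \<one> \<star> t)" if "t \<in> TC" for t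
    using that
   proof (induction t rule: T_induct)
    case (tns b c)
    then show ?case using a kB Bone
     by (simp add: vt[OF aa] vt[OF a]  tns_m Bmult mult_r_one assB)
   next
    case (add t t')
    then show ?case using l1
     by (simp add: lft_add[OF v[OF aa]] lft_add[OF v[OF a]] tp.T.r_distr)
   qed
   have e2: "lft (v a) (tns \<one> k \<star> t) = lft (v a) t \<otimes> k" if "t \<in> TC" for t
    using that
   proof (induction t rule: T_induct)
    case (tns b c)
    then show ?case using a kB Bone
     by (simp add: vt[OF a]  tns_m Bmult mult_l_one assB p1c mult_closed)
   next
    case (add t t')
    then show ?case using l2 lft_closed[OF v[OF a]] kB
     by (simp add: lft_add[OF v[OF a]] tp.T.r_distr mult_l_distr)
   qed
   show ?thesis unfolding p_def e1[OF zT] zk[OF k] e2[OF zT] ..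
  qed
 qed
qed

lemma Sp_act_comm:
 assumes "K \<subseteq> B" "r \<in> Sp K K" "!!a. a \<in> AC ==> p a \<in> AC"
  "!!x y. x \<in> AC ==> y \<in> AC ==> p (x \<oplus> y) = p x \<oplus> p y"
  "!!k a. k \<in> K ==> a \<in> AC ==> p (k \<otimes> a) = k \<otimes> p a"
  "!!k a. k \<in> K ==> a \<in> AC ==> p (a \<otimes> k) = p a \<otimes> k" "a \<in> AC"
 shows "p (act r a) = act r (p a)"
 using assms(2)
proof (induction rule: Sp.induct)
 case (tns x y)
 then have xy: "x \<in> B" "y \<in> B" using assms(1) by auto
 then show ?case using assms(3,5,6,7) tns by (simp add: act_tns mult_closed)
next
 case (add t t')
 then show ?case using assms(3,4,7) SpB[OF add(1) assms(1,1)] SpB[OF add(2) assms(1,1)] by (simp add: act_add_l)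
qed

lemma comm_act_l:
 assumes "K \<subseteq> B" "r \<in> Sp K K" "k \<in> B" "!!x. x \<in> K ==> k \<otimes> x = x \<otimes> k" "a \<in> AC"
 shows "act r (k \<otimes> a) = k \<otimes> act r a"
 using assms(2)
proof (induction rule: Sp.induct)
 case (tns x y)
 then have xy: "x \<in> B" "y \<in> B" using assms(1) by auto
 have "x \<otimes> (k \<otimes> a) = k \<otimes> (x \<otimes> a)" using assB(1)[of x k a] assB(1)[of k x a] assms(3,5) assms(4)[OF tns(1)] xy by simp
 then show ?case using xy assms(3,5) by (simp add: act_tns assB mult_closed)
next
 case (add t t')
 then show ?case using SpB[OF add(1) assms(1,1)] SpB[OF add(2) assms(1,1)] assms(3,5)
  by (simp add: act_add_l mult_closed mult_r_distr)
qed

lemma comm_act_r: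
 assumes "K \<subseteq> B" "r \<in> Sp K K" "k \<in> B" "!!x. x \<in> K ==> k \<otimes> x = x \<otimes> k" "a \<in> AC"
 shows "act r (a \<otimes> k) = act r a \<otimes> k"
 using assms(2)
proof (induction rule: Sp.induct)
 case (tns x y)
 then have xy: "x \<in> B" "y \<in> B" using assms(1) by auto
 have "(x \<otimes> (a \<otimes> k)) \<otimes> y = (x \<otimes> a) \<otimes> (k \<otimes> y)" using xy assms(3,5) by (simp add: assB mult_closed)
 also have "\<dots> = ((x \<otimes> a) \<otimes> y) \<otimes> k" using assms(4)[OF tns(2)] xy assms(3,5) by (simp add: assB mult_closed)
 finally show ?case using xy assms(3,5) by (simp add: act_tns mult_closed)
next
 case (add t t')
 then show ?case using SpB[OF add(1) assms(1,1)] SpB[OF add(2) assms(1,1)] assms(3,5)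
  by (simp add: act_add_l mult_closed mult_l_distr)
qed

lemma image_act_subsp: assumes "r \<in> TC" shows "subsp (act r ` AC)"
proof (rule subspI)
 show "act r ` AC \<subseteq> AC" using assms by auto
 show "\<zero> \<in> act r ` AC" using act_zero_r[OF assms] by (intro image_eqI[of _ _ "\<zero>"]) simp_all
next
 fix x y assume "x \<in> act r ` AC" "y \<in> act r ` AC"
 then obtain a b where ab: "x = act r a" "y = act r b" "a \<in> AC" "b \<in> AC" by blast
 then have "x \<oplus> y = act r (a \<oplus> b)" using act_add_r[OF assms ab(3,4)] by simp
 then show "x \<oplus> y \<in> act r ` AC" using ab by (intro image_eqI[of _ _ "a \<oplus> b"]) simp_all
next
 fix c x assume c: "c \<in> carrier F" and "x \<in> act r ` AC"
 then obtain a where ab: "x = act r a" "a \<in> AC" by blast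
 then have "c \<odot> x = act r (c \<odot> a)" using act_smult[OF assms ab(2) c] by simp
 then show "c \<odot> x \<in> act r ` AC" using ab c by (intro image_eqI[of _ _ "c \<odot> a"]) simp_all
qed

text \<open>The image \<open>r A\<close> is a subbimodule because \<open>K\<close> is commutative,
  so it is the image of a bimodule projection \<open>p\<close>. Such a \<open>p\<close> commutes
  with \<open>r\<close>, hence \<open>r a = p (r a) = r (p a)\<close>, and this lies in
  \<open>r (r A) = 0\<close>.\<close>

lemma sepid_reduced:
 assumes "sepid K z" "!!x y. x \<in> K ==> y \<in> K ==> x \<otimes> y = y \<otimes> x" "r \<in> Sp K K" "r \<star> r = \<zero>\<^sub>T"
 shows "r = \<zero>\<^sub>T"
proof -
 have K: "K \<subseteq> B" using assms(1) by (simp add: sepid_def)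
 have rT: "r \<in> TC" by (rule SpB[OF assms(3) K K])
 let ?N = "act r ` AC"
 have kN: "k \<otimes> n \<in> ?N" "n \<otimes> k \<in> ?N" if kn: "k \<in> K" "n \<in> ?N" for k n
 proof -
  obtain a where a: "n = act r a" "a \<in> AC" using kn(2) by blast
  have k: "k \<in> B" using kn(1) K by blast
  show "k \<otimes> n \<in> ?N" using comm_act_l[OF K assms(3) k _ a(2)] assms(2)[OF kn(1)] a k
   by (intro image_eqI[of _ _ "k \<otimes> a"]) (simp_all add: mult_closed)
  show "n \<otimes> k \<in> ?N" using comm_act_r[OF K assms(3) k _ a(2)] assms(2)[OF kn(1)] a k
   by (intro image_eqI[of _ _ "a \<otimes> k"]) (simp_all add: mult_closed)
 qed
 obtain p where p: "lin_map F A A p" "!!a. a \<in> AC ==> p a \<in> ?N" "!!n. n \<in> ?N ==> p n = n"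
  "!!k a. k \<in> K ==> a \<in> AC ==> p (k \<otimes> a) = k \<otimes> p a"
  "!!k a. k \<in> K ==> a \<in> AC ==> p (a \<otimes> k) = p a \<otimes> k"
  using maschke[OF assms(1) image_act_subsp[OF rT] kN] by blast
 have pc: "!!a. a \<in> AC ==> p a \<in> AC"
  and pa: "!!x y. x \<in> AC ==> y \<in> AC ==> p (x \<oplus> y) = p x \<oplus> p y"
  using p(1) unfolding lin_map_def by blast+
 show ?thesis
 proof (rule faithful[OF rT])
  fix a assume a: "a \<in> AC"
  have "act r a = p (act r a)" by (rule p(3)[symmetric]) (use a in blast)
  also have "\<dots> = act r (p a)" by (rule Sp_act_comm[OF K assms(3) pc pa p(4,5) a])
  finally have e: "act r a = act r (p a)" .
  obtain b where b: "p a = act r b" "b \<in> AC" using p(2)[OF a] by blast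
  show "act r a = \<zero>" unfolding e b(1) using act_mult[OF rT rT b(2)] assms(4) b(2) by (simp add: act_zero_l)
 qed
qed

text \<open>A functional \<open>m\<close> with \<open>m 1 = 1\<close>, applied to the second factors
  of both sides, gives \<open>x = m(x) 1\<close>.\<close>

lemma fixed_scalar:
 assumes "x \<in> B" "tns x \<one> = tns \<one> x"
 shows "\<exists>c \<in> carrier F. x = c \<odot> \<one>"
proof -
 have ab: "\<one>\<^bsub>AB\<^esub> \<notin> {\<zero>\<^bsub>AB\<^esub>}" using BA.one_nz by simp
 obtain m where "functional F AB m" and m1: "m \<one>\<^bsub>AB\<^esub> = \<one>\<^bsub>F\<^esub>"
  using BA.functional_ex[OF tp.B.subsp_zero _ ab] tp.B.one_closed by metis
 then have m: "!!b. b \<in> B ==> m b \<in> carrier F" "!!b c. b \<in> B ==> c \<in> B ==> m (b \<oplus> c) = m b \<oplus>\<^bsub>F\<^esub> m c"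
  "!!s b. s \<in> carrier F ==> b \<in> B ==> m (s \<odot> b) = s \<otimes>\<^bsub>F\<^esub> m b" and m1: "m \<one> = \<one>\<^bsub>F\<^esub>"
  unfolding functional_def by simp_all
 have u: "bilA (%b c. m c \<odot> b)"
 proof (rule bilAI)
  fix s b c assume "s \<in> carrier F" "b \<in> B" "c \<in> carrier (opposite_algebra AB)"
  then show "m c \<odot> (s \<odot> b) = s \<odot> (m c \<odot> b)" "m (s \<odot> c) \<odot> b = s \<odot> (m c \<odot> b)"
   using smult_assoc1[of "m c" s b] smult_assoc1[of s "m c" b] R.m_comm[of s "m c"] m by simp_all
 qed (simp_all add: m smult_l_distr smult_r_distr)
 have "lft (%b c. m c \<odot> b) (tns x \<one>) = lft (%b c. m c \<odot> b) (tns \<one> x)" using assms(2) by simp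
 then have "m \<one> \<odot> x = m x \<odot> \<one>" using lft_tns[OF u] assms(1) Bone by simp
 then have "x = m x \<odot> \<one>" using m1 assms(1) by simp
 then show ?thesis using m(1)[OF assms(1)] by blast
qed

lemma tns_eq_lift:
 assumes "!!t. t \<in> TC ==> g t \<in> TC" "!!t u. t \<in> TC ==> u \<in> TC ==> g (t \<boxplus> u) = g t \<boxplus> g u"
  "!!b c. b \<in> B ==> c \<in> B ==> g (tns b c) = tns b c" "t \<in> TC"
 shows "g t = t"
 using assms(4)
proof (induction t rule: T_induct)
 case (tns b c)
 then show ?case using assms(3) by simp
next
 case (add t u)
 then show ?case using assms(2) by simp
qed

text \<open>Slicing: \<open>t = \<Sum> h_i(t) \<otimes> b_i\<close>, where \<open>h_i\<close>
  contracts the second factor with a functional. Contraction commutes with multiplication in the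
  first factor, so the slices of \<open>t\<close> lie in the centralizer \<open>C\<close> of
  \<open>U\<close>, and \<open>t\<close> lies in \<open>C \<otimes> B\<close>. In the same way
  \<open>t\<close> lies in \<open>B \<otimes> C\<close>; a projection of \<open>B\<close> onto
  \<open>C\<close> combines the two.\<close>

lemma cent_Sp:
 assumes "U \<subseteq> B" "t \<in> TC" "!!u. u \<in> U ==> tns u \<one> \<star> t = t \<star> tns u \<one>"
  "!!u. u \<in> U ==> tns \<one> u \<star> t = t \<star> tns \<one> u"
 shows "t \<in> Sp (tp.B.cent U) (tp.B.cent U)"
proof -
 let ?C = "tp.B.cent U"
 have cen: "x \<in> ?C \<longleftrightarrow> x \<in> B \<and> (\<forall>u \<in> U. x \<otimes> u = u \<otimes> x)" for x by (simp add: tp.B.cent_def)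
 have CB: "?C \<subseteq> B" using cen by blast
 have Csub: "tp.B.subsp ?C" by (rule tp.B.subalgD(1)[OF tp.B.cent_subalg]) (simp add: assms(1))
 have C0: "\<zero> \<in> ?C" using tp.B.subspD(2)[OF Csub] by simp
 have UB: "u \<in> B" if "u \<in> U" for u using that assms(1) by blast
 obtain n b l where bB': "!!i. i < n ==> b i \<in> carrier AB"
  and lf: "!!i. i < n ==> functional F AB (l i)"
  and ex': "!!x. x \<in> carrier AB ==> x = nsum AB (%i. l i x \<odot>\<^bsub>AB\<^esub> b i) (n :: nat)"
  by (rule BA.dual_system[OF tp.B.subsp_carrier]) blast
 have bB: "b i \<in> B" if "i < n" for i using bB'[OF that] by simp
 have ex: "x = nsum A (%i. l i x \<odot> b i) n" if "x \<in> B" for x using ex'[of x] that by simp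
 have l: "l i x \<in> carrier F" "l i (x \<oplus> y) = l i x \<oplus>\<^bsub>F\<^esub> l i y" "s \<in> carrier F ==> l i (s \<odot> x) = s \<otimes>\<^bsub>F\<^esub> l i x"
  if "i < n" "x \<in> B" "y \<in> B" for i x y s
  using lf[OF that(1)] that(2,3) unfolding functional_def by simp_all
 have lc: "l i x \<in> carrier F" if "i < n" "x \<in> B" for i x using l(1)[OF that that(2)] .
 have u1: "bilA (%x y. l i y \<odot> x)" if i: "i < n" for i
 proof (rule bilAI)
  fix s b c assume "s \<in> carrier F" "b \<in> B" "c \<in> carrier (opposite_algebra AB)"
  then show "l i c \<odot> (s \<odot> b) = s \<odot> (l i c \<odot> b)" "l i (s \<odot> c) \<odot> b = s \<odot> (l i c \<odot> b)"
   using smult_assoc1[of "l i c" s b] smult_assoc1[of s "l i c" b] R.m_comm[of s "l i c"] l[OF i] lc[OF i] by simp_all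
 qed (simp_all add: l[OF i] lc[OF i] smult_l_distr smult_r_distr)
 have u2: "bilA (%x y. l i x \<odot> y)" if i: "i < n" for i
 proof (rule bilAI)
  fix s b c assume "s \<in> carrier F" "b \<in> B" "c \<in> carrier (opposite_algebra AB)"
  then show "l i (s \<odot> b) \<odot> c = s \<odot> (l i b \<odot> c)" "l i b \<odot> (s \<odot> c) = s \<odot> (l i b \<odot> c)"
   using smult_assoc1[of "l i b" s c] smult_assoc1[of s "l i b" c] R.m_comm[of s "l i b"] l[OF i] lc[OF i] by simp_all
 qed (simp_all add: l[OF i] lc[OF i] smult_l_distr smult_r_distr)
 \<comment> \<open>\<open>h1 i\<close> contracts the second factor with \<open>l i\<close>, and
   \<open>h2 i\<close> the first one.\<close>
 define h1 where "h1 i = lft (%x y. l i y \<odot> x)" for i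
 define h2 where "h2 i = lft (%x y. l i x \<odot> y)" for i
 note h1 = lft_closed[OF u1, folded h1_def] lft_add[OF u1, folded h1_def] lft_tns[OF u1, folded h1_def]
 note h2 = lft_closed[OF u2, folded h2_def] lft_add[OF u2, folded h2_def] lft_tns[OF u2, folded h2_def]
 have h1B: "h1 i t \<in> B" if i: "i < n" and t: "t \<in> TC" for i t
  using t by (induction t rule: T_induct) (simp_all add: h1[OF i] lc[OF i] Bsmult Badd)
 have h2B: "h2 i t \<in> B" if i: "i < n" and t: "t \<in> TC" for i t
  using t by (induction t rule: T_induct) (simp_all add: h2[OF i] lc[OF i] Bsmult Badd)
 have "nsum T (%i. tns (h1 i t) (b i)) n = t" if t: "t \<in> TC" for t
 proof (rule tns_eq_lift[where g = "%t. nsum T (%i. tns (h1 i t) (b i)) n", OF _ _ _ t])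
  show "nsum T (%i. tns (h1 i t) (b i)) n \<in> TC" if "t \<in> TC" for t
   by (rule tp.T.nsum_closed) (simp add: h1B bB that)
  show "nsum T (%i. tns (h1 i (t \<boxplus> u)) (b i)) n = nsum T (%i. tns (h1 i t) (b i)) n \<boxplus> nsum T (%i. tns (h1 i u) (b i)) n"
   if "t \<in> TC" "u \<in> TC" for t u
  proof -
   have "nsum T (%i. tns (h1 i (t \<boxplus> u)) (b i)) n = nsum T (%i. tns (h1 i t) (b i) \<boxplus> tns (h1 i u) (b i)) n"
    by (rule nsum_cong) (simp add: h1(2) that h1B bB tns_al)
   then show ?thesis using tp.T.nsum_add[of n "%i. tns (h1 i t) (b i)" "%i. tns (h1 i u) (b i)"] h1B bB that by simp
  qed
  fix x y assume xy: "x \<in> B" "y \<in> B"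
  have "nsum T (%i. tns (h1 i (tns x y)) (b i)) n = nsum T (%i. tns x (l i y \<odot> b i)) n"
   by (rule nsum_cong) (simp add: h1(3) xy lc bB tns_s)
  also have "\<dots> = tns x y" using tns_nsum_r[of x n "%i. l i y \<odot> b i"] ex[OF xy(2)] xy lc bB by (simp add: Bsmult)
  finally show "nsum T (%i. tns (h1 i (tns x y)) (b i)) n = tns x y" .
 qed
 then have e1: "nsum T (%i. tns (h1 i t) (b i)) n = t" using assms(2) by simp
 have "nsum T (%i. tns (b i) (h2 i t)) n = t" if t: "t \<in> TC" for t
 proof (rule tns_eq_lift[where g = "%t. nsum T (%i. tns (b i) (h2 i t)) n", OF _ _ _ t])
  show "nsum T (%i. tns (b i) (h2 i t)) n \<in> TC" if "t \<in> TC" for t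
   by (rule tp.T.nsum_closed) (simp add: h2B bB that)
  show "nsum T (%i. tns (b i) (h2 i (t \<boxplus> u))) n = nsum T (%i. tns (b i) (h2 i t)) n \<boxplus> nsum T (%i. tns (b i) (h2 i u)) n"
   if "t \<in> TC" "u \<in> TC" for t u
  proof -
   have "nsum T (%i. tns (b i) (h2 i (t \<boxplus> u))) n = nsum T (%i. tns (b i) (h2 i t) \<boxplus> tns (b i) (h2 i u)) n"
    by (rule nsum_cong) (simp add: h2(2) that h2B bB tns_ar)
   then show ?thesis using tp.T.nsum_add[of n "%i. tns (b i) (h2 i t)" "%i. tns (b i) (h2 i u)"] h2B bB that by simp
  qed
  fix x y assume xy: "x \<in> B" "y \<in> B"
  have "nsum T (%i. tns (b i) (h2 i (tns x y))) n = nsum T (%i. tns (l i x \<odot> b i) y) n"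
   by (rule nsum_cong) (simp add: h2(3) xy lc bB tns_s)
  also have "\<dots> = tns x y" using tns_nsum_l[of y n "%i. l i x \<odot> b i"] ex[OF xy(1)] xy lc bB by (simp add: Bsmult)
  finally show "nsum T (%i. tns (b i) (h2 i (tns x y))) n = tns x y" .
 qed
 then have e2: "nsum T (%i. tns (b i) (h2 i t)) n = t" using assms(2) by simp
 have h1C: "h1 i t \<in> ?C" if i: "i < n" for i
  unfolding cen
 proof (intro conjI ballI h1B[OF i assms(2)])
  fix u assume u: "u \<in> U"
  have uT: "tns u \<one> \<in> TC" using UB[OF u] Bone by simp
  have "h1 i (tns u \<one> \<star> s) = u \<otimes> h1 i s" if "s \<in> TC" for s
   using that
  proof (induction s rule: T_induct)
   case (tns x y)
   then show ?case using UB[OF u] Bone lc[OF i] by (simp add: tns_m h1(3)[OF i] Bmult mult_r_one mult_smult_r)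
  next
   case (add s s')
   then show ?case using uT h1(1)[OF i] UB[OF u] by (simp add: tp.T.r_distr h1(2)[OF i] mult_r_distr)
  qed
  moreover have "h1 i (s \<star> tns u \<one>) = h1 i s \<otimes> u" if "s \<in> TC" for s
   using that
  proof (induction s rule: T_induct)
   case (tns x y)
   then show ?case using UB[OF u] Bone lc[OF i] by (simp add: tns_m h1(3)[OF i] Bmult mult_l_one mult_smult_l)
  next
   case (add s s')
   then show ?case using uT h1(1)[OF i] UB[OF u] by (simp add: tp.T.l_distr h1(2)[OF i] mult_l_distr)
  qed
  ultimately show "h1 i t \<otimes> u = u \<otimes> h1 i t" using assms(3)[OF u] assms(2) by metis
 qed
 have h2C: "h2 i t \<in> ?C" if i: "i < n" for i
  unfolding cen
 proof (intro conjI ballI h2B[OF i assms(2)])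
  fix u assume u: "u \<in> U"
  have uT: "tns \<one> u \<in> TC" using UB[OF u] Bone by simp
  have "h2 i (tns \<one> u \<star> s) = h2 i s \<otimes> u" if "s \<in> TC" for s
   using that
  proof (induction s rule: T_induct)
   case (tns x y)
   then show ?case using UB[OF u] Bone lc[OF i] by (simp add: tns_m h2(3)[OF i] Bmult mult_l_one mult_smult_l)
  next
   case (add s s')
   then show ?case using uT h2(1)[OF i] UB[OF u] by (simp add: tp.T.r_distr h2(2)[OF i] mult_l_distr)
  qed
  moreover have "h2 i (s \<star> tns \<one> u) = u \<otimes> h2 i s" if "s \<in> TC" for s
   using that
  proof (induction s rule: T_induct)
   case (tns x y)
   then show ?case using UB[OF u] Bone lc[OF i] by (simp add: tns_m h2(3)[OF i] Bmult mult_r_one mult_smult_r)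
  next
   case (add s s')
   then show ?case using uT h2(1)[OF i] UB[OF u] by (simp add: tp.T.l_distr h2(2)[OF i] mult_r_distr)
  qed
  ultimately show "h2 i t \<otimes> u = u \<otimes> h2 i t" using assms(4)[OF u] assms(2) by metis
 qed
 have "nsum T (%i. tns (h1 i t) (b i)) n \<in> Sp ?C B"
  by (rule Sp_nsum[OF CB C0 Bzero]) (simp_all add: Sp.tns h1C bB)
 then have s1: "t \<in> Sp ?C B" unfolding e1 .
 have "nsum T (%i. tns (b i) (h2 i t)) n \<in> Sp B ?C"
  by (rule Sp_nsum[OF subset_refl Bzero C0]) (simp_all add: Sp.tns h2C bB CB)
 then have s2: "t \<in> Sp B ?C" unfolding e2 .
 obtain p where "lin_map F AB AB p" and pC': "!!x. x \<in> carrier AB ==> p x \<in> ?C" and pi: "!!x. x \<in> ?C ==> p x = x"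
  by (rule BA.projection_ex[OF Csub]) blast
 then have p: "!!x y. x \<in> B ==> y \<in> B ==> p (x \<oplus> y) = p x \<oplus> p y" "!!s x. s \<in> carrier F ==> x \<in> B ==> p (s \<odot> x) = s \<odot> p x"
  and pC: "!!x. x \<in> B ==> p x \<in> ?C"
  unfolding lin_map_def by simp_all
 have pB: "p x \<in> B" if "x \<in> B" for x using pC[OF that] CB by blast
 \<comment> \<open>\<open>q\<close> applies the projection \<open>p\<close> to the first factor: it
   fixes \<open>t\<close> as an element of \<open>C \<otimes> B\<close>, and it maps
   \<open>B \<otimes> C\<close> into \<open>C \<otimes> C\<close>.\<close>
 obtain q where q: "!!t. t \<in> TC ==> q t \<in> carrier Tm"
  "!!t t'. t \<in> TC ==> t' \<in> TC ==> q (t \<boxplus> t') = q t \<oplus>\<^bsub>Tm\<^esub> q t'"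
  "!!b c. b \<in> B ==> c \<in> carrier (opposite_algebra AB) ==> q (tns b c) = tns (p b) c"
 proof (rule T_lift[of Tm "%b c. tns (p b) c", OF TV.vspace_axioms])
  fix s b c assume "s \<in> carrier F" "b \<in> B" "c \<in> carrier (opposite_algebra AB)"
  then show "tns (p (s \<odot> b)) c = s \<odot>\<^bsub>Tm\<^esub> tns (p b) c" "tns (p b) (s \<odot> c) = s \<odot>\<^bsub>Tm\<^esub> tns (p b) c"
   by (simp_all add: p pB sm_tns tns_s)
 next
  fix h assume 1: "!!t. t \<in> TC ==> h t \<in> carrier Tm"
   and 2: "!!t t'. t \<in> TC ==> t' \<in> TC ==> h (t \<boxplus> t') = h t \<oplus>\<^bsub>Tm\<^esub> h t'"
   and 3: "!!b c. b \<in> B ==> c \<in> carrier (opposite_algebra AB) ==> h (tns b c) = tns (p b) c"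
  from that[OF 1 2 3] show thesis by simp
 qed (simp_all add: p pB tns_al tns_ar)
 have "q u = u" if "u \<in> Sp ?C B" for u
  using that
 proof (induction rule: Sp.induct)
  case (tns x y)
  then show ?case using CB pi by (simp add: q(3) subset_iff)
 next
  case (add u v)
  then show ?case using q(2)[OF SpB[OF add(1) CB subset_refl] SpB[OF add(2) CB subset_refl]] by simp
 qed
 then have qt: "q t = t" using s1 by simp
 have "q u \<in> Sp ?C ?C" if "u \<in> Sp B ?C" for u
  using that
 proof (induction rule: Sp.induct)
  case (tns x y)
  then show ?case using CB pC by (simp add: q(3) subset_iff Sp.tns)
 next
  case (add u v)
  then show ?case using q(2)[OF SpB[OF add(1) subset_refl CB] SpB[OF add(2) subset_refl CB]] by (simp add: Sp.add)
 qed
 then show ?thesis using s2 qt by metis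
qed

text \<open>A multiplication operator of \<open>B\<close>, applied to one tensor factor only, is a
  sum of two-sided multiplications in \<open>T\<close> by elements of \<open>B \<otimes> 1\<close>
  or \<open>1 \<otimes> B\<close>. It therefore preserves every ideal of \<open>T\<close>.\<close>

lemma mop_T:
 assumes "tp.B.mop p" "ideal I T" "t \<in> I"
 obtains P Q where "!!t. t \<in> I ==> P t \<in> I" "!!t. t \<in> I ==> Q t \<in> I"
  "!!t. t \<in> TC ==> P t \<in> TC" "!!t. t \<in> TC ==> Q t \<in> TC"
  "!!t u. t \<in> TC ==> u \<in> TC ==> P (t \<boxplus> u) = P t \<boxplus> P u"
  "!!t u. t \<in> TC ==> u \<in> TC ==> Q (t \<boxplus> u) = Q t \<boxplus> Q u"
  "!!b c. b \<in> B ==> c \<in> B ==> P (tns b c) = tns (p b) c"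
  "!!b c. b \<in> B ==> c \<in> B ==> Q (tns b c) = tns b (p c)"
proof -
 interpret I: ideal I T by fact
 have Ic: "!!t. t \<in> I ==> t \<in> TC" by (rule I.a_Hcarr)
 obtain n u v where u': "!!i. u i \<in> carrier AB" and v': "!!i. v i \<in> carrier AB"
  and p': "!!x. x \<in> carrier AB ==> p x = nsum AB (%i. u i \<otimes>\<^bsub>AB\<^esub> x \<otimes>\<^bsub>AB\<^esub> v i) (n :: nat)"
  by (rule tp.B.mopE[OF assms(1)]) blast
 have u: "u i \<in> B" and v: "v i \<in> B" for i using u' v' by simp_all
 have p: "p x = nsum A (%i. (u i \<otimes> x) \<otimes> v i) n" if "x \<in> B" for x using p'[of x] that by simp
 define P where "P t = nsum T (%i. tns (u i) \<one> \<star> t \<star> tns (v i) \<one>) n" for t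
 \<comment> \<open>\<open>u\<close> and \<open>v\<close> change sides because the second factor
   carries the opposite product.\<close>
 define Q where "Q t = nsum T (%i. tns \<one> (v i) \<star> t \<star> tns \<one> (u i)) n" for t
 have c: "tns (u i) \<one> \<in> TC" "tns (v i) \<one> \<in> TC" "tns \<one> (v i) \<in> TC" "tns \<one> (u i) \<in> TC" for i
  using u v Bone by simp_all
 show ?thesis
 proof (rule that[of P Q])
  fix t assume t: "t \<in> I"
  show "P t \<in> I" unfolding P_def
   by (rule tp.T.nsum_in) (use t c I.I_l_closed I.I_r_closed Ic in \<open>auto intro: I.a_closed\<close>)
  show "Q t \<in> I" unfolding Q_def
   by (rule tp.T.nsum_in) (use t c I.I_l_closed I.I_r_closed Ic in \<open>auto intro: I.a_closed\<close>)
 next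
  fix t assume "t \<in> TC"
  then show "P t \<in> TC" "Q t \<in> TC" unfolding P_def Q_def using c by simp_all
 next
  fix t t' assume t: "t \<in> TC" "t' \<in> TC"
  have "P (t \<boxplus> t') = nsum T (%i. tns (u i) \<one> \<star> t \<star> tns (v i) \<one> \<boxplus> tns (u i) \<one> \<star> t' \<star> tns (v i) \<one>) n"
   unfolding P_def by (rule nsum_cong) (simp add: t c tp.T.l_distr tp.T.r_distr)
  also have "\<dots> = P t \<boxplus> P t'" unfolding P_def by (rule tp.T.nsum_add) (simp_all add: t c)
  finally show "P (t \<boxplus> t') = P t \<boxplus> P t'" .
  have "Q (t \<boxplus> t') = nsum T (%i. tns \<one> (v i) \<star> t \<star> tns \<one> (u i) \<boxplus> tns \<one> (v i) \<star> t' \<star> tns \<one> (u i)) n"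
   unfolding Q_def by (rule nsum_cong) (simp add: t c tp.T.l_distr tp.T.r_distr)
  also have "\<dots> = Q t \<boxplus> Q t'" unfolding Q_def by (rule tp.T.nsum_add) (simp_all add: t c)
  finally show "Q (t \<boxplus> t') = Q t \<boxplus> Q t'" .
 next
  fix b c assume bc: "b \<in> B" "c \<in> B"
  have "P (tns b c) = nsum T (%i. tns ((u i \<otimes> b) \<otimes> v i) c) n" unfolding P_def
   by (rule nsum_cong) (simp add: tns_m u v bc Bone Bmult mult_l_one mult_r_one)
  also have "\<dots> = tns (p b) c" unfolding p[OF bc(1)]
   using tns_nsum_l[of c n "%i. (u i \<otimes> b) \<otimes> v i"] bc u v by (simp add: Bmult)
  finally show "P (tns b c) = tns (p b) c" .
  have "Q (tns b c) = nsum T (%i. tns b ((u i \<otimes> c) \<otimes> v i)) n" unfolding Q_def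
   by (rule nsum_cong) (simp add: tns_m u v bc Bone Bmult mult_l_one mult_r_one assB)
  also have "\<dots> = tns b (p c)" unfolding p[OF bc(2)]
   using tns_nsum_r[of b n "%i. (u i \<otimes> c) \<otimes> v i"] bc u v by (simp add: Bmult)
  finally show "Q (tns b c) = tns b (p c)" .
 qed
qed

abbreviation "L \<equiv> tp.B.cent B"

lemma L_iff: "x \<in> L \<longleftrightarrow> x \<in> B \<and> (\<forall>u \<in> B. x \<otimes> u = u \<otimes> x)"
 by (simp add: tp.B.cent_def)

lemma L_B: "L \<subseteq> B" using L_iff by blast

text \<open>The coordinate operators of a dual basis of \<open>B\<close> over \<open>L\<close>,
  applied to both factors, stay inside the ideal and take values in \<open>L \<otimes> L\<close>.
  Since \<open>t\<close> can be rebuilt from its coordinates, some coordinate of it is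
  nonzero.\<close>

lemma ideal_meets_center:
 assumes "ideal I T" "t \<in> I" "t \<noteq> \<zero>\<^sub>T"
 shows "\<exists>z \<in> I. z \<in> Sp L L \<and> z \<noteq> \<zero>\<^sub>T"
proof -
 interpret I: ideal I T by fact
 obtain n b p where b': "!!i. i < n ==> b i \<in> carrier AB" and pm: "!!i. i < n ==> tp.B.mop (p i)"
  and pL': "!!i y. i < n ==> y \<in> carrier AB ==> p i y \<in> tp.B.cent (carrier AB)"
  and ex': "!!y. y \<in> carrier AB ==> y = nsum AB (%i. b i \<otimes>\<^bsub>AB\<^esub> p i y) (n :: nat)"
  by (rule BA.mop_dual_basis) blast
 have b: "b i \<in> B" if "i < n" for i using b'[OF that] by simp
 have pL: "p i y \<in> L" if "i < n" "y \<in> B" for i y using pL'[of i y] that by simp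
 have pB: "p i y \<in> B" if "i < n" "y \<in> B" for i y using pL[OF that] L_B by blast
 have ex: "y = nsum A (%i. b i \<otimes> p i y) n" if "y \<in> B" for y using ex'[of y] that by simp
 \<comment> \<open>\<open>mop_T\<close> yields the two operators for one \<open>i\<close> at a time;
   their properties are collected so that pairs can be chosen for all \<open>i\<close>
   simultaneously.\<close>
 define R where "R i PQ \<longleftrightarrow> (\<forall>t \<in> I. fst PQ t \<in> I \<and> snd PQ t \<in> I) \<and> (\<forall>t \<in> TC. fst PQ t \<in> TC \<and> snd PQ t \<in> TC) \<and>
  (\<forall>t \<in> TC. \<forall>u \<in> TC. fst PQ (t \<boxplus> u) = fst PQ t \<boxplus> fst PQ u \<and> snd PQ (t \<boxplus> u) = snd PQ t \<boxplus> snd PQ u) \<and>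
  (\<forall>x \<in> B. \<forall>y \<in> B. fst PQ (tns x y) = tns (p i x) y \<and> snd PQ (tns x y) = tns x (p i y))" for i PQ
 define PQ where "PQ i = (SOME PQ. R i PQ)" for i
 have PQ: "R i (PQ i)" if i: "i < n" for i unfolding PQ_def
  apply (rule mop_T[OF pm[OF i] assms(1,2)])
  subgoal for P Q by (rule someI[of _ "(P, Q)"]) (simp add: R_def)
  done
 define P where "P i = fst (PQ i)" for i
 define Q where "Q i = snd (PQ i)" for i
 have PI: "P i t \<in> I" "Q i t \<in> I" if "i < n" "t \<in> I" for i t using PQ[OF that(1)] that(2) unfolding P_def Q_def R_def by blast+
 have PT: "P i t \<in> TC" "Q i t \<in> TC" if "i < n" "t \<in> TC" for i t using PQ[OF that(1)] that(2) unfolding P_def Q_def R_def by blast+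
 have Pa: "P i (t \<boxplus> u) = P i t \<boxplus> P i u" "Q i (t \<boxplus> u) = Q i t \<boxplus> Q i u"
  if "i < n" "t \<in> TC" "u \<in> TC" for i t u using PQ[OF that(1)] that(2,3) unfolding P_def Q_def R_def by blast+
 have Pt: "P i (tns x y) = tns (p i x) y" "Q i (tns x y) = tns x (p i y)" if "i < n" "x \<in> B" "y \<in> B" for i x y
  using PQ[OF that(1)] that(2,3) unfolding P_def Q_def R_def by blast+
 have c: "tns (b i) \<one> \<in> TC" "tns \<one> (b i) \<in> TC" if "i < n" for i using b[OF that] Bone by simp_all
 have eP: "nsum T (%i. tns (b i) \<one> \<star> P i t) n = t" if t: "t \<in> TC" for t
 proof (rule tns_eq_lift[where g = "%t. nsum T (%i. tns (b i) \<one> \<star> P i t) n", OF _ _ _ t])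
  show "nsum T (%i. tns (b i) \<one> \<star> P i t) n \<in> TC" if "t \<in> TC" for t
   by (rule tp.T.nsum_closed) (simp add: c PT that)
  show "nsum T (%i. tns (b i) \<one> \<star> P i (t \<boxplus> u)) n = nsum T (%i. tns (b i) \<one> \<star> P i t) n \<boxplus> nsum T (%i. tns (b i) \<one> \<star> P i u) n"
   if "t \<in> TC" "u \<in> TC" for t u
  proof -
   have "nsum T (%i. tns (b i) \<one> \<star> P i (t \<boxplus> u)) n = nsum T (%i. tns (b i) \<one> \<star> P i t \<boxplus> tns (b i) \<one> \<star> P i u) n"
    by (rule nsum_cong) (simp add: Pa PT that c tp.T.r_distr)
   then show ?thesis using tp.T.nsum_add[of n "%i. tns (b i) \<one> \<star> P i t" "%i. tns (b i) \<one> \<star> P i u"] c PT that by simp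
  qed
  fix x y assume xy: "x \<in> B" "y \<in> B"
  have "nsum T (%i. tns (b i) \<one> \<star> P i (tns x y)) n = nsum T (%i. tns (b i \<otimes> p i x) y) n"
   by (rule nsum_cong) (simp add: Pt xy b pB tns_m Bone mult_r_one)
  also have "\<dots> = tns x y" using tns_nsum_l[of y n "%i. b i \<otimes> p i x"] ex[OF xy(1)] xy b pB by (simp add: Bmult)
  finally show "nsum T (%i. tns (b i) \<one> \<star> P i (tns x y)) n = tns x y" .
 qed
 have eQ: "nsum T (%i. tns \<one> (b i) \<star> Q i t) n = t" if t: "t \<in> TC" for t
 proof (rule tns_eq_lift[where g = "%t. nsum T (%i. tns \<one> (b i) \<star> Q i t) n", OF _ _ _ t])
  show "nsum T (%i. tns \<one> (b i) \<star> Q i t) n \<in> TC" if "t \<in> TC" for t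
   by (rule tp.T.nsum_closed) (simp add: c PT that)
  show "nsum T (%i. tns \<one> (b i) \<star> Q i (t \<boxplus> u)) n = nsum T (%i. tns \<one> (b i) \<star> Q i t) n \<boxplus> nsum T (%i. tns \<one> (b i) \<star> Q i u) n"
   if "t \<in> TC" "u \<in> TC" for t u
  proof -
   have "nsum T (%i. tns \<one> (b i) \<star> Q i (t \<boxplus> u)) n = nsum T (%i. tns \<one> (b i) \<star> Q i t \<boxplus> tns \<one> (b i) \<star> Q i u) n"
    by (rule nsum_cong) (simp add: Pa PT that c tp.T.r_distr)
   then show ?thesis using tp.T.nsum_add[of n "%i. tns \<one> (b i) \<star> Q i t" "%i. tns \<one> (b i) \<star> Q i u"] c PT that by simp
  qed
  fix x y assume xy: "x \<in> B" "y \<in> B"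
  have pc: "p i y \<otimes> b i = b i \<otimes> p i y" if "i < n" for i using pL[OF that xy(2)] b[OF that] unfolding L_iff by blast
  have "nsum T (%i. tns \<one> (b i) \<star> Q i (tns x y)) n = nsum T (%i. tns x (b i \<otimes> p i y)) n"
   by (rule nsum_cong) (simp add: Pt xy b pB tns_m Bone mult_l_one pc)
  also have "\<dots> = tns x y" using tns_nsum_r[of x n "%i. b i \<otimes> p i y"] ex[OF xy(2)] xy b pB by (simp add: Bmult)
  finally show "nsum T (%i. tns \<one> (b i) \<star> Q i (tns x y)) n = tns x y" .
 qed
 have tT: "t \<in> TC" using I.a_Hcarr[OF assms(2)] .
 have "\<exists>i < n. P i t \<noteq> \<zero>\<^sub>T"
 proof (rule ccontr)
  assume "\<not> ?thesis"
  then have "nsum T (%i. tns (b i) \<one> \<star> P i t) n = \<zero>\<^sub>T" using c by (intro tp.T.nsum_zero) simp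
  then show False using eP[OF tT] assms(3) by simp
 qed
 then obtain i where i: "i < n" "P i t \<noteq> \<zero>\<^sub>T" by blast
 have "\<exists>k < n. Q k (P i t) \<noteq> \<zero>\<^sub>T"
 proof (rule ccontr)
  assume "\<not> ?thesis"
  then have "nsum T (%k. tns \<one> (b k) \<star> Q k (P i t)) n = \<zero>\<^sub>T" using c by (intro tp.T.nsum_zero) simp
  then show False using eQ[OF PT(1)[OF i(1) tT]] i by simp
 qed
 then obtain k where k: "k < n" "Q k (P i t) \<noteq> \<zero>\<^sub>T" by blast
 have "Q k (P i s) \<in> Sp L L" if "s \<in> TC" for s
  using that
 proof (induction s rule: T_induct)
  case (tns x y)
  then show ?case using i(1) k(1) pB pL by (simp add: Pt Sp.tns)
 next
  case (add s s')
  then show ?case using i(1) k(1) by (simp add: Pa PT Sp.add)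
 qed
 then show ?thesis using k(2) PI(2)[OF k(1) PI(1)[OF i(1) assms(2)]] tT by blast
qed

end

section \<open>Endomorphisms given by the tensor product\<close>

lemma (in ring) ring_idealI:
 assumes "I \<subseteq> carrier R" "\<zero> \<in> I" "!!x y. x \<in> I ==> y \<in> I ==> x \<oplus> y \<in> I"
  "!!b x. b \<in> carrier R ==> x \<in> I ==> b \<otimes> x \<in> I" "!!b x. b \<in> carrier R ==> x \<in> I ==> x \<otimes> b \<in> I"
 shows "ideal I R"
proof (rule idealI[OF ring_axioms])
 have "\<ominus> x \<in> I" if x: "x \<in> I" for x
 proof -
  have "(\<ominus> \<one>) \<otimes> x \<in> I" by (rule assms(4)[OF _ x]) simp
  then show ?thesis using x assms(1) by (simp add: l_minus subset_iff)
 qed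
 then show "subgroup I (add_monoid R)"
  using assms(1,2,3) by (intro add.subgroupI) (auto simp: a_inv_def)
qed (use assms(4,5) in simp_all)

section \<open>The commutative ring \<open>Z\<close>, the image of
  \<open>L \<otimes> L\<close>\<close>

context qassoc begin

lemma Lc: "x \<in> L ==> y \<in> B ==> x \<otimes> y = y \<otimes> x" using L_iff by blast

lemma L_alg: "tp.B.subalg L" by (rule tp.B.cent_subalg) simp

lemma L_closed: "\<zero> \<in> L" "\<one> \<in> L" "x \<in> L ==> y \<in> L ==> x \<otimes> y \<in> L" "c \<in> carrier F ==> x \<in> L ==> c \<odot> x \<in> L"
 using tp.B.subspD(2,6)[OF tp.B.subalgD(1)[OF L_alg]] tp.B.subalgD(2,3)[OF L_alg] by simp_all

abbreviation "Z \<equiv> Sp L L"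

lemma ZT: "z \<in> Z ==> z \<in> TC" by (rule SpB[OF _ L_B L_B])

lemma Z_comm: assumes "z \<in> Z" "t \<in> TC" shows "z \<star> t = t \<star> z"
proof (rule Sp_commute[OF assms(1) Sp_all[OF assms(2)]])
 show "x \<otimes> y = y \<otimes> x" if "x \<in> L" "y \<in> B" for x y using Lc that .
 then show "x \<otimes> y = y \<otimes> x" if "x \<in> L" "y \<in> C0" for x y using that by simp
qed (use L_B in simp_all)

lemma Z_one: "\<one>\<^sub>T \<in> Z" unfolding tns_1[symmetric] by (intro Sp.tns L_closed)

lemma Z_mult: "z \<in> Z ==> w \<in> Z ==> z \<star> w \<in> Z"
 by (rule Sp_mult) (simp_all add: L_B L_closed)

lemma Z_add: "z \<in> Z ==> w \<in> Z ==> z \<boxplus> w \<in> Z" by (rule Sp.add)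

lemma Z_zero: "\<zero>\<^sub>T \<in> Z" by (rule Sp_zero) (simp_all add: L_B L_closed)

lemma sone_Z: "c \<in> carrier F ==> tns (c \<odot> \<one>) \<one> \<in> Z" by (intro Sp.tns L_closed)

lemma Z_minus: assumes "z \<in> Z" "w \<in> Z" shows "z \<ominus>\<^bsub>T\<^esub> w \<in> Z"
proof -
 have "tns ((\<ominus>\<^bsub>F\<^esub> \<one>\<^bsub>F\<^esub>) \<odot> \<one>) \<one> \<star> w \<in> Z" by (rule Z_mult[OF sone_Z assms(2)]) simp
 moreover have "tns ((\<ominus>\<^bsub>F\<^esub> \<one>\<^bsub>F\<^esub>) \<odot> \<one>) \<one> = \<ominus>\<^bsub>T\<^esub> \<one>\<^sub>T"
 proof (rule tp.T.minus_equality[symmetric])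
  have "tns ((\<ominus>\<^bsub>F\<^esub> \<one>\<^bsub>F\<^esub>) \<odot> \<one>) \<one> \<boxplus> tns \<one> \<one> = tns ((\<ominus>\<^bsub>F\<^esub> \<one>\<^bsub>F\<^esub>) \<odot> \<one> \<oplus> \<one>) \<one>"
   by (rule tns_al[symmetric]) (simp_all add: Bsmult Bone)
  also have "(\<ominus>\<^bsub>F\<^esub> \<one>\<^bsub>F\<^esub>) \<odot> \<one> \<oplus> \<one> = \<zero>" using oneA by (simp add: smult_l_minus l_neg)
  finally show "tns ((\<ominus>\<^bsub>F\<^esub> \<one>\<^bsub>F\<^esub>) \<odot> \<one>) \<one> \<boxplus> \<one>\<^sub>T = \<zero>\<^sub>T" by (simp add: tns_1 tns_zero_l Bone)
 qed (simp_all add: Bsmult Bone)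
 ultimately have "\<ominus>\<^bsub>T\<^esub> w \<in> Z" using ZT[OF assms(2)] by (simp add: tp.T.l_minus)
 then show ?thesis unfolding tp.T.minus_eq using assms(1) by (intro Z_add)
qed

text \<open>The chain of subspaces \<open>z^(n+1) Z\<close> becomes stationary, so
  \<open>z^(n+1) = z^(n+2) w\<close>. Since \<open>Z\<close> is reduced, the surplus powers of
  \<open>z\<close> can be cancelled one by one, leaving \<open>z (1 - z w) = 0\<close>.\<close>

lemma Z_von_neumann_regular:
 assumes "sepid L d" "z \<in> Z"
 shows "\<exists>w \<in> Z. z = z \<star> (z \<star> w)"
proof -
 have LL: "!!x y. x \<in> L ==> y \<in> L ==> x \<otimes> y = y \<otimes> x" using Lc L_B by blast
 note red = sepid_reduced[OF assms(1) LL]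
 have zT: "z \<in> TC" by (rule ZT[OF assms(2)])
 define g where "g = (%y. z \<star> y)"
 have gZ: "(g ^^ n) y \<in> Z" if "y \<in> Z" for n y
  using that by (induction n) (simp_all add: g_def Z_mult assms(2))
 have gadd: "(g ^^ n) (x \<boxplus> y) = (g ^^ n) x \<boxplus> (g ^^ n) y" if "x \<in> Z" "y \<in> Z" for n x y
  using ZT[OF gZ[OF that(1)]] ZT[OF gZ[OF that(2)]] by (induction n) (simp_all add: g_def zT tp.T.r_distr)
 have gm: "(g ^^ n) (x \<star> y) = (g ^^ n) x \<star> y" if "x \<in> Z" "y \<in> Z" for n x y
  using ZT[OF gZ[OF that(1)]] ZT[OF that(2)] by (induction n) (simp_all add: g_def zT tp.T.m_assoc)
 define f where "f n = (g ^^ Suc n) ` Z" for n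
 have sub: "TV.subsp (f n)" for n
 proof (rule TV.subspI)
  show "f n \<subseteq> carrier Tm"
  proof
   fix x assume "x \<in> f n"
   then obtain a where "a \<in> Z" "x = (g ^^ Suc n) a" unfolding f_def by blast
   then show "x \<in> carrier Tm" using ZT[OF gZ[of a "Suc n"]] by simp
  qed
  have "(g ^^ Suc n) \<zero>\<^sub>T = \<zero>\<^sub>T" by (induction n) (simp_all add: g_def zT)
  then show "\<zero>\<^bsub>Tm\<^esub> \<in> f n" unfolding f_def using Z_zero by (metis Tm_simps(4) image_eqI)
 next
  fix x y assume "x \<in> f n" "y \<in> f n"
  then obtain a b where ab: "a \<in> Z" "b \<in> Z" "x = (g ^^ Suc n) a" "y = (g ^^ Suc n) b" unfolding f_def by blast
  have "x \<oplus>\<^bsub>Tm\<^esub> y = (g ^^ Suc n) (a \<boxplus> b)" unfolding ab(3,4) gadd[OF ab(1,2)] by simp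
  then show "x \<oplus>\<^bsub>Tm\<^esub> y \<in> f n" unfolding f_def using Z_add[OF ab(1,2)] by (rule image_eqI)
 next
  fix c x assume c: "c \<in> carrier F" and "x \<in> f n"
  then obtain a where ab: "a \<in> Z" "x = (g ^^ Suc n) a" unfolding f_def by blast
  have cz: "tns (c \<odot> \<one>) \<one> \<in> Z" by (rule sone_Z[OF c])
  have "(g ^^ Suc n) (a \<star> tns (c \<odot> \<one>) \<one>) = c \<odot>\<^bsub>Tm\<^esub> x"
   unfolding gm[OF ab(1) cz] ab(2) sm_eq by (rule Z_comm[OF gZ[OF ab(1)] ZT[OF cz]])
  then show "c \<odot>\<^bsub>Tm\<^esub> x \<in> f n" unfolding f_def using Z_mult[OF ab(1) cz] by (metis image_eqI)
 qed
 obtain n where n: "!!m. f m \<subseteq> f n ==> f m = f n"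
  by (rule TV.min_ex[of "%_. True" "0 :: nat" f]) (use sub in auto)
 have "f (Suc n) \<subseteq> f n"
 proof
  fix x assume "x \<in> f (Suc n)"
  then obtain a where a: "a \<in> Z" "x = (g ^^ Suc (Suc n)) a" unfolding f_def by blast
  then have "x = (g ^^ Suc n) (g a)" by (simp add: funpow_swap1)
  then show "x \<in> f n" unfolding f_def using gZ[OF a(1), of 1] by (intro image_eqI[of _ _ "g a"]) simp_all
 qed
 then have "f (Suc n) = f n" by (rule n)
 moreover have "(g ^^ Suc n) \<one>\<^sub>T \<in> f n" unfolding f_def using Z_one by (rule imageI)
 ultimately have "(g ^^ Suc n) \<one>\<^sub>T \<in> f (Suc n)" by (simp only:)
 then obtain w where w: "w \<in> Z" "(g ^^ Suc n) \<one>\<^sub>T = (g ^^ Suc (Suc n)) w" unfolding f_def by (rule imageE)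
 have zw: "z \<star> w \<in> Z" by (rule Z_mult[OF assms(2) w(1)])
 \<comment> \<open>If \<open>z z v = 0\<close>, then \<open>z v\<close> has square zero.\<close>
 have inj: "z \<star> v = \<zero>\<^sub>T" if v: "v \<in> Z" and e: "z \<star> (z \<star> v) = \<zero>\<^sub>T" for v
 proof (rule red)
  show "z \<star> v \<in> Z" by (rule Z_mult[OF assms(2) v])
  have "z \<star> v \<star> (z \<star> v) = z \<star> ((v \<star> z) \<star> v)" using zT ZT[OF v] by (simp add: tp.T.m_assoc)
  also have "v \<star> z = z \<star> v" by (rule Z_comm[OF v zT])
  also have "z \<star> (z \<star> v \<star> v) = (z \<star> (z \<star> v)) \<star> v" using zT ZT[OF v] by (simp add: tp.T.m_assoc)
  finally show "z \<star> v \<star> (z \<star> v) = \<zero>\<^sub>T" unfolding e using ZT[OF v] by simp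
 qed
 have kill: "(g ^^ m) (z \<star> v) = \<zero>\<^sub>T ==> z \<star> v = \<zero>\<^sub>T" if v: "v \<in> Z" for m v
 proof (induction m)
  case (Suc m)
  have "(g ^^ m) (z \<star> v) = z \<star> (g ^^ m) v" using funpow_swap1[of g m v] by (simp add: g_def)
  then have "z \<star> (z \<star> (g ^^ m) v) = \<zero>\<^sub>T" using Suc.prems by (simp add: g_def)
  then have "z \<star> (g ^^ m) v = \<zero>\<^sub>T" by (rule inj[OF gZ[OF v]])
  then show ?case using Suc.IH \<open>(g ^^ m) (z \<star> v) = z \<star> (g ^^ m) v\<close> by simp
 qed simp
 have v: "\<one>\<^sub>T \<ominus>\<^bsub>T\<^esub> z \<star> w \<in> Z" by (rule Z_minus[OF Z_one zw])
 have e1: "(g ^^ Suc n) (z \<star> w) = (g ^^ Suc n) \<one>\<^sub>T"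
  unfolding w(2) using funpow_swap1[of g "Suc n" w] by (simp add: g_def)
 have "(g ^^ Suc n) ((\<one>\<^sub>T \<ominus>\<^bsub>T\<^esub> z \<star> w) \<boxplus> z \<star> w) = (g ^^ Suc n) \<one>\<^sub>T"
  using ZT[OF zw] by (simp add: tp.T.minus_eq tp.T.a_assoc tp.T.l_neg del: funpow.simps)
 then have "(g ^^ Suc n) (\<one>\<^sub>T \<ominus>\<^bsub>T\<^esub> z \<star> w) \<boxplus> (g ^^ Suc n) \<one>\<^sub>T = (g ^^ Suc n) \<one>\<^sub>T"
  unfolding gadd[OF v zw] e1 .
 then have "(g ^^ Suc n) (\<one>\<^sub>T \<ominus>\<^bsub>T\<^esub> z \<star> w) = \<zero>\<^sub>T"
  using tp.T.add.l_cancel_one[of "(g ^^ Suc n) \<one>\<^sub>T" "(g ^^ Suc n) (\<one>\<^sub>T \<ominus>\<^bsub>T\<^esub> z \<star> w)"]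
   tp.T.add.r_cancel_one[of "(g ^^ Suc n) \<one>\<^sub>T" "(g ^^ Suc n) (\<one>\<^sub>T \<ominus>\<^bsub>T\<^esub> z \<star> w)"]
   ZT[OF gZ[OF v]] ZT[OF gZ[OF Z_one]] by metis
 then have "(g ^^ n) (z \<star> (\<one>\<^sub>T \<ominus>\<^bsub>T\<^esub> z \<star> w)) = \<zero>\<^sub>T"
  using funpow_swap1[of g n "\<one>\<^sub>T \<ominus>\<^bsub>T\<^esub> z \<star> w"] by (simp add: g_def)
 then have k: "z \<star> (\<one>\<^sub>T \<ominus>\<^bsub>T\<^esub> z \<star> w) = \<zero>\<^sub>T" by (rule kill[OF v])
 have "z \<ominus>\<^bsub>T\<^esub> z \<star> (z \<star> w) = \<zero>\<^sub>T"
  using k zT ZT[OF zw] by (simp add: tp.T.minus_eq tp.T.r_distr tp.T.r_minus)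
 then have "z = z \<star> (z \<star> w)" by (rule tp.T.minus_zero_imp_eq[rotated 2]) (use zT ZT[OF zw] in simp_all)
 then show ?thesis using w(1) by blast
qed

text \<open>\<open>e\<close> is an idempotent outside \<open>G\<close> with \<open>e Z\<close>
  minimal. A nonzero \<open>z\<close> in \<open>e Z\<close> gives by regularity the idempotent
  \<open>z w\<close> in \<open>e Z\<close>, and this has to be \<open>e\<close>. Thus
  \<open>e Z\<close> is a field, and \<open>e\<close> can be chosen outside any prescribed proper
  ideal.\<close>

lemma primitive_central_idempotent:
 assumes "sepid L d" "ideal G T" "\<one>\<^sub>T \<notin> G"
 obtains e where "e \<in> Z" "e \<star> e = e" "e \<notin> G"
  "!!z. z \<in> Z ==> z \<noteq> \<zero>\<^sub>T ==> e \<star> z = z ==> \<exists>w \<in> Z. z \<star> w = e"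
proof -
 interpret G: ideal G T by fact
 let ?P = "%e. e \<in> Z \<and> e \<star> e = e \<and> e \<notin> G"
 define f where "f e = (%y. e \<star> y) ` Z" for e
 have sub: "TV.subsp (f e)" if e: "e \<in> Z" for e
 proof (rule TV.subspI)
  show "f e \<subseteq> carrier Tm" unfolding f_def using ZT e by auto
  show "\<zero>\<^bsub>Tm\<^esub> \<in> f e" unfolding f_def using Z_zero ZT[OF e] by (intro image_eqI[of _ _ "\<zero>\<^sub>T"]) simp_all
 next
  fix x y assume "x \<in> f e" "y \<in> f e"
  then obtain a b where ab: "a \<in> Z" "b \<in> Z" "x = e \<star> a" "y = e \<star> b" unfolding f_def by blast
  have "x \<oplus>\<^bsub>Tm\<^esub> y = e \<star> (a \<boxplus> b)" using ab ZT e by (simp add: tp.T.r_distr)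
  then show "x \<oplus>\<^bsub>Tm\<^esub> y \<in> f e" unfolding f_def using Z_add[OF ab(1,2)] by (rule image_eqI)
 next
  fix c x assume c: "c \<in> carrier F" and "x \<in> f e"
  then obtain a where ab: "a \<in> Z" "x = e \<star> a" unfolding f_def by blast
  have cz: "tns (c \<odot> \<one>) \<one> \<in> Z" by (rule sone_Z[OF c])
  have "c \<odot>\<^bsub>Tm\<^esub> x = x \<star> tns (c \<odot> \<one>) \<one>"
   unfolding sm_eq by (rule Z_comm[OF cz]) (use ab ZT e in simp)
  also have "\<dots> = e \<star> (a \<star> tns (c \<odot> \<one>) \<one>)" unfolding ab(2)
   by (rule tp.T.m_assoc) (use ab ZT e cz in simp_all)
  finally show "c \<odot>\<^bsub>Tm\<^esub> x \<in> f e" unfolding f_def using Z_mult[OF ab(1) cz] by (rule image_eqI)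
 qed
 obtain e where e: "?P e" and mn: "!!x. ?P x ==> f x \<subseteq> f e ==> f x = f e"
 proof (rule TV.min_ex[of ?P "\<one>\<^sub>T" f])
  show "?P \<one>\<^sub>T" using Z_one assms(3) by simp
  show "TV.subsp (f x)" if "?P x" for x by (rule sub) (use that in simp)
 qed simp
 have eT: "e \<in> TC" using ZT e by simp
 have key: "x = e" if x: "x \<in> Z" "x \<star> x = x" "x \<notin> G" "e \<star> x = x" for x
 proof -
  have xT: "x \<in> TC" by (rule ZT[OF x(1)])
  have "f x \<subseteq> f e"
  proof
   fix y assume "y \<in> f x"
   then obtain a where a: "a \<in> Z" "y = x \<star> a" unfolding f_def by (rule imageE)
   have "y = e \<star> (x \<star> a)" unfolding a(2) using tp.T.m_assoc[OF eT xT ZT[OF a(1)]] x(4) by simp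
   then show "y \<in> f e" unfolding f_def using Z_mult[OF x(1) a(1)] by (rule image_eqI)
  qed
  then have "f x = f e" using x by (intro mn) simp
  moreover have "e \<in> f e" unfolding f_def using e by (intro image_eqI[of _ _ e]) simp_all
  ultimately have "e \<in> f x" by (simp only:)
  then obtain y where y: "y \<in> Z" "e = x \<star> y" unfolding f_def by (rule imageE)
  have "x \<star> e = e" unfolding y(2) using tp.T.m_assoc[OF xT xT ZT[OF y(1)]] x(2) by simp
  then show ?thesis using Z_comm[OF x(1) eT] x(4) by simp
 qed
 show ?thesis
 proof (rule that[of e])
  fix z assume z: "z \<in> Z" "z \<noteq> \<zero>\<^sub>T" "e \<star> z = z"
  have zT: "z \<in> TC" by (rule ZT[OF z(1)])
  obtain w where w: "w \<in> Z" "z = z \<star> (z \<star> w)" using Z_von_neumann_regular[OF assms(1) z(1)] by blast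
  have wT: "w \<in> TC" by (rule ZT[OF w(1)])
  define x where "x = z \<star> w"
  have xZ: "x \<in> Z" unfolding x_def by (rule Z_mult[OF z(1) w(1)])
  have xT: "x \<in> TC" by (rule ZT[OF xZ])
  have zx: "z \<star> x = z" using w(2) by (simp add: x_def)
  have xx: "x \<star> x = x"
  proof -
   have "x \<star> x = x \<star> z \<star> w" unfolding x_def using zT wT by (simp add: tp.T.m_assoc)
   also have "x \<star> z = z" using Z_comm[OF xZ zT] zx by simp
   finally show ?thesis by (simp add: x_def)
  qed
  have ex: "e \<star> x = x" unfolding x_def using tp.T.m_assoc[OF eT zT wT] z(3) by simp
  have xe: "x \<star> e = x" using Z_comm[OF xZ eT] ex by simp
  have "x = e"
  proof (cases "x \<in> G")
   case False
   then show ?thesis using key xZ xx ex by blast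
  next
   \<comment> \<open>If \<open>x\<close> lies in \<open>G\<close>, the complementary idempotent
     \<open>e - x\<close> does not, so it equals \<open>e\<close> by minimality; then
     \<open>x\<close> is zero and so is \<open>z\<close>.\<close>
   case True
   define y where "y = e \<ominus>\<^bsub>T\<^esub> x"
   have yZ: "y \<in> Z" unfolding y_def by (rule Z_minus) (use e xZ in simp_all)
   have yT: "y \<in> TC" by (rule ZT[OF yZ])
   have ey: "e \<star> y = y" unfolding y_def using e eT xT ex by (simp add: tp.T.minus_eq tp.T.r_distr tp.T.r_minus)
   have xy: "x \<star> y = \<zero>\<^sub>T" unfolding y_def using eT xT xe xx by (simp add: tp.T.minus_eq tp.T.r_distr tp.T.r_minus tp.T.r_neg)
   have yy: "y \<star> y = y"
   proof -
    have "y \<star> y = e \<star> y \<ominus>\<^bsub>T\<^esub> x \<star> y" unfolding y_def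
     using eT xT by (simp add: tp.T.minus_eq tp.T.l_distr tp.T.l_minus)
    then show ?thesis using ey xy yT by (simp add: tp.T.minus_eq)
   qed
   have "e = y \<boxplus> x" unfolding y_def using eT xT by (simp add: tp.T.minus_eq tp.T.a_assoc tp.T.l_neg)
   then have "y \<notin> G" using e True G.a_closed by metis
   then have "y = e" using key yZ yy ey by blast
   then have "x \<star> e = \<zero>\<^sub>T" using xy by simp
   then have "x = \<zero>\<^sub>T" using xe by simp
   then have "z = \<zero>\<^sub>T" using zx zT by simp
   then show ?thesis using z(2) by simp
  qed
  then show "\<exists>w \<in> Z. z \<star> w = e" using w(1) by (auto simp: x_def)
 qed (use e in simp_all)
qed

end

text \<open>\<open>f\<close> is the matrix unit at position (0, 0), and \<open>z\<close> is the
  entry of \<open>x\<close> at that position, so \<open>f x f = z f\<close>.\<close>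

lemma (in ring) matrix_corner:
 assumes S: "ideal S R" and e: "e \<in> S" "!!x. x \<in> S ==> e \<otimes> x = x \<and> x \<otimes> e = x" "e \<noteq> \<zero>"
  and mat: "matrix_over_center (component_ring R S)"
 obtains f where "f \<in> S" "f \<otimes> f = f" "f \<noteq> \<zero>"
  "!!x. x \<in> S ==> \<exists>z \<in> S. (\<forall>y \<in> S. z \<otimes> y = y \<otimes> z) \<and> f \<otimes> (x \<otimes> f) = z \<otimes> f"
proof -
 interpret S: ideal S R by fact
 have Sc: "x \<in> carrier R" if "x \<in> S" for x using S.a_Hcarr that .
 have Sm: "x \<otimes> y \<in> S" if "x \<in> S" "y \<in> S" for x y using S.I_l_closed[OF that(2) Sc[OF that(1)]] .
 have one: "(THE e. e \<in> S \<and> (\<forall>x \<in> S. e \<otimes> x = x \<and> x \<otimes> e = x)) = e"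
 proof (rule the_equality)
  fix e' assume e': "e' \<in> S \<and> (\<forall>x \<in> S. e' \<otimes> x = x \<and> x \<otimes> e' = x)"
  then have "e' \<otimes> e = e" using e(1) by simp
  moreover have "e' \<otimes> e = e'" using e(2)[of e'] e' by simp
  ultimately show "e' = e" by simp
 qed (use e(1,2) in simp)
 define Q where "Q = component_ring R S"
 have Qs [simp]: "carrier Q = S" "monoid.mult Q = monoid.mult R" "ring.add Q = ring.add R" "ring.zero Q = \<zero>" "\<one>\<^bsub>Q\<^esub> = e"
  unfolding Q_def component_ring_def by (simp_all add: one)
 have ab: "abelian_group Q"
 proof (rule abelian_groupI)
  show "\<exists>y \<in> carrier Q. y \<oplus>\<^bsub>Q\<^esub> x = \<zero>\<^bsub>Q\<^esub>" if "x \<in> carrier Q" for x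
   using that Sc by (intro bexI[of _ "\<ominus> x"]) (simp_all add: l_neg)
 qed (simp_all add: Sc a_ac)
 have rQ: "ring Q"
  by (rule ringI[OF ab]) (simp_all add: Group.monoid_def Sc Sm e m_assoc l_distr r_distr)
 interpret Q: ring Q by (rule rQ)
 define N where "N = alg_center Q"
 have N_iff: "z \<in> N \<longleftrightarrow> z \<in> S \<and> (\<forall>y \<in> S. z \<otimes> y = y \<otimes> z)" for z
 proof -
  have "associator Q x y w = \<zero>\<^bsub>Q\<^esub>" if "x \<in> S" "y \<in> S" "w \<in> S" for x y w
   unfolding associator_def using that Q.m_assoc[of x y w] Q.m_closed by (simp add: Q.minus_eq Q.r_neg del: Qs(2-5))
  then show ?thesis unfolding N_def alg_center_def nucleus_def by auto
 qed
 have NS: "z \<in> S" if "z \<in> N" for z using that N_iff by blast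
 have Nc: "z \<in> carrier R" if "z \<in> N" for z using Sc[OF NS[OF that]] .
 have N0: "\<zero> \<in> N" unfolding N_iff using Sc by simp
 have Ne: "e \<in> N" unfolding N_iff using e by simp
 have Na: "z \<oplus> w \<in> N" if "z \<in> N" "w \<in> N" for z w
  using that unfolding N_iff by (simp add: Sc l_distr r_distr)
 have Nn: "\<ominus> z \<in> N" if "z \<in> N" for z
  using that unfolding N_iff by (simp add: Sc l_minus r_minus)
 have Nm: "z \<otimes> w \<in> N" if "z \<in> N" "w \<in> N" for z w
  unfolding N_iff
 proof (intro conjI ballI)
  show "z \<otimes> w \<in> S" using Sm NS that by simp
  fix y assume y: "y \<in> S"
  have c: "z \<in> carrier R" "w \<in> carrier R" "y \<in> carrier R" using that Nc Sc y by simp_all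
  have zy: "z \<otimes> y = y \<otimes> z" and wy: "w \<otimes> y = y \<otimes> w" using that y unfolding N_iff by blast+
  show "z \<otimes> w \<otimes> y = y \<otimes> (z \<otimes> w)" by (metis c zy wy m_assoc)
 qed
 define D where "D = Q\<lparr>carrier := N\<rparr>"
 have Ds [simp]: "carrier D = N" "monoid.mult D = monoid.mult R" "ring.add D = ring.add R" "ring.zero D = \<zero>" "\<one>\<^bsub>D\<^esub> = e"
  unfolding D_def by simp_all
 interpret D: abelian_group D
 proof (rule abelian_groupI)
  show "\<exists>y \<in> carrier D. y \<oplus>\<^bsub>D\<^esub> x = \<zero>\<^bsub>D\<^esub>" if "x \<in> carrier D" for x
   using that Nc Nn by (intro bexI[of _ "\<ominus> x"]) (simp_all add: l_neg)
 qed (simp_all add: Nc Na N0 a_ac)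
 obtain n h where n: "n > 0" and h: "h \<in> ring_iso Q (matrix_ring n D)"
  and hz: "!!z x. z \<in> N ==> x \<in> S ==> h (z \<otimes> x) = restrict (%p. z \<otimes> h x p) ({..<n} \<times> {..<n})"
  using mat unfolding matrix_over_center_def Q_def[symmetric] N_def[symmetric] D_def[symmetric] by auto
 let ?I = "{..<n} \<times> {..<n}"
 have hbij: "bij_betw h S (?I \<rightarrow>\<^sub>E N)" and hm: "!!x y. x \<in> S ==> y \<in> S ==> h (x \<otimes> y) = h x \<otimes>\<^bsub>matrix_ring n D\<^esub> h y"
  and ha: "!!x y. x \<in> S ==> y \<in> S ==> h (x \<oplus> y) = restrict (%p. h x p \<oplus> h y p) ?I"
  using h unfolding ring_iso_def ring_hom_def by (simp_all add: matrix_ring_def)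
 have hi: "x = y" if "x \<in> S" "y \<in> S" "h x = h y" for x y
  using hbij that unfolding bij_betw_def inj_on_def by blast
 have hN: "h x (i, j) \<in> N" if "x \<in> S" "i < n" "j < n" for x i j
  using bij_betw_apply[OF hbij that(1)] that(2,3) by (auto simp: PiE_iff)
 define E where "E = restrict (%p. if p = (0, 0) then e else \<zero>) ?I"
 have "E \<in> ?I \<rightarrow>\<^sub>E N" unfolding E_def using Ne N0 by auto
 then obtain f where f: "f \<in> S" "h f = E" using hbij unfolding bij_betw_def by (metis imageE)
 have single: "(\<Oplus>\<^bsub>D\<^esub>k \<in> {..<n}. g k) = g 0" if "g 0 \<in> N" "!!k. k < n ==> k \<noteq> 0 ==> g k = \<zero>" for g
 proof -
  have "(\<Oplus>\<^bsub>D\<^esub>k \<in> {..<n}. g k) = (\<Oplus>\<^bsub>D\<^esub>k \<in> {..<n}. if 0 = k then g k else \<zero>\<^bsub>D\<^esub>)"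
   by (rule D.finsum_cong') (use that N0 in auto)
  also have "\<dots> = g 0" by (rule D.finsum_singleton) (use n that N0 in \<open>auto\<close>, metis N0 neq0_conv)
  finally show ?thesis .
 qed
 have mulE: "(U \<otimes>\<^bsub>matrix_ring n D\<^esub> E) (i, j) = U (i, 0) \<otimes> E (0, j)"
  if U: "!!i j. i < n ==> j < n ==> U (i, j) \<in> N" and ij: "i < n" "j < n" for U i j
 proof -
  have "(U \<otimes>\<^bsub>matrix_ring n D\<^esub> E) (i, j) = (\<Oplus>\<^bsub>D\<^esub>k \<in> {..<n}. U (i, k) \<otimes> E (k, j))"
   using ij by (simp add: matrix_ring_def)
  also have "\<dots> = U (i, 0) \<otimes> E (0, j)"
   by (rule single) (use U ij n Ne N0 Nc in \<open>auto simp: E_def intro!: Nm\<close>)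
  finally show ?thesis .
 qed
 have Emul: "(E \<otimes>\<^bsub>matrix_ring n D\<^esub> U) (i, j) = E (i, 0) \<otimes> U (0, j)"
  if U: "!!i j. i < n ==> j < n ==> U (i, j) \<in> N" and ij: "i < n" "j < n" for U i j
 proof -
  have "(E \<otimes>\<^bsub>matrix_ring n D\<^esub> U) (i, j) = (\<Oplus>\<^bsub>D\<^esub>k \<in> {..<n}. E (i, k) \<otimes> U (k, j))"
   using ij by (simp add: matrix_ring_def)
  also have "\<dots> = E (i, 0) \<otimes> U (0, j)"
   by (rule single) (use U ij n Ne N0 Nc in \<open>auto simp: E_def intro!: Nm\<close>)
  finally show ?thesis .
 qed
 have ext: "U = W" if "U \<in> extensional ?I" "W \<in> extensional ?I" "!!i j. i < n ==> j < n ==> U (i, j) = W (i, j)" for U W :: "nat \<times> nat => 'a"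
  by (rule extensionalityI[OF that(1,2)]) (use that(3) in auto)
 have EN: "E (i, j) \<in> N" if "i < n" "j < n" for i j using that Ne N0 by (simp add: E_def)
 have mext: "U \<otimes>\<^bsub>matrix_ring n D\<^esub> W \<in> extensional ?I" for U W by (simp add: matrix_ring_def)
 have ee: "e \<otimes> e = e" using e by simp
 have ec: "e \<in> carrier R" using Sc e by simp
 have EE: "E \<otimes>\<^bsub>matrix_ring n D\<^esub> E = E"
 proof (rule ext[OF mext])
  show "E \<in> extensional ?I" by (simp add: E_def)
  fix i j assume "i < n" "j < n"
  then show "(E \<otimes>\<^bsub>matrix_ring n D\<^esub> E) (i, j) = E (i, j)"
   using mulE[of E i j] EN n ec ee by (simp add: E_def)
 qed
 show ?thesis
 proof (rule that[OF f(1)])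
  show "f \<otimes> f = f" by (rule hi) (use Sm f hm EE in simp_all)
  show "f \<noteq> \<zero>"
  proof
   assume "f = \<zero>"
   then have "f \<oplus> f = f" by simp
   then have "E (0, 0) = E (0, 0) \<oplus> E (0, 0)" using ha[OF f(1) f(1)] f(2) n by (metis (no_types, lifting) SigmaI lessThan_iff restrict_apply')
   then have "e = e \<oplus> e" using n by (simp add: E_def)
   then show False using ec e(3) by (metis add.r_cancel_one')
  qed
  fix x assume x: "x \<in> S"
  define z where "z = h x (0, 0)"
  have z: "z \<in> N" unfolding z_def using hN[OF x n n] .
  have "f \<otimes> (x \<otimes> f) = z \<otimes> f"
  proof (rule hi)
   show "f \<otimes> (x \<otimes> f) \<in> S" "z \<otimes> f \<in> S" using Sm f(1) x NS[OF z] by simp_all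
   have 1: "h (f \<otimes> (x \<otimes> f)) = E \<otimes>\<^bsub>matrix_ring n D\<^esub> (h x \<otimes>\<^bsub>matrix_ring n D\<^esub> E)"
    using hm f x Sm by simp
   have 2: "h (z \<otimes> f) = restrict (%p. z \<otimes> E p) ?I" using hz[OF z f(1)] f(2) by simp
   have xE: "(h x \<otimes>\<^bsub>matrix_ring n D\<^esub> E) (i, j) = h x (i, 0) \<otimes> E (0, j)" if "i < n" "j < n" for i j
    by (rule mulE) (use hN[OF x] that in simp_all)
   show "h (f \<otimes> (x \<otimes> f)) = h (z \<otimes> f)"
    unfolding 1 2
   proof (rule ext[OF mext])
    fix i j assume ij: "i < n" "j < n"
    have "(E \<otimes>\<^bsub>matrix_ring n D\<^esub> (h x \<otimes>\<^bsub>matrix_ring n D\<^esub> E)) (i, j) = E (i, 0) \<otimes> (h x \<otimes>\<^bsub>matrix_ring n D\<^esub> E) (0, j)"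
     by (rule Emul) (use xE hN[OF x] EN Nm n ij in simp_all)
    also have "\<dots> = E (i, 0) \<otimes> (z \<otimes> E (0, j))" using xE[OF n ij(2)] by (simp add: z_def)
    also have "\<dots> = z \<otimes> E (i, j)" using ij n Nc[OF z] ec z e(2)[OF NS[OF z]] ee by (simp add: E_def Sm)
    finally show "(E \<otimes>\<^bsub>matrix_ring n D\<^esub> (h x \<otimes>\<^bsub>matrix_ring n D\<^esub> E)) (i, j) = restrict (%p. z \<otimes> E p) ?I (i, j)"
     using ij by simp
   qed simp
  qed
  then show "\<exists>z \<in> S. (\<forall>y \<in> S. z \<otimes> y = y \<otimes> z) \<and> f \<otimes> (x \<otimes> f) = z \<otimes> f"
   using z N_iff by blast
 qed
qed

section \<open>Maps that commute with \<open>Z\<close>\<close>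

context qassoc begin

text \<open>The elements \<open>t\<close> for which \<open>t \<circ> \<phi>\<close> comes from \<open>T\<close> for all \<open>Z\<close>-linear \<open>\<phi>\<close> form an ideal;
 if it were proper it would miss a simple component of \<open>T\<close>, which is impossible because such a
 component acts on \<open>A\<close> as the full ring of linear maps over its center.\<close>
theorem Z_linear_in_T:
 assumes sL: "sepid L d"
  and phi: "lin_map F A A \<phi>" "!!l a. l \<in> L ==> a \<in> AC ==> \<phi> (l \<otimes> a) = l \<otimes> \<phi> a"
   "!!l a. l \<in> L ==> a \<in> AC ==> \<phi> (a \<otimes> l) = \<phi> a \<otimes> l"
 shows "\<exists>s \<in> TC. \<forall>a \<in> AC. \<phi> a = act s a"
proof -
 \<comment> \<open>Scalars of \<open>F\<close> act through \<open>Z\<close>, so maps compatible with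
   \<open>Z\<close> are automatically linear over \<open>F\<close>. Closure under composition with
   elements of \<open>T\<close> makes the set \<open>G\<close> below an ideal.\<close>
 define Phi where "Phi = {\<psi>. (\<forall>a \<in> AC. \<psi> a \<in> AC) \<and>
   (\<forall>a \<in> AC. \<forall>b \<in> AC. \<psi> (a \<oplus> b) = \<psi> a \<oplus> \<psi> b) \<and>
   (\<forall>z \<in> Z. \<forall>a \<in> AC. \<psi> (act z a) = act z (\<psi> a))}"
 have pc: "\<psi> a \<in> AC" if "\<psi> \<in> Phi" "a \<in> AC" for \<psi> a using that unfolding Phi_def by blast
 have pa: "\<psi> (a \<oplus> b) = \<psi> a \<oplus> \<psi> b" if "\<psi> \<in> Phi" "a \<in> AC" "b \<in> AC" for \<psi> a b using that unfolding Phi_def by blast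
 have pz: "\<psi> (act z a) = act z (\<psi> a)" if "\<psi> \<in> Phi" "z \<in> Z" "a \<in> AC" for \<psi> z a using that unfolding Phi_def by blast
 have phic: "!!a. a \<in> AC ==> \<phi> a \<in> AC"
  and phia: "!!x y. x \<in> AC ==> y \<in> AC ==> \<phi> (x \<oplus> y) = \<phi> x \<oplus> \<phi> y"
  using phi(1) unfolding lin_map_def by blast+
 have phiP: "\<phi> \<in> Phi"
  unfolding Phi_def using phic phia Sp_act_comm[OF L_B _ phic phia phi(2,3)] by simp
 have compP: "(%a. act r (\<psi> a)) \<in> Phi" if r: "r \<in> TC" and p: "\<psi> \<in> Phi" for r \<psi>
  unfolding Phi_def
 proof (intro CollectI conjI ballI)
  fix z a assume z: "z \<in> Z" and a: "a \<in> AC"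
  have "act r (\<psi> (act z a)) = act (r \<star> z) (\<psi> a)" using pz[OF p z a] r ZT[OF z] pc[OF p a] by (simp add: act_mult)
  also have "r \<star> z = z \<star> r" using Z_comm[OF z r] by simp
  finally show "act r (\<psi> (act z a)) = act z (act r (\<psi> a))" using r ZT[OF z] pc[OF p a] by (simp add: act_mult)
 qed (simp_all add: r pc[OF p] pa[OF p] act_add_r)
 have comp2: "(%a. \<psi> (act r a)) \<in> Phi" if r: "r \<in> TC" and p: "\<psi> \<in> Phi" for r \<psi>
  unfolding Phi_def
 proof (intro CollectI conjI ballI)
  fix z a assume z: "z \<in> Z" and a: "a \<in> AC"
  have "act r (act z a) = act z (act r a)" using Z_comm[OF z r] r ZT[OF z] a by (metis act_mult)
  then show "\<psi> (act r (act z a)) = act z (\<psi> (act r a))" using pz[OF p z act_closed[OF r a]] by simp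
 qed (simp_all add: r pc[OF p] pa[OF p] act_add_r)
 define G where "G = {t \<in> TC. \<forall>\<psi> \<in> Phi. \<exists>s \<in> TC. \<forall>a \<in> AC. act t (\<psi> a) = act s a}"
 have GI: "t \<in> G" if "t \<in> TC" "!!\<psi>. \<psi> \<in> Phi ==> \<exists>s \<in> TC. \<forall>a \<in> AC. act t (\<psi> a) = act s a" for t
  using that unfolding G_def by blast
 have GD: "\<exists>s \<in> TC. \<forall>a \<in> AC. act t (\<psi> a) = act s a" if "t \<in> G" "\<psi> \<in> Phi" for t \<psi>
  using that unfolding G_def by blast
 have GT: "t \<in> TC" if "t \<in> G" for t using that unfolding G_def by blast
 have G: "ideal G T"
 proof (rule tp.T.ring_idealI)
  show "G \<subseteq> TC" using GT by blast
  show "\<zero>\<^sub>T \<in> G"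
  proof (rule GI)
   fix \<psi> assume p: "\<psi> \<in> Phi"
   show "\<exists>s \<in> TC. \<forall>a \<in> AC. act \<zero>\<^sub>T (\<psi> a) = act s a"
    by (intro bexI[of _ "\<zero>\<^sub>T"] ballI) (simp_all add: act_zero_l pc[OF p])
  qed simp
 next
  fix x y assume x: "x \<in> G" and y: "y \<in> G"
  show "x \<boxplus> y \<in> G"
  proof (rule GI)
   fix \<psi> assume p: "\<psi> \<in> Phi"
   obtain s where s: "s \<in> TC" "\<forall>a \<in> AC. act x (\<psi> a) = act s a" using GD[OF x p] by blast
   obtain s' where s': "s' \<in> TC" "\<forall>a \<in> AC. act y (\<psi> a) = act s' a" using GD[OF y p] by blast
   show "\<exists>s \<in> TC. \<forall>a \<in> AC. act (x \<boxplus> y) (\<psi> a) = act s a"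
    by (intro bexI[of _ "s \<boxplus> s'"] ballI) (simp_all add: act_add_l GT x y s s' pc[OF p])
  qed (simp add: GT x y)
 next
  fix b x assume b: "b \<in> TC" and x: "x \<in> G"
  show "b \<star> x \<in> G"
  proof (rule GI)
   fix \<psi> assume p: "\<psi> \<in> Phi"
   obtain s where s: "s \<in> TC" "\<forall>a \<in> AC. act x (\<psi> a) = act s a" using GD[OF x p] by blast
   show "\<exists>s \<in> TC. \<forall>a \<in> AC. act (b \<star> x) (\<psi> a) = act s a"
    by (intro bexI[of _ "b \<star> s"] ballI) (simp_all add: act_mult GT x b s pc[OF p])
  qed (simp add: GT x b)
  show "x \<star> b \<in> G"
  proof (rule GI)
   fix \<psi> assume p: "\<psi> \<in> Phi"
   obtain s where s: "s \<in> TC" "\<forall>a \<in> AC. act x (act b (\<psi> a)) = act s a" using GD[OF x compP[OF b p]] by blast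
   show "\<exists>s \<in> TC. \<forall>a \<in> AC. act (x \<star> b) (\<psi> a) = act s a"
    by (intro bexI[of _ s] ballI) (simp_all add: act_mult GT x b s pc[OF p])
  qed (simp add: GT x b)
 qed
 have "\<one>\<^sub>T \<in> G"
 proof (rule ccontr)
  assume no: "\<one>\<^sub>T \<notin> G"
  interpret G: ideal G T by (rule G)
  obtain e where e: "e \<in> Z" "e \<star> e = e" "e \<notin> G"
   and einv: "!!z. z \<in> Z ==> z \<noteq> \<zero>\<^sub>T ==> e \<star> z = z ==> \<exists>w \<in> Z. z \<star> w = e"
   by (rule primitive_central_idempotent[OF sL G no]) blast
  have eT: "e \<in> TC" by (rule ZT[OF e(1)])
  have e0: "e \<noteq> \<zero>\<^sub>T" using e(3) G.zero_closed by auto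
  \<comment> \<open>\<open>S = e T\<close>. Every nonzero ideal of \<open>T\<close> meets
    \<open>Z\<close>, and within \<open>S\<close> it meets the field \<open>e Z\<close>, so it
    contains \<open>e\<close>: hence \<open>S\<close> is a simple component.\<close>
  define S where "S = {t \<in> TC. e \<star> t = t}"
  have ST: "t \<in> TC" and eS: "e \<star> t = t" if "t \<in> S" for t using that unfolding S_def by auto
  have Se: "t \<star> e = t" if "t \<in> S" for t using Z_comm[OF e(1) ST[OF that]] eS[OF that] by simp
  have SI: "e \<star> t \<in> S" if "t \<in> TC" for t
   unfolding S_def using tp.T.m_assoc[OF eT eT that] e(2) eT that by simp
  have eeS: "e \<in> S" unfolding S_def using e eT by simp
  have S: "ideal S T"
  proof (rule tp.T.ring_idealI)
   fix b x assume b: "b \<in> TC" and x: "x \<in> S"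
   have "e \<star> (b \<star> x) = b \<star> (e \<star> x)"
    using tp.T.m_assoc[OF eT b ST[OF x]] tp.T.m_assoc[OF b eT ST[OF x]] Z_comm[OF e(1) b] by simp
   then show "b \<star> x \<in> S" unfolding S_def using b ST[OF x] eS[OF x] by simp
   show "x \<star> b \<in> S" unfolding S_def using b ST[OF x] eS[OF x] tp.T.m_assoc[OF eT ST[OF x] b] by simp
  qed (use eT in \<open>auto simp: S_def tp.T.r_distr\<close>)
  have Smin: "J = {\<zero>\<^sub>T} \<or> J = S" if J: "ideal J T" "J \<subseteq> S" for J
  proof (cases "J = {\<zero>\<^sub>T}")
   case False
   interpret J: ideal J T by (rule J)
   have "\<zero>\<^sub>T \<in> J" by (rule J.zero_closed)
   then obtain t where t: "t \<in> J" "t \<noteq> \<zero>\<^sub>T" using False by blast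
   obtain z where z: "z \<in> J" "z \<in> Z" "z \<noteq> \<zero>\<^sub>T" using ideal_meets_center[OF J(1) t] by blast
   have "e \<star> z = z" by (rule eS) (use z(1) J(2) in blast)
   then obtain w where w: "w \<in> Z" "z \<star> w = e" using einv[OF z(2,3)] by blast
   have eJ: "e \<in> J" using J.I_r_closed[OF z(1) ZT[OF w(1)]] w(2) by simp
   have "S \<subseteq> J"
   proof
    fix s assume s: "s \<in> S"
    show "s \<in> J" using J.I_r_closed[OF eJ ST[OF s]] eS[OF s] by simp
   qed
   then show ?thesis using J(2) by blast
  qed simp
  have "simple_component T S"
   unfolding simple_component_def using S Smin eeS e0 by blast
  then have mt: "matrix_over_center (component_ring T S)" using qaD(8) unfolding normal_algebra_def by blast
  have eSe: "e \<star> x = x \<and> x \<star> e = x" if "x \<in> S" for x using eS[OF that] Se[OF that] by simp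
  obtain f where f: "f \<in> S" "f \<star> f = f" "f \<noteq> \<zero>\<^sub>T"
   and fSf: "!!x. x \<in> S ==> \<exists>z \<in> S. (\<forall>y \<in> S. z \<star> y = y \<star> z) \<and> f \<star> (x \<star> f) = z \<star> f"
   apply (rule tp.T.matrix_corner[OF S eeS eSe e0 mt])
    apply assumption
   subgoal premises p for f using p(2-) by (rule p(1))
   done
  have fT: "f \<in> TC" by (rule ST[OF f(1)])
  have SZ: "z \<in> Z" if z: "z \<in> S" "\<forall>y \<in> S. z \<star> y = y \<star> z" for z
  proof (rule cent_Sp[OF subset_refl ST[OF z(1)]])
   have zT: "z \<in> TC" by (rule ST[OF z(1)])
   have "t \<star> z = z \<star> t" if t: "t \<in> TC" for t
   proof -
    have "t \<star> z = (e \<star> t) \<star> z" using tp.T.m_assoc[OF t eT zT] Z_comm[OF e(1) t] eS[OF z(1)] by simp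
    also have "\<dots> = z \<star> (e \<star> t)" using z(2) SI[OF t] by simp
    also have "\<dots> = z \<star> t" using tp.T.m_assoc[OF zT eT t] Se[OF z(1)] by simp
    finally show ?thesis .
   qed
   then show "tns u \<one> \<star> z = z \<star> tns u \<one>" "tns \<one> u \<star> z = z \<star> tns \<one> u" if "u \<in> B" for u
    using that Bone by simp_all
  qed
  \<comment> \<open>The two-sided ideal generated by \<open>f\<close>; it is all of
    \<open>S\<close>, so \<open>e = \<Sum> p_j f q_j\<close>.\<close>
  define J where "J = {nsum T (%j. p j \<star> (f \<star> q j)) m | p q m. (\<forall>j. p j \<in> TC) \<and> (\<forall>j. q j \<in> TC)}"
  have JI: "nsum T (%j. p j \<star> (f \<star> q j)) m \<in> J" if "!!j. p j \<in> TC" "!!j. q j \<in> TC" for p q m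
   unfolding J_def using that by blast
  have JE: "\<exists>p q m. x = nsum T (%j. p j \<star> (f \<star> q j)) m \<and> (\<forall>j. p j \<in> TC) \<and> (\<forall>j. q j \<in> TC)" if "x \<in> J" for x
   using that unfolding J_def by blast
  have Jid: "ideal J T"
  proof (rule tp.T.ring_idealI)
   show "J \<subseteq> TC"
   proof
    fix x assume "x \<in> J"
    then obtain p q m where "x = nsum T (%j. p j \<star> (f \<star> q j)) m" "\<forall>j. p j \<in> TC" "\<forall>j. q j \<in> TC"
     using JE[OF \<open>x \<in> J\<close>] by blast
    then show "x \<in> TC" using fT by simp
   qed
   show "\<zero>\<^sub>T \<in> J" using JI[of "%_. \<zero>\<^sub>T" "%_. \<zero>\<^sub>T" 0] by simp
  next
   fix x y assume "x \<in> J" "y \<in> J"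
   obtain p q m where x: "x = nsum T (%j. p j \<star> (f \<star> q j)) m" "\<forall>j. p j \<in> TC" "\<forall>j. q j \<in> TC"
    using JE[OF \<open>x \<in> J\<close>] by blast
   obtain p' q' m' where y: "y = nsum T (%j. p' j \<star> (f \<star> q' j)) m'" "\<forall>j. p' j \<in> TC" "\<forall>j. q' j \<in> TC"
    using JE[OF \<open>y \<in> J\<close>] by blast
   let ?p = "%j. if j < m then p j else p' (j - m)" and ?q = "%j. if j < m then q j else q' (j - m)"
   have "nsum T (%j. ?p j \<star> (f \<star> ?q j)) (m + m') =
    nsum T (%j. if j < m then p j \<star> (f \<star> q j) else p' (j - m) \<star> (f \<star> q' (j - m))) (m + m')"
    by (rule nsum_cong) simp
   also have "\<dots> = x \<boxplus> y" unfolding x(1) y(1) by (rule tp.T.nsum_append) (use x y fT in simp_all)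
   finally have "x \<boxplus> y = nsum T (%j. ?p j \<star> (f \<star> ?q j)) (m + m')" by simp
   moreover have "nsum T (%j. ?p j \<star> (f \<star> ?q j)) (m + m') \<in> J" by (rule JI) (use x y in simp_all)
   ultimately show "x \<boxplus> y \<in> J" by simp
  next
   fix b x assume b: "b \<in> TC" and "x \<in> J"
   then obtain p q m where x: "x = nsum T (%j. p j \<star> (f \<star> q j)) m" "\<forall>j. p j \<in> TC" "\<forall>j. q j \<in> TC"
    using JE[OF \<open>x \<in> J\<close>] by blast
   have "b \<star> x = nsum T (%j. b \<star> (p j \<star> (f \<star> q j))) m" unfolding x(1)
    by (rule tp.T.endo_nsum[where h = "%t. b \<star> t"])
     (use b x fT in \<open>simp_all add: tp.T.r_distr\<close>)
   also have "\<dots> = nsum T (%j. (b \<star> p j) \<star> (f \<star> q j)) m"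
    by (rule nsum_cong) (use b x fT in \<open>simp add: tp.T.m_assoc\<close>)
   finally show "b \<star> x \<in> J" using JI[of "%j. b \<star> p j" q m] b x by simp
   have "x \<star> b = nsum T (%j. p j \<star> (f \<star> q j) \<star> b) m" unfolding x(1)
    by (rule tp.T.endo_nsum[where h = "%t. t \<star> b"])
     (use b x fT in \<open>simp_all add: tp.T.l_distr\<close>)
   also have "\<dots> = nsum T (%j. p j \<star> (f \<star> (q j \<star> b))) m"
    by (rule nsum_cong) (use b x fT in \<open>simp add: tp.T.m_assoc\<close>)
   finally show "x \<star> b \<in> J" using JI[of p "%j. q j \<star> b" m] b x by simp
  qed
  interpret Si: ideal S T by (rule S)
  have JS: "J \<subseteq> S"
  proof
   fix x assume "x \<in> J"
   then obtain p q m where x: "x = nsum T (%j. p j \<star> (f \<star> q j)) m" "\<forall>j. p j \<in> TC" "\<forall>j. q j \<in> TC"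
    using JE[OF \<open>x \<in> J\<close>] by blast
   show "x \<in> S" unfolding x(1)
    by (rule tp.T.nsum_in) (use x Si.a_subset Si.zero_closed Si.a_closed f(1) Si.I_l_closed Si.I_r_closed in auto)
  qed
  have fJ: "f \<in> J" using JI[of "%_. \<one>\<^sub>T" "%_. \<one>\<^sub>T" 1] fT by simp
  then have "J = S" using Smin[OF Jid JS] f(3) by blast
  then obtain p q m where pq: "e = nsum T (%j. p j \<star> (f \<star> q j)) m" "!!j. p j \<in> TC" "!!j. q j \<in> TC"
   using JE[of e] eeS by blast
  have "\<exists>a' \<in> AC. act f a' \<noteq> \<zero>" using faithful[OF fT] f(3) by blast
  then obtain a' where a': "a' \<in> AC" "act f a' \<noteq> \<zero>" by blast
  \<comment> \<open>A nonzero vector fixed by \<open>f\<close>; it is going to generate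
    \<open>e A\<close>.\<close>
  define a where "a = act f a'"
  have a: "a \<in> AC" unfolding a_def using fT a'(1) by simp
  have fa: "act f a = a" unfolding a_def using act_mult[OF fT fT a'(1)] f(2) by simp
  have a0: "a \<noteq> \<zero>" using a'(2) a_def by simp
  \<comment> \<open>\<open>S a + (1 - e) A\<close> is a faithful submodule and thus equals
    \<open>A\<close> by minimality. Applying \<open>e\<close> gives
    \<open>e A = S a\<close>.\<close>
  define Pm where "Pm = {act s a \<oplus> (x \<ominus> act e x) | s x. s \<in> S \<and> x \<in> AC}"
  have PmI: "act s a \<oplus> (x \<ominus> act e x) \<in> Pm" if "s \<in> S" "x \<in> AC" for s x unfolding Pm_def using that by blast
  have PmE: "\<exists>s x. w = act s a \<oplus> (x \<ominus> act e x) \<and> s \<in> S \<and> x \<in> AC" if "w \<in> Pm" for w using that unfolding Pm_def by blast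
  have Pstable: "act t w \<in> Pm" if t: "t \<in> TC" and "w \<in> Pm" for t w
  proof -
   obtain s x where sx: "w = act s a \<oplus> (x \<ominus> act e x)" "s \<in> S" "x \<in> AC" using PmE[OF \<open>w \<in> Pm\<close>] by blast
   have sT: "s \<in> TC" by (rule ST[OF sx(2)])
   have "act t (act e x) = act e (act t x)" using Z_comm[OF e(1) t] act_mult[OF t eT sx(3)] act_mult[OF eT t sx(3)] by simp
   then have "act t (x \<ominus> act e x) = act t x \<ominus> act e (act t x)"
    using additive_minus[OF abelian_group_axioms abelian_group_axioms, where h = "act t" and x = x and y = "act e x"]
     act_add_r[OF t] t eT sx(3) by simp
   then have "act t w = act (t \<star> s) a \<oplus> (act t x \<ominus> act e (act t x))"
    unfolding sx(1) using act_add_r[OF t, of "act s a" "x \<ominus> act e x"] act_mult[OF t sT a] sT a eT sx(3) by simp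
   then show ?thesis using PmI[of "t \<star> s" "act t x"] Si.I_l_closed[OF sx(2) t] t sx(3) by simp
  qed
  have Psub: "subsp Pm"
  proof (rule subspI)
   show "Pm \<subseteq> AC" using PmE ST a eT by force
   show "\<zero> \<in> Pm" using PmI[OF Si.zero_closed zero_closed] a eT r_neg[OF zero_closed] by (simp add: act_zero_l act_zero_r minus_eq)
  next
   fix v w assume v: "v \<in> Pm" and w: "w \<in> Pm"
   obtain s x where sx: "v = act s a \<oplus> (x \<ominus> act e x)" "s \<in> S" "x \<in> AC" using PmE[OF v] by blast
   obtain s' x' where sx': "w = act s' a \<oplus> (x' \<ominus> act e x')" "s' \<in> S" "x' \<in> AC" using PmE[OF w] by blast
   have c: "act s a \<in> AC" "act s' a \<in> AC" "act e x \<in> AC" "act e x' \<in> AC"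
    using ST[OF sx(2)] ST[OF sx'(2)] a eT sx(3) sx'(3) by simp_all
   have "v \<oplus> w = act (s \<boxplus> s') a \<oplus> ((x \<oplus> x') \<ominus> act e (x \<oplus> x'))"
    unfolding sx(1) sx'(1) act_add_l[OF ST[OF sx(2)] ST[OF sx'(2)] a] act_add_r[OF eT sx(3) sx'(3)]
    using c sx(3) sx'(3) by (simp add: minus_eq minus_add a_ac)
   then show "v \<oplus> w \<in> Pm" using PmI[of "s \<boxplus> s'" "x \<oplus> x'"] Si.a_closed[OF sx(2) sx'(2)] sx(3) sx'(3) by simp
  next
   fix c w assume c: "c \<in> carrier F" and w: "w \<in> Pm"
   have wA: "w \<in> AC" using PmE[OF w] ST a eT by force
   have "act (tns (c \<odot> \<one>) \<one>) w = c \<odot> w" using c wA Bone by (simp add: act_tns Bsmult mult_smult_l mult_smult_r mult_l_one mult_r_one)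
   then show "c \<odot> w \<in> Pm" using Pstable[OF sone[OF c] w] by simp
  qed
  have "Pm = AC"
  proof (rule minimal[OF Psub])
   fix b c w assume bc: "b \<in> B" "c \<in> B" and w: "w \<in> Pm"
   show "(b \<otimes> w) \<otimes> c \<in> Pm" using Pstable[of "tns b c" w] bc w subspD(7)[OF Psub w] by (simp add: act_tns)
  next
   fix r assume r: "r \<in> TC" and z: "!!x. x \<in> Pm ==> act r x = \<zero>"
   have re: "r = r \<star> e"
   proof (rule faithful_eq)
    fix x assume x: "x \<in> AC"
    have "\<zero> \<oplus> (x \<ominus> act e x) \<in> Pm" using PmI[OF Si.zero_closed x] a by (simp add: act_zero_l)
    then have "x \<ominus> act e x \<in> Pm" using x eT by simp
    then have "act r (x \<ominus> act e x) = \<zero>" by (rule z)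
    moreover have "act r (x \<ominus> act e x) = act r x \<ominus> act r (act e x)"
     by (rule additive_minus[OF abelian_group_axioms abelian_group_axioms]) (use r x eT act_add_r[OF r] in simp_all)
    ultimately have "act r x = act r (act e x)" using minus_zero_imp_eq[of "act r x" "act r (act e x)"] r x eT by simp
    then show "act r x = act (r \<star> e) x" using act_mult[OF r eT x] by simp
   qed (use r eT in simp_all)
   have rS: "r \<in> S" using SI[OF r] Z_comm[OF e(1) r] re by simp
   have rs: "act r (act s a) = \<zero>" if s: "s \<in> S" for s
   proof -
    have "act s a \<oplus> (\<zero> \<ominus> act e \<zero>) \<in> Pm" by (rule PmI[OF s zero_closed])
    then have "act s a \<in> Pm" using ST[OF s] a eT r_neg[OF zero_closed] by (simp add: act_zero_r minus_eq)
    then show ?thesis by (rule z)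
   qed
   \<comment> \<open>The annihilator of \<open>S a\<close> in \<open>S\<close>. It is an ideal of
     \<open>T\<close> that misses \<open>f\<close>, because \<open>f (f a) = a\<close> is nonzero,
     so it vanishes by simplicity of the component.\<close>
   define H where "H = {t \<in> S. \<forall>s \<in> S. act t (act s a) = \<zero>}"
   have Hid: "ideal H T"
   proof (rule tp.T.ring_idealI)
    show "H \<subseteq> TC" unfolding H_def using ST by blast
    show "\<zero>\<^sub>T \<in> H" unfolding H_def using Si.zero_closed ST a by (simp add: act_zero_l)
    show "x \<boxplus> y \<in> H" if "x \<in> H" "y \<in> H" for x y
     using that unfolding H_def using Si.a_closed ST a by (simp add: act_add_l)
    fix b x assume b: "b \<in> TC" and x: "x \<in> H"
    then have xS: "x \<in> S" and xz: "!!s. s \<in> S ==> act x (act s a) = \<zero>" unfolding H_def by auto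
    have xT: "x \<in> TC" by (rule ST[OF xS])
    show "b \<star> x \<in> H" unfolding H_def
     using Si.I_l_closed[OF xS b] xz ST a b xT by (simp add: act_mult act_zero_r)
    have "act (x \<star> b) (act s a) = \<zero>" if s: "s \<in> S" for s
     using xz[OF Si.I_l_closed[OF s b]] act_mult[OF b ST[OF s] a] act_mult[OF xT b, of "act s a"] ST[OF s] a by simp
    then show "x \<star> b \<in> H" unfolding H_def using Si.I_r_closed[OF xS b] by simp
   qed
   have "f \<notin> H" unfolding H_def using f(1) fa a0 by force
   then have "H = {\<zero>\<^sub>T}" using Smin[OF Hid] f(1) unfolding H_def by blast
   moreover have "r \<in> H" unfolding H_def using rS rs by simp
   ultimately show "r = \<zero>\<^sub>T" by blast
  qed
  then have ex: "\<exists>s \<in> S. act e x = act s a" if x: "x \<in> AC" for x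
  proof -
   have "x \<in> Pm" using x \<open>Pm = carrier A\<close> by simp
   then obtain s y where sy: "x = act s a \<oplus> (y \<ominus> act e y)" "s \<in> S" "y \<in> AC" using PmE by blast
   have c: "act s a \<in> AC" "act e y \<in> AC" using ST[OF sy(2)] a eT sy(3) by simp_all
   have "act e (y \<ominus> act e y) = act e y \<ominus> act e (act e y)"
    by (rule additive_minus[OF abelian_group_axioms abelian_group_axioms]) (use eT sy(3) act_add_r[OF eT] in simp_all)
   also have "\<dots> = \<zero>" using act_mult[OF eT eT sy(3)] e(2) c by (simp add: minus_eq r_neg)
   finally have "act e x = act e (act s a)"
    unfolding sy(1) using act_add_r[OF eT c(1), of "y \<ominus> act e y"] sy(3) c eT by simp
   also have "\<dots> = act s a" using act_mult[OF eT ST[OF sy(2)] a] eS[OF sy(2)] by simp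
   finally show ?thesis using sy(2) by blast
  qed
  have "e \<in> G"
  proof (rule GI[OF eT])
   fix \<psi> assume p: "\<psi> \<in> Phi"
   have psi0: "\<psi> \<zero> = \<zero>"
    by (rule additive_zero[OF abelian_group_axioms abelian_group_axioms]) (simp_all add: pc[OF p] pa[OF p])
   \<comment> \<open>Each \<open>e \<psi> (p_j a)\<close> lies in \<open>e A = S a\<close>; write it
     as \<open>s_j a\<close>. For any \<open>x\<close> let \<open>e x = r a\<close>. By the property
     of \<open>f\<close> there are \<open>z_j\<close> in \<open>Z\<close> with
     \<open>f q_j r f = z_j f\<close>, whence \<open>e x = \<Sum> z_j p_j a\<close>. As
     \<open>\<psi>\<close> commutes with \<open>Z\<close>, it follows that
     \<open>e \<psi> (x) = \<Sum> z_j s_j a = \<Sum> s_j f q_j r a\<close>, and the coefficients on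
     the right do not depend on \<open>x\<close>.\<close>
   have sj: "\<exists>s. s \<in> S \<and> act e (\<psi> (act (p j) a)) = act s a" for j
    using ex[of "\<psi> (act (p j) a)"] pc[OF p, of "act (p j) a"] pq(2)[of j] a by auto
   then obtain s where s: "!!j. s j \<in> S" "!!j. act e (\<psi> (act (p j) a)) = act (s j) a" by metis
   have sT: "s j \<in> TC" for j by (rule ST[OF s(1)])
   define t where "t = nsum T (%j. s j \<star> (f \<star> q j)) m"
   have tT: "t \<in> TC" unfolding t_def using sT fT pq(3) by simp
   have te: "t \<star> e \<in> TC" using tT eT by simp
   have "act e (\<psi> x) = act (t \<star> e) x" if x: "x \<in> AC" for x
   proof -
    obtain r where r: "r \<in> S" "act e x = act r a" using ex[OF x] by blast
    have rT: "r \<in> TC" by (rule ST[OF r(1)])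
    have "\<exists>z. z \<in> Z \<and> f \<star> ((q j \<star> r) \<star> f) = z \<star> f" for j
    proof -
     have "q j \<star> r \<in> S" by (rule Si.I_l_closed[OF r(1) pq(3)])
     from fSf[OF this] show ?thesis using SZ by blast
    qed
    then obtain z where z: "!!j. z j \<in> Z" "!!j. f \<star> ((q j \<star> r) \<star> f) = z j \<star> f" by metis
    have zT: "z j \<in> TC" for j by (rule ZT[OF z(1)])
    have fq: "act (f \<star> q j) (act r a) = act (z j) a" for j
    proof -
     have "act (f \<star> q j) (act r a) = act (f \<star> q j) (act r (act f a))" by (simp add: fa)
     also have "\<dots> = act (f \<star> ((q j \<star> r) \<star> f)) a"
      using fT pq(3)[of j] rT a by (simp add: act_mult)
     also have "\<dots> = act (z j) (act f a)" unfolding z(2) using zT fT a by (simp add: act_mult)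
     finally show ?thesis by (simp add: fa)
    qed
    have fqc: "f \<star> q j \<in> TC" for j using fT pq(3) by simp
    have ra: "act r a \<in> AC" using rT a by simp
    have er: "act e (act r a) = act r a" using act_mult[OF eT rT a] eS[OF r(1)] by simp
    have sum1: "act r a = nsum A (%j. act (z j) (act (p j) a)) m"
    proof -
     have "act e (act r a) = nsum A (%j. act (p j \<star> (f \<star> q j)) (act r a)) m"
      by (subst pq(1), rule act_nsum[OF ra]) (use pq(2) fqc in simp)
     also have "\<dots> = nsum A (%j. act (z j) (act (p j) a)) m"
     proof (rule nsum_cong)
      fix j
      have "act (p j \<star> (f \<star> q j)) (act r a) = act (p j) (act (z j) a)"
       using act_mult[OF pq(2) fqc ra, of j j] fq[of j] by simp
      also have "\<dots> = act (z j) (act (p j) a)"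
       using Z_comm[OF z(1) pq(2), of j j] act_mult[OF pq(2) zT a, of j j] act_mult[OF zT pq(2) a, of j j] by simp
      finally show "act (p j \<star> (f \<star> q j)) (act r a) = act (z j) (act (p j) a)" .
     qed
     finally show ?thesis unfolding er .
    qed
    have pja: "act (p j) a \<in> AC" for j using pq(2) a by simp
    have "act e (\<psi> x) = \<psi> (act e x)" using pz[OF p e(1) x] by simp
    also have "\<dots> = \<psi> (act r a)" by (simp add: r(2))
    also have "\<dots> = nsum A (%j. \<psi> (act (z j) (act (p j) a))) m" unfolding sum1
     by (rule additive_nsum[OF abelian_group_axioms abelian_group_axioms]) (simp_all add: pc[OF p] pa[OF p] zT pja)
    finally have l0: "act e (\<psi> x) = nsum A (%j. \<psi> (act (z j) (act (p j) a))) m" .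
    have "act e (act e (\<psi> x)) = act e (\<psi> x)" using act_mult[OF eT eT pc[OF p x]] e(2) by simp
    moreover have "act e (nsum A (%j. \<psi> (act (z j) (act (p j) a))) m) = nsum A (%j. act e (\<psi> (act (z j) (act (p j) a)))) m"
     by (rule additive_nsum[OF abelian_group_axioms abelian_group_axioms]) (simp_all add: eT act_add_r pc[OF p] zT pja)
    ultimately have l1: "act e (\<psi> x) = nsum A (%j. act e (\<psi> (act (z j) (act (p j) a)))) m" using l0 by simp
    have "act (t \<star> e) x = act t (act r a)" using act_mult[OF tT eT x] r(2) by simp
    also have "\<dots> = nsum A (%j. act (s j \<star> (f \<star> q j)) (act r a)) m" unfolding t_def
     by (rule act_nsum[OF ra]) (use sT fqc in simp)
    also have "\<dots> = nsum A (%j. act e (\<psi> (act (z j) (act (p j) a)))) m"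
    proof (rule nsum_cong)
     fix j
     have "act (s j \<star> (f \<star> q j)) (act r a) = act (s j) (act (z j) a)"
      using act_mult[OF sT fqc ra, of j j] fq[of j] by simp
     also have "\<dots> = act (z j) (act (s j) a)"
      using Z_comm[OF z(1) sT, of j j] act_mult[OF sT zT a, of j j] act_mult[OF zT sT a, of j j] by simp
     also have "\<dots> = act (z j) (act e (\<psi> (act (p j) a)))" by (simp add: s(2))
     also have "\<dots> = act e (act (z j) (\<psi> (act (p j) a)))"
      using Z_comm[OF z(1) eT, of j] act_mult[OF eT zT pc[OF p pja], of j j] act_mult[OF zT eT pc[OF p pja], of j j] by simp
     also have "\<dots> = act e (\<psi> (act (z j) (act (p j) a)))" using pz[OF p z(1) pja, of j j] by simp
     finally show "act (s j \<star> (f \<star> q j)) (act r a) = act e (\<psi> (act (z j) (act (p j) a)))" .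
    qed
    finally show ?thesis using l1 by simp
   qed
   then show "\<exists>s \<in> TC. \<forall>a \<in> AC. act e (\<psi> a) = act s a" using te by blast
  qed
  then show False using e(3) by simp
 qed
 from GD[OF this phiP] obtain s where s: "s \<in> TC" "\<forall>a \<in> AC. act \<one>\<^sub>T (\<phi> a) = act s a" by blast
 then have "\<forall>a \<in> AC. \<phi> a = act s a" using phic by (simp add: act_one)
 then show ?thesis using s(1) by blast
qed

end

section \<open>Values of coefficient lists and of their derivatives\<close>

context ring begin

lemma eval_nsum:
 assumes "set p \<subseteq> carrier R" "x \<in> carrier R"
 shows "eval p x = nsum R (%k. coeff p k \<otimes> x [^] k) (length p)"
 using assms(1)
proof (induction p)
 case (Cons a p)
 have "nsum R (%k. coeff (a # p) k \<otimes> x [^] k) (length p) = nsum R (%k. coeff p k \<otimes> x [^] k) (length p)"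
  by (rule nsum_cong) simp
 moreover have "nsum R (%k. coeff p k \<otimes> x [^] k) (length p) \<in> carrier R"
  by (rule nsum_closed) (use Cons.prems assms(2) in simp)
 ultimately show ?case using Cons assms(2) by (simp add: a_comm)
qed simp

lemma formal_deriv_set:
 "set (map (%i. add_pow R (Suc i) (coeff p (Suc i))) (rev [0..<n])) \<subseteq> carrier R" if "set p \<subseteq> carrier R"
 using that by auto

lemma eval_formal_deriv:
 assumes "set p \<subseteq> carrier R" "x \<in> carrier R"
 shows "eval (formal_deriv R p) x = nsum R (%k. add_pow R (Suc k) (coeff p (Suc k)) \<otimes> x [^] k) (length p - 1)"
proof -
 let ?g = "%i. add_pow R (Suc i) (coeff p (Suc i))" and ?n = "length p - 1"
 let ?q = "map ?g (rev [0..<?n])"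
 have c: "coeff ?q k = ?g k" if "k < ?n" for k
 proof -
  have "coeff ?q k = ?q ! (length ?q - 1 - k)" by (rule coeff_nth) (use that in simp)
  also have "\<dots> = ?g (rev [0..<?n] ! (?n - 1 - k))" using that by (subst nth_map) simp_all
  also have "rev [0..<?n] ! (?n - 1 - k) = k" using that by (subst rev_nth) simp_all
  finally show ?thesis .
 qed
 have "eval (formal_deriv R p) x = eval ?q x"
  unfolding formal_deriv_def by (rule eval_normalize[OF formal_deriv_set[OF assms(1)] assms(2)])
 also have "\<dots> = nsum R (%k. coeff ?q k \<otimes> x [^] k) (length ?q)"
  by (rule eval_nsum[OF formal_deriv_set[OF assms(1)] assms(2)])
 also have "length ?q = ?n" by simp
 also have "nsum R (%k. coeff ?q k \<otimes> x [^] k) ?n = nsum R (%k. ?g k \<otimes> x [^] k) ?n"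
  by (rule nsum_cong) (simp only: c)
 finally show ?thesis .
qed

lemma formal_deriv_carrier:
 assumes "subring K R" "p \<in> carrier (univ_poly R K)"
 shows "formal_deriv R p \<in> carrier (univ_poly R K)"
proof -
 have sp: "set p \<subseteq> K" using assms(2) unfolding univ_poly_carrier[symmetric] polynomial_def by auto
 have z: "\<zero> \<in> K" by (rule subringE(2)[OF assms(1)])
 have c: "coeff p i \<in> K" for i using sp z by (induction p) auto
 have "add_pow R (n :: nat) y \<in> K" if "y \<in> K" for n y
  using that subringE(2,7)[OF assms(1)] by (induction n) (simp_all add: add_pow_def)
 then have "set (map (%i. add_pow R (Suc i) (coeff p (Suc i))) (rev [0..<length p - 1])) \<subseteq> K"
  using c by (simp only: set_map set_rev set_upt) blast
 then show ?thesis unfolding formal_deriv_def univ_poly_carrier[symmetric] by (rule normalize_gives_polynomial)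
qed

end

section \<open>Minimal polynomials as coefficient sequences\<close>

context division_algebra begin

abbreviation "base \<equiv> (%c. c \<odot> \<one>) ` carrier F"

lemma base_subalg: "subalg base"
 unfolding subalg_def
proof (intro conjI ballI)
 show "subsp base"
 proof (rule subspI)
  show "\<zero> \<in> base" by (rule image_eqI[of _ _ "\<zero>\<^bsub>F\<^esub>"]) (simp_all add: smult_l_null)
  show "x \<oplus> y \<in> base" if xy: "x \<in> base" "y \<in> base" for x y
  proof -
   obtain c d where "c \<in> carrier F" "x = c \<odot> \<one>" "d \<in> carrier F" "y = d \<odot> \<one>" using xy by blast
   then show ?thesis by (intro image_eqI[of _ _ "c \<oplus>\<^bsub>F\<^esub> d"]) (simp_all add: smult_l_distr)
  qed
  show "c \<odot> x \<in> base" if c: "c \<in> carrier F" and x: "x \<in> base" for c x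
  proof -
   obtain d where "d \<in> carrier F" "x = d \<odot> \<one>" using x by blast
   then show ?thesis using c by (intro image_eqI[of _ _ "c \<otimes>\<^bsub>F\<^esub> d"]) (simp_all add: smult_assoc1)
  qed
 qed auto
 show "\<one> \<in> base" by (rule image_eqI[of _ _ "\<one>\<^bsub>F\<^esub>"]) simp_all
 fix x y assume xy: "x \<in> base" "y \<in> base"
 obtain c d where cd: "c \<in> carrier F" "x = c \<odot> \<one>" "d \<in> carrier F" "y = d \<odot> \<one>" using xy by blast
 have "x \<otimes> y = c \<odot> (\<one> \<otimes> (d \<odot> \<one>))" unfolding cd(2,4) by (rule mult_smult_l) (use cd in simp_all)
 also have "\<dots> = (c \<otimes>\<^bsub>F\<^esub> d) \<odot> \<one>" using cd by (simp add: smult_assoc1)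
 finally have "x \<otimes> y = (c \<otimes>\<^bsub>F\<^esub> d) \<odot> \<one>" .
 then show "x \<otimes> y \<in> base" using cd by simp
qed

lemma field_of_comm:
 assumes comm: "\<forall>x \<in> carrier A. \<forall>y \<in> carrier A. x \<otimes> y = y \<otimes> x"
 shows "field A" "subfield base A"
proof -
 interpret A: cring A
  by (intro cring.intro ring_axioms comm_monoid.intro monoid_axioms comm_monoid_axioms.intro comm[rule_format])
 show f: "field A"
 proof (rule A.cring_fieldI2)
  show "\<zero> \<noteq> \<one>" using one_nz by simp
  show "\<exists>b \<in> carrier A. a \<otimes> b = \<one>" if "a \<in> carrier A" "a \<noteq> \<zero>" for a using inv_ex[OF that] by blast
 qed
 interpret A: field A by (rule f)
 have bc: "base \<subseteq> carrier A" by auto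
 show "subfield base A"
 proof (rule A.subfieldI')
  note b = base_subalg[THEN subalgD(1)]
  show "subring base A"
   by (rule subringI[OF bc subalgD(2)[OF base_subalg] subspD(4)[OF b] subalgD(3)[OF base_subalg] subspD(3)[OF b]])
  fix k assume k: "k \<in> base - {\<zero>}"
  then obtain y where y: "y \<in> base" "k \<otimes> y = \<one>" using inv_in_subalg[OF base_subalg, of k] by blast
  have "inv k = y" by (rule A.comm_inv_char) (use y k bc in auto)
  then show "inv k \<in> base" using y(1) by simp
 qed
qed

lemma relation_poly:
 assumes "x \<in> carrier A" "!!k. a k \<in> carrier F" "a n = \<one>\<^bsub>F\<^esub>"
 shows "\<exists>p \<in> carrier (univ_poly A base). p \<noteq> [] \<and> degree p = n \<and> eval p x = nsum A (%k. a k \<odot> x [^] k) (Suc n)"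
proof
 let ?p = "map (%i. a i \<odot> \<one>) (rev [0..<Suc n])"
 have set: "set ?p \<subseteq> base" using assms(2) by auto
 have setA: "set ?p \<subseteq> carrier A" using assms(2) by auto
 show "?p \<in> carrier (univ_poly A base)"
  unfolding univ_poly_carrier[symmetric] polynomial_def using set one_nz assms(3) by simp
 have c: "coeff ?p k = a k \<odot> \<one>" if "k < Suc n" for k
 proof -
  have "coeff ?p k = ?p ! (length ?p - 1 - k)" by (rule coeff_nth) (use that in simp)
  also have "\<dots> = map (%i. a i \<odot> \<one>) (rev [0..<Suc n]) ! (n - k)" by (simp only: length_map length_rev length_upt) simp
  also have "\<dots> = a (rev [0..<Suc n] ! (n - k)) \<odot> \<one>" by (rule nth_map) (use that in simp)
  also have "rev [0..<Suc n] ! (n - k) = k" using that by (subst rev_nth) (simp_all del: upt_Suc)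
  finally show ?thesis .
 qed
 have "eval ?p x = nsum A (%k. coeff ?p k \<otimes> x [^] k) (length ?p)" by (rule eval_nsum[OF setA assms(1)])
 also have "length ?p = Suc n" by simp
 also have "nsum A (%k. coeff ?p k \<otimes> x [^] k) (Suc n) = nsum A (%k. a k \<odot> x [^] k) (Suc n)"
  using c assms(1,2) by (intro nsum_cong) (simp add: mult_smult_l mult_l_one)
 finally show "?p \<noteq> [] \<and> degree ?p = n \<and> eval ?p x = nsum A (%k. a k \<odot> x [^] k) (Suc n)" by simp
qed

lemma algebraic_base:
 assumes "x \<in> carrier A" shows "(algebraic over base) x"
proof -
 obtain a n where a: "\<forall>k. a k \<in> carrier F" "a n = \<one>\<^bsub>F\<^esub>" "nsum A (%k. a k \<odot> x [^] k) (Suc n) = \<zero>"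
  using monic_ex[OF assms] by blast
 obtain p where p: "p \<in> carrier (univ_poly A base)" "p \<noteq> []" "eval p x = nsum A (%k. a k \<odot> x [^] k) (Suc n)"
  using relation_poly[where a = a, OF assms _ a(2)] a(1) by blast
 show ?thesis by (rule algebraicI[OF p(1,2)]) (simp only: p(3) a(3))
qed

text \<open>An irreducible polynomial is coprime to its derivative unless it divides it, and for the
  minimal polynomial of \<open>x\<close> divisibility means that the derivative vanishes at
  \<open>x\<close>. This translates \<open>separable_element\<close> into a statement about sums;
  the minimality of \<open>n\<close> is what makes the difference quotient nonzero later.\<close>

lemma Irr_relation:
 assumes comm: "\<forall>x \<in> carrier A. \<forall>y \<in> carrier A. x \<otimes> y = y \<otimes> x" and x: "x \<in> carrier A"
 obtains a n where "!!k. a k \<in> carrier F" "a n = \<one>\<^bsub>F\<^esub>" "nsum A (%k. a k \<odot> x [^] k) (Suc n) = \<zero>"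
  "!!b m. (!!k. b k \<in> carrier F) ==> b m = \<one>\<^bsub>F\<^esub> ==> nsum A (%k. b k \<odot> x [^] k) (Suc m) = \<zero> ==> n \<le> m"
  "separable_element A base x \<longleftrightarrow> nsum A (%k. add_pow F (Suc k) (a (Suc k)) \<odot> x [^] k) n \<noteq> \<zero>"
proof -
 interpret A: field A by (rule field_of_comm(1)[OF comm])
 note sf = field_of_comm(2)[OF comm]
 note sr = subfieldE(1)[OF sf]
 interpret U: principal_domain "univ_poly A base" by (rule A.univ_poly_is_principal[OF sf])
 let ?p = "Irr base x"
 note alg = algebraic_base[OF x]
 note pE = A.IrrE[OF sf x alg]
 have p0: "?p \<noteq> []" using A.pirreducibleE(1)[OF sr pE(1,2)] .
 have pset: "set ?p \<subseteq> base" using pE(1) p0 unfolding univ_poly_carrier[symmetric] polynomial_def by auto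
 have psetA: "set ?p \<subseteq> carrier A" using pset by auto
 define n where "n = degree ?p"
 have len: "length ?p = Suc n" using p0 by (simp add: n_def)
 have "coeff ?p k \<in> base" for k
  using pset subalgD(1)[OF base_subalg] subspD(2) by (cases "k < length ?p") (auto simp: coeff_length coeff_nth subset_iff)
 then have "\<exists>c. c \<in> carrier F \<and> coeff ?p k = c \<odot> \<one> \<and> (k = n \<longrightarrow> c = \<one>\<^bsub>F\<^esub>)" for k
 proof (cases "k = n")
  case True
  then show ?thesis using lead_coeff_simp[OF p0] pE(3) by (intro exI[of _ "\<one>\<^bsub>F\<^esub>"]) (simp add: n_def)
 qed blast
 then obtain a where a: "!!k. a k \<in> carrier F" "!!k. coeff ?p k = a k \<odot> \<one>" "a n = \<one>\<^bsub>F\<^esub>" by metis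
 have add_pow_smult: "add_pow A (m :: nat) (c \<odot> \<one>) = add_pow F m c \<odot> \<one>" if "c \<in> carrier F" for m c
  using that by (induction m) (simp_all add: smult_l_distr smult_l_null)
 have cm: "(c \<odot> \<one>) \<otimes> x [^] k = c \<odot> x [^] k" if "c \<in> carrier F" for c and k :: nat
  using that x by (simp add: mult_smult_l mult_l_one)
 have rel: "nsum A (%k. a k \<odot> x [^] k) (Suc n) = eval ?p x"
  unfolding eval_nsum[OF psetA x] len using a x by (intro nsum_cong) (simp add: mult_smult_l mult_l_one)
 have der: "nsum A (%k. add_pow F (Suc k) (a (Suc k)) \<odot> x [^] k) n = eval (formal_deriv A ?p) x"
  unfolding eval_formal_deriv[OF psetA x] n_def[symmetric] a(2) add_pow_smult[OF a(1)]
  by (rule nsum_cong, rule cm[symmetric]) (rule R.add.nat_pow_closed[OF a(1)])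
 note dc = formal_deriv_carrier[OF sr pE(1)]
 have sep_iff: "separable_element A base x \<longleftrightarrow> eval (formal_deriv A ?p) x \<noteq> \<zero>"
 proof
  assume s: "separable_element A base x"
  show "eval (formal_deriv A ?p) x \<noteq> \<zero>"
  proof
   assume "eval (formal_deriv A ?p) x = \<zero>"
   then have dv: "?p divides\<^bsub>univ_poly A base\<^esub> formal_deriv A ?p"
    using A.Irr_minimal[OF sf x alg dc] A.pdivides_iff_shell[OF sf pE(1) dc] by simp
   have "\<forall>y \<in> carrier (univ_poly A base). y divides\<^bsub>univ_poly A base\<^esub> ?p \<and>
     y divides\<^bsub>univ_poly A base\<^esub> formal_deriv A ?p \<longrightarrow> y divides\<^bsub>univ_poly A base\<^esub> \<one>\<^bsub>univ_poly A base\<^esub>"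
    using s unfolding separable_element_def isgcd_def by (elim conjE)
   from mp[OF bspec[OF this pE(1)] conjI[OF U.divides_refl[OF pE(1)] dv]]
   have "?p \<in> Units (univ_poly A base)" unfolding U.Unit_eq_dividesone[OF pE(1)] .
   then show False using A.pirreducibleE(2)[OF sr pE(1,2)] by simp
  qed
 next
  assume nz: "eval (formal_deriv A ?p) x \<noteq> \<zero>"
  show "separable_element A base x"
   unfolding separable_element_def isgcd_def
  proof (intro conjI ballI impI)
   show "\<one>\<^bsub>univ_poly A base\<^esub> divides\<^bsub>univ_poly A base\<^esub> ?p" "\<one>\<^bsub>univ_poly A base\<^esub> divides\<^bsub>univ_poly A base\<^esub> formal_deriv A ?p"
    using U.one_divides pE(1) dc by auto
   fix y assume y: "y \<in> carrier (univ_poly A base)"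
    and d: "y divides\<^bsub>univ_poly A base\<^esub> ?p \<and> y divides\<^bsub>univ_poly A base\<^esub> formal_deriv A ?p"
   have "y \<in> Units (univ_poly A base) \<or> y \<sim>\<^bsub>univ_poly A base\<^esub> ?p"
    by (rule divides_pirreducible_condition[OF pE(2) y conjunct1[OF d]])
   then show "y divides\<^bsub>univ_poly A base\<^esub> \<one>\<^bsub>univ_poly A base\<^esub>"
   proof
    assume "y \<sim>\<^bsub>univ_poly A base\<^esub> ?p"
    then have "?p divides\<^bsub>univ_poly A base\<^esub> y" unfolding associated_def by simp
    then have "?p divides\<^bsub>univ_poly A base\<^esub> formal_deriv A ?p" using d U.divides_trans[OF _ _ pE(1)] by blast
    then obtain c where c: "c \<in> carrier (univ_poly A base)" "formal_deriv A ?p = ?p \<otimes>\<^bsub>univ_poly A base\<^esub> c"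
     unfolding factor_def by blast
    have "eval (formal_deriv A ?p) x = eval ?p x \<otimes> eval c x"
     unfolding c(2) by (rule ring_hom_memE(2)[OF A.eval_is_hom[OF sr x] pE(1) c(1)])
    moreover have "eval c x \<in> carrier A" by (rule ring_hom_memE(1)[OF A.eval_is_hom[OF sr x] c(1)])
    ultimately show ?thesis using nz pE(4) by simp
   qed (use U.unit_divides U.one_closed in blast)
  qed
 qed
 show thesis
 proof (rule that[of a n])
  fix b m assume b: "!!k. b k \<in> carrier F" "b m = \<one>\<^bsub>F\<^esub>" "nsum A (%k. b k \<odot> x [^] k) (Suc m) = \<zero>"
  obtain q where q: "q \<in> carrier (univ_poly A base)" "q \<noteq> []" "degree q = m" "eval q x = \<zero>"
   using relation_poly[where a = b, OF x b(1,2)] unfolding b(3) by blast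
  show "n \<le> m" unfolding n_def q(3)[symmetric]
   by (rule A.pdivides_imp_degree_le[OF sr pE(1) q(1,2) A.Irr_minimal[OF sf x alg q(1,4)]])
 qed (use a rel pE(4) sep_iff der in simp_all)
qed

lemma separable_element_sep:
 assumes "\<forall>x \<in> carrier A. \<forall>y \<in> carrier A. x \<otimes> y = y \<otimes> x" "x \<in> carrier A" "separable_element A base x"
 shows "sep x"
proof (rule Irr_relation[OF assms(1,2)])
 fix a n
 assume a: "!!k. a k \<in> carrier F" "nsum A (%k. a k \<odot> x [^] k) (Suc n) = \<zero>"
  "separable_element A base x \<longleftrightarrow> nsum A (%k. add_pow F (Suc k) (a (Suc k)) \<odot> x [^] k) n \<noteq> \<zero>"
 show "sep x" unfolding sep_def
  by (intro exI[of _ a] exI[of _ n] conjI allI a(1,2)) (use a(3) assms(3) in blast)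
qed

end

lemma (in vspace) nsum_const:
 "v \<in> carrier V ==> nsum V (%_. v) m = add_pow F m \<one>\<^bsub>F\<^esub> \<odot>\<^bsub>V\<^esub> v"
 by (induction m) (simp_all add: smult_l_null smult_l_distr)

text \<open>\<open>D\<close> has its own identity \<open>e\<close>. The pair of \<open>D\<close> and
  \<open>K\<close> stands for a corner and its torus, for the center taken twice, or for a torus
  taken twice.\<close>

locale qassoc_sub = qassoc F A B
 for F :: "('f, 'n) ring_scheme" and A :: "('f, 'a, 'm) module_scheme" (structure) and B :: "'a set" +
 fixes D :: "'a set" and e :: 'a and K :: "'a set"
 assumes D_B: "D \<subseteq> B" and D_div: "division_algebra F (A\<lparr>carrier := D, one := e\<rparr>)"
  and K_sub: "assoc_algebra.subalg F (A\<lparr>carrier := D, one := e\<rparr>) K"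
  and K_comm: "!!x y. x \<in> K ==> y \<in> K ==> x \<otimes> y = y \<otimes> x"

sublocale qassoc_sub \<subseteq> D: division_algebra F "A\<lparr>carrier := D, one := e\<rparr>" by (rule D_div)

section \<open>Difference quotients of polynomials\<close>

context qassoc_sub begin

abbreviation pw :: "'a => nat => 'a" where "pw x k \<equiv> x [^]\<^bsub>A\<lparr>carrier := D, one := e\<rparr>\<^esub> k"

lemma DB [simp]: "x \<in> D ==> x \<in> B" using D_B by blast
lemma De [simp]: "e \<in> D" using D.one_closed by simp
lemma D0 [simp]: "\<zero> \<in> D" using D.zero_closed by simp
lemma Dm [simp]: "x \<in> D ==> y \<in> D ==> x \<otimes> y \<in> D" using D.m_closed[of x y] by simp
lemma Da [simp]: "x \<in> D ==> y \<in> D ==> x \<oplus> y \<in> D" using D.a_closed[of x y] by simp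
lemma Ds [simp]: "c \<in> carrier F ==> y \<in> D ==> c \<odot> y \<in> D" using D.smult_closed[of c y] by simp
lemma Dl [simp]: "x \<in> D ==> e \<otimes> x = x" using D.l_one[of x] by simp
lemma Dr [simp]: "x \<in> D ==> x \<otimes> e = x" using D.r_one[of x] by simp
lemma e_nz: "e \<noteq> \<zero>" using D.one_nz by simp

lemma subalgK:
 assumes "D.subalg G"
 shows "G \<subseteq> D" "\<zero> \<in> G" "e \<in> G" "x \<in> G ==> y \<in> G ==> x \<otimes> y \<in> G" "x \<in> G ==> y \<in> G ==> x \<oplus> y \<in> G"
  "c \<in> carrier F ==> x \<in> G ==> c \<odot> x \<in> G" "x \<in> G ==> pw x k \<in> G"
 using D.subspD(1,2,3,6)[OF D.subalgD(1)[OF assms]] D.subalgD(2,3)[OF assms] D.subalg_pow[OF assms] by simp_all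

lemma KD [simp]: "x \<in> K ==> x \<in> D" using subalgK(1)[OF K_sub] by blast

lemma pw_simps [simp]: "pw x 0 = e" "x \<in> D ==> pw x k \<in> D"
 using D.nat_pow_closed[of x k] by simp_all

lemma pw_Suc: "x \<in> D ==> pw x (Suc k) = x \<otimes> pw x k"
 using D.nat_pow_Suc2[of x k] by simp

lemma pw_mult: "x \<in> D ==> pw x i \<otimes> pw x j = pw x (i + j)"
 using D.nat_pow_mult[of x i j] by simp

lemma Sp_De: assumes "t \<in> Sp D D" shows "tns e e \<star> t = t" "act t \<one> \<in> D" "act t e = act t \<one>"
proof -
 note c = SpB[OF _ D_B D_B]
 have "tns e e \<star> t = t \<and> act t \<one> \<in> D \<and> act t e = act t \<one>"
  using assms
 proof (induction rule: Sp.induct)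
  case (tns x y)
  then show ?case by (simp add: tns_m act_tns mult_r_one oneA)
 next
  case (add t u)
  then show ?case using c[OF add(1)] c[OF add(2)] oneA by (simp add: tp.T.r_distr act_add_l)
 qed
 then show "tns e e \<star> t = t" "act t \<one> \<in> D" "act t e = act t \<one>" by simp_all
qed

text \<open>\<open>(X^k - Y^k) / (X - Y)\<close> at \<open>X = x \<otimes> e\<close> and
  \<open>Y = e \<otimes> x\<close>, which is 0 for \<open>k = 0\<close>.\<close>

definition w :: "'a => nat => ('a \<times> 'a => 'f) set" where
 "w x k = nsum T (%i. tns (pw x (k - Suc i)) (pw x i)) k"

text \<open>The difference quotient \<open>(f(X) - f(Y)) / (X - Y)\<close> of \<open>f = \<Sum> a\<^sub>k X\<^sup>k\<close> at \<open>X = x \<otimes> 1\<close>, \<open>Y = 1 \<otimes> x\<close>.\<close>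
definition quot :: "(nat => 'f) => nat => 'a => ('a \<times> 'a => 'f) set" where
 "quot a n x = nsum T (%k. tns (a k \<odot> e) e \<star> w x k) (Suc n)"

lemma w_Sp: assumes "D.subalg G" "x \<in> G" shows "w x k \<in> Sp G G"
 unfolding w_def
proof (rule Sp_nsum)
 have "G \<subseteq> B" using subalgK(1)[OF assms(1)] D_B by blast
 then show "G \<subseteq> B" "G \<subseteq> C0" by simp_all
qed (use subalgK[OF assms(1)] assms(2) in \<open>auto intro: Sp.tns\<close>)

lemma D_subalg: "D.subalg D" using D.subalg_carrier by simp

lemma w_D: "x \<in> D ==> w x k \<in> Sp D D" by (rule w_Sp[OF D_subalg])

lemma w_T [simp]: "x \<in> D ==> w x k \<in> TC" by (rule SpB[OF w_D D_B D_B])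

lemma w_Suc: assumes "x \<in> D" shows "w x (Suc k) = tns x e \<star> w x k \<boxplus> tns e (pw x k)"
proof -
 have "tns x e \<star> w x k = nsum T (%i. tns x e \<star> tns (pw x (k - Suc i)) (pw x i)) k"
  unfolding w_def by (rule tp.T.endo_nsum[where h = "%t. tns x e \<star> t"])
   (use assms in \<open>simp_all add: tp.T.r_distr\<close>)
 also have "\<dots> = nsum T (%i. tns (pw x (Suc k - Suc i)) (pw x i)) k"
 proof (rule nsum_cong)
  fix i assume "i < k"
  then have k: "Suc k - Suc i = Suc (k - Suc i)" by simp
  show "tns x e \<star> tns (pw x (k - Suc i)) (pw x i) = tns (pw x (Suc k - Suc i)) (pw x i)"
   unfolding k pw_Suc[OF assms] using assms by (simp add: tns_m)
 qed
 finally show ?thesis by (simp add: w_def)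
qed

text \<open>The identity \<open>(X - Y) w = X^k - Y^k\<close>, arranged so that no subtraction
  occurs.\<close>

lemma w_flip:
 assumes "x \<in> D"
 shows "tns x e \<star> w x k \<boxplus> tns e (pw x k) = tns e x \<star> w x k \<boxplus> tns (pw x k) e"
proof (induction k)
 case 0
 then show ?case using assms by (simp add: w_def)
next
 case (Suc k)
 let ?X = "tns x e" and ?Y = "tns e x"
 have c: "?X \<in> TC" "?Y \<in> TC" "w x k \<in> TC" "tns e (pw x k) \<in> TC" "tns (pw x k) e \<in> TC"
  using assms by simp_all
 have XY: "?X \<star> ?Y = ?Y \<star> ?X" using assms by (simp add: tns_m)
 have X: "?X \<star> w x (Suc k) = ?X \<star> (?Y \<star> w x k) \<boxplus> tns (pw x (Suc k)) e"
 proof -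
  have "?X \<star> w x (Suc k) = ?X \<star> (?Y \<star> w x k \<boxplus> tns (pw x k) e)" unfolding w_Suc[OF assms] Suc.IH ..
  also have "\<dots> = ?X \<star> (?Y \<star> w x k) \<boxplus> ?X \<star> tns (pw x k) e" by (rule tp.T.r_distr) (use c in simp_all)
  also have "?X \<star> tns (pw x k) e = tns (pw x (Suc k)) e" unfolding pw_Suc[OF assms] using assms by (simp add: tns_m)
  finally show ?thesis .
 qed
 have Y: "?Y \<star> w x (Suc k) = ?Y \<star> (?X \<star> w x k) \<boxplus> tns e (pw x (Suc k))"
 proof -
  have "?Y \<star> w x (Suc k) = ?Y \<star> (?X \<star> w x k) \<boxplus> ?Y \<star> tns e (pw x k)"
   unfolding w_Suc[OF assms] by (rule tp.T.r_distr) (use c in simp_all)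
  also have "?Y \<star> tns e (pw x k) = tns e (pw x (Suc k))" using assms by (simp add: tns_m)
  finally show ?thesis .
 qed
 have "?X \<star> (?Y \<star> w x k) = ?Y \<star> (?X \<star> w x k)"
  using tp.T.m_assoc[OF c(1,2,3)] tp.T.m_assoc[OF c(2,1,3)] XY by simp
 then show ?case unfolding X Y using assms c by (simp add: tp.T.a_ac)
qed

lemma scal_e:
 assumes "c \<in> carrier F" "u \<in> D" "v \<in> D"
 shows "tns (c \<odot> e) e \<star> tns u v = tns (c \<odot> u) v"
 using assms by (simp add: tns_m mult_smult_l)

lemma quot_Sp:
 assumes "D.subalg G" "x \<in> G" "!!k. a k \<in> carrier F"
 shows "quot a n x \<in> Sp G G"
 unfolding quot_def
proof (rule Sp_nsum)
 have GB: "G \<subseteq> B" using subalgK(1)[OF assms(1)] D_B by blast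
 then show "G \<subseteq> B" "G \<subseteq> C0" by simp_all
 show "tns (a i \<odot> e) e \<star> w x i \<in> Sp G G" for i
  by (rule Sp_mult) (use GB subalgK[OF assms(1)] assms(3) w_Sp[OF assms(1,2)] in \<open>auto intro: Sp.tns\<close>)
qed (use subalgK[OF assms(1)] in simp_all)

lemma quot_T: "x \<in> D ==> (!!k. a k \<in> carrier F) ==> quot a n x \<in> TC"
 by (rule SpB[OF quot_Sp[OF D_subalg] D_B D_B])

text \<open>Multiplying out sets \<open>Y = X\<close>: each of the \<open>k\<close> summands of
  \<open>w x k\<close> becomes \<open>x^(k-1)\<close>, and the difference quotient becomes the
  derivative at \<open>x\<close>.\<close>

lemma quot_act:
 assumes "x \<in> D" "!!k. a k \<in> carrier F"
 shows "act (quot a n x) \<one> = nsum A (%k. add_pow F (Suc k) (a (Suc k)) \<odot> pw x k) n"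
proof -
 have w: "act (w x (Suc k)) \<one> = add_pow F (Suc k) \<one>\<^bsub>F\<^esub> \<odot> pw x k" for k
 proof -
  have "act (w x (Suc k)) \<one> = nsum A (%i. act (tns (pw x (Suc k - Suc i)) (pw x i)) \<one>) (Suc k)"
   unfolding w_def by (rule act_nsum) (use assms oneA in simp_all)
  also have "\<dots> = nsum A (%_. pw x k) (Suc k)"
   by (rule nsum_cong) (use assms oneA in \<open>simp add: act_tns mult_r_one pw_mult\<close>)
  also have "\<dots> = add_pow F (Suc k) \<one>\<^bsub>F\<^esub> \<odot> pw x k" by (rule nsum_const) (use assms in simp)
  finally show ?thesis .
 qed
 have w0: "act (w x 0) \<one> = \<zero>" using oneA by (simp add: w_def act_zero_l)
 have wD: "act (w x k) \<one> \<in> D" for k by (rule Sp_De(2)[OF w_D[OF assms(1)]])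
 have t: "act (tns (a k \<odot> e) e \<star> w x k) \<one> = a k \<odot> act (w x k) \<one>" for k
  using act_mult[of "tns (a k \<odot> e) e" "w x k" \<one>] assms oneA wD by (simp add: act_tns mult_smult_l)
 have "act (quot a n x) \<one> = nsum A (%k. act (tns (a k \<odot> e) e \<star> w x k) \<one>) (Suc n)"
  unfolding quot_def by (rule act_nsum) (use assms oneA in simp_all)
 also have "\<dots> = nsum A (%k. a k \<odot> act (w x k) \<one>) (Suc n)" by (rule nsum_cong) (rule t)
 also have "\<dots> = a 0 \<odot> act (w x 0) \<one> \<oplus> nsum A (%k. a (Suc k) \<odot> act (w x (Suc k)) \<one>) n"
  by (rule nsum_Suc_shift) (use assms wD in simp)
 also have "nsum A (%k. a (Suc k) \<odot> act (w x (Suc k)) \<one>) n = nsum A (%k. add_pow F (Suc k) (a (Suc k)) \<odot> pw x k) n"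
 proof (rule nsum_cong)
  fix k
  have c: "add_pow F (Suc k) \<one>\<^bsub>F\<^esub> \<in> carrier F" by (rule R.add.nat_pow_closed) simp
  show "a (Suc k) \<odot> act (w x (Suc k)) \<one> = add_pow F (Suc k) (a (Suc k)) \<odot> pw x k"
   unfolding w D.add_pow_F[OF assms(2)] using smult_assoc1[OF assms(2) c, of "pw x k"] R.m_comm[OF assms(2) c] assms(1) by simp
 qed
 finally have "act (quot a n x) \<one> = a 0 \<odot> act (w x 0) \<one> \<oplus> nsum A (%k. add_pow F (Suc k) (a (Suc k)) \<odot> pw x k) n" .
 moreover have "nsum A (%k. add_pow F (Suc k) (a (Suc k)) \<odot> pw x k) n \<in> AC"
  by (rule nsum_closed) (use assms R.add.nat_pow_closed in simp)
 ultimately show ?thesis unfolding w0 using assms(2) by (simp only: smult_r_null l_zero)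
qed

text \<open>\<open>(X - Y)\<close> times the quotient is \<open>f(X) - f(Y)\<close>, and both of
  these vanish when \<open>x\<close> is a root of \<open>f\<close>.\<close>

lemma quot_flip:
 assumes "x \<in> D" "!!k. a k \<in> carrier F" "nsum A (%k. a k \<odot> pw x k) (Suc n) = \<zero>"
 shows "tns x e \<star> quot a n x = tns e x \<star> quot a n x"
proof -
 let ?al = "%k. tns (a k \<odot> e) e"
 have c: "?al k \<in> TC" "tns e (pw x k) \<in> TC" "tns (pw x k) e \<in> TC" "tns x e \<in> TC" "tns e x \<in> TC" for k
  using assms by simp_all
 \<comment> \<open>The \<open>v k\<close> are the powers of \<open>Y\<close> or of \<open>X\<close>;
   weighted with the \<open>a k\<close> they add up to \<open>f(Y)\<close> or \<open>f(X)\<close>,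
   hence to zero, and adding them puts each term into the shape of \<open>w_flip\<close>.\<close>
 have main: "u \<star> quot a n x = nsum T (%k. ?al k \<star> (u \<star> w x k \<boxplus> v k)) (Suc n)"
  if u: "u \<in> TC" "!!k. u \<star> ?al k = ?al k \<star> u" and v: "!!k. v k \<in> TC"
   "nsum T (%k. ?al k \<star> v k) (Suc n) = \<zero>\<^sub>T" for u v
 proof -
  have "u \<star> quot a n x = nsum T (%k. u \<star> (?al k \<star> w x k)) (Suc n)"
   unfolding quot_def by (rule tp.T.endo_nsum[where h = "%t. u \<star> t"])
    (use assms u(1) c in \<open>simp_all add: tp.T.r_distr\<close>)
  also have "\<dots> = nsum T (%k. ?al k \<star> (u \<star> w x k)) (Suc n)"
  proof (rule nsum_cong)
   fix k show "u \<star> (?al k \<star> w x k) = ?al k \<star> (u \<star> w x k)"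
    using tp.T.m_assoc[OF u(1) c(1) w_T[OF assms(1)], of k k] tp.T.m_assoc[OF c(1) u(1) w_T[OF assms(1)], of k k] u(2)[of k] by simp
  qed
  finally have e1: "u \<star> quot a n x = \<dots>" .
  have "nsum T (%k. ?al k \<star> (u \<star> w x k \<boxplus> v k)) (Suc n) =
    nsum T (%k. ?al k \<star> (u \<star> w x k) \<boxplus> ?al k \<star> v k) (Suc n)"
   by (rule nsum_cong, rule tp.T.r_distr) (use c u(1) v(1) assms(1) in simp_all)
  also have "\<dots> = nsum T (%k. ?al k \<star> (u \<star> w x k)) (Suc n) \<boxplus> nsum T (%k. ?al k \<star> v k) (Suc n)"
   by (rule tp.T.nsum_add) (use c u(1) v(1) assms(1) in simp_all)
  finally show ?thesis unfolding v(2) e1[symmetric] using quot_T[OF assms(1,2)] u(1) by simp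
 qed
 have z1: "nsum T (%k. ?al k \<star> tns e (pw x k)) (Suc n) = \<zero>\<^sub>T"
 proof -
  have "nsum T (%k. ?al k \<star> tns e (pw x k)) (Suc n) = nsum T (%k. tns e (a k \<odot> pw x k)) (Suc n)"
   by (rule nsum_cong) (use assms(1,2) in \<open>simp add: scal_e tns_s\<close>)
  also have "\<dots> = tns e (nsum A (%k. a k \<odot> pw x k) (Suc n))"
   using tns_nsum_r[of e "Suc n" "%k. a k \<odot> pw x k"] assms(1,2) by simp
  finally show ?thesis unfolding assms(3) by (simp add: tns_zero_r)
 qed
 have z2: "nsum T (%k. ?al k \<star> tns (pw x k) e) (Suc n) = \<zero>\<^sub>T"
 proof -
  have "nsum T (%k. ?al k \<star> tns (pw x k) e) (Suc n) = nsum T (%k. tns (a k \<odot> pw x k) e) (Suc n)"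
   by (rule nsum_cong) (use assms(1,2) in \<open>simp add: scal_e\<close>)
  also have "\<dots> = tns (nsum A (%k. a k \<odot> pw x k) (Suc n)) e"
   using tns_nsum_l[of e "Suc n" "%k. a k \<odot> pw x k"] assms(1,2) by simp
  finally show ?thesis unfolding assms(3) by (simp add: tns_zero_l)
 qed
 have cm: "tns x e \<star> ?al k = ?al k \<star> tns x e" "tns e x \<star> ?al k = ?al k \<star> tns e x" for k
  using assms(1,2) by (simp_all add: tns_m mult_smult_l mult_smult_r)
 show ?thesis
  unfolding main[OF c(4) cm(1) c(2) z1] main[OF c(5) cm(2) c(3) z2] w_flip[OF assms(1)] ..
qed

text \<open>It is a subalgebra for each \<open>z\<close>, so the defining condition of a
  separability idempotent has to be verified on generators only.\<close>

definition equalizer :: "('a \<times> 'a => 'f) set => 'a set" where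
 "equalizer z = {k \<in> K. tns k e \<star> z = tns e k \<star> z}"

lemma equalizer_subalg:
 assumes z: "z \<in> TC"
 shows "D.subalg (equalizer z)"
proof -
 note k = subalgK[OF K_sub]
 have "D.subsp (equalizer z)"
 proof (rule D.subspI)
  show "equalizer z \<subseteq> carrier (A\<lparr>carrier := D, one := e\<rparr>)" by (auto simp: equalizer_def)
  show "\<zero>\<^bsub>A\<lparr>carrier := D, one := e\<rparr>\<^esub> \<in> equalizer z" using k z by (simp add: equalizer_def tns_zero_l tns_zero_r)
 next
  fix x y assume xy: "x \<in> equalizer z" "y \<in> equalizer z"
  then show "x \<oplus>\<^bsub>A\<lparr>carrier := D, one := e\<rparr>\<^esub> y \<in> equalizer z"
   using k z by (simp add: equalizer_def tns_al tns_ar tp.T.l_distr)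
 next
  fix c x assume c: "c \<in> carrier F" and x: "x \<in> equalizer z"
  have xK: "x \<in> K" and xz: "tns x e \<star> z = tns e x \<star> z" using x by (simp_all add: equalizer_def)
  have "tns (c \<odot> x) e = tns (c \<odot> e) e \<star> tns x e" "tns e (c \<odot> x) = tns (c \<odot> e) e \<star> tns e x"
   using c xK by (simp_all add: scal_e tns_s)
  then have "tns (c \<odot> x) e \<star> z = tns e (c \<odot> x) \<star> z" using xz c xK z by (simp add: tp.T.m_assoc)
  then show "c \<odot>\<^bsub>A\<lparr>carrier := D, one := e\<rparr>\<^esub> x \<in> equalizer z" using k(6)[OF c xK] by (simp add: equalizer_def)
 qed
 moreover have "x \<otimes> y \<in> equalizer z" if "x \<in> equalizer z" "y \<in> equalizer z" for x y
 proof -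
  have xy: "x \<in> K" "y \<in> K" and e: "tns x e \<star> z = tns e x \<star> z" "tns y e \<star> z = tns e y \<star> z"
   using that by (simp_all add: equalizer_def)
  have c: "tns x e \<in> TC" "tns e x \<in> TC" "tns y e \<in> TC" "tns e y \<in> TC" using xy by simp_all
  have "tns (x \<otimes> y) e \<star> z = tns x e \<star> tns y e \<star> z" using xy by (simp add: tns_m)
  also have "\<dots> = (tns x e \<star> tns e y) \<star> z" using tp.T.m_assoc[OF c(1,3) z] tp.T.m_assoc[OF c(1,4) z] e by simp
  also have "tns x e \<star> tns e y = tns e y \<star> tns x e" using xy by (simp add: tns_m)
  also have "(tns e y \<star> tns x e) \<star> z = (tns e y \<star> tns e x) \<star> z" using tp.T.m_assoc[OF c(4,1) z] tp.T.m_assoc[OF c(4,2) z] e by simp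
  also have "tns e y \<star> tns e x = tns e (x \<otimes> y)" using xy by (simp add: tns_m)
  finally show ?thesis using k(4)[OF xy] by (simp add: equalizer_def)
 qed
 moreover have "e \<in> equalizer z" using k by (simp add: equalizer_def)
 ultimately show ?thesis unfolding D.subalg_def by simp
qed

text \<open>By \<open>quot_flip\<close>, \<open>x\<close> lies in the equalizer of the quotient
  \<open>q\<close>, so a tensor \<open>t\<close> built from powers of \<open>x\<close> acts on
  \<open>q\<close> through its product: \<open>t q = (act t 1 \<otimes> e) q\<close>. For
  \<open>t = q\<close> the product is the derivative at \<open>x\<close>, which is zero.\<close>

lemma quot_square:
 assumes "x \<in> K" "!!k. a k \<in> carrier F" "nsum A (%k. a k \<odot> pw x k) (Suc n) = \<zero>"
  "nsum A (%k. add_pow F (Suc k) (a (Suc k)) \<odot> pw x k) n = \<zero>"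
 shows "quot a n x \<star> quot a n x = \<zero>\<^sub>T"
proof -
 let ?q = "quot a n x"
 have xD: "x \<in> D" using assms(1) by simp
 have qT: "?q \<in> TC" by (rule quot_T[OF xD assms(2)])
 have xE: "x \<in> equalizer ?q" unfolding equalizer_def using assms(1) quot_flip[OF xD assms(2,3)] by simp
 note E = subalgK[OF equalizer_subalg[OF qT]]
 have EB: "equalizer ?q \<subseteq> B" using E(1) D_B by blast
 have "t \<star> ?q = tns (act t \<one>) e \<star> ?q \<and> act t \<one> \<in> D" if "t \<in> Sp (equalizer ?q) (equalizer ?q)" for t
  using that
 proof (induction rule: Sp.induct)
  case (tns u v)
  have uv: "u \<in> D" "v \<in> D" and ve: "tns v e \<star> ?q = tns e v \<star> ?q" using tns by (auto simp: equalizer_def)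
  have c: "tns u e \<in> TC" "tns e v \<in> TC" "tns v e \<in> TC" using uv by simp_all
  have "tns u v \<star> ?q = (tns u e \<star> tns e v) \<star> ?q" using uv by (simp add: tns_m)
  also have "\<dots> = (tns u e \<star> tns v e) \<star> ?q" using tp.T.m_assoc[OF c(1,2) qT] tp.T.m_assoc[OF c(1,3) qT] ve by simp
  also have "tns u e \<star> tns v e = tns (act (tns u v) \<one>) e" using uv oneA by (simp add: tns_m act_tns mult_r_one)
  finally show ?case using uv oneA by (simp add: act_tns mult_r_one)
 next
  case (add t u)
  have c: "t \<in> TC" "u \<in> TC" using SpB[OF add(1) EB EB] SpB[OF add(2) EB EB] .
  show ?case using add(3,4) c qT oneA by (simp add: act_add_l tp.T.l_distr tns_al)
 qed
 moreover have "?q \<in> Sp (equalizer ?q) (equalizer ?q)" by (rule quot_Sp[OF equalizer_subalg[OF qT] xE assms(2)])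
 moreover have "act ?q \<one> = \<zero>" by (rule trans[OF quot_act[OF xD assms(2)] assms(4)])
 ultimately have "?q \<star> ?q = tns \<zero> e \<star> ?q" by metis
 then show ?thesis using qT by (simp add: tns_zero_l)
qed

text \<open>By minimality of \<open>n\<close>, the power \<open>x^(n-1)\<close> is not a combination
  of lower ones, so some functional \<open>\<mu>\<close> is 1 at it and 0 at these. Contracting the
  first factor with \<open>\<mu>\<close> kills \<open>w x k\<close> for \<open>k < n\<close> and
  turns \<open>w x n\<close> into \<open>e\<close>; as \<open>a n = 1\<close>, the quotient is sent
  to \<open>e\<close>.\<close>

lemma quot_nonzero:
 assumes "x \<in> D" "!!k. a k \<in> carrier F" "nsum A (%k. a k \<odot> pw x k) (Suc n) = \<zero>" "a n = \<one>\<^bsub>F\<^esub>"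
  and min: "!!b m. (!!k. b k \<in> carrier F) ==> b m = \<one>\<^bsub>F\<^esub> ==> nsum A (%k. b k \<odot> pw x k) (Suc m) = \<zero> ==> n \<le> m"
 shows "quot a n x \<noteq> \<zero>\<^sub>T"
proof -
 have pA: "pw x k \<in> AC" for k using assms(1) by simp
 have "n \<noteq> 0"
 proof
  assume "n = 0"
  then show False using assms(3,4) e_nz by simp
 qed
 then obtain m where m: "n = Suc m" using not0_implies_Suc by blast
 define W where "W = {v. \<exists>c. (\<forall>k. c k \<in> carrier F) \<and> v = nsum A (%j. c j \<odot> pw x j) m}"
 have WI: "nsum A (%j. c j \<odot> pw x j) m \<in> W" if "!!k. c k \<in> carrier F" for c unfolding W_def using that by blast
 have W: "subsp W"
 proof (rule subspI)
  show "W \<subseteq> AC" unfolding W_def using pA by auto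
  have "nsum A (%j. \<zero>\<^bsub>F\<^esub> \<odot> pw x j) m = \<zero>" by (rule nsum_zero) (simp add: smult_l_null pA)
  then show "\<zero> \<in> W" using WI[of "%_. \<zero>\<^bsub>F\<^esub>"] by simp
 next
  fix v u assume "v \<in> W" "u \<in> W"
  then obtain c d where c: "\<forall>k. c k \<in> carrier F" "v = nsum A (%j. c j \<odot> pw x j) m"
   and d: "\<forall>k. d k \<in> carrier F" "u = nsum A (%j. d j \<odot> pw x j) m" unfolding W_def by blast
  have "v \<oplus> u = nsum A (%j. c j \<odot> pw x j \<oplus> d j \<odot> pw x j) m" unfolding c(2) d(2)
   by (rule nsum_add[symmetric]) (use c d pA in simp_all)
  also have "\<dots> = nsum A (%j. (c j \<oplus>\<^bsub>F\<^esub> d j) \<odot> pw x j) m"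
   by (rule nsum_cong) (use c d pA in \<open>simp add: smult_l_distr\<close>)
  finally show "v \<oplus> u \<in> W" using WI[of "%j. c j \<oplus>\<^bsub>F\<^esub> d j"] c d by simp
 next
  fix s v assume s: "s \<in> carrier F" and "v \<in> W"
  then obtain c where c: "\<forall>k. c k \<in> carrier F" "v = nsum A (%j. c j \<odot> pw x j) m" unfolding W_def by blast
  have "s \<odot> v = nsum A (%j. s \<odot> (c j \<odot> pw x j)) m" unfolding c(2)
   by (rule endo_nsum[where h = "%v. s \<odot> v"])
    (use c s pA in \<open>simp_all add: smult_r_distr\<close>)
  also have "\<dots> = nsum A (%j. (s \<otimes>\<^bsub>F\<^esub> c j) \<odot> pw x j) m"
   by (rule nsum_cong) (use c s pA in \<open>simp add: smult_assoc1\<close>)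
  finally show "s \<odot> v \<in> W" using WI[of "%j. s \<otimes>\<^bsub>F\<^esub> c j"] c s by simp
 qed
 have pW: "pw x j \<in> W" if "j < m" for j
 proof -
  have "nsum A (%i. (if i = j then \<one>\<^bsub>F\<^esub> else \<zero>\<^bsub>F\<^esub>) \<odot> pw x i) m = nsum A (%i. if i = j then pw x j else \<zero>) m"
   by (rule nsum_cong) (simp add: smult_l_null pA)
  also have "\<dots> = pw x j" by (rule nsum_single[OF that pA])
  finally show ?thesis using WI[of "%i. if i = j then \<one>\<^bsub>F\<^esub> else \<zero>\<^bsub>F\<^esub>"] by simp
 qed
 have "pw x m \<notin> W"
 proof
  assume "pw x m \<in> W"
  then obtain c where c: "\<forall>k. c k \<in> carrier F" "pw x m = nsum A (%j. c j \<odot> pw x j) m" unfolding W_def by blast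
  define b where "b j = (if j = m then \<one>\<^bsub>F\<^esub> else \<ominus>\<^bsub>F\<^esub> c j)" for j
  have bF: "b k \<in> carrier F" for k using c(1) by (simp add: b_def)
  have "nsum A (%k. b k \<odot> pw x k) m = nsum A (%k. \<ominus> (c k \<odot> pw x k)) m"
   by (rule nsum_cong) (use c(1) pA in \<open>simp add: b_def smult_l_minus\<close>)
  also have "\<dots> = \<ominus> nsum A (%k. c k \<odot> pw x k) m"
   by (rule endo_nsum[where h = "%v. \<ominus> v", symmetric])
    (use c(1) pA in \<open>simp_all add: minus_add\<close>)
  also have "\<dots> = \<ominus> pw x m" using c(2) by simp
  finally have "nsum A (%k. b k \<odot> pw x k) (Suc m) = \<zero>" using pA by (simp add: b_def l_neg)
  from min[OF bF _ this] show False using m by (simp add: b_def)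
 qed
 then obtain \<mu> where mu: "functional F A \<mu>" "!!v. v \<in> W ==> \<mu> v = \<zero>\<^bsub>F\<^esub>" "\<mu> (pw x m) = \<one>\<^bsub>F\<^esub>"
  using functional_ex[OF W pA, of m] by blast
 have muc: "\<mu> v \<in> carrier F" if "v \<in> AC" for v using mu(1) that unfolding functional_def by blast
 have mua: "\<mu> (v \<oplus> u) = \<mu> v \<oplus>\<^bsub>F\<^esub> \<mu> u" if "v \<in> AC" "u \<in> AC" for v u using mu(1) that unfolding functional_def by blast
 have mus: "\<mu> (c \<odot> v) = c \<otimes>\<^bsub>F\<^esub> \<mu> v" if "c \<in> carrier F" "v \<in> AC" for c v using mu(1) that unfolding functional_def by blast
 define u where "u b c = \<mu> b \<odot> c" for b c
 have ub: "bilA u"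
 proof (rule bilAI)
  fix s b c assume s: "s \<in> carrier F" and bc: "b \<in> B" "c \<in> C0"
  show "u (s \<odot> b) c = s \<odot> u b c" using s bc muc mus by (simp add: u_def smult_assoc1)
  have "\<mu> b \<odot> (s \<odot> c) = (\<mu> b \<otimes>\<^bsub>F\<^esub> s) \<odot> c" using s bc muc by (simp add: smult_assoc1)
  also have "\<dots> = (s \<otimes>\<^bsub>F\<^esub> \<mu> b) \<odot> c" using s bc muc by (simp add: R.m_comm)
  finally show "u b (s \<odot> c) = s \<odot> u b c" using s bc muc by (simp add: u_def smult_assoc1)
 qed (simp_all add: u_def muc mua smult_l_distr smult_r_distr)
 have ut: "lft u (tns b c) = \<mu> b \<odot> c" if "b \<in> B" "c \<in> B" for b c
  by (subst lft_tns[OF ub]) (simp_all add: that u_def)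
 have lsum: "lft u (nsum T g k) = nsum A (%i. lft u (g i)) k" if "!!i. i < k ==> g i \<in> TC" for g k
  by (rule additive_nsum[OF tp.T.abelian_group_axioms abelian_group_axioms lft_closed[OF ub] lft_add[OF ub] that])
 have lw: "lft u (w x k) = nsum A (%i. \<mu> (pw x (k - Suc i)) \<odot> pw x i) k" for k
 proof -
  have "lft u (w x k) = nsum A (%i. lft u (tns (pw x (k - Suc i)) (pw x i))) k" unfolding w_def by (rule lsum) (use assms(1) in simp)
  also have "\<dots> = nsum A (%i. \<mu> (pw x (k - Suc i)) \<odot> pw x i) k" by (rule nsum_cong, rule ut) (use assms(1) in simp_all)
  finally show ?thesis .
 qed
 have l0: "lft u (w x k) = \<zero>" if "k < n" for k unfolding lw
 proof (rule nsum_zero)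
  fix i assume "i < k"
  then have "k - Suc i < m" using that m by simp
  then show "\<mu> (pw x (k - Suc i)) \<odot> pw x i = \<zero>" using mu(2)[OF pW] pA by (simp add: smult_l_null)
 qed
 have l1: "lft u (w x n) = e"
 proof -
  have "lft u (w x n) = \<mu> (pw x (Suc m - Suc 0)) \<odot> pw x 0 \<oplus> nsum A (%i. \<mu> (pw x (Suc m - Suc (Suc i))) \<odot> pw x (Suc i)) m"
   unfolding lw m by (rule nsum_Suc_shift) (use muc pA in simp)
  also have "nsum A (%i. \<mu> (pw x (Suc m - Suc (Suc i))) \<odot> pw x (Suc i)) m = \<zero>"
  proof (rule nsum_zero)
   fix i assume "i < m"
   then have "Suc m - Suc (Suc i) < m" by simp
   then show "\<mu> (pw x (Suc m - Suc (Suc i))) \<odot> pw x (Suc i) = \<zero>" by (simp only: mu(2)[OF pW] smult_l_null[OF pA])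
  qed
  finally show ?thesis using mu(3) by simp
 qed
 have lscal: "lft u (tns (c \<odot> e) e \<star> t) = c \<odot> lft u t" if c: "c \<in> carrier F" and "t \<in> Sp D D" for c t
  using that(2)
 proof (induction rule: Sp.induct)
  case (tns b d)
  then show ?case using c muc mus by (simp add: scal_e ut smult_assoc1)
 next
  case (add t s)
  have ts: "t \<in> TC" "s \<in> TC" using SpB[OF add(1) D_B D_B] SpB[OF add(2) D_B D_B] .
  then show ?case using add(3,4) c lft_closed[OF ub] by (simp add: tp.T.r_distr lft_add[OF ub] smult_r_distr)
 qed
 have "lft u (quot a n x) = nsum A (%k. lft u (tns (a k \<odot> e) e \<star> w x k)) (Suc n)"
  unfolding quot_def by (rule lsum) (use assms(1,2) in simp)
 also have "\<dots> = nsum A (%k. a k \<odot> lft u (w x k)) (Suc n)" by (rule nsum_cong, rule lscal[OF assms(2) w_D[OF assms(1)]])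
 also have "\<dots> = nsum A (%k. a k \<odot> lft u (w x k)) n \<oplus> a n \<odot> lft u (w x n)" by simp
 also have "nsum A (%k. a k \<odot> lft u (w x k)) n = \<zero>" by (rule nsum_zero) (use l0 assms(2) in \<open>simp add: smult_r_null\<close>)
 finally have qe: "lft u (quot a n x) = e" unfolding l1 assms(4) by simp
 have "lft u \<zero>\<^sub>T = \<zero>"
  by (rule additive_zero[OF tp.T.abelian_group_axioms abelian_group_axioms lft_closed[OF ub] lft_add[OF ub]])
 then show ?thesis using qe e_nz by auto
qed

section \<open>Separability idempotents from separable generators\<close>

definition sepid_rel :: "'a set => ('a \<times> 'a => 'f) set => bool" where
 "sepid_rel S z \<longleftrightarrow> z \<in> Sp K K \<and> S \<subseteq> equalizer z \<and> act z \<one> = e"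

lemma KB: "K \<subseteq> B" using KD by auto

lemma Sp_K_D: "Sp K K \<subseteq> Sp D D" by (rule Sp_mono) auto

text \<open>The difference quotient of a separating polynomial, divided by the value of its
  derivative at \<open>s\<close>. The division is possible inside \<open>K\<close>, a subalgebra of
  a division algebra.\<close>

lemma sepid_single:
 assumes "s \<in> K" "D.sep s"
 shows "\<exists>z. sepid_rel {s} z"
proof -
 have sD: "s \<in> D" using assms(1) by simp
 obtain a n where a: "!!k. a k \<in> carrier F" and r: "nsum A (%k. a k \<odot> pw s k) (Suc n) = \<zero>"
  and d: "nsum A (%k. add_pow F (Suc k) (a (Suc k)) \<odot> pw s k) n \<noteq> \<zero>"
  using assms(2) unfolding D.sep_def by auto
 let ?q = "quot a n s" and ?d = "nsum A (%k. add_pow F (Suc k) (a (Suc k)) \<odot> pw s k) n"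
 note k = subalgK[OF K_sub]
 have dK: "?d \<in> K"
 proof -
  have "nsum (A\<lparr>carrier := D, one := e\<rparr>) (%k. add_pow F (Suc k) (a (Suc k)) \<odot> pw s k) n \<in> K"
   by (rule D.nsum_in) (use k R.add.nat_pow_closed a assms(1) in auto)
  then show ?thesis by simp
 qed
 obtain g where g: "g \<in> K" "?d \<otimes> g = e" using D.inv_in_subalg[OF K_sub dK] d by auto
 have qS: "?q \<in> Sp K K" by (rule quot_Sp[OF K_sub assms(1) a])
 have qT: "?q \<in> TC" by (rule SpB[OF qS KB KB])
 have eg: "tns e g \<in> Sp K K" using k(3) g(1) by (rule Sp.tns)
 have z: "tns e g \<star> ?q \<in> Sp K K" by (rule Sp_mult[OF eg qS]) (use KB k(4) in auto)
 have c: "tns s e \<in> TC" "tns e s \<in> TC" "tns e g \<in> TC" using sD g(1) by simp_all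
 have "tns s e \<star> (tns e g \<star> ?q) = tns e g \<star> (tns s e \<star> ?q)"
  using tp.T.m_assoc[OF c(1,3) qT] tp.T.m_assoc[OF c(3,1) qT] sD g(1) by (simp add: tns_m)
 also have "\<dots> = tns e g \<star> (tns e s \<star> ?q)" unfolding quot_flip[OF sD a r] ..
 also have "\<dots> = tns e s \<star> (tns e g \<star> ?q)"
  using tp.T.m_assoc[OF c(2,3) qT] tp.T.m_assoc[OF c(3,2) qT] sD g(1) K_comm[OF assms(1) g(1)] by (simp add: tns_m)
 finally have fl: "tns s e \<star> (tns e g \<star> ?q) = tns e s \<star> (tns e g \<star> ?q)" .
 have "act (tns e g \<star> ?q) \<one> = act (tns e g) ?d" using act_mult[OF c(3) qT oneA] quot_act[OF sD a] by simp
 also have "\<dots> = e" using dK g by (simp add: act_tns)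
 finally show ?thesis using z fl assms(1) unfolding sepid_rel_def equalizer_def by blast
qed

text \<open>The product of the elements found for the single generators: multiplying in the
  commutative image of \<open>K \<otimes> K\<close> can only enlarge an equalizer, and the product
  \<open>e\<close> of each factor is preserved.\<close>

lemma sepid_finite:
 assumes "finite S" "S \<subseteq> K" "!!s. s \<in> S ==> D.sep s"
 shows "\<exists>z. sepid_rel S z"
 using assms
proof (induction S)
 case empty
 have "tns e e \<in> Sp K K" using subalgK(3)[OF K_sub] by (intro Sp.tns)
 moreover have "act (tns e e) \<one> = e" using oneA by (simp add: act_tns mult_r_one)
 ultimately show ?case unfolding sepid_rel_def by blast
next
 case (insert s S)
 obtain z where z: "sepid_rel S z" using insert by auto
 obtain y where y: "sepid_rel {s} y" using sepid_single[of s] insert.prems by auto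
 note k = subalgK[OF K_sub]
 have zS: "z \<in> Sp K K" and yS: "y \<in> Sp K K" and z1: "act z \<one> = e" and y1: "act y \<one> = e"
  using z y unfolding sepid_rel_def by auto
 have zT: "z \<in> TC" and yT: "y \<in> TC" using SpB[OF zS KB KB] SpB[OF yS KB KB] .
 have yz: "y \<star> z = z \<star> y" by (rule Sp_commute[OF yS zS]) (use KB K_comm in auto)
 have eqm: "equalizer u \<subseteq> equalizer (u \<star> v)" if uv: "u \<in> TC" "v \<in> TC" for u v
 proof
  fix x assume x: "x \<in> equalizer u"
  then have xK: "x \<in> K" and xe: "tns x e \<star> u = tns e x \<star> u" by (auto simp: equalizer_def)
  have "tns x e \<star> (u \<star> v) = tns e x \<star> (u \<star> v)"
   using tp.T.m_assoc[of "tns x e" u v] tp.T.m_assoc[of "tns e x" u v] xe xK uv by simp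
  then show "x \<in> equalizer (u \<star> v)" using xK by (simp add: equalizer_def)
 qed
 have "insert s S \<subseteq> equalizer (y \<star> z)"
  using eqm[OF yT zT] eqm[OF zT yT] z y unfolding yz sepid_rel_def by blast
 moreover have "y \<star> z \<in> Sp K K" by (rule Sp_mult[OF yS zS]) (use KB k(4) in auto)
 moreover have "act (y \<star> z) \<one> = e"
  using act_mult[OF yT zT oneA] z1 y1 Sp_De(3)[of y] yS Sp_K_D by auto
 ultimately show ?case unfolding sepid_rel_def by blast
qed

lemma sepid_gen:
 assumes "finite S" "K = D.gen S" "S \<subseteq> D" "!!s. s \<in> S ==> D.sep s"
 shows "\<exists>z. sepid_rel K z"
proof -
 have SK: "S \<subseteq> K" unfolding assms(2) by (rule D.gen_incl)
 obtain z where z: "sepid_rel S z" using sepid_finite[OF assms(1) SK assms(4)] by blast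
 have zT: "z \<in> TC" using z KB SpB unfolding sepid_rel_def by blast
 have "D.gen S \<subseteq> equalizer z"
  by (rule D.gen_min[OF equalizer_subalg[OF zT]]) (use z in \<open>simp add: sepid_rel_def\<close>)
 then show ?thesis using z assms(2) unfolding sepid_rel_def by blast
qed

end

section \<open>Etale subalgebras\<close>

context qassoc_sub begin

lemma K_subsp: "subsp K"
 by (rule subspI) (use subalgK(2,5,6)[OF K_sub] in \<open>simp_all add: subset_iff\<close>)

lemma sepid_gen_ex:
 assumes "finite S" "K = D.gen S" "S \<subseteq> D" "!!s. s \<in> S ==> D.sep s"
 shows "\<exists>z \<in> Sp K K. (\<forall>k \<in> K. tns k e \<star> z = tns e k \<star> z) \<and> act z \<one> = e"
 using sepid_gen[OF assms] unfolding sepid_rel_def equalizer_def by blast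

end

lemma finite_dimensional_one_update [simp]:
 "finite_dimensional F (A\<lparr>carrier := D, one := e\<rparr>) = finite_dimensional F (A\<lparr>carrier := D\<rparr>)"
 by (simp add: finite_dimensional_def finsum_def)

section \<open>The center of \<open>B\<close> and tori in the corners\<close>

context qassoc begin

abbreviation corner :: "'a => 'a set" where "corner e \<equiv> tp.B.corner e"

abbreviation corner_ring :: "'a => ('f, 'a, 'm) module_scheme" where
 "corner_ring e \<equiv> A\<lparr>carrier := corner e, one := e\<rparr>"

lemma corner_iff: "x \<in> corner e \<longleftrightarrow> x \<in> B \<and> e \<otimes> x = x \<and> x \<otimes> e = x"
 by (auto simp: tp.B.corner_def)

lemma subsp_of_B: "submodule W F AB ==> subsp W"
 by (rule subspI) (use tp.B.subspD(1,2,3,6)[of W] in \<open>auto simp: subset_iff\<close>)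

lemma division_algebraI:
 assumes "subsp D" "D \<subseteq> B" "!!x y. x \<in> D ==> y \<in> D ==> x \<otimes> y \<in> D"
  "e \<in> D" "!!x. x \<in> D ==> e \<otimes> x = x" "!!x. x \<in> D ==> x \<otimes> e = x" "e \<noteq> \<zero>"
  "!!x. x \<in> D ==> x \<noteq> \<zero> ==> \<exists>y \<in> D. y \<otimes> x = e"
 shows "division_algebra F (A\<lparr>carrier := D, one := e\<rparr>)"
proof (intro division_algebra.intro fd_algebra.intro fd_algebra_axioms.intro division_algebra_axioms.intro)
 show "assoc_algebra F (A\<lparr>carrier := D, one := e\<rparr>)"
  by (rule subalgebra_assoc[OF assms(1) _ assms(3-6)]) (use assms(2) B_nuc in blast)
 show "finite_dimensional F (A\<lparr>carrier := D, one := e\<rparr>)" using subsp_fin_dim[OF assms(1)] by simp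
qed (use assms(7,8) in simp_all)

lemma alg_center_B: "alg_center AB = L"
proof -
 have "associator AB x y z = \<zero>\<^bsub>AB\<^esub>" if "x \<in> B" "y \<in> B" "z \<in> B" for x y z
 proof -
  have e: "x \<otimes> y \<otimes> z = x \<otimes> (y \<otimes> z)" and c: "x \<otimes> (y \<otimes> z) \<in> carrier AB"
   using that by (simp_all add: assB Bmult)
  show ?thesis using tp.B.r_neg[OF c] e by (simp add: associator_def a_minus_def)
 qed
 then show ?thesis unfolding alg_center_def nucleus_def by (auto simp: L_iff)
qed

lemma L_subsp: "subsp L" by (rule subsp_of_B) (rule tp.B.subalgD(1)[OF L_alg])

lemma L_field: "field (A\<lparr>carrier := L\<rparr>)"
 "x \<in> L ==> separable_element (A\<lparr>carrier := L\<rparr>) ((%c. c \<odot> \<one>) ` carrier F) x"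
 using qaD(7) unfolding finite_separable_extension_def alg_center_B by simp_all

lemma B_nz: "\<one> \<noteq> \<zero>" using BA.one_nz by simp

lemma L_inv: assumes "x \<in> L" "x \<noteq> \<zero>" shows "\<exists>y \<in> L. y \<otimes> x = \<one> \<and> x \<otimes> y = \<one>"
proof -
 interpret L: field "A\<lparr>carrier := L\<rparr>" by (rule L_field)
 have "x \<in> Units (A\<lparr>carrier := L\<rparr>)" unfolding L.field_Units using assms by simp
 then show ?thesis unfolding Units_def by auto
qed

lemma L_division: "division_algebra F (A\<lparr>carrier := L, one := \<one>\<rparr>)"
 by (rule division_algebraI[OF L_subsp L_B L_closed(3,2) _ _ B_nz])
  (use L_inv L_B in \<open>auto simp: mult_l_one mult_r_one subset_iff\<close>)

lemma L_sep: assumes "x \<in> L" shows "assoc_algebra.sep F (A\<lparr>carrier := L, one := \<one>\<rparr>) x"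
 by (rule division_algebra.separable_element_sep[OF L_division]) (use Lc L_B L_field(2) assms in \<open>simp_all add: subset_iff\<close>)

text \<open>All elements of \<open>L\<close> are separable, so a finite spanning set of
  \<open>L\<close> is a finite set of separable generators.\<close>

lemma L_sepid: "\<exists>d. sepid L d"
proof -
 interpret LD: division_algebra F "A\<lparr>carrier := L, one := \<one>\<rparr>" by (rule L_division)
 obtain S where S: "finite S" "S \<subseteq> L" "L = spanV S" by (rule subsp_fin_span[OF L_subsp]) blast
 have sub: "LD.subalg L" using LD.subalg_carrier by simp
 have q: "qassoc_sub F A B L \<one> L"
  by (intro qassoc_sub.intro qassoc_axioms qassoc_sub_axioms.intro L_B L_division sub) (use Lc L_B in blast)
 have g: "LD.subalg (LD.gen S)" by (rule LD.gen_subalg) (use S(2) in simp)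
 have gL: "LD.gen S \<subseteq> L" by (rule LD.gen_min[OF sub S(2)])
 have "subsp (LD.gen S)"
  by (rule subspI) (use LD.subspD(2,3,6)[OF LD.subalgD(1)[OF g]] gL L_B in \<open>auto simp: subset_iff\<close>)
 then have "L \<subseteq> LD.gen S" unfolding S(3)[symmetric] using spanV_min[OF _ LD.gen_incl] S(3) by blast
 then have "L = LD.gen S" using gL by blast
 from qassoc_sub.sepid_gen_ex[OF q S(1) this S(2)] L_sep S(2)
 have "\<exists>z \<in> Sp L L. (\<forall>k \<in> L. tns k \<one> \<star> z = tns \<one> k \<star> z) \<and> act z \<one> = \<one>" by blast
 then show ?thesis unfolding sepid_def using L_B by blast
qed

text \<open>\<open>Q\<close> takes the place of a maximal separable subfield of the corner. The
  conditions are the ones that pass to sums over orthogonal idempotents: a separability idempotent,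
  the share of \<open>L\<close> in the corner, and a commutative centralizer.\<close>

definition torus :: "'a => 'a set => bool" where
 "torus e Q \<longleftrightarrow> qassoc_sub F A B (corner e) e Q \<and>
   (\<exists>z \<in> Sp Q Q. (\<forall>k \<in> Q. tns k e \<star> z = tns e k \<star> z) \<and> act z \<one> = e) \<and> (\<forall>l \<in> L. e \<otimes> l \<in> Q) \<and>
   (\<forall>c \<in> corner e. \<forall>c' \<in> corner e. (\<forall>k \<in> Q. c \<otimes> k = k \<otimes> c \<and> c' \<otimes> k = k \<otimes> c') \<longrightarrow> c \<otimes> c' = c' \<otimes> c)"

lemma corner_division:
 assumes "BA.division_decomp g E" "e \<in> E"
 shows "division_algebra F (corner_ring e)" "e \<in> B" "corner e \<subseteq> B"
proof -
 note E = BA.division_decompD[OF assms(1)]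
 show eB: "e \<in> B" using E(2) assms(2) by (auto simp: corner_iff)
 show cB: "corner e \<subseteq> B" by (auto simp: corner_iff)
 have ee: "e \<otimes> e = e" using E(3)[OF assms(2)] by simp
 show "division_algebra F (corner_ring e)"
 proof (rule division_algebraI)
  show "subsp (corner e)" by (rule subsp_of_B, rule tp.B.corner_subsp) (use eB in simp)
  show "x \<otimes> y \<in> corner e" if "x \<in> corner e" "y \<in> corner e" for x y
   using tp.B.corner_mult[of e x y] that eB by simp
 qed (use eB cB ee E(4,7)[OF assms(2)] in \<open>auto simp: corner_iff\<close>)
qed

text \<open>\<open>max_separable_subfield\<close> in the corner. The elements \<open>e l\<close>
  with \<open>l\<close> in \<open>L\<close> centralize everything in the corner, so the maximality
  clause puts them into \<open>Q\<close> once they are known to be separable.\<close>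

lemma torus_ex:
 assumes "BA.division_decomp g E" "e \<in> E"
 shows "\<exists>Q. torus e Q"
proof -
 note cd = corner_division[OF assms]
 interpret D: division_algebra F "corner_ring e" by (rule cd(1))
 interpret LD: division_algebra F "A\<lparr>carrier := L, one := \<one>\<rparr>" by (rule L_division)
 have ce: "x \<in> B" "e \<otimes> x = x" "x \<otimes> e = x" if "x \<in> corner e" for x using that by (simp_all add: corner_iff)
 have eB: "e \<in> B" by (rule cd(2))
 obtain S where S: "finite S" "S \<subseteq> corner e" "S \<subseteq> D.cent S" "!!s. s \<in> S ==> D.sep s"
  and mx: "!!c. c \<in> D.cent (D.gen S) ==> D.sep c ==> c \<in> D.gen S"
  and cm: "!!x y. x \<in> D.cent (D.gen S) ==> y \<in> D.cent (D.gen S) ==> x \<otimes> y = y \<otimes> x"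
  by (rule D.max_separable_subfield) simp
 let ?Q = "D.gen S"
 have Sc: "S \<subseteq> carrier (corner_ring e)" using S(2) by simp
 have Qs: "D.subalg ?Q" by (rule D.gen_subalg[OF Sc])
 have Qc: "?Q \<subseteq> corner e" using D.subspD(1)[OF D.subalgD(1)[OF Qs]] by simp
 have cI: "c \<in> D.cent ?Q" if "c \<in> corner e" "!!k. k \<in> ?Q ==> c \<otimes> k = k \<otimes> c" for c
  unfolding D.cent_def using that by simp
 have Qcomm: "x \<otimes> y = y \<otimes> x" if "x \<in> ?Q" "y \<in> ?Q" for x y
  using D.gen_comm[OF Sc S(3)] that unfolding D.cent_def by auto
 have q: "qassoc_sub F A B (corner e) e ?Q"
  by (intro qassoc_sub.intro qassoc_axioms qassoc_sub_axioms.intro cd(1,3) Qs Qcomm)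
 have "e \<otimes> l \<in> ?Q" if l: "l \<in> L" for l
 proof (rule mx)
  have lB: "l \<in> B" using l L_B by blast
  have le: "e \<otimes> l = l \<otimes> e" using Lc[OF l eB] by simp
  have ee: "e \<otimes> e = e" using ce(2)[of e] D.one_closed by simp
  have elc: "e \<otimes> l \<in> corner e"
  proof -
   have "e \<otimes> (e \<otimes> l) = e \<otimes> l" using assB(1)[of e e l] eB lB ee by simp
   moreover have "(e \<otimes> l) \<otimes> e = e \<otimes> l" unfolding le using assB(1)[of l e e] eB lB ee by simp
   ultimately show ?thesis using Bmult[OF eB lB] by (simp add: corner_iff)
  qed
  show "e \<otimes> l \<in> D.cent ?Q"
  proof (rule cI[OF elc])
   fix k assume "k \<in> ?Q"
   then have k: "k \<in> B" "e \<otimes> k = k" "k \<otimes> e = k" using ce Qc by blast+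
   have "(e \<otimes> l) \<otimes> k = (l \<otimes> e) \<otimes> k" by (simp add: le)
   also have "\<dots> = l \<otimes> k" using assB(1)[of l e k] k lB eB by simp
   also have "\<dots> = k \<otimes> l" using Lc[OF l k(1)] .
   also have "\<dots> = k \<otimes> (e \<otimes> l)" using assB(1)[of k e l] k lB eB by simp
   finally show "(e \<otimes> l) \<otimes> k = k \<otimes> (e \<otimes> l)" .
  qed
  \<comment> \<open>A polynomial that separates \<open>l\<close> also separates \<open>e l\<close>:
    its value there is \<open>e\<close> times the old value, and its derivative is \<open>e\<close>
    times a nonzero, hence invertible, element of the field \<open>L\<close>.\<close>
  obtain a n where a: "!!k. a k \<in> carrier F" and r: "nsum A (%k. a k \<odot> l [^]\<^bsub>A\<lparr>carrier := L, one := \<one>\<rparr>\<^esub> k) (Suc n) = \<zero>"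
   and d: "nsum A (%k. add_pow F (Suc k) (a (Suc k)) \<odot> l [^]\<^bsub>A\<lparr>carrier := L, one := \<one>\<rparr>\<^esub> k) n \<noteq> \<zero>"
   using L_sep[OF l] unfolding LD.sep_def by auto
  let ?l = "%k::nat. l [^]\<^bsub>A\<lparr>carrier := L, one := \<one>\<rparr>\<^esub> k"
  have lk: "?l k \<in> L" for k using LD.nat_pow_closed[of l k] l by simp
  have lkB: "?l k \<in> B" for k using lk L_B by blast
  have pw: "(e \<otimes> l) [^]\<^bsub>corner_ring e\<^esub> k = e \<otimes> ?l k" for k :: nat
  proof (induction k)
   case 0
   show ?case using eB by (simp add: mult_r_one)
  next
   case (Suc k)
   have "(e \<otimes> l) [^]\<^bsub>corner_ring e\<^esub> Suc k = (e \<otimes> ?l k) \<otimes> (e \<otimes> l)" using Suc by simp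
   also have "\<dots> = (?l k \<otimes> e) \<otimes> (e \<otimes> l)" using Lc[OF lk eB, of k] by simp
   also have "\<dots> = ?l k \<otimes> (e \<otimes> l)" using assB(1)[of "?l k" e "e \<otimes> l"] assB(1)[of e e l] ee eB lB lkB Bmult[OF eB lB] by simp
   also have "\<dots> = (?l k \<otimes> e) \<otimes> l" using assB(1)[of "?l k" e l] eB lB lkB by simp
   also have "\<dots> = e \<otimes> (?l k \<otimes> l)" using Lc[OF lk eB, of k] assB(1)[of e "?l k" l] eB lB lkB by simp
   finally show ?case by simp
  qed
  have es: "nsum A (%k. c k \<odot> (e \<otimes> ?l k)) m = e \<otimes> nsum A (%k. c k \<odot> ?l k) m" if c: "!!k. c k \<in> carrier F" for c m
  proof -
   have "e \<otimes> nsum A (%k. c k \<odot> ?l k) m = nsum A (%k. e \<otimes> (c k \<odot> ?l k)) m"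
    by (rule endo_nsum[where h = "%v. e \<otimes> v"])
     (use c eB lkB in \<open>simp_all add: mult_r_distr mult_closed\<close>)
   also have "\<dots> = nsum A (%k. c k \<odot> (e \<otimes> ?l k)) m"
    by (rule nsum_cong) (use c eB lkB in \<open>simp add: mult_smult_r\<close>)
   finally show ?thesis by simp
  qed
  let ?d = "nsum A (%k. add_pow F (Suc k) (a (Suc k)) \<odot> ?l k) n"
  have ac: "add_pow F (Suc k) (a (Suc k)) \<in> carrier F" for k by (rule R.add.nat_pow_closed[OF a])
  have dL: "?d \<in> L" by (rule nsum_in) (use subspD(1,2,3)[OF L_subsp] L_closed(4)[OF ac lk] in auto)
  have "e \<otimes> ?d \<noteq> \<zero>"
  proof
   assume z: "e \<otimes> ?d = \<zero>"
   obtain y where y: "y \<in> L" "?d \<otimes> y = \<one>" using L_inv[OF dL d] by blast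
   have "e = e \<otimes> (?d \<otimes> y)" using y eB by (simp add: mult_r_one)
   also have "\<dots> = (e \<otimes> ?d) \<otimes> y" using assB(1)[of e ?d y] eB dL y(1) L_B by (simp add: subset_iff)
   also have "\<dots> = \<zero>" unfolding z using y(1) L_B by (simp add: zero_mult_l subset_iff)
   finally show False using D.one_nz by simp
  qed
  show "D.sep (e \<otimes> l)"
   unfolding D.sep_def using a es[of a "Suc n", OF a] es[of "%k. add_pow F (Suc k) (a (Suc k))" n, OF ac] r eB \<open>e \<otimes> ?d \<noteq> \<zero>\<close>
   by (intro exI[of _ a] exI[of _ n]) (simp add: pw zero_mult_r del: nsum.simps D.nat_pow_Suc)
 qed
 moreover have "\<exists>z \<in> Sp ?Q ?Q. (\<forall>k \<in> ?Q. tns k e \<star> z = tns e k \<star> z) \<and> act z \<one> = e"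
  by (rule qassoc_sub.sepid_gen_ex[OF q S(1) refl S(2,4)])
 moreover have "c \<otimes> c' = c' \<otimes> c"
  if "c \<in> corner e" "c' \<in> corner e" "\<forall>k \<in> ?Q. c \<otimes> k = k \<otimes> c \<and> c' \<otimes> k = k \<otimes> c'" for c c'
  by (rule cm) (rule cI, use that in auto)+
 ultimately show ?thesis using q unfolding torus_def by blast
qed

lemma torus_family:
 obtains E Q where "BA.division_decomp \<one> E" "\<forall>e \<in> E. torus e (Q e)"
proof -
 obtain E where E: "BA.division_decomp \<one> E"
  using BA.idempotent_decomposition[of \<one>] Bone oneA by (auto simp: mult_l_one)
 then have "\<forall>e \<in> E. \<exists>Q. torus e Q" using torus_ex by blast
 then obtain Q where "\<forall>e \<in> E. torus e (Q e)" by (rule bchoice[THEN exE])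
 then show ?thesis using that E by blast
qed

lemma Sp_unit:
 assumes "t \<in> Sp Q Q" "Q \<subseteq> B" "e \<in> B" "!!q. q \<in> Q ==> e \<otimes> q = q \<and> q \<otimes> e = q"
 shows "tns e e \<star> t = t"
 using assms(1)
proof (induction rule: Sp.induct)
 case (tns x y)
 have "x \<in> B" "y \<in> B" using tns assms(2) by auto
 then show ?case using tns assms(3,4) by (simp add: tns_m)
next
 case (add t u)
 then show ?case using SpB[OF add(1) assms(2,2)] SpB[OF add(2) assms(2,2)] assms(3) by (simp add: tp.T.r_distr)
qed

text \<open>The direct sum of the \<open>Q e\<close>, described by Peirce components: the block
  diagonal elements whose block at \<open>e\<close> lies in \<open>Q e\<close>.\<close>

definition torus_sum :: "'a set => ('a => 'a set) => 'a set" where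
 "torus_sum E Q = {x \<in> B. \<forall>e \<in> E. e \<otimes> x = x \<otimes> e \<and> e \<otimes> x \<in> Q e}"

section \<open>The algebra \<open>K\<close> attached to a family of tori\<close>

context
 fixes E Q
 assumes E: "BA.division_decomp \<one> E" and Q: "\<forall>e \<in> E. torus e (Q e)"
begin

lemma E_facts:
 "e \<in> E ==> e \<in> B" "e \<in> E ==> e \<otimes> e = e" "e \<in> E ==> e' \<in> E ==> e \<noteq> e' ==> e \<otimes> e' = \<zero>" "finite E"
 using BA.division_decompD(1,3,5)[OF E] corner_division(2)[OF E] by simp_all

lemma Q_sub: "e \<in> E ==> qassoc_sub F A B (corner e) e (Q e)" using Q unfolding torus_def by blast

lemma Q_facts:
 assumes "e \<in> E"
 shows "subsp (Q e)" "e \<in> Q e" "x \<in> Q e ==> y \<in> Q e ==> x \<otimes> y \<in> Q e" "Q e \<subseteq> corner e" "Q e \<subseteq> B"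
  "x \<in> Q e ==> y \<in> Q e ==> x \<otimes> y = y \<otimes> x" "x \<in> Q e ==> e \<otimes> x = x" "x \<in> Q e ==> x \<otimes> e = x"
proof -
 note q = Q_sub[OF assms]
 note ks = qassoc_sub.subalgK[OF q qassoc_sub.K_sub[OF q]]
 show "subsp (Q e)" by (rule qassoc_sub.K_subsp[OF q])
 show Qc: "Q e \<subseteq> corner e" by (rule ks(1))
 then show "Q e \<subseteq> B" "x \<in> Q e ==> e \<otimes> x = x" "x \<in> Q e ==> x \<otimes> e = x" by (auto simp: corner_iff)
 show "e \<in> Q e" by (rule ks(3))
 show "x \<in> Q e ==> y \<in> Q e ==> x \<otimes> y \<in> Q e" by (rule ks(4))
 show "x \<in> Q e ==> y \<in> Q e ==> x \<otimes> y = y \<otimes> x" by (rule qassoc_sub.K_comm[OF q])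
qed

lemma E_sum: assumes "u \<in> B" shows "finsum AB (%e. e \<otimes> u) E = u"
proof -
 have "finsum AB (%e. e) E \<otimes>\<^bsub>AB\<^esub> u = finsum AB (%e. e \<otimes>\<^bsub>AB\<^esub> u) E"
  by (rule tp.B.finsum_ldistr) (use assms E_facts in auto)
 then show ?thesis using BA.division_decompD(6)[OF E] assms by (simp add: mult_l_one)
qed

text \<open>As the idempotents add up to 1, equations in \<open>B\<close> may be checked block by
  block.\<close>

lemma E_eq:
 assumes "u \<in> B" "v \<in> B" "!!e. e \<in> E ==> e \<otimes> u = e \<otimes> v" shows "u = v"
proof -
 have "finsum AB (%e. e \<otimes> u) E = finsum AB (%e. e \<otimes> v) E"
  by (rule tp.B.finsum_cong') (use assms E_facts Bmult in auto)
 then show ?thesis using E_sum assms by simp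
qed

abbreviation "Kt \<equiv> torus_sum E Q"

lemma K_iff: "x \<in> Kt \<longleftrightarrow> x \<in> B \<and> (\<forall>e \<in> E. e \<otimes> x = x \<otimes> e \<and> e \<otimes> x \<in> Q e)" by (simp add: torus_sum_def)

lemma KD: "x \<in> Kt ==> x \<in> B" "x \<in> Kt ==> e \<in> E ==> e \<otimes> x = x \<otimes> e" "x \<in> Kt ==> e \<in> E ==> e \<otimes> x \<in> Q e"
 unfolding K_iff by blast+

lemma K_B: "Kt \<subseteq> B" using KD(1) by blast

lemma K_prod: assumes "x \<in> Kt" "y \<in> Kt" "e \<in> E" shows "e \<otimes> (x \<otimes> y) = (e \<otimes> x) \<otimes> (e \<otimes> y)"
proof -
 note c = KD(1)[OF assms(1)] KD(1)[OF assms(2)] E_facts(1)[OF assms(3)]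
 have "(e \<otimes> x) \<otimes> (e \<otimes> y) = ((x \<otimes> e) \<otimes> e) \<otimes> y" using KD(2)[OF assms(1,3)] assB(1)[of "x \<otimes> e" e y] c Bmult by simp
 also have "(x \<otimes> e) \<otimes> e = e \<otimes> x" using KD(2)[OF assms(1,3)] assB(1)[of x e e] c E_facts(2)[OF assms(3)] by simp
 also have "(e \<otimes> x) \<otimes> y = e \<otimes> (x \<otimes> y)" using assB(1)[of e x y] c by simp
 finally show ?thesis by simp
qed

lemma K_subsp: "subsp Kt"
proof (rule subspI)
 show "Kt \<subseteq> AC" using K_B Bc by blast
 show "\<zero> \<in> Kt" unfolding K_iff using Bzero E_facts(1) subspD(2)[OF Q_facts(1)] by (simp add: zero_mult_l zero_mult_r)
 show "x \<oplus> y \<in> Kt" if xy: "x \<in> Kt" "y \<in> Kt" for x y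
  unfolding K_iff
 proof (intro conjI ballI)
  show "x \<oplus> y \<in> B" by (rule Badd[OF KD(1)[OF xy(1)] KD(1)[OF xy(2)]])
  fix e assume e: "e \<in> E"
  have d: "e \<otimes> (x \<oplus> y) = e \<otimes> x \<oplus> e \<otimes> y" "(x \<oplus> y) \<otimes> e = x \<otimes> e \<oplus> y \<otimes> e"
   using KD(1)[OF xy(1)] KD(1)[OF xy(2)] E_facts(1)[OF e] by (simp_all add: mult_l_distr mult_r_distr)
  show "e \<otimes> (x \<oplus> y) = (x \<oplus> y) \<otimes> e" unfolding d KD(2)[OF xy(1) e] KD(2)[OF xy(2) e] ..
  show "e \<otimes> (x \<oplus> y) \<in> Q e" unfolding d
   by (rule subspD(3)[OF Q_facts(1)[OF e] KD(3)[OF xy(1) e] KD(3)[OF xy(2) e]])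
 qed
 show "c \<odot> x \<in> Kt" if c: "c \<in> carrier F" and x: "x \<in> Kt" for c x
  unfolding K_iff
 proof (intro conjI ballI)
  show "c \<odot> x \<in> B" by (rule Bsmult[OF c KD(1)[OF x]])
  fix e assume e: "e \<in> E"
  have d: "e \<otimes> (c \<odot> x) = c \<odot> (e \<otimes> x)" "(c \<odot> x) \<otimes> e = c \<odot> (x \<otimes> e)"
   using c KD(1)[OF x] E_facts(1)[OF e] by (simp_all add: mult_smult_l mult_smult_r)
  show "e \<otimes> (c \<odot> x) = (c \<odot> x) \<otimes> e" unfolding d KD(2)[OF x e] ..
  show "e \<otimes> (c \<odot> x) \<in> Q e" unfolding d
   by (rule subspD(6)[OF Q_facts(1)[OF e] c KD(3)[OF x e]])
 qed
qed

lemma L_K: "L \<subseteq> Kt"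
proof
 fix l assume l: "l \<in> L"
 show "l \<in> Kt" unfolding K_iff
 proof (intro conjI ballI)
  show "l \<in> B" using l L_B by blast
  fix e assume e: "e \<in> E"
  show "e \<otimes> l = l \<otimes> e" using Lc[OF l E_facts(1)[OF e]] by simp
  show "e \<otimes> l \<in> Q e" using bspec[OF Q e] l unfolding torus_def by blast
 qed
qed

lemma K_one: "\<one> \<in> Kt" using L_K L_closed(2) by blast

lemma K_mult: assumes "x \<in> Kt" "y \<in> Kt" shows "x \<otimes> y \<in> Kt" unfolding K_iff
proof (intro conjI ballI)
 note c = KD(1)[OF assms(1)] KD(1)[OF assms(2)]
 show "x \<otimes> y \<in> B" using Bmult[OF c] .
 fix e assume e: "e \<in> E"
 note eB = E_facts(1)[OF e]
 show "e \<otimes> (x \<otimes> y) \<in> Q e" unfolding K_prod[OF assms e] by (intro Q_facts(3)[OF e] KD(3) assms e)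
 have "e \<otimes> (x \<otimes> y) = (x \<otimes> e) \<otimes> y" using assB(1)[of e x y] c eB KD(2)[OF assms(1) e] by simp
 also have "\<dots> = x \<otimes> (y \<otimes> e)" using assB(1)[of x e y] c eB KD(2)[OF assms(2) e] by simp
 also have "\<dots> = (x \<otimes> y) \<otimes> e" using assB(1)[of x y e] c eB by simp
 finally show "e \<otimes> (x \<otimes> y) = (x \<otimes> y) \<otimes> e" .
qed

lemma K_comm: assumes "x \<in> Kt" "y \<in> Kt" shows "x \<otimes> y = y \<otimes> x"
proof (rule E_eq)
 fix e assume e: "e \<in> E"
 show "e \<otimes> (x \<otimes> y) = e \<otimes> (y \<otimes> x)" unfolding K_prod[OF assms e] K_prod[OF assms(2,1) e]
  by (rule Q_facts(6)[OF e]) (intro KD(3) assms e)+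
qed (use Bmult KD(1) assms in simp_all)

lemma Q_K: assumes "e \<in> E" shows "Q e \<subseteq> Kt"
proof
 fix x assume x: "x \<in> Q e"
 have xB: "x \<in> B" using x Q_facts(5)[OF assms] by blast
 note eB = E_facts(1)[OF assms]
 show "x \<in> Kt" unfolding K_iff
 proof (intro conjI ballI)
  fix f assume f: "f \<in> E"
  note fB = E_facts(1)[OF f]
  have "f \<otimes> x = x \<otimes> f \<and> f \<otimes> x \<in> Q f"
  proof (cases "f = e")
   case True
   then show ?thesis using Q_facts(7,8)[OF assms x] x by simp
  next
   case False
   have "f \<otimes> x = (f \<otimes> e) \<otimes> x" using assB(1)[of f e x] Q_facts(7)[OF assms x] fB eB xB by simp
   also have "\<dots> = \<zero>" using E_facts(3)[OF f assms False] xB by (simp add: zero_mult_l)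
   finally have 1: "f \<otimes> x = \<zero>" .
   have "x \<otimes> f = x \<otimes> (e \<otimes> f)" using assB(1)[of x e f] Q_facts(8)[OF assms x] fB eB xB by simp
   also have "\<dots> = \<zero>" using E_facts(3)[OF assms f] False xB by (simp add: zero_mult_r)
   finally show ?thesis using 1 subspD(2)[OF Q_facts(1)[OF f]] by simp
  qed
  then show "f \<otimes> x = x \<otimes> f" "f \<otimes> x \<in> Q f" by blast+
 qed (rule xB)
qed

text \<open>An element that centralizes \<open>K\<close> commutes with the idempotents, which lie in
  \<open>K\<close>. It is therefore block diagonal, and its block at \<open>e\<close> centralizes
  \<open>Q e\<close> inside the corner, where centralizers are commutative by the choice of the
  torus.\<close>

lemma K_cent:
 assumes "c \<in> tp.B.cent Kt" "c' \<in> tp.B.cent Kt" shows "c \<otimes> c' = c' \<otimes> c"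
proof -
 have cB: "c \<in> B" "c' \<in> B" and ck: "!!k. k \<in> Kt ==> c \<otimes> k = k \<otimes> c" "!!k. k \<in> Kt ==> c' \<otimes> k = k \<otimes> c'"
  using assms unfolding tp.B.cent_def by auto
 show ?thesis
 proof (rule E_eq)
  fix e assume e: "e \<in> E"
  note eB = E_facts(1)[OF e] and ee = E_facts(2)[OF e]
  have eK: "e \<in> Kt" using Q_K[OF e] Q_facts(2)[OF e] by blast
  have sw: "e \<otimes> d \<in> corner e \<and> (\<forall>k \<in> Q e. (e \<otimes> d) \<otimes> k = k \<otimes> (e \<otimes> d))"
   if d: "d \<in> B" "!!k. k \<in> Kt ==> d \<otimes> k = k \<otimes> d" for d
  proof -
   have ed: "d \<otimes> e = e \<otimes> d" by (rule d(2)[OF eK])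
   have 1: "e \<otimes> (e \<otimes> d) = e \<otimes> d" using assB(1)[of e e d] eB d(1) ee by simp
   have 2: "(e \<otimes> d) \<otimes> e = e \<otimes> d" unfolding ed[symmetric] using assB(1)[of d e e] eB d(1) ee by simp
   have 3: "(e \<otimes> d) \<otimes> k = k \<otimes> (e \<otimes> d)" if k: "k \<in> Q e" for k
   proof -
    have kB: "k \<in> B" using k Q_facts(5)[OF e] by blast
    have kK: "k \<in> Kt" using k Q_K[OF e] by blast
    have "(e \<otimes> d) \<otimes> k = (d \<otimes> e) \<otimes> k" unfolding ed ..
    also have "\<dots> = d \<otimes> k" using assB(1)[of d e k] Q_facts(7)[OF e k] d(1) eB kB by simp
    also have "\<dots> = k \<otimes> d" by (rule d(2)[OF kK])
    also have "\<dots> = k \<otimes> (e \<otimes> d)" using assB(1)[of k e d] Q_facts(8)[OF e k] d(1) eB kB by simp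
    finally show ?thesis .
   qed
   show ?thesis using 1 2 3 Bmult[OF eB d(1)] by (simp add: corner_iff)
  qed
  have m: "(e \<otimes> d) \<otimes> (e \<otimes> d') = e \<otimes> (d \<otimes> d')" if "d \<in> B" "d' \<in> B" "e \<otimes> d = d \<otimes> e" for d d'
  proof -
   have "(e \<otimes> d) \<otimes> (e \<otimes> d') = ((d \<otimes> e) \<otimes> e) \<otimes> d'" using that assB(1)[of "d \<otimes> e" e d'] eB Bmult by simp
   also have "(d \<otimes> e) \<otimes> e = e \<otimes> d" using that assB(1)[of d e e] eB ee by simp
   also have "(e \<otimes> d) \<otimes> d' = e \<otimes> (d \<otimes> d')" using that assB(1)[of e d d'] eB by simp
   finally show ?thesis .
  qed
  have "(e \<otimes> c) \<otimes> (e \<otimes> c') = (e \<otimes> c') \<otimes> (e \<otimes> c)"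
   using bspec[OF Q e] sw[OF cB(1) ck(1)] sw[OF cB(2) ck(2)] unfolding torus_def by blast
  then show "e \<otimes> (c \<otimes> c') = e \<otimes> (c' \<otimes> c)" using m[OF cB] m[OF cB(2,1)] ck[OF eK] by simp
 qed (use Bmult cB in simp_all)
qed

text \<open>The sum of the separability idempotents of the blocks; their images under multiplication
  are the idempotents \<open>e\<close>, which add up to 1.\<close>

lemma K_sepid: "\<exists>z. sepid Kt z"
proof -
 have KC: "Kt \<subseteq> C0" using K_B by simp
 have "\<exists>z \<in> Sp Kt Kt. (\<forall>k \<in> Kt. tns k \<one> \<star> z = tns \<one> k \<star> z) \<and> act z \<one> = finsum AB (%e. e) E'"
  if "finite E'" "E' \<subseteq> E" for E'
  using that
 proof (induction E')
  case empty
  have "\<zero>\<^sub>T \<in> Sp Kt Kt" using subspD(2)[OF K_subsp] by (intro Sp_zero K_B KC)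
  then show ?case using oneA KD(1) Bone by (intro bexI[of _ "\<zero>\<^sub>T"]) (simp_all add: act_zero_l)
 next
  case (insert e E')
  then have e: "e \<in> E" by simp
  note eB = E_facts(1)[OF e] and ee = E_facts(2)[OF e]
  obtain z where z: "z \<in> Sp Kt Kt" "!!k. k \<in> Kt ==> tns k \<one> \<star> z = tns \<one> k \<star> z"
   "act z \<one> = finsum AB (%e. e) E'" using insert by auto
  obtain y where y: "y \<in> Sp (Q e) (Q e)" "!!k. k \<in> Q e ==> tns k e \<star> y = tns e k \<star> y" "act y \<one> = e"
   using bspec[OF Q e] unfolding torus_def by blast
  have yK: "y \<in> Sp Kt Kt" using y(1) Sp_mono[OF Q_K[OF e] Q_K[OF e]] by blast
  have zT: "z \<in> TC" and yT: "y \<in> TC" using SpB[OF z(1) K_B K_B] SpB[OF yK K_B K_B] .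
  have yu: "tns e e \<star> y = y" by (rule Sp_unit[OF y(1) Q_facts(5)[OF e] eB]) (simp add: Q_facts(7,8)[OF e])
  \<comment> \<open>\<open>y\<close> absorbs \<open>e \<otimes> e\<close>, so multiplying it by
    \<open>k \<otimes> 1\<close> amounts to multiplying it by \<open>e k \<otimes> e\<close>, where
    \<open>e k\<close> lies in \<open>Q e\<close>.\<close>
  have yk: "tns k \<one> \<star> y = tns \<one> k \<star> y" if k: "k \<in> Kt" for k
  proof -
   have kB: "k \<in> B" by (rule KD(1)[OF k])
   note c = kB Bone eB
   have t: "tns k \<one> \<in> TC" "tns \<one> k \<in> TC" "tns e e \<in> TC" using c by simp_all
   have "tns k \<one> \<star> y = (tns k \<one> \<star> tns e e) \<star> y" using tp.T.m_assoc[OF t(1,3) yT] yu by simp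
   also have "tns k \<one> \<star> tns e e = tns (e \<otimes> k) e" using c KD(2)[OF k e] by (simp add: tns_m mult_r_one)
   also have "tns (e \<otimes> k) e \<star> y = tns e (e \<otimes> k) \<star> y" by (rule y(2)[OF KD(3)[OF k e]])
   also have "tns e (e \<otimes> k) = tns \<one> k \<star> tns e e" using c by (simp add: tns_m mult_l_one)
   also have "(tns \<one> k \<star> tns e e) \<star> y = tns \<one> k \<star> y" using tp.T.m_assoc[OF t(2,3) yT] yu by simp
   finally show ?thesis .
  qed
  have "act (y \<boxplus> z) \<one> = finsum AB (%e. e) (insert e E')"
  proof -
   have "finsum AB (%e. e) (insert e E') = e \<oplus>\<^bsub>AB\<^esub> finsum AB (%e. e) E'"
    by (rule tp.B.finsum_insert) (use insert E_facts(1) in auto)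
   then show ?thesis using act_add_l[OF yT zT oneA] y(3) z(3) by simp
  qed
  moreover have "tns k \<one> \<star> (y \<boxplus> z) = tns \<one> k \<star> (y \<boxplus> z)" if k: "k \<in> Kt" for k
   using yk[OF k] z(2)[OF k] yT zT KD(1)[OF k] Bone by (simp add: tp.T.r_distr)
  ultimately show ?case using Sp.add[OF yK z(1)] by blast
 qed
 from this[OF E_facts(4) subset_refl] show ?thesis
  unfolding sepid_def using K_B BA.division_decompD(6)[OF E] by auto
qed

end

end

section \<open>Bimodule endomorphisms\<close>

lemma RDirProd_list_map:
 assumes "!!e. e \<in> set es ==> f e \<in> carrier (M e)" "!!e. e \<in> set es ==> g e \<in> carrier (M e)"
 shows "map f es \<in> carrier (RDirProd_list (map M es))"
  "map f es \<otimes>\<^bsub>RDirProd_list (map M es)\<^esub> map g es = map (%e. f e \<otimes>\<^bsub>M e\<^esub> g e) es"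
  "map f es \<oplus>\<^bsub>RDirProd_list (map M es)\<^esub> map g es = map (%e. f e \<oplus>\<^bsub>M e\<^esub> g e) es"
proof -
 have mem: "map h es \<in> carrier (RDirProd_list (map M es))" if "!!e. e \<in> set es ==> h e \<in> carrier (M e)" for h es
  by (rule RDirProd_list_carrier_memI) (use that in simp_all)
 show "map f es \<in> carrier (RDirProd_list (map M es))" by (rule mem[OF assms(1)])
 have "map f es \<otimes>\<^bsub>RDirProd_list (map M es)\<^esub> map g es = map (%e. f e \<otimes>\<^bsub>M e\<^esub> g e) es \<and>
  map f es \<oplus>\<^bsub>RDirProd_list (map M es)\<^esub> map g es = map (%e. f e \<oplus>\<^bsub>M e\<^esub> g e) es"
  using assms
 proof (induction es)
  case Nil
  show ?case by (simp add: monoid.defs)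
 next
  case (Cons e es)
  let ?P = "RDirProd (M e) (RDirProd_list (map M es))"
  have c: "(f e, map f es) \<in> carrier ?P" "(g e, map g es) \<in> carrier ?P"
   using Cons.prems mem[of es f] mem[of es g] by (simp_all add: RDirProd_carrier)
  note h = RDirProd_list_hom1[of "M e" "map M es"]
  show ?case
   using ring_hom_mult[OF h c] ring_hom_add[OF h c] Cons
   by (simp add: RDirProd_def DirProd_def monoid.defs)
 qed
 then show "map f es \<otimes>\<^bsub>RDirProd_list (map M es)\<^esub> map g es = map (%e. f e \<otimes>\<^bsub>M e\<^esub> g e) es"
  "map f es \<oplus>\<^bsub>RDirProd_list (map M es)\<^esub> map g es = map (%e. f e \<oplus>\<^bsub>M e\<^esub> g e) es" by simp_all
qed

text \<open>The factors in \<open>etale_algebra\<close> have the record type \<open>module\<close>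
  without further fields, while \<open>A\<close> may be an extension of it. Truncation moves a
  subalgebra of \<open>A\<close> to that type and leaves its algebra structure unchanged.\<close>

lemma truncate_simps [simp]:
 "carrier (module.truncate M) = carrier M" "monoid.mult (module.truncate M) = monoid.mult M"
 "one (module.truncate M) = one M" "ring.zero (module.truncate M) = ring.zero M"
 "ring.add (module.truncate M) = ring.add M" "smult (module.truncate M) = smult M"
 by (simp_all add: module.defs)

lemma nsum_truncate_record [simp]: "nsum (module.truncate M) f n = nsum M f n"
 by (induction n) simp_all

lemma nat_pow_truncate_record [simp]: "x [^]\<^bsub>module.truncate M\<^esub> (n :: nat) = x [^]\<^bsub>M\<^esub> n"
 by (induction n) (simp_all add: nat_pow_def)

lemma assoc_algebra_truncate:
 assumes "assoc_algebra F M" shows "assoc_algebra F (module.truncate M)"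
proof -
 interpret assoc_algebra F M by fact
 have "module F (module.truncate M)"
  by (intro moduleI module.axioms(1)[OF module_axioms] abelian_group_cong[OF abelian_group_axioms])
   (simp_all add: smult_l_distr smult_r_distr smult_assoc1)
 then show ?thesis
  by (intro assoc_algebra.intro unital_algebra.intro assoc_algebra_axioms.intro unital_algebra_axioms.intro)
   (simp_all add: field_axioms mult_l_one mult_r_one mult_l_distr mult_r_distr mult_smult_l mult_smult_r massoc)
qed

lemma finite_dimensional_truncate [simp]: "finite_dimensional F (module.truncate M) = finite_dimensional F M"
 by (simp add: finite_dimensional_def finsum_def finprod_def)

lemma division_algebra_truncate:
 assumes "division_algebra F M" shows "division_algebra F (module.truncate M)"
proof -
 interpret division_algebra F M by fact
 show ?thesis
  by (intro division_algebra.intro fd_algebra.intro fd_algebra_axioms.intro division_algebra_axioms.intro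
    assoc_algebra_truncate assoc_algebra_axioms) (simp_all add: fd one_nz left_inv_ex)
qed

lemma (in assoc_algebra) comm_algebra:
 assumes "!!x y. x \<in> carrier A ==> y \<in> carrier A ==> x \<otimes> y = y \<otimes> x" shows "algebra F A"
 by (intro algebra.intro module_axioms algebra_axioms.intro cring.intro ring_axioms comm_monoid.intro monoid_axioms
   comm_monoid_axioms.intro assms mult_smult_l)

section \<open>Endomorphisms of \<open>A\<close> as a bimodule over \<open>K\<close>\<close>

context qassoc begin

definition bimod_end :: "'a set => ('a => 'a) => bool" where
 "bimod_end K \<phi> \<longleftrightarrow> lin_map F A A \<phi> \<and>
   (\<forall>k \<in> K. \<forall>a \<in> AC. \<phi> (k \<otimes> a) = k \<otimes> \<phi> a \<and> \<phi> (a \<otimes> k) = \<phi> a \<otimes> k)"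

lemma bimod_endD:
 assumes "bimod_end K \<phi>"
 shows "a \<in> AC ==> \<phi> a \<in> AC" "x \<in> AC ==> y \<in> AC ==> \<phi> (x \<oplus> y) = \<phi> x \<oplus> \<phi> y"
  "c \<in> carrier F ==> a \<in> AC ==> \<phi> (c \<odot> a) = c \<odot> \<phi> a"
  "k \<in> K ==> a \<in> AC ==> \<phi> (k \<otimes> a) = k \<otimes> \<phi> a" "k \<in> K ==> a \<in> AC ==> \<phi> (a \<otimes> k) = \<phi> a \<otimes> k"
  "lin_map F A A \<phi>"
 using assms unfolding bimod_end_def lin_map_def by blast+

context
 fixes K z
 assumes KB: "K \<subseteq> B" and Ksub: "subsp K" and K1: "\<one> \<in> K"
  and Km: "!!x y. x \<in> K ==> y \<in> K ==> x \<otimes> y \<in> K" and Kcomm: "!!x y. x \<in> K ==> y \<in> K ==> x \<otimes> y = y \<otimes> x"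
  and LK: "L \<subseteq> K" and Kcent: "!!c c'. c \<in> tp.B.cent K ==> c' \<in> tp.B.cent K ==> c \<otimes> c' = c' \<otimes> c"
  and Kz: "sepid K z"
begin

lemma KBd: "k \<in> K ==> k \<in> B" using KB by blast

lemma RT: "r \<in> Sp K K ==> r \<in> TC" by (rule SpB[OF _ KB KB])

text \<open>Since \<open>K\<close> contains \<open>L\<close>, an endomorphism is linear over
  \<open>L\<close> on both sides and so comes from some \<open>s\<close> in \<open>T\<close>. By
  faithfulness \<open>s\<close> commutes with \<open>K \<otimes> 1\<close> and
  \<open>1 \<otimes> K\<close>, and \<open>cent_Sp\<close> applies.\<close>

lemma end_T:
 assumes "bimod_end K \<phi>"
 shows "\<exists>t \<in> Sp (tp.B.cent K) (tp.B.cent K). \<forall>a \<in> AC. \<phi> a = act t a"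
proof -
 note p = bimod_endD[OF assms]
 obtain d where d: "sepid L d" using L_sepid by blast
 obtain s where s: "s \<in> TC" "\<forall>a \<in> AC. \<phi> a = act s a"
  using Z_linear_in_T[OF d p(6)] p(4,5) LK by blast
 have sa: "act s a = \<phi> a" if "a \<in> AC" for a using s(2) that by simp
 have "s \<in> Sp (tp.B.cent K) (tp.B.cent K)"
 proof (rule cent_Sp[OF KB s(1)])
  fix k assume k: "k \<in> K"
  note kB = KBd[OF k]
  have t: "tns k \<one> \<in> TC" "tns \<one> k \<in> TC" using kB Bone by simp_all
  show "tns k \<one> \<star> s = s \<star> tns k \<one>"
  proof (rule faithful_eq)
   fix a assume a: "a \<in> AC"
   show "act (tns k \<one> \<star> s) a = act (s \<star> tns k \<one>) a"
    using act_mult[OF t(1) s(1) a] act_mult[OF s(1) t(1) a] p(1,4) k kB a Bone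
    by (simp add: sa act_tns mult_r_one mult_closed)
  qed (use t s in simp_all)
  show "tns \<one> k \<star> s = s \<star> tns \<one> k"
  proof (rule faithful_eq)
   fix a assume a: "a \<in> AC"
   show "act (tns \<one> k \<star> s) a = act (s \<star> tns \<one> k) a"
    using act_mult[OF t(2) s(1) a] act_mult[OF s(1) t(2) a] p(1,5) k kB a Bone
    by (simp add: sa act_tns mult_l_one mult_closed)
  qed (use t s in simp_all)
 qed
 then show ?thesis using s(2) by blast
qed

text \<open>Both maps come from the tensor square of the centralizer of \<open>K\<close>, which is
  commutative.\<close>

lemma end_comm:
 assumes "bimod_end K \<phi>" "bimod_end K \<psi>" "a \<in> AC"
 shows "\<phi> (\<psi> a) = \<psi> (\<phi> a)"
proof -
 let ?C = "tp.B.cent K"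
 have CB: "?C \<subseteq> B" using tp.B.cent_carrier by simp
 obtain s t where s: "s \<in> Sp ?C ?C" "\<forall>a \<in> AC. \<phi> a = act s a" and t: "t \<in> Sp ?C ?C" "\<forall>a \<in> AC. \<psi> a = act t a"
  using end_T assms(1,2) by meson
 have sT: "s \<in> TC" and tT: "t \<in> TC" using SpB[OF s(1) CB CB] SpB[OF t(1) CB CB] .
 have "s \<star> t = t \<star> s" by (rule Sp_commute[OF s(1) t(1)]) (use CB Kcent in auto)
 then show ?thesis using act_mult[OF sT tT assms(3)] act_mult[OF tT sT assms(3)] s(2) t(2) assms(3) sT tT by simp
qed

abbreviation orbit :: "'a => 'a set" where "orbit a \<equiv> (%r. act r a) ` Sp K K"

lemma tns_K: "x \<in> K ==> y \<in> K ==> tns x y \<in> Sp K K" by (rule Sp.tns)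

lemma R_mult: "r \<in> Sp K K ==> s \<in> Sp K K ==> r \<star> s \<in> Sp K K"
 by (rule Sp_mult) (use KB Km in simp_all)

lemma R_comm: "r \<in> Sp K K ==> s \<in> Sp K K ==> r \<star> s = s \<star> r"
 by (rule Sp_commute) (use KB Kcomm in simp_all)

lemma orbit_act:
 assumes "a \<in> AC" "x \<in> orbit a" "r \<in> Sp K K" shows "act r x \<in> orbit a"
proof -
 obtain s where s: "s \<in> Sp K K" "x = act s a" using assms(2) by blast
 have "act r x = act (r \<star> s) a" using act_mult[OF RT[OF assms(3)] RT[OF s(1)] assms(1)] s(2) by simp
 then show ?thesis using R_mult[OF assms(3) s(1)] by blast
qed

lemma orbit_subsp: assumes a: "a \<in> AC" shows "subsp (orbit a)"
proof (rule subspI)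
 show "orbit a \<subseteq> AC" using RT a by auto
 have "\<zero>\<^sub>T \<in> Sp K K" using subspD(2)[OF Ksub] KB by (intro Sp_zero) simp_all
 then show "\<zero> \<in> orbit a" using act_zero_l[OF a] by (intro image_eqI[of _ _ "\<zero>\<^sub>T"]) simp_all
next
 fix x y assume "x \<in> orbit a" "y \<in> orbit a"
 then obtain r s where r: "r \<in> Sp K K" "x = act r a" and s: "s \<in> Sp K K" "y = act s a" by blast
 show "x \<oplus> y \<in> orbit a" using act_add_l[OF RT[OF r(1)] RT[OF s(1)] a] r s Sp.add[OF r(1) s(1)]
  by (intro image_eqI[of _ _ "r \<boxplus> s"]) simp_all
next
 fix c x assume c: "c \<in> carrier F" and x: "x \<in> orbit a"
 have xA: "x \<in> AC" using x RT a by auto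
 have "tns (c \<odot> \<one>) \<one> \<in> Sp K K" using subspD(6)[OF Ksub c K1] K1 by (rule tns_K)
 moreover have "act (tns (c \<odot> \<one>) \<one>) x = c \<odot> x"
  using c xA Bone oneA by (simp add: act_tns Bsmult mult_smult_l mult_l_one mult_r_one)
 ultimately show "c \<odot> x \<in> orbit a" using orbit_act[OF a x] by metis
qed

lemma orbit_self: "a \<in> AC ==> a \<in> orbit a"
 using tns_K[OF K1 K1] act_one[of a] tns_1 by (metis image_eqI)

lemma orbit_mult:
 assumes "a \<in> AC" "x \<in> orbit a" "k \<in> K" shows "k \<otimes> x \<in> orbit a" "x \<otimes> k \<in> orbit a"
proof -
 have xA: "x \<in> AC" using assms(1,2) RT by auto
 show "k \<otimes> x \<in> orbit a" using orbit_act[OF assms(1,2) tns_K[OF assms(3) K1]] xA KBd[OF assms(3)] Bone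
  by (simp add: act_tns mult_r_one mult_closed)
 show "x \<otimes> k \<in> orbit a" using orbit_act[OF assms(1,2) tns_K[OF K1 assms(3)]] xA KBd[OF assms(3)] Bone
  by (simp add: act_tns mult_l_one)
qed

lemma projection_end:
 assumes "subsp N" "!!k n. k \<in> K ==> n \<in> N ==> k \<otimes> n \<in> N" "!!k n. k \<in> K ==> n \<in> N ==> n \<otimes> k \<in> N"
 shows "\<exists>p. bimod_end K p \<and> (\<forall>a \<in> AC. p a \<in> N) \<and> (\<forall>n \<in> N. p n = n)"
proof (rule maschke[OF Kz assms])
 fix p
 assume "lin_map F A A p" "!!a. a \<in> AC ==> p a \<in> N" "!!n. n \<in> N ==> p n = n"
  "!!k a. k \<in> K ==> a \<in> AC ==> p (k \<otimes> a) = k \<otimes> p a"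
  "!!k a. k \<in> K ==> a \<in> AC ==> p (a \<otimes> k) = p a \<otimes> k"
 then show ?thesis unfolding bimod_end_def by (intro exI[of _ p]) simp
qed

text \<open>The cyclic subbimodule is the image of a bimodule projection, and any other endomorphism
  commutes with that projection.\<close>

lemma end_orbit:
 assumes "bimod_end K \<phi>" "a \<in> AC" "x \<in> orbit a" shows "\<phi> x \<in> orbit a"
proof -
 obtain p where p: "bimod_end K p" "\<forall>b \<in> AC. p b \<in> orbit a" "\<forall>n \<in> orbit a. p n = n"
  using projection_end[OF orbit_subsp[OF assms(2)] orbit_mult(1)[OF assms(2)] orbit_mult(2)[OF assms(2)]] by blast
 have xA: "x \<in> AC" using subspD(7)[OF orbit_subsp[OF assms(2)] assms(3)] .
 have "\<phi> x = p (\<phi> x)" using end_comm[OF assms(1) p(1) xA] p(3) assms(3) by simp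
 then show ?thesis using p(2) bimod_endD(1)[OF assms(1) xA] by metis
qed

text \<open>Let the orbit of \<open>a\<close> be maximal and \<open>p\<close> a bimodule projection
  onto it. For any \<open>y\<close> the vector \<open>x = a + (y - p y)\<close> satisfies
  \<open>p x = a\<close>, so \<open>a\<close> lies in the orbit of \<open>x\<close> by
  \<open>end_orbit\<close>. Maximality forces the two orbits to agree, and then
  \<open>y - p y\<close> and \<open>y\<close> lie in the orbit of \<open>a\<close>.\<close>

lemma cyclic: "\<exists>a \<in> AC. orbit a = AC"
proof -
 obtain a where a: "a \<in> AC" and mx: "!!x. x \<in> AC ==> orbit a \<subseteq> orbit x ==> orbit x = orbit a"
  by (rule max_ex[of "%a. a \<in> AC" \<zero> orbit]) (use orbit_subsp in blast)+
 note os = subspD[OF orbit_subsp[OF a]]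
 have "y \<in> orbit a" if y: "y \<in> AC" for y
 proof -
  obtain p where p: "bimod_end K p" "\<forall>b \<in> AC. p b \<in> orbit a" "\<forall>n \<in> orbit a. p n = n"
   using projection_end[OF orbit_subsp[OF a] orbit_mult(1)[OF a] orbit_mult(2)[OF a]] by blast
  note pD = bimod_endD[OF p(1)]
  have py: "p y \<in> orbit a" using p(2) y by simp
  have pyA: "p y \<in> AC" by (rule os(7)[OF py])
  define x where "x = a \<oplus> (y \<ominus> p y)"
  have xA: "x \<in> AC" using a y pyA by (simp add: x_def)
  have "p (y \<ominus> p y) = p y \<ominus> p (p y)"
   by (rule additive_minus[OF abelian_group_axioms abelian_group_axioms pD(1,2) y pyA])
  also have "p (p y) = p y" using p(3) py by blast
  also have "p y \<ominus> p y = \<zero>" using pyA by (simp add: minus_eq r_neg)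
  finally have pz: "p (y \<ominus> p y) = \<zero>" .
  have "p a = a" using p(3) orbit_self[OF a] by blast
  then have "p x = a" unfolding x_def using pD(2)[OF a, of "y \<ominus> p y"] pz a y pyA by simp
  then have aox: "a \<in> orbit x" using end_orbit[OF p(1) xA orbit_self[OF xA]] by simp
  have "orbit a \<subseteq> orbit x" using orbit_act[OF xA aox] by blast
  then have "x \<in> orbit a" using mx[OF xA] orbit_self[OF xA] by blast
  then have "x \<ominus> a \<in> orbit a" by (rule os(5)[OF _ orbit_self[OF a]])
  moreover have "x \<ominus> a = y \<ominus> p y"
  proof -
   have "x \<ominus> a = (y \<ominus> p y) \<oplus> (a \<oplus> \<ominus> a)" unfolding x_def using a y pyA by (simp only: minus_eq a_ac a_closed a_inv_closed)
   then show ?thesis using a y pyA by (simp add: r_neg)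
  qed
  ultimately have "(y \<ominus> p y) \<oplus> p y \<in> orbit a" using os(3) py by simp
  then show ?thesis using y pyA by (simp add: minus_eq a_assoc l_neg)
 qed
 then show ?thesis using a os(1) by blast
qed

text \<open>On a cyclic module over a commutative ring, an endomorphism is determined by the image
  \<open>r a\<close> of the generator \<open>a\<close> and is multiplication by
  \<open>r\<close>.\<close>

lemma end_R:
 assumes "bimod_end K \<phi>"
 shows "\<exists>r \<in> Sp K K. \<forall>x \<in> AC. \<phi> x = act r x"
proof -
 note p = bimod_endD[OF assms]
 obtain a where a: "a \<in> AC" "orbit a = AC" using cyclic by blast
 then obtain r where r: "r \<in> Sp K K" "\<phi> a = act r a" using p(1)[OF a(1)] by blast
 have "\<phi> x = act r x" if "x \<in> AC" for x
 proof -
  have "x \<in> orbit a" using that unfolding a(2) .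
  then obtain s where s: "x = act s a" "s \<in> Sp K K" by (rule imageE)
  note s = s(2,1)
  have "\<phi> x = act s (\<phi> a)" unfolding s(2) by (rule Sp_act_comm[OF KB s(1) p(1,2,4,5) a(1)])
  also have "\<dots> = act (s \<star> r) a" using act_mult[OF RT[OF s(1)] RT[OF r(1)] a(1)] r(2) by simp
  also have "\<dots> = act r x" using R_comm[OF s(1) r(1)] act_mult[OF RT[OF r(1)] RT[OF s(1)] a(1)] s(2) by simp
  finally show ?thesis .
 qed
 then show ?thesis using r(1) by blast
qed

lemma Sp_act_one: assumes "r \<in> Sp K K" shows "act r \<one> \<in> K"
 using assms
proof (induction rule: Sp.induct)
 case (tns x y)
 then show ?case using Km KBd oneA by (simp add: act_tns mult_r_one)
next
 case (add r s)
 then show ?case using act_add_l[OF RT[OF add(1)] RT[OF add(2)] oneA] subspD(3)[OF Ksub] by simp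
qed

text \<open>Multiplication by a central \<open>x\<close> is a bimodule endomorphism, hence the
  action of some \<open>r\<close> in the image of \<open>K \<otimes> K\<close>; evaluated at 1 this
  puts \<open>x\<close> into \<open>K\<close> and thus into \<open>B\<close>. Now
  \<open>x \<otimes> 1\<close> and \<open>1 \<otimes> x\<close> act alike on \<open>A\<close>, so
  they agree by faithfulness, and \<open>x\<close> is a scalar.\<close>

lemma central: "central_algebra F A"
 unfolding central_algebra_def
proof (intro conjI equalityI subsetI)
 show "\<one> \<noteq> \<zero>" by (rule B_nz)
next
 fix x assume "x \<in> alg_center A"
 then have xn: "x \<in> nucleus A" and xc: "!!a. a \<in> AC ==> x \<otimes> a = a \<otimes> x" by (auto simp: alg_center_def)
 have xA: "x \<in> AC" using xn nucleus_carrier by blast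
 have "bimod_end K (%a. x \<otimes> a)"
  unfolding bimod_end_def lin_map_def
 proof (intro conjI ballI)
  fix k a assume k: "k \<in> K" and a: "a \<in> AC"
  have kA: "k \<in> AC" using KBd[OF k] by simp
  have "x \<otimes> (k \<otimes> a) = (k \<otimes> x) \<otimes> a" using nucleusD(1)[OF xn kA a] xc[OF kA] by simp
  then show "x \<otimes> (k \<otimes> a) = k \<otimes> (x \<otimes> a)" using nucleusD(2)[OF xn kA a] by simp
  show "x \<otimes> (a \<otimes> k) = (x \<otimes> a) \<otimes> k" using nucleusD(1)[OF xn a kA] by simp
 qed (simp_all add: xA mult_closed mult_r_distr mult_smult_r)
 then obtain r where r: "r \<in> Sp K K" "\<forall>a \<in> AC. x \<otimes> a = act r a" using end_R by blast
 have "x = act r \<one>" using r(2) oneA xA mult_r_one[OF xA] by metis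
 then have xB: "x \<in> B" using Sp_act_one[OF r(1)] KBd by simp
 have "tns x \<one> = tns \<one> x"
  by (rule faithful_eq) (use xB Bone xc in \<open>simp_all add: act_tns mult_l_one mult_r_one mult_closed\<close>)
 then show "x \<in> (%c. c \<odot> \<one>) ` carrier F" using fixed_scalar[OF xB] by blast
next
 fix x assume "x \<in> (%c. c \<odot> \<one>) ` carrier F"
 then obtain c where c: "c \<in> carrier F" "x = c \<odot> \<one>" by blast
 have "x \<in> nucleus A" unfolding c(2) by (rule nucB[OF Bsmult[OF c(1) Bone]])
 moreover have "x \<otimes> a = a \<otimes> x" if "a \<in> AC" for a
  unfolding c(2) using c(1) that oneA by (simp add: mult_smult_l mult_smult_r mult_l_one mult_r_one)
 ultimately show "x \<in> alg_center A" by (simp add: alg_center_def)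
qed

lemma K_assoc: "assoc_algebra F (A\<lparr>carrier := K\<rparr>)"
proof -
 have "assoc_algebra F (A\<lparr>carrier := K, one := \<one>\<rparr>)"
  by (rule subalgebra_assoc[OF Ksub _ Km K1]) (use KB B_nuc KBd in \<open>auto simp: mult_l_one mult_r_one\<close>)
 then show ?thesis by simp
qed

text \<open>The tensor product of \<open>K\<close> with itself is a different ring from its image in
  \<open>T\<close>; the first half of the proof matches their elements and actions. After that,
  bimodule endomorphisms are the same as ring elements, and a faithful section is tested on the
  endomorphisms provided by the splitting.\<close>

lemma minimally_faithful_K:
 "minimally_faithful (tensor_algebra F (A\<lparr>carrier := K\<rparr>) (A\<lparr>carrier := K\<rparr>)) (bimodule F A)"
proof -
 interpret KT: tensor_action F A K "A\<lparr>carrier := K\<rparr>"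
  by (intro tensor_action.intro unital_algebra_axioms tensor_action_axioms.intro K_assoc)
   (use KB B_nuc Kcomm in auto)
 have KTc: "carrier (A\<lparr>carrier := K\<rparr>) = K" by simp
 have to_KT: "\<exists>t \<in> carrier KT.T. \<forall>a \<in> AC. KT.act t a = act r a" if "r \<in> Sp K K" for r
  using that
 proof (induction rule: Sp.induct)
  case (tns x y)
  then show ?case using KBd by (intro bexI[of _ "KT.tns x y"]) (simp_all add: act_tns KT.act_tns)
 next
  case (add r s)
  then obtain t u where "t \<in> carrier KT.T" "\<forall>a \<in> AC. KT.act t a = act r a"
   "u \<in> carrier KT.T" "\<forall>a \<in> AC. KT.act u a = act s a" by blast
  then show ?case using RT[OF add(1)] RT[OF add(2)]
   by (intro bexI[of _ "t \<oplus>\<^bsub>KT.T\<^esub> u"]) (simp_all add: act_add_l KT.act_add_l)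
 qed
 obtain p where "lin_map F A A p" and pK: "!!a. a \<in> AC ==> p a \<in> K" and pi: "!!k. k \<in> K ==> p k = k"
  by (rule projection_ex[OF Ksub]) blast
 then have pa: "!!x y. x \<in> AC ==> y \<in> AC ==> p (x \<oplus> y) = p x \<oplus> p y"
  and ps: "!!c x. c \<in> carrier F ==> x \<in> AC ==> p (c \<odot> x) = c \<odot> p x" unfolding lin_map_def by blast+
 \<comment> \<open>The map \<open>p \<otimes> p\<close> from \<open>T\<close> back to the tensor
   square of \<open>K\<close>. As it undoes the passage to \<open>T\<close>, faithfulness of
   \<open>T\<close> on \<open>A\<close> carries over to the tensor square of
   \<open>K\<close>.\<close>
 obtain h where h: "!!t. t \<in> TC ==> h t \<in> carrier KT.T"
  "!!t t'. t \<in> TC ==> t' \<in> TC ==> h (t \<boxplus> t') = h t \<oplus>\<^bsub>KT.T\<^esub> h t'"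
  "!!b c. b \<in> B ==> c \<in> B ==> h (tns b c) = KT.tns (p b) (p c)"
 proof (rule T_lift[OF KT.Tm_vspace, of "%b c. KT.tns (p b) (p c)"])
  fix s b c assume "s \<in> carrier F" "b \<in> B" "c \<in> C0"
  then show "KT.tns (p (s \<odot> b)) (p c) = s \<odot>\<^bsub>KT.Tm\<^esub> KT.tns (p b) (p c)"
   "KT.tns (p b) (p (s \<odot> c)) = s \<odot>\<^bsub>KT.Tm\<^esub> KT.tns (p b) (p c)"
   by (simp_all add: ps pK KT.sm_tns KT.tns_s)
 next
  fix h assume 1: "!!t. t \<in> TC ==> h t \<in> carrier KT.Tm"
   and 2: "!!t t'. t \<in> TC ==> t' \<in> TC ==> h (t \<boxplus> t') = h t \<oplus>\<^bsub>KT.Tm\<^esub> h t'"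
   and 3: "!!b c. b \<in> B ==> c \<in> C0 ==> h (tns b c) = KT.tns (p b) (p c)"
  from that[of h] 1 2 3 show thesis by simp
 qed (simp_all add: pa pK KT.tns_al KT.tns_ar)
 have h0: "h \<zero>\<^sub>T = \<zero>\<^bsub>KT.T\<^esub>"
  by (rule additive_zero[OF tp.T.abelian_group_axioms KT.tp.T.abelian_group_axioms h(1,2)])
 have of_KT: "\<exists>r \<in> Sp K K. (\<forall>a \<in> AC. act r a = KT.act t a) \<and> h r = t" if "t \<in> carrier KT.T" for t
  using that
 proof (induction t rule: KT.T_induct)
  case (tns x y)
  then show ?case using KBd tns_K by (intro bexI[of _ "tns x y"]) (simp_all add: act_tns KT.act_tns h pi)
 next
  case (add t u)
  then obtain r s where r: "r \<in> Sp K K" "\<forall>a \<in> AC. act r a = KT.act t a" "h r = t"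
   and s: "s \<in> Sp K K" "\<forall>a \<in> AC. act s a = KT.act u a" "h s = u" by blast
  then show ?case using RT[OF r(1)] RT[OF s(1)] add(1,2)
   by (intro bexI[of _ "r \<boxplus> s"]) (simp_all add: act_add_l KT.act_add_l h Sp.add)
 qed
 have faith: "t = \<zero>\<^bsub>KT.T\<^esub>" if t: "t \<in> carrier KT.T" and z: "!!a. a \<in> AC ==> KT.act t a = \<zero>" for t
 proof -
  obtain r where r: "r \<in> Sp K K" "\<forall>a \<in> AC. act r a = KT.act t a" "h r = t" using of_KT[OF t] by blast
  have "r = \<zero>\<^sub>T" by (rule faithful[OF RT[OF r(1)]]) (use r(2) z in simp)
  then show ?thesis using r(3) h0 by simp
 qed
 have sec: "P = AC \<and> N = {\<zero>}"
  if P: "submodule P KT.T (bimodule F A)" and N: "submodule N KT.T (bimodule F A)" and NP: "N \<subseteq> P"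
   and fs: "faithful_module KT.T (module_section (bimodule F A) P N)" for P N
 proof -
  have fz: "r = \<zero>\<^bsub>KT.T\<^esub>" if "r \<in> carrier KT.T" "!!x. x \<in> P ==> KT.act r x \<in> N" for r
   using fs KT.section_faithful_iff[OF P N NP] that by blast
  \<comment> \<open>An endomorphism is the action of a ring element, so faithfulness of the section
    \<open>P / N\<close> says that it vanishes as soon as it maps \<open>P\<close> into
    \<open>N\<close>.\<close>
  have end0: "\<phi> x = \<zero>" if e: "bimod_end K \<phi>" and m: "!!x. x \<in> P ==> \<phi> x \<in> N" and x: "x \<in> AC" for \<phi> x
  proof -
   obtain r where r: "r \<in> Sp K K" "\<forall>x \<in> AC. \<phi> x = act r x" using end_R[OF e] by blast
   obtain t where t: "t \<in> carrier KT.T" "\<forall>a \<in> AC. KT.act t a = act r a" using to_KT[OF r(1)] by blast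
   have PA: "P \<subseteq> AC" using subspD(1)[OF KT.submodule_subspace(1)[OF P]] .
   have "t = \<zero>\<^bsub>KT.T\<^esub>" by (rule fz[OF t(1)]) (use m t(2) r(2) PA in \<open>auto simp: subset_iff\<close>)
   then show ?thesis using r(2) t(2) x KT.act_zero_l[OF x] by simp
  qed
  have stable: "k \<otimes> w \<in> W" "w \<otimes> k \<in> W" if W: "submodule W KT.T (bimodule F A)" and k: "k \<in> K" and w: "w \<in> W" for W k w
  proof -
   have wA: "w \<in> AC" using subspD(7)[OF KT.submodule_subspace(1)[OF W] w] .
   have kA: "k \<in> AC" using KBd[OF k] by simp
   show "k \<otimes> w \<in> W" using KT.submodule_subspace(2)[OF W, of "KT.tns k \<one>" w] k K1 w wA kA
    by (simp add: KT.act_tns mult_r_one mult_closed)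
   show "w \<otimes> k \<in> W" using KT.submodule_subspace(2)[OF W, of "KT.tns \<one> k" w] k K1 w wA kA
    by (simp add: KT.act_tns mult_l_one)
  qed
  note sP = KT.submodule_subspace(1)[OF P] and sN = KT.submodule_subspace(1)[OF N]
  obtain \<rho> where rho: "bimod_end K \<rho>" "\<forall>a \<in> AC. \<rho> a \<in> P" "\<forall>n \<in> P. \<rho> n = n"
   using projection_end[OF sP stable(1)[OF P] stable(2)[OF P]] by blast
  obtain \<pi> where pi: "bimod_end K \<pi>" "\<forall>a \<in> AC. \<pi> a \<in> N" "\<forall>n \<in> N. \<pi> n = n"
   using projection_end[OF sN stable(1)[OF N] stable(2)[OF N]] by blast
  note rD = bimod_endD[OF rho(1)]
  have cK: "k \<in> AC" if "k \<in> K" for k using KBd[OF that] by simp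
  have md: "k \<otimes> (x \<ominus> y) = k \<otimes> x \<ominus> k \<otimes> y" "(x \<ominus> y) \<otimes> k = x \<otimes> k \<ominus> y \<otimes> k"
   if "k \<in> AC" "x \<in> AC" "y \<in> AC" for k x y
   using additive_minus[OF abelian_group_axioms abelian_group_axioms, of "%v. k \<otimes> v" x y]
    additive_minus[OF abelian_group_axioms abelian_group_axioms, of "%v. v \<otimes> k" x y] that
   by (simp_all add: mult_closed mult_l_distr mult_r_distr)
  \<comment> \<open>\<open>1 - \<rho>\<close> kills \<open>P\<close>, and \<open>\<pi>\<close> maps
    everything into \<open>N\<close>. Hence both vanish, which means that \<open>P\<close> is all of
    \<open>A\<close> and \<open>N\<close> is zero.\<close>
  have "bimod_end K (%x. x \<ominus> \<rho> x)"
   unfolding bimod_end_def lin_map_def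
  proof (intro conjI ballI)
   fix x y assume xy: "x \<in> AC" "y \<in> AC"
   show "x \<oplus> y \<ominus> \<rho> (x \<oplus> y) = x \<ominus> \<rho> x \<oplus> (y \<ominus> \<rho> y)"
    using xy rD(1,2) by (simp add: minus_eq minus_add a_ac)
  next
   fix c x assume "c \<in> carrier F" "x \<in> AC"
   then show "c \<odot> x \<ominus> \<rho> (c \<odot> x) = c \<odot> (x \<ominus> \<rho> x)"
    using rD(1,3) by (simp add: minus_eq smult_r_distr smult_r_minus)
  qed (simp_all add: rD md cK)
  from end0[OF this] have r0: "x \<ominus> \<rho> x = \<zero>" if "x \<in> AC" for x
   using that rho(3) subspD(2)[OF sN] subspD(7)[OF sP] by (simp add: minus_eq r_neg)
  have "x \<in> P" if "x \<in> AC" for x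
   using minus_zero_imp_eq[OF that rD(1)[OF that] r0[OF that]] rho(2) that by metis
  then have PA: "P = AC" using subspD(1)[OF sP] by blast
  have "n = \<zero>" if n: "n \<in> N" for n
  proof -
   have nA: "n \<in> AC" using subspD(7)[OF sN n] .
   have "\<pi> n = \<zero>" by (rule end0[OF pi(1) _ nA]) (use pi(2) subspD(7)[OF sP] in blast)
   then show ?thesis using pi(3) n by simp
  qed
  then show ?thesis using PA subspD(2)[OF sN] by blast
 qed
 show ?thesis
  unfolding minimally_faithful_def
 proof (intro conjI allI impI)
  show "left_module KT.T (bimodule F A)" by (rule KT.bimodule_left_module)
  show "faithful_module KT.T (bimodule F A)"
   unfolding faithful_module_def using faith unfolding KT.act_def by simp
  fix P N assume PN: "submodule P KT.T (bimodule F A) \<and> submodule N KT.T (bimodule F A) \<and> N \<subseteq> P \<and>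
   faithful_module KT.T (module_section (bimodule F A) P N)"
  have "P = AC \<and> N = {\<zero>}" by (rule sec) (use PN in blast)+
  then show "P = carrier (bimodule F A)" "N = {\<zero>\<^bsub>bimodule F A\<^esub>}" by simp_all
 qed
qed

end

end

section \<open>Semiassociativity\<close>

context qassoc begin

context
 fixes E Q
 assumes E: "BA.division_decomp \<one> E" and Q: "\<forall>e \<in> E. torus e (Q e)"
begin

abbreviation factor :: "'a => ('f, 'a) module" where
 "factor e \<equiv> module.truncate (A\<lparr>carrier := Q e, one := e\<rparr>)"

lemma Q_division:
 assumes e: "e \<in> E"
 shows "division_algebra F (A\<lparr>carrier := Q e, one := e\<rparr>)"
proof -
 note q = Q_sub[OF E Q e] and f = Q_facts[OF E Q e]
 interpret D: division_algebra F "corner_ring e" by (rule corner_division(1)[OF E e])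
 show ?thesis
 proof (rule division_algebraI[OF f(1,5,3,2,7,8)])
  show "e \<noteq> \<zero>" using D.one_nz by simp
  fix x assume x: "x \<in> Q e" "x \<noteq> \<zero>"
  obtain y where y: "y \<in> Q e" "x \<otimes> y = e" using D.inv_in_subalg[OF qassoc_sub.K_sub[OF q], of x] x by auto
  then show "\<exists>y \<in> Q e. y \<otimes> x = e" using f(6)[OF x(1) y(1)] by (intro bexI[of _ y]) simp_all
 qed
qed

lemma torus_sum_sepid: "\<exists>z. sepid (torus_sum E Q) z" by (rule K_sepid[OF E Q])

text \<open>If the derivative of the minimal polynomial of \<open>x\<close> vanished at
  \<open>x\<close>, the difference quotient of that polynomial would be a nonzero element of square
  zero in the image of \<open>Q e \<otimes> Q e\<close>. That image lies in the image of
  \<open>K \<otimes> K\<close>, which is reduced by the separability idempotent of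
  \<open>K\<close>.\<close>

lemma factor_separable:
 assumes e: "e \<in> E"
 shows "finite_separable_extension F (factor e)"
proof -
 note f = Q_facts[OF E Q e]
 note dv = Q_division[OF e]
 interpret N: division_algebra F "factor e" by (rule division_algebra_truncate[OF dv])
 interpret DQ: division_algebra F "A\<lparr>carrier := Q e, one := e\<rparr>" by (rule dv)
 have comm: "\<forall>x \<in> carrier (factor e). \<forall>y \<in> carrier (factor e). x \<otimes>\<^bsub>factor e\<^esub> y = y \<otimes>\<^bsub>factor e\<^esub> x" using f(6) by simp
 have sub: "DQ.subalg (Q e)" using DQ.subalg_carrier by simp
 have q: "qassoc_sub F A B (Q e) e (Q e)"
  by (intro qassoc_sub.intro qassoc_axioms qassoc_sub_axioms.intro f(5,6) dv sub)
 obtain z where z: "sepid (torus_sum E Q) z" using torus_sum_sepid by blast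
 have QK: "Q e \<subseteq> torus_sum E Q" by (rule Q_K[OF E Q e])
 have "separable_element (factor e) N.base x" if x: "x \<in> Q e" for x
 proof (rule ccontr)
  assume ns: "\<not> separable_element (factor e) N.base x"
  have xN: "x \<in> carrier (factor e)" using x by simp
  show False
  proof (rule N.Irr_relation[OF comm xN])
   fix a n
   assume a: "!!k. a k \<in> carrier F" "a n = \<one>\<^bsub>F\<^esub>"
    and r: "nsum (factor e) (%k. a k \<odot>\<^bsub>factor e\<^esub> x [^]\<^bsub>factor e\<^esub> k) (Suc n) = \<zero>\<^bsub>factor e\<^esub>"
    and mn: "!!b m. (!!k. b k \<in> carrier F) ==> b m = \<one>\<^bsub>F\<^esub> ==>
     nsum (factor e) (%k. b k \<odot>\<^bsub>factor e\<^esub> x [^]\<^bsub>factor e\<^esub> k) (Suc m) = \<zero>\<^bsub>factor e\<^esub> ==> n \<le> m"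
    and s: "separable_element (factor e) N.base x \<longleftrightarrow>
     nsum (factor e) (%k. add_pow F (Suc k) (a (Suc k)) \<odot>\<^bsub>factor e\<^esub> x [^]\<^bsub>factor e\<^esub> k) n \<noteq> \<zero>\<^bsub>factor e\<^esub>"
   let ?pw = "%k. x [^]\<^bsub>A\<lparr>carrier := Q e, one := e\<rparr>\<^esub> k"
   have r': "nsum A (%k. a k \<odot> ?pw k) (Suc n) = \<zero>"
    using r by (simp only: truncate_simps nsum_truncate_record nat_pow_truncate_record nsum_update) simp
   have d': "nsum A (%k. add_pow F (Suc k) (a (Suc k)) \<odot> ?pw k) n = \<zero>"
    using s ns by (simp only: truncate_simps nsum_truncate_record nat_pow_truncate_record nsum_update) simp
   have mn': "n \<le> m" if "!!k. b k \<in> carrier F" "b m = \<one>\<^bsub>F\<^esub>" "nsum A (%k. b k \<odot> ?pw k) (Suc m) = \<zero>" for b m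
   proof (rule mn[of b m])
    show "nsum (factor e) (%k. b k \<odot>\<^bsub>factor e\<^esub> x [^]\<^bsub>factor e\<^esub> k) (Suc m) = \<zero>\<^bsub>factor e\<^esub>"
     using that(3) by (simp only: truncate_simps nsum_truncate_record nat_pow_truncate_record nsum_update) simp
   qed (use that in simp_all)
   let ?q = "qassoc_sub.quot F A B (Q e) e a n x"
   have sq: "?q \<star> ?q = \<zero>\<^sub>T" by (rule qassoc_sub.quot_square[OF q x a(1) r' d'])
   have "?q \<in> Sp (Q e) (Q e)" by (rule qassoc_sub.quot_Sp[OF q sub x a(1)])
   then have qK: "?q \<in> Sp (torus_sum E Q) (torus_sum E Q)" using Sp_mono[OF QK QK] by blast
   have "?q = \<zero>\<^sub>T" by (rule sepid_reduced[OF z _ qK sq]) (rule K_comm[OF E Q])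
   moreover have "?q \<noteq> \<zero>\<^sub>T" by (rule qassoc_sub.quot_nonzero[OF q x a(1) r' a(2) mn'])
   ultimately show False by simp
  qed
 qed
 moreover have "field (factor e)" by (rule N.field_of_comm(1)[OF comm])
 moreover have "algebra F (factor e)" by (rule N.comm_algebra) (use comm in blast)
 moreover have "field F" by (rule field_axioms)
 ultimately show ?thesis unfolding finite_separable_extension_def using N.fd by simp
qed

text \<open>The sum of the prescribed blocks; other blocks do not interfere because the idempotents
  are orthogonal. It yields surjectivity of \<open>K\<close> onto the product of the tori.\<close>

lemma E_combine:
 assumes y: "!!e. e \<in> E ==> y e \<in> Q e"
 shows "\<exists>x \<in> torus_sum E Q. \<forall>e \<in> E. e \<otimes> x = y e"
proof -
 note Ef = E_facts[OF E Q]
 note QK = Q_K[OF E Q]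
 note Ks = subspD[OF K_subsp[OF E Q]]
 have "\<exists>x \<in> torus_sum E Q. \<forall>e \<in> E. e \<otimes> x = (if e \<in> E' then y e else \<zero>)" if "finite E'" "E' \<subseteq> E" for E'
  using that
 proof (induction E')
  case empty
  show ?case using Ks(2) Ef(1) by (intro bexI[of _ \<zero>]) (simp_all add: zero_mult_r)
 next
  case (insert f E')
  then obtain x where x: "x \<in> torus_sum E Q" "!!e. e \<in> E ==> e \<otimes> x = (if e \<in> E' then y e else \<zero>)" by auto
  have f: "f \<in> E" using insert by simp
  have yf: "y f \<in> Q f" "y f \<in> B" using y[OF f] Q_facts(5)[OF E Q f] by blast+
  have xA: "x \<in> AC" by (rule Ks(7)[OF x(1)])
  have "e \<otimes> (x \<oplus> y f) = (if e \<in> insert f E' then y e else \<zero>)" if e: "e \<in> E" for e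
  proof -
   have d: "e \<otimes> (x \<oplus> y f) = e \<otimes> x \<oplus> e \<otimes> y f" using Ef(1)[OF e] xA yf(2) by (simp add: mult_r_distr)
   show ?thesis
   proof (cases "e = f")
    case True
    then show ?thesis using d x(2)[OF e] insert.hyps Q_facts(7)[OF E Q f yf(1)] yf(2) by simp
   next
    case False
    have yA: "y e \<in> AC" using y[OF e] Q_facts(5)[OF E Q e] by auto
    have "e \<otimes> y f = e \<otimes> (f \<otimes> y f)" using Q_facts(7)[OF E Q f yf(1)] by simp
    also have "\<dots> = (e \<otimes> f) \<otimes> y f" using assB(1)[of e f "y f"] Ef(1)[OF e] Ef(1)[OF f] yf(2) by simp
    also have "\<dots> = \<zero>" using Ef(3)[OF e f False] yf(2) by (simp add: zero_mult_l)
    finally show ?thesis using d x(2)[OF e] False yA by simp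
   qed
  qed
  moreover have "x \<oplus> y f \<in> torus_sum E Q" using Ks(3)[OF x(1)] QK[OF f] yf(1) by blast
  ultimately show ?case by blast
 qed
 from this[OF Ef(4) subset_refl] show ?thesis by auto
qed

text \<open>The blocks \<open>e x\<close> of a block diagonal \<open>x\<close> determine
  \<open>x\<close>, are arbitrary, and multiply independently: this is the product decomposition of
  \<open>K\<close> into the fields \<open>Q e\<close>.\<close>

lemma torus_sum_etale: "etale_algebra F (A\<lparr>carrier := torus_sum E Q\<rparr>)"
proof -
 let ?K = "torus_sum E Q"
 note Ef = E_facts[OF E Q] and KD = KD[OF E Q]
 obtain es where es: "set es = E" "distinct es" using finite_distinct_list[OF Ef(4)] by blast
 define h where "h x = map (%e. e \<otimes> x) es" for x
 let ?P = "RDirProd_list (map factor es)"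
 have mem: "e \<otimes> x \<in> carrier (factor e)" if "x \<in> ?K" "e \<in> set es" for x e using KD(3)[OF that(1)] that(2) es(1) by simp
 have KA: "x \<in> AC" if "x \<in> ?K" for x using Bc[OF KD(1)[OF that]] .
 have eA: "e \<in> AC" if "e \<in> set es" for e using Bc[OF Ef(1)] that es(1) by simp
 have asK: "assoc_algebra F (A\<lparr>carrier := ?K\<rparr>)"
 proof -
  have "assoc_algebra F (A\<lparr>carrier := ?K, one := \<one>\<rparr>)"
  proof (rule subalgebra_assoc)
   show "submodule ?K F A" by (rule K_subsp[OF E Q])
   show "?K \<subseteq> nucleus A" using K_B[OF E Q] B_nuc by blast
   show "x \<otimes> y \<in> ?K" if "x \<in> ?K" "y \<in> ?K" for x y by (rule K_mult[OF E Q that])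
   show "\<one> \<in> ?K" by (rule K_one[OF E Q])
  qed (simp_all add: KA mult_l_one mult_r_one)
  then show ?thesis by simp
 qed
 have alg: "algebra F (A\<lparr>carrier := ?K\<rparr>)"
  by (rule assoc_algebra.comm_algebra[OF asK]) (simp add: K_comm[OF E Q])
 have inj: "x = y" if x: "x \<in> ?K" and y: "y \<in> ?K" and e: "h x = h y" for x y
 proof (rule E_eq[OF E Q KD(1)[OF x] KD(1)[OF y]])
  fix f assume "f \<in> E"
  then show "f \<otimes> x = f \<otimes> y" using e es(1) unfolding h_def by (simp add: map_eq_conv)
 qed
 have surj: "\<exists>x \<in> ?K. h x = as" if as: "as \<in> carrier ?P" for as
 proof -
  have l: "length as = length es" and m: "!!i. i < length es ==> as ! i \<in> Q (es ! i)"
   using RDirProd_list_carrier_mem[OF as] by simp_all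
  \<comment> \<open>The given list is indexed by position; \<open>y\<close> reindexes it by
    idempotents, which is well defined because \<open>es\<close> has no repetitions.\<close>
  define y where "y e = as ! (THE i. i < length es \<and> es ! i = e)" for e
  have yi: "y (es ! i) = as ! i" if "i < length es" for i
  proof -
   have "(THE j. j < length es \<and> es ! j = es ! i) = i"
    by (rule the_equality) (use that es(2) nth_eq_iff_index_eq in auto)
   then show ?thesis by (simp add: y_def)
  qed
  have yQ: "y e \<in> Q e" if e: "e \<in> E" for e
  proof -
   obtain i where "i < length es" "es ! i = e" using e es(1) by (metis in_set_conv_nth)
   then show ?thesis using yi m by metis
  qed
  obtain x where x: "x \<in> ?K" "!!e. e \<in> E ==> e \<otimes> x = y e" using E_combine[OF yQ] by blast
  have "h x = as"
  proof (rule nth_equalityI)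
   show "length (h x) = length as" using l by (simp add: h_def)
   fix i assume "i < length (h x)"
   then have i: "i < length es" by (simp add: h_def)
   then have "es ! i \<in> E" using es(1) nth_mem by blast
   then show "h x ! i = as ! i" using i x(2) yi by (simp add: h_def)
  qed
  then show ?thesis using x(1) by blast
 qed
 have "h \<in> ring_iso (A\<lparr>carrier := ?K\<rparr>) ?P"
 proof (rule ring_iso_memI)
  show hc: "h x \<in> carrier ?P" if "x \<in> carrier (A\<lparr>carrier := ?K\<rparr>)" for x
   unfolding h_def by (rule RDirProd_list_map(1)[OF mem mem]) (use that in simp_all)
  show "bij_betw h (carrier (A\<lparr>carrier := ?K\<rparr>)) (carrier ?P)"
   unfolding bij_betw_def
  proof (intro conjI equalityI subsetI)
   show "inj_on h (carrier (A\<lparr>carrier := ?K\<rparr>))" using inj by (auto simp: inj_on_def)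
   show "as \<in> carrier ?P" if "as \<in> h ` carrier (A\<lparr>carrier := ?K\<rparr>)" for as using that hc by blast
   show "as \<in> h ` carrier (A\<lparr>carrier := ?K\<rparr>)" if "as \<in> carrier ?P" for as using surj[OF that] by auto
  qed
  fix x y assume "x \<in> carrier (A\<lparr>carrier := ?K\<rparr>)" "y \<in> carrier (A\<lparr>carrier := ?K\<rparr>)"
  then have xy: "x \<in> ?K" "y \<in> ?K" by simp_all
  have "h x \<otimes>\<^bsub>?P\<^esub> h y = map (%e. (e \<otimes> x) \<otimes> (e \<otimes> y)) es"
   unfolding h_def using RDirProd_list_map(2)[of es "%e. e \<otimes> x" factor "%e. e \<otimes> y", OF mem[OF xy(1)] mem[OF xy(2)]] by simp
  also have "\<dots> = h (x \<otimes> y)" unfolding h_def using K_prod[OF E Q xy] es(1) by simp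
  finally show "h (x \<otimes>\<^bsub>A\<lparr>carrier := ?K\<rparr>\<^esub> y) = h x \<otimes>\<^bsub>?P\<^esub> h y" by simp
  have "h x \<oplus>\<^bsub>?P\<^esub> h y = map (%e. e \<otimes> x \<oplus> e \<otimes> y) es"
   unfolding h_def using RDirProd_list_map(3)[of es "%e. e \<otimes> x" factor "%e. e \<otimes> y", OF mem[OF xy(1)] mem[OF xy(2)]] by simp
  also have "\<dots> = h (x \<oplus> y)" unfolding h_def using KA[OF xy(1)] KA[OF xy(2)] eA by (simp add: mult_r_distr)
  finally show "h (x \<oplus>\<^bsub>A\<lparr>carrier := ?K\<rparr>\<^esub> y) = h x \<oplus>\<^bsub>?P\<^esub> h y" by simp
 next
  have "\<one>\<^bsub>?P\<^esub> = map (%e. e) es" unfolding RDirProd_list_one by (induction es) simp_all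
  also have "\<dots> = h \<one>" unfolding h_def by (rule map_cong) (simp_all add: mult_r_one[OF eA])
  finally show "h \<one>\<^bsub>A\<lparr>carrier := ?K\<rparr>\<^esub> = \<one>\<^bsub>?P\<^esub>" by simp
 qed
 moreover have "h (c \<odot>\<^bsub>A\<lparr>carrier := ?K\<rparr>\<^esub> x) ! i = c \<odot>\<^bsub>map factor es ! i\<^esub> (h x ! i)"
  if "c \<in> carrier F" "x \<in> carrier (A\<lparr>carrier := ?K\<rparr>)" "i < length (map factor es)" for c x i
  using that KA eA[of "es ! i"] by (simp add: h_def mult_smult_r)
 moreover have "\<forall>N \<in> set (map factor es). finite_separable_extension F N" using factor_separable es(1) by simp
 ultimately show ?thesis unfolding etale_algebra_def using alg
  by (intro conjI exI[of _ "map factor es"] exI[of _ h]) simp_all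
qed

lemma torus_sum_semiassociative: "semiassociative F A"
proof -
 let ?K = "torus_sum E Q"
 obtain z where z: "sepid ?K z" using torus_sum_sepid by blast
 have Km: "x \<otimes> y \<in> ?K" if "x \<in> ?K" "y \<in> ?K" for x y by (rule K_mult[OF E Q that])
 have Kc: "x \<otimes> y = y \<otimes> x" if "x \<in> ?K" "y \<in> ?K" for x y by (rule K_comm[OF E Q that])
 have Kt: "x \<otimes> y = y \<otimes> x" if "x \<in> tp.B.cent ?K" "y \<in> tp.B.cent ?K" for x y by (rule K_cent[OF E Q that])
 note K = K_B[OF E Q] K_subsp[OF E Q] K_one[OF E Q] L_K[OF E Q] z
 have "central_algebra F A" by (rule central[where K = "?K" and z = z]; (rule K | erule (1) Km | erule (1) Kc | erule (1) Kt))
 moreover have "minimally_faithful (tensor_algebra F (A\<lparr>carrier := ?K\<rparr>) (A\<lparr>carrier := ?K\<rparr>)) (bimodule F A)"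
  by (rule minimally_faithful_K[where K = "?K" and z = z]; (rule K | erule (1) Km | erule (1) Kc | erule (1) Kt))
 moreover have "unital_subalgebra F A ?K"
  unfolding unital_subalgebra_def using K(2,3) Km by blast
 moreover have "?K \<subseteq> nucleus A" using K(1) B_nuc by blast
 ultimately show ?thesis
  unfolding semiassociative_def using A_fd torus_sum_etale by blast
qed

end

lemma semiassociative: "semiassociative F A"
 by (rule torus_family) (rule torus_sum_semiassociative)

end

theorem proposition5p7:
 fixes F :: "('f, 'n) ring_scheme" and A :: "('f, 'a, 'm) module_scheme" and B :: "'a set"
 assumes "unital_algebra F A"
  and "quasi_associative F A B"
 shows "semiassociative F A"
 by (rule qassoc.semiassociative[OF qassoc.intro[OF assms(1) qassoc_axioms.intro[OF assms(2)]]])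

end
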